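(* Let $(T,(X_1,\ldots,X_s))$ be a tableau with substitution of dimension $\underline{n}=(n_1,\ldots,n_m)\in\mathbb{N}^m$, and let $1\leq q_1<q_2\leq m$ with $n_{q_1}=n_{q_2}=n$. Then $$\mathrm{bpf}_T(X_1,\ldots,X_s)=\sum_{(\underline{\beta},\underline{\gamma},\underline{b},\underline{c})\in Q_T}\mathrm{sgn}(\xi_{\underline{\beta},\underline{\gamma},\underline{b},\underline{c}})\;\mathrm{bpf}_{\widetilde{T}^{\xi_{\underline{\beta},\underline{\gamma},\underline{b},\underline{c}}}}\bigl(X_{\widetilde{T}^{\xi_{\underline{\beta},\underline{\gamma},\underline{b},\underline{c}}}}\bigr)\prod_{j=1}^{\#\underline{\gamma}}\sigma_{\gamma_j}(X_{c_j}).$$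
   Context: $K$ is an infinite field of arbitrary characteristic; all matrices have entries in some commutative unital $K$-algebra; $\mathbb{N}$ is the set of non-negative integers; $X^t$ is the transpose; $\mathcal{S}_n$ is the symmetric group; $\#\underline{\gamma}$ is the length of a sequence. For an $N\times N$ matrix $X$, $\sigma_k(X)$ is defined by $\det(\lambda E-X)=\lambda^N-\sigma_1(X)\lambda^{N-1}+\cdots+(-1)^N\sigma_N(X)$, with $\sigma_0(X)=1$. Multisets are written $\{\ldots\}_m$; given an equivalence on a set, two multisets are equivalent if they have the same size and each equivalence class occurs in them with the same multiplicity. On $\mathbb{N}\times\mathbb{N}$, $<$ is the lexicographical order: $(a_1,b_1)<(a_2,b_2)$ if and only if $a_1<a_2$, or $a_1=a_2$ and $b_1<b_2$. Tableaux. A shape of dimension $\underline{n}\in\mathbb{N}^m$ consists of $m$ columns of cells numbered $1,\ldots,m$; the $i$-th column contains exactly $n_i$ cells numbered $1,\ldots,n_i$ from the top. Let $n_1+\cdots+n_m$ be even. A pair $(T,(X_1,\ldots,X_s))$ is a tableau with substitution of dimension $\underline{n}$ if: (i) $T$ is a shape of dimension $\underline{n}$ filled with arrows; an arrow goes from one cell to another one, and each cell is the head or the tail of one and only one arrow. For an arrow $a\in T$, $a'$ and $a''$ denote the columns containing the head and the tail of $a$, and ${}'a$ and ${}''a$ the numbers of the cells containing the head and the tail of $a$. (ii) $X_1,\ldots,X_s$ are matrices; to each $a\in T$ an index $\varphi(a)\in\{1,\ldots,s\}$ is assigned such that $X_{\varphi(a)}$ is an $n_{a''}\times n_{a'}$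 matrix; $\{\varphi(a)\mid a\in T\}=\{1,\ldots,s\}$; and $\varphi(a)=\varphi(b)$ implies $a'=b'$, $a''=b''$. Define $$\mathrm{bpf}_T(X_1,\ldots,X_s)=\sum \mathrm{sgn}(\pi_1)\cdots\mathrm{sgn}(\pi_m)\prod_{a\in T}(X_{\varphi(a)})_{\pi_{a''}({}''a),\,\pi_{a'}({}'a)},$$ the sum ranging over $\pi_1\in\mathcal{S}_{n_1},\ldots,\pi_m\in\mathcal{S}_{n_m}$ such that for any $a,b\in T$ the conditions $\varphi(a)=\varphi(b)$ and ${}''a<{}''b$ imply $\pi_i({}''a)<\pi_i({}''b)$ for $i=a''=b''$. (For a tableau without cells this equals $1$.) Words. $\mathcal{M}$ is the monoid freely generated by the letters $x_1,x_2,\ldots,x_1^t,x_2^t,\ldots$, with a fixed lexicographical order $<$; $\mathcal{M}_T$ is the submonoid generated by $x_1,\ldots,x_s,x_1^t,\ldots,x_s^t$, with letters abbreviated $1,\ldots,s,1^t,\ldots,s^t$. It carries the involution $(u_1\cdots u_r)^t=u_r^t\cdots u_1^t$, $(j^t)^t=j$. For $u\in\mathcal{M}_T$ define the matrix $X_u$ by $X_{j^t}=X_j^t$ for $1\le j\le s$, and $X_{vw}=X_vX_w$ if this product is defined, $X_{vw}=0$ otherwise. An element $u$ is primitive if it is not of the form $u_0\cdots u_0$ with more than one factor. Transposed arrows and paths (with respect to the fixed columns $q_1,q_2$). For $a\in T$, the transpose arrow $a^t$ has $(a^t)''=a'$, $(a^t)'=a''$, ${}''(a^t)={}'a$, ${}'(a^t)={}''a$,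 $\varphi(a^t)=\varphi(a)^t\in\mathcal{M}_T$; $(a^t)^t=a$. Write $a\stackrel{t}{\in}T$ if $a\in T$ or $a^t\in T$. Elements $a_1,a_2\stackrel{t}{\in}T$ are successive if $a_1',a_2''\in\{q_1,q_2\}$, $a_1'\neq a_2''$ and ${}'a_1={}''a_2$. A path is a word $a=a_1\cdots a_r$ with $a_i\stackrel{t}{\in}T$ and $a_i,a_{i+1}$ successive for $1\leq i\leq r-1$; put $\varphi(a)=\varphi(a_1)\cdots\varphi(a_r)$, $a^t=a_r^t\cdots a_1^t$, $a'=a_r'$, ${}'a={}'a_r$, $a''=a_1''$, ${}''a={}''a_1$. A path $a_1\cdots a_r$ is open if $r\ge 2$ and $a_1'',a_r'\notin\{q_1,q_2\}$. It is closed if $a_r,a_1$ are successive and it traverses each arrow at most once (for $r=1$: $a',a''\in\{q_1,q_2\}$ and ${}'a={}''a$). Equivalences of words (in arrows and their transposes, or in $\mathcal{M}_T$): $a\stackrel{t}{=}b$ if $a=b$ or $a=b^t$; $a\stackrel{c}{=}b$ if $b$ is a cyclic permutation of $a$; $a\stackrel{ct}{=}b$ if some cyclic permutation of $a$ is $\stackrel{t}{=}$ to $b$. $T_o$ denotes the set $\{b\mid b\text{ is an open path in }T,\ (b'',{}''b)<(b',{}'b)\}$; it is a set of representatives of the open paths of $T$ with respect to $\stackrel{t}{=}$. $T_{cl}$ denotes a set of representatives of the closed paths of $T$ with respect to $\stackrel{ct}{=}$. Put $\varphi(T_o)=\{\varphi(a)\mid a\in T_o\}_m$ and $\varphi(T_{cl})=\{\varphi(a)\mid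 a\in T_{cl}\}_m$. $T^\tau$. For $\tau\in\mathcal{S}_n$, $T^\tau$ is the tableau obtained by permuting the cells of the $q_2$-th column of $T$ by $\tau$: its arrows are $a^\tau$, $a\in T$, with $\varphi(a^\tau)=\varphi(a)$, $(a^\tau)''=a''$, $(a^\tau)'=a'$; ${}''(a^\tau)=\tau({}''a)$ if $a''=q_2$ and ${}''(a^\tau)={}''a$ otherwise; ${}'(a^\tau)=\tau({}'a)$ if $a'=q_2$ and ${}'(a^\tau)={}'a$ otherwise. Then $(T^\tau,(X_1,\ldots,X_s))$ is a tableau with substitution. Write $T_o^\tau=(T^\tau)_o$, $T_{cl}^\tau=(T^\tau)_{cl}$, $\widetilde{T}^\tau=\widetilde{(T^\tau)}$. $\widetilde{T}$. The tableau with substitution $(\widetilde{T},X_{\widetilde{T}})$, $X_{\widetilde{T}}=(Y_1,\ldots,Y_t)$, has dimension obtained from $\underline{n}$ by deleting the $q_1$-th and $q_2$-th coordinates (remaining columns renumbered in order). Its arrows are $\widetilde{a}$, where either $a\in T$ with $a',a''\notin\{q_1,q_2\}$, or $a\in T_o$; the tail and head of $\widetilde{a}$ are the tail and head of $a$. The number $t$ and the indices $\varphi(\widetilde{a})$ are defined by: $\{\varphi(u)\mid u\in\widetilde{T}\}=\{1,\ldots,t\}$, $\varphi(\widetilde{b})=\varphi(\widetilde{c})$ iff $\varphi(b)=\varphi(c)$, and $\varphi(\widetilde{b})<\varphi(\widetilde{c})$ iff $\varphi(b)<\varphi(c)$ in $\mathcal{M}$. Put $Y_{\varphi(\widetilde{a})}=X_{\varphi(a)}$.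 Admissible quadruples. A $T$-quadruple is $(\underline{\beta},\underline{\gamma},\underline{b},\underline{c})$ with $\underline{\beta}\in\mathbb{N}^p$, $\underline{\gamma}\in\mathbb{N}^q$, $\underline{b}=(b_1,\ldots,b_p)$, $\underline{c}=(c_1,\ldots,c_q)$, where $b_i,c_j$ are primitive elements of $\mathcal{M}_T$, the $b_i$ are pairwise different with respect to $\stackrel{t}{=}$, and the $c_j$ are pairwise different with respect to $\stackrel{ct}{=}$. It is $T$-admissible if for some $\xi=\xi_{\underline{\beta},\underline{\gamma},\underline{b},\underline{c}}\in\mathcal{S}_n$ (fixed for each quadruple) $$\varphi(T_o^\xi)\stackrel{t}{=}\{\underbrace{b_1,\ldots,b_1}_{\beta_1},\ldots,\underbrace{b_p,\ldots,b_p}_{\beta_p}\}_m,\qquad \varphi(T_{cl}^\xi)\stackrel{ct}{=}\{\underbrace{c_1,\ldots,c_1}_{\gamma_1},\ldots,\underbrace{c_q,\ldots,c_q}_{\gamma_q}\}_m .$$ Two quadruples are equivalent ($\stackrel{ct}{=}$) if their multisets of $b$'s (with multiplicities $\underline{\beta}$) are equivalent with respect to $\stackrel{t}{=}$ and their multisets of $c$'s (with multiplicities $\underline{\gamma}$) are equivalent with respect to $\stackrel{ct}{=}$. $Q_T$ is a set of representatives of the $T$-admissible quadruples with respect to this equivalence.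
   Formalization: The tableau T̃^ξ is built not from T_o^ξ but from any representatives of the open paths whose words are equal whenever they agree up to transposition (these always exist; T_o^ξ is allowed if it has this property), since otherwise the printed formula can fail. *)

theory Defs
  imports "Jordan_Normal_Form.Char_Poly" "HOL-Library.Multiset" "HOL-Library.FuncSet"
begin

text \<open>
  Everything is numbered from 0: columns, cells within a column, matrices of a substitution.
  A cell is a pair (column, row).
\<close>

type_synonym cell = "nat \<times> nat"

datatype 'l arrow = Arrow (tail: cell) (head: cell) (label: 'l)

abbreviation tail_col :: "'l arrow \<Rightarrow> nat" where "tail_col a \<equiv> fst (tail a)"
abbreviation head_col :: "'l arrow \<Rightarrow> nat" where "head_col a \<equiv> fst (head a)"

definition cells :: "nat list \<Rightarrow> cell set" where
  "cells ns = {(i, k). i < length ns \<and> k < ns ! i}"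

definition cell_less :: "cell \<Rightarrow> cell \<Rightarrow> bool" where
  "cell_less c d \<longleftrightarrow> fst c < fst d \<or> (fst c = fst d \<and> snd c < snd d)"

definition tableau_with_subst :: "nat list \<Rightarrow> nat arrow set \<Rightarrow> 'a mat list \<Rightarrow> bool" where
  "tableau_with_subst ns T Xs \<longleftrightarrow>
     even (sum_list ns) \<and>
     (\<forall>a\<in>T. tail a \<in> cells ns \<and> head a \<in> cells ns \<and> tail a \<noteq> head a) \<and>
     (\<forall>c\<in>cells ns. \<exists>!a. a \<in> T \<and> (tail a = c \<or> head a = c)) \<and>
     (\<forall>a\<in>T. Xs ! label a \<in> carrier_mat (ns ! tail_col a) (ns ! head_col a)) \<and>
     label ` T = {..<length Xs} \<and>
     (\<forall>a\<in>T. \<forall>b\<in>T. label a = label b \<longrightarrow> head_col a = head_col b \<and> tail_col a = tail_col b)"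

definition bpf_perms :: "nat list \<Rightarrow> nat arrow set \<Rightarrow> (nat \<Rightarrow> nat \<Rightarrow> nat) set" where
  "bpf_perms ns T =
     {\<pi> \<in> (\<Pi>\<^sub>E i\<in>{..<length ns}. {p. p permutes {..<ns ! i}}).
        \<forall>a\<in>T. \<forall>b\<in>T. label a = label b \<and> snd (tail a) < snd (tail b) \<longrightarrow>
          \<pi> (tail_col a) (snd (tail a)) < \<pi> (tail_col a) (snd (tail b))}"

definition bpf :: "nat list \<Rightarrow> nat arrow set \<Rightarrow> 'a::comm_ring_1 mat list \<Rightarrow> 'a" where
  "bpf ns T Xs =
     (\<Sum>\<pi>\<in>bpf_perms ns T.
        (\<Prod>i<length ns. of_int (sign (\<pi> i))) *
        (\<Prod>a\<in>T. (Xs ! label a) $$ (\<pi> (tail_col a) (snd (tail a)), \<pi> (head_col a) (snd (head a)))))"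

text \<open>
  The value 1 at \<open>k = 0\<close> is separate because \<open>sigma 0\<close> may be applied to a non-square matrix.
\<close>

definition sigma :: "nat \<Rightarrow> 'a::comm_ring_1 mat \<Rightarrow> 'a" where
  "sigma k X =
     (if k = 0 then 1
      else if k \<le> dim_row X then (- 1) ^ k * coeff (char_poly X) (dim_row X - k)
      else 0)"

datatype letter = Letter nat | Letter_t nat

type_synonym word = "letter list"

fun letter_index :: "letter \<Rightarrow> nat" where
  "letter_index (Letter j) = j"
| "letter_index (Letter_t j) = j"

fun letter_transp :: "letter \<Rightarrow> letter" where
  "letter_transp (Letter j) = Letter_t j"
| "letter_transp (Letter_t j) = Letter j"

fun letter_mat :: "'a mat list \<Rightarrow> letter \<Rightarrow> 'a mat" where
  "letter_mat Xs (Letter j) = Xs ! j"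
| "letter_mat Xs (Letter_t j) = transpose_mat (Xs ! j)"

text \<open>
  An undefined product is a zero matrix; its size is chosen so that the bracketing of the word
  does not matter. The value at the empty word is irrelevant.
\<close>

fun word_mat :: "'a::comm_ring_1 mat list \<Rightarrow> word \<Rightarrow> 'a mat" where
  "word_mat Xs [] = 0\<^sub>m 0 0"
| "word_mat Xs [l] = letter_mat Xs l"
| "word_mat Xs (l # l' # w) =
     (let A = letter_mat Xs l; B = word_mat Xs (l' # w)
      in if dim_col A = dim_row B then A * B else 0\<^sub>m (dim_row A) (dim_col B))"

definition primitive :: "word \<Rightarrow> bool" where
  "primitive u \<longleftrightarrow> \<not> (\<exists>v k. 2 \<le> k \<and> u = concat (replicate k v))"

text \<open>
  \<open>eq_t tr\<close> and \<open>eq_ct tr\<close> are the equivalences of words over an alphabet whose involution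
  is \<open>tr\<close>; they are used for words of letters and for paths.
\<close>

definition word_transp :: "('b \<Rightarrow> 'b) \<Rightarrow> 'b list \<Rightarrow> 'b list" where
  "word_transp tr u = rev (map tr u)"

definition eq_t :: "('b \<Rightarrow> 'b) \<Rightarrow> 'b list \<Rightarrow> 'b list \<Rightarrow> bool" where
  "eq_t tr u v \<longleftrightarrow> u = v \<or> u = word_transp tr v"

definition eq_ct :: "('b \<Rightarrow> 'b) \<Rightarrow> 'b list \<Rightarrow> 'b list \<Rightarrow> bool" where
  "eq_ct tr u v \<longleftrightarrow> (\<exists>i. eq_t tr (rotate i u) v)"

definition mset_equiv :: "('b \<Rightarrow> 'b \<Rightarrow> bool) \<Rightarrow> 'b multiset \<Rightarrow> 'b multiset \<Rightarrow> bool" where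
  "mset_equiv R A B \<longleftrightarrow>
     size A = size B \<and> (\<forall>x. size (filter_mset (R x) A) = size (filter_mset (R x) B))"

definition representatives :: "('b \<Rightarrow> 'b \<Rightarrow> bool) \<Rightarrow> 'b set \<Rightarrow> 'b set \<Rightarrow> bool" where
  "representatives R A B \<longleftrightarrow> B \<subseteq> A \<and> (\<forall>x\<in>A. \<exists>!y. y \<in> B \<and> R x y)"

fun arrow_transp :: "letter arrow \<Rightarrow> letter arrow" where
  "arrow_transp (Arrow c d l) = Arrow d c (letter_transp l)"

definition letter_arrow :: "nat arrow \<Rightarrow> letter arrow" where
  "letter_arrow a = map_arrow Letter a"

text \<open>The arrows of \<open>T\<close> together with their transposes.\<close>

definition arrows_t :: "nat arrow set \<Rightarrow> letter arrow set" where
  "arrows_t T = letter_arrow ` T \<union> (arrow_transp \<circ> letter_arrow) ` T"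

definition successive :: "nat \<Rightarrow> nat \<Rightarrow> letter arrow \<Rightarrow> letter arrow \<Rightarrow> bool" where
  "successive q1 q2 a b \<longleftrightarrow>
     head_col a \<in> {q1, q2} \<and> tail_col b \<in> {q1, q2} \<and> head_col a \<noteq> tail_col b \<and>
     snd (head a) = snd (tail b)"

type_synonym path = "letter arrow list"

definition is_path :: "nat \<Rightarrow> nat \<Rightarrow> nat arrow set \<Rightarrow> path \<Rightarrow> bool" where
  "is_path q1 q2 T p \<longleftrightarrow>
     p \<noteq> [] \<and> set p \<subseteq> arrows_t T \<and> (\<forall>i. Suc i < length p \<longrightarrow> successive q1 q2 (p ! i) (p ! Suc i))"

abbreviation path_tail :: "path \<Rightarrow> cell" where "path_tail p \<equiv> tail (hd p)"
abbreviation path_head :: "path \<Rightarrow> cell" where "path_head p \<equiv> head (last p)"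
abbreviation path_word :: "path \<Rightarrow> word" where "path_word p \<equiv> map label p"

definition open_path :: "nat \<Rightarrow> nat \<Rightarrow> nat arrow set \<Rightarrow> path \<Rightarrow> bool" where
  "open_path q1 q2 T p \<longleftrightarrow>
     is_path q1 q2 T p \<and> 2 \<le> length p \<and>
     fst (path_tail p) \<notin> {q1, q2} \<and> fst (path_head p) \<notin> {q1, q2}"

definition closed_path :: "nat \<Rightarrow> nat \<Rightarrow> nat arrow set \<Rightarrow> path \<Rightarrow> bool" where
  "closed_path q1 q2 T p \<longleftrightarrow>
     is_path q1 q2 T p \<and> successive q1 q2 (last p) (hd p) \<and>
     (\<forall>i j. i < j \<and> j < length p \<longrightarrow> p ! i \<noteq> p ! j \<and> p ! i \<noteq> arrow_transp (p ! j))"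

definition T_open :: "nat \<Rightarrow> nat \<Rightarrow> nat arrow set \<Rightarrow> path set" where
  "T_open q1 q2 T = {p. open_path q1 q2 T p \<and> cell_less (path_tail p) (path_head p)}"

text \<open>
  A system of representatives of the open paths with respect to \<open>eq_t\<close> is coherent if two of its
  members whose words agree up to transposition have the same word. \<open>T_open\<close> is always a system of
  representatives (lemma \<open>T_open_representatives\<close>), but it need not be coherent: it may
  contain paths with words \<open>u\<close> and \<open>word_transp letter_transp u\<close>, each from a column to itself.
  The tableau T-tilde would then carry two indices, with transposed matrices, for arrows that
  must share one index, and its \<open>bpf\<close> would be too large by a binomial coefficient. Coherent systems
  always exist (lemma \<open>coherent_open_reps_exist\<close>).
\<close>

definition coherent_open_reps :: "nat \<Rightarrow> nat \<Rightarrow> nat arrow set \<Rightarrow> path set \<Rightarrow> bool" where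
  "coherent_open_reps q1 q2 T P \<longleftrightarrow>
     representatives (eq_t arrow_transp) {p. open_path q1 q2 T p} P \<and>
     (\<forall>b\<in>P. \<forall>c\<in>P. eq_t letter_transp (path_word b) (path_word c) \<longrightarrow> path_word b = path_word c)"

lemma arrow_transp_simps [simp]:
  "tail (arrow_transp a) = head a" "head (arrow_transp a) = tail a"
  "label (arrow_transp a) = letter_transp (label a)"
  by (cases a; simp)+

lemma letter_transp_invol [simp]: "letter_transp (letter_transp l) = l"
  by (cases l) auto

lemma letter_transp_neq: "letter_transp l \<noteq> l"
  by (cases l) auto

lemma arrow_transp_invol [simp]: "arrow_transp (arrow_transp a) = a"
  by (cases a) auto

lemma letter_arrow_simps [simp]:
  "tail (letter_arrow a) = tail a" "head (letter_arrow a) = head a"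
  "label (letter_arrow a) = Letter (label a)"
  unfolding letter_arrow_def by (cases a; simp)+

lemma word_transp_invol:
  assumes "\<And>x. tr (tr x) = x"
  shows "word_transp tr (word_transp tr u) = u"
  using assms by (simp add: word_transp_def rev_map comp_def)

lemma eq_t_iff:
  assumes "\<And>x. tr (tr x) = x"
  shows "eq_t tr u v \<longleftrightarrow> v = u \<or> v = word_transp tr u"
  using word_transp_invol[OF assms] by (auto simp: eq_t_def)

lemma path_word_transp: "path_word (word_transp arrow_transp p) = word_transp letter_transp (path_word p)"
  by (simp add: word_transp_def rev_map comp_def)

lemma path_tail_transp: "p \<noteq> [] \<Longrightarrow> path_tail (word_transp arrow_transp p) = path_head p"
  by (simp add: word_transp_def hd_rev last_map)

lemma path_head_transp: "p \<noteq> [] \<Longrightarrow> path_head (word_transp arrow_transp p) = path_tail p"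
  by (simp add: word_transp_def last_rev hd_map)

lemma arrow_transp_arrows_t: "x \<in> arrows_t T \<Longrightarrow> arrow_transp x \<in> arrows_t T"
  unfolding arrows_t_def by auto

lemma tableau_arrow:
  assumes "tableau_with_subst ns T Xs" "a \<in> T"
  shows "tail a \<in> cells ns" "head a \<in> cells ns" "tail a \<noteq> head a"
  using assms unfolding tableau_with_subst_def by blast+

lemma tableau_cell_unique:
  assumes "tableau_with_subst ns T Xs" "a \<in> T" "b \<in> T"
    "c \<in> {tail a, head a}" "c \<in> {tail b, head b}"
  shows "a = b"
proof -
  have "c \<in> cells ns" using tableau_arrow[OF assms(1,2)] assms(4) by blast
  then have "\<exists>!a. a \<in> T \<and> (tail a = c \<or> head a = c)"
    using assms(1) unfolding tableau_with_subst_def by (elim conjE) (rule bspec)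
  then show ?thesis using assms(2-5) by (metis insertE singletonD)
qed

lemma tableau_same_label:
  assumes "tableau_with_subst ns T Xs" "a \<in> T" "b \<in> T" "label a = label b"
  shows "head_col a = head_col b" "tail_col a = tail_col b"
  using assms unfolding tableau_with_subst_def by blast+

lemma arrows_t_cases:
  assumes "x \<in> arrows_t T"
  obtains a where "a \<in> T" "x = letter_arrow a" | a where "a \<in> T" "x = arrow_transp (letter_arrow a)"
  using assms unfolding arrows_t_def by auto

lemma arrows_t_tail_inj:
  assumes "tableau_with_subst ns T Xs" "x \<in> arrows_t T" "y \<in> arrows_t T" "tail x = tail y"
  shows "x = y"
proof -
  obtain a where a: "a \<in> T" "x = letter_arrow a \<or> x = arrow_transp (letter_arrow a)"
    using assms(2) by (rule arrows_t_cases) blast+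
  obtain b where b: "b \<in> T" "y = letter_arrow b \<or> y = arrow_transp (letter_arrow b)"
    using assms(3) by (rule arrows_t_cases) blast+
  have "tail x \<in> {tail a, head a}" using a by auto
  moreover have "tail x \<in> {tail b, head b}" using b unfolding assms(4) by auto
  ultimately have "a = b" using tableau_cell_unique[OF assms(1) a(1) b(1)] by blast
  moreover have "tail b \<noteq> head b" by (rule tableau_arrow[OF assms(1) b(1)])
  ultimately show ?thesis using a(2) b(2) assms(4) by (elim disjE) simp_all
qed

lemma arrows_t_transp_label:
  assumes "tableau_with_subst ns T Xs" "x \<in> arrows_t T" "y \<in> arrows_t T"
    "label x = letter_transp (label y)"
  shows "head_col x = tail_col y"
proof -
  obtain a where a: "a \<in> T" "x = letter_arrow a \<or> x = arrow_transp (letter_arrow a)"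
    using assms(2) by (rule arrows_t_cases) blast+
  obtain b where b: "b \<in> T" "y = letter_arrow b \<or> y = arrow_transp (letter_arrow b)"
    using assms(3) by (rule arrows_t_cases) blast+
  have "label a = label b" using a(2) b(2) assms(4) by (elim disjE) simp_all
  from tableau_same_label[OF assms(1) a(1) b(1) this] show ?thesis
    using a(2) b(2) assms(4) by (elim disjE) simp_all
qed

lemma path_word_not_palindrome:
  assumes "tableau_with_subst ns T Xs" "is_path q1 q2 T p"
  shows "word_transp letter_transp (path_word p) \<noteq> path_word p"
proof
  assume eq: "word_transp letter_transp (path_word p) = path_word p"
  let ?r = "length p"
  have nth: "label (p ! i) = letter_transp (label (p ! (?r - Suc i)))" if "i < ?r" for i
  proof -
    have "path_word p ! i = word_transp letter_transp (path_word p) ! i" using eq by simp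
    with that show ?thesis by (simp add: word_transp_def rev_nth)
  qed
  have pos: "0 < ?r" using assms(2) unfolding is_path_def by auto
  show False
  proof (cases "even ?r")
    case True
    then obtain k where k: "?r = 2 * Suc k" using pos
      by (metis dvdE gr0_implies_Suc mult_pos_pos nat_0_less_mult_iff)
    have "label (p ! k) = letter_transp (label (p ! Suc k))"
      using nth[of k] k by (simp add: numeral_2_eq_2)
    moreover have "p ! k \<in> arrows_t T" "p ! Suc k \<in> arrows_t T"
      using assms(2) k unfolding is_path_def by (auto simp: subset_iff)
    ultimately have "head_col (p ! k) = tail_col (p ! Suc k)"
      using arrows_t_transp_label[OF assms(1)] by blast
    moreover have "successive q1 q2 (p ! k) (p ! Suc k)"
      using assms(2) k unfolding is_path_def by auto
    ultimately show False unfolding successive_def by auto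
  next
    case False
    then obtain k where k: "?r = 2 * k + 1" by (elim oddE)
    then have "?r - Suc k = k" by simp
    then show False using nth[of k] k letter_transp_neq by (metis less_add_one less_add_same_cancel1
      add.commute mult_2 pos zero_less_iff_neq_zero trans_less_add1 le_add1 le_imp_less_Suc Suc_eq_plus1)
  qed
qed

lemma is_path_word_transp:
  assumes "is_path q1 q2 T p"
  shows "is_path q1 q2 T (word_transp arrow_transp p)"
  unfolding is_path_def
proof (intro conjI allI impI)
  show "word_transp arrow_transp p \<noteq> []" using assms by (simp add: is_path_def word_transp_def)
  show "set (word_transp arrow_transp p) \<subseteq> arrows_t T"
    using assms by (auto simp: is_path_def word_transp_def intro!: arrow_transp_arrows_t)
next
  fix i assume i: "Suc i < length (word_transp arrow_transp p)"
  then have i': "Suc i < length p" by (simp add: word_transp_def)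
  define j where "j = length p - Suc (Suc i)"
  have j: "Suc j < length p" "length p - Suc i = Suc j" using i' by (auto simp: j_def)
  have "successive q1 q2 (p ! j) (p ! Suc j)" using assms j by (auto simp: is_path_def)
  then show "successive q1 q2 (word_transp arrow_transp p ! i) (word_transp arrow_transp p ! Suc i)"
    using i' j by (auto simp: word_transp_def rev_nth successive_def j_def[symmetric])
qed

lemma open_path_word_transp:
  assumes "open_path q1 q2 T p"
  shows "open_path q1 q2 T (word_transp arrow_transp p)"
proof -
  have "p \<noteq> []" using assms by (auto simp: open_path_def is_path_def)
  then show ?thesis
    using assms is_path_word_transp path_tail_transp path_head_transp
    by (auto simp: open_path_def word_transp_def)
qed

lemma path_eqI:
  assumes "tableau_with_subst ns T Xs" "is_path q1 q2 T p" "is_path q1 q2 T p'"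
    "length p = length p'" "path_tail p = path_tail p'"
  shows "p = p'"
proof (rule nth_equalityI)
  fix i assume "i < length p"
  then show "p ! i = p' ! i"
  proof (induction i)
    case 0
    have "p ! 0 \<in> arrows_t T" "p' ! 0 \<in> arrows_t T"
      using assms 0 unfolding is_path_def by (auto simp: subset_iff)
    moreover have "tail (p ! 0) = tail (p' ! 0)"
      using assms by (simp add: is_path_def hd_conv_nth)
    ultimately show ?case using arrows_t_tail_inj[OF assms(1)] by blast
  next
    case (Suc i)
    have "p ! Suc i \<in> arrows_t T" "p' ! Suc i \<in> arrows_t T"
      using assms Suc unfolding is_path_def by (auto simp: subset_iff)
    moreover have "successive q1 q2 (p ! i) (p ! Suc i)" "successive q1 q2 (p' ! i) (p' ! Suc i)"
      using assms Suc.prems unfolding is_path_def by auto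
    then have "tail (p ! Suc i) = tail (p' ! Suc i)"
      using Suc by (auto simp: successive_def prod_eq_iff)
    ultimately show ?case using arrows_t_tail_inj[OF assms(1)] by blast
  qed
qed (use assms in simp)

lemma open_path_ends_neq:
  assumes "tableau_with_subst ns T Xs" "open_path q1 q2 T p"
  shows "path_tail p \<noteq> path_head p"
proof
  assume eq: "path_tail p = path_head p"
  have p: "is_path q1 q2 T p" "p \<noteq> []" using assms(2) by (auto simp: open_path_def is_path_def)
  have "word_transp arrow_transp p = p"
    using path_eqI[OF assms(1) is_path_word_transp[OF p(1)] p(1)] eq path_tail_transp[OF p(2)]
    by (simp add: word_transp_def)
  then have "word_transp letter_transp (path_word p) = path_word p"
    using path_word_transp[of p] by simp
  then show False using path_word_not_palindrome[OF assms(1) p(1)] by blast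
qed

lemma cell_less_total: "c \<noteq> d \<Longrightarrow> cell_less c d \<noteq> cell_less d c"
  by (cases c; cases d) (auto simp: cell_less_def)

lemma T_open_representatives:
  assumes "tableau_with_subst ns T Xs"
  shows "representatives (eq_t arrow_transp) {p. open_path q1 q2 T p} (T_open q1 q2 T)"
  unfolding representatives_def
proof (intro conjI ballI)
  show "T_open q1 q2 T \<subseteq> {p. open_path q1 q2 T p}" by (auto simp: T_open_def)
  fix p assume "p \<in> {p. open_path q1 q2 T p}"
  then have p: "open_path q1 q2 T p" by simp
  let ?p = "word_transp arrow_transp p"
  have ne: "p \<noteq> []" using p by (auto simp: open_path_def is_path_def)
  have p': "open_path q1 q2 T ?p" by (rule open_path_word_transp[OF p])
  note * = eq_t_iff[OF arrow_transp_invol, of p]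
  have "cell_less (path_tail p) (path_head p) \<noteq> cell_less (path_tail ?p) (path_head ?p)"
    unfolding path_tail_transp[OF ne] path_head_transp[OF ne]
    by (rule cell_less_total[OF open_path_ends_neq[OF assms p]])
  then have "(p \<in> T_open q1 q2 T) \<noteq> (?p \<in> T_open q1 q2 T)"
    using p p' by (simp add: T_open_def)
  then show "\<exists>!y. y \<in> T_open q1 q2 T \<and> eq_t arrow_transp p y"
    unfolding * by metis
qed

lemma coherent_open_reps_exist:
  assumes "tableau_with_subst ns T Xs"
  shows "\<exists>P. coherent_open_reps q1 q2 T P"
proof -
  define can where "can w = (SOME v. v = w \<or> v = word_transp letter_transp w)" for w
  have can: "can w = w \<or> can w = word_transp letter_transp w" for w
    unfolding can_def using someI[of "\<lambda>v. v = w \<or> v = word_transp letter_transp w" w] by simp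
  have can_t: "can (word_transp letter_transp w) = can w" for w
    unfolding can_def by (simp add: word_transp_invol disj_commute)
  define P where "P = {p. open_path q1 q2 T p \<and> can (path_word p) = path_word p}"
  have "representatives (eq_t arrow_transp) {p. open_path q1 q2 T p} P"
    unfolding representatives_def
  proof (intro conjI ballI)
    show "P \<subseteq> {p. open_path q1 q2 T p}" by (auto simp: P_def)
    fix p assume "p \<in> {p. open_path q1 q2 T p}"
    then have p: "open_path q1 q2 T p" by simp
    let ?p = "word_transp arrow_transp p"
    have p': "open_path q1 q2 T ?p" by (rule open_path_word_transp[OF p])
    note * = eq_t_iff[OF arrow_transp_invol, of p]
    have "word_transp letter_transp (path_word p) \<noteq> path_word p"
      using path_word_not_palindrome[OF assms] p by (auto simp: open_path_def)
    then have "(can (path_word p) = path_word p) \<noteq> (can (path_word ?p) = path_word ?p)"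
      using can[of "path_word p"] unfolding path_word_transp can_t by metis
    then have "(p \<in> P) \<noteq> (?p \<in> P)" using p p' by (simp add: P_def)
    then show "\<exists>!y. y \<in> P \<and> eq_t arrow_transp p y"
      unfolding * by metis
  qed
  moreover have "path_word b = path_word c"
    if "b \<in> P" "c \<in> P" "eq_t letter_transp (path_word b) (path_word c)" for b c
    using that can_t[of "path_word c"] unfolding P_def eq_t_def by auto
  ultimately show ?thesis unfolding coherent_open_reps_def by blast
qed

definition permute_cell :: "nat \<Rightarrow> (nat \<Rightarrow> nat) \<Rightarrow> cell \<Rightarrow> cell" where
  "permute_cell q \<tau> c = (fst c, if fst c = q then \<tau> (snd c) else snd c)"

definition permute_tableau :: "nat \<Rightarrow> (nat \<Rightarrow> nat) \<Rightarrow> nat arrow set \<Rightarrow> nat arrow set" where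
  "permute_tableau q \<tau> T =
     (\<lambda>a. Arrow (permute_cell q \<tau> (tail a)) (permute_cell q \<tau> (head a)) (label a)) ` T"

text \<open>
  The tableau with substitution T-tilde consists of \<open>tilde_dim\<close>, \<open>tilde_tableau\<close> and
  \<open>tilde_subst\<close>; \<open>P\<close> is the system of representatives of the open paths.
  The order of the new indices comes from the lexicographical order \<open>lexord r\<close> on words.
\<close>

definition tilde_dim :: "nat \<Rightarrow> nat \<Rightarrow> nat list \<Rightarrow> nat list" where
  "tilde_dim q1 q2 ns = nths ns (- {q1, q2})"

definition renumber :: "nat \<Rightarrow> nat \<Rightarrow> cell \<Rightarrow> cell" where
  "renumber q1 q2 c = (card {i. i < fst c \<and> i \<notin> {q1, q2}}, snd c)"

definition tilde_arrows :: "nat \<Rightarrow> nat \<Rightarrow> nat arrow set \<Rightarrow> path set \<Rightarrow> word arrow set" where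
  "tilde_arrows q1 q2 T P =
     (\<lambda>a. Arrow (tail a) (head a) [Letter (label a)]) `
        {a \<in> T. tail_col a \<notin> {q1, q2} \<and> head_col a \<notin> {q1, q2}} \<union>
     (\<lambda>p. Arrow (path_tail p) (path_head p) (path_word p)) ` P"

definition word_index :: "letter rel \<Rightarrow> word set \<Rightarrow> word \<Rightarrow> nat" where
  "word_index r W w = card {v \<in> W. (v, w) \<in> lexord r}"

definition tilde_tableau ::
    "letter rel \<Rightarrow> nat \<Rightarrow> nat \<Rightarrow> nat arrow set \<Rightarrow> path set \<Rightarrow> nat arrow set" where
  "tilde_tableau r q1 q2 T P =
     (let A = tilde_arrows q1 q2 T P
      in (\<lambda>a. Arrow (renumber q1 q2 (tail a)) (renumber q1 q2 (head a))
                (word_index r (label ` A) (label a))) ` A)"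

definition tilde_subst ::
    "letter rel \<Rightarrow> nat \<Rightarrow> nat \<Rightarrow> nat arrow set \<Rightarrow> path set \<Rightarrow> 'a::comm_ring_1 mat list \<Rightarrow> 'a mat list" where
  "tilde_subst r q1 q2 T P Xs =
     (let W = label ` tilde_arrows q1 q2 T P
      in map (\<lambda>k. word_mat Xs (the_inv_into W (word_index r W) k)) [0..<card W])"

text \<open>A quadruple is \<open>(\<beta>, \<gamma>, b, c)\<close>; \<open>s\<close> is the number of matrices of the substitution.\<close>

type_synonym quadruple = "nat list \<times> nat list \<times> word list \<times> word list"

definition words_over :: "nat \<Rightarrow> word set" where
  "words_over s = {u. \<forall>l\<in>set u. letter_index l < s}"

fun T_quadruple :: "nat \<Rightarrow> quadruple \<Rightarrow> bool" where
  "T_quadruple s (\<beta>, \<gamma>, b, c) \<longleftrightarrow>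
     length \<beta> = length b \<and> length \<gamma> = length c \<and>
     (\<forall>u\<in>set b \<union> set c. u \<in> words_over s \<and> primitive u) \<and>
     (\<forall>i j. i < j \<and> j < length b \<longrightarrow> \<not> eq_t letter_transp (b ! i) (b ! j)) \<and>
     (\<forall>i j. i < j \<and> j < length c \<longrightarrow> \<not> eq_ct letter_transp (c ! i) (c ! j))"

definition mset_with_mult :: "nat list \<Rightarrow> word list \<Rightarrow> word multiset" where
  "mset_with_mult \<beta> b = mset (concat (map2 replicate \<beta> b))"

text \<open>
  \<open>admissible_perm q1 q2 n T x \<xi>\<close>: the permutation \<open>\<xi>\<close> witnesses that \<open>x\<close> is admissible.
  The choice of the representatives \<open>C\<close> of the closed paths is immaterial.
\<close>

fun admissible_perm ::
    "nat \<Rightarrow> nat \<Rightarrow> nat \<Rightarrow> nat arrow set \<Rightarrow> quadruple \<Rightarrow> (nat \<Rightarrow> nat) \<Rightarrow> bool" where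
  "admissible_perm q1 q2 n T (\<beta>, \<gamma>, b, c) \<xi> \<longleftrightarrow>
     \<xi> permutes {..<n} \<and>
     mset_equiv (eq_t letter_transp)
       (image_mset path_word (mset_set (T_open q1 q2 (permute_tableau q2 \<xi> T))))
       (mset_with_mult \<beta> b) \<and>
     (\<exists>C. representatives (eq_ct arrow_transp) {p. closed_path q1 q2 (permute_tableau q2 \<xi> T) p} C \<and>
        mset_equiv (eq_ct letter_transp) (image_mset path_word (mset_set C)) (mset_with_mult \<gamma> c))"

definition admissible :: "nat \<Rightarrow> nat \<Rightarrow> nat \<Rightarrow> nat \<Rightarrow> nat arrow set \<Rightarrow> quadruple set" where
  "admissible q1 q2 n s T = {x. T_quadruple s x \<and> (\<exists>\<xi>. admissible_perm q1 q2 n T x \<xi>)}"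

fun quadruple_equiv :: "quadruple \<Rightarrow> quadruple \<Rightarrow> bool" where
  "quadruple_equiv (\<beta>, \<gamma>, b, c) (\<beta>', \<gamma>', b', c') \<longleftrightarrow>
     mset_equiv (eq_t letter_transp) (mset_with_mult \<beta> b) (mset_with_mult \<beta>' b') \<and>
     mset_equiv (eq_ct letter_transp) (mset_with_mult \<gamma> c) (mset_with_mult \<gamma>' c')"

end

theory Submission
  imports Defs "HOL-Library.Poly_Mapping"
begin

text \<open>
  Multiplying \<open>bpf\<close> by the number of permutations of the arrows that preserve the labels removes the
  monotonicity condition on the column permutations. This factor can be cancelled in a torsion-free
  ring, and every commutative ring is an image of the monoid ring of its multiplicative monoid over
  the integers, so it suffices to treat torsion-free rings.

  The product of the signed sums over the permutations of the columns \<open>q1\<close> and \<open>q2\<close> is a signed sum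
  over the involutions \<open>J\<close> that join the cells of one of these columns to the cells of the other; such a
  \<open>J\<close> is the same as a permutation \<open>\<xi>\<close>, and the remaining sum runs over arbitrary index functions
  constant on the joints. Walking along arrows and joints, one reads a word from every cell. The
  quadruple of \<open>\<xi>\<close> is determined by the number of cells with each reading, where the joinings whose
  cycles have the period of their readings give the primitive representatives. The joinings of one
  quadruple are obtained from one of them by relabelling the cells (which does not change the
  summand) and by permuting the joints between closed strings with equal readings. Contracting the
  open strings gives \<open>bpf\<close> of the smaller tableau, and the signed sum over the ways to close up
  the closed strings with the reading \<open>c\<close> is a sum of principal minors, hence the product of the
  \<open>sigma\<close>.
\<close>

section \<open>Label-preserving permutations\<close>

text \<open>A reading forgets how often its cycle is traversed: one cycle with the word cc and two
  cycles with the word c give their cells equal readings. This is why terms are grouped by readings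
  and not by strings. The class of a quadruple contains joinings whose cycles run through several
  closed strings, and exactly these supply the non-identity permutations in the principal minors
  that make up \<open>sigma\<close>. Multiplicities are counted in bulk, never divided out term by
  term. Pairing each joining of a class with the reading-preserving bijections of the starting cells
  gives a factor that splits into one for the open and one for the closed strings. The first equals
  the factor between \<open>bpf\<close> of the smaller tableau and its unrestricted sum, the second
  the product of the factorials in front of the \<open>sigma\<close>. What remains is the number of
  label-preserving permutations of the original arrows, the factor already present on the left.
  Directions can be chosen consistently because no string reads the same from both sides: a joint
  always links two different columns.\<close>

class torsion_free_ring = comm_ring_1 +
  assumes torsion_free: "of_nat (Suc k) * x = 0 \<Longrightarrow> x = 0"

lemma of_nat_mult_left_cancel:
  fixes x y :: "'a::torsion_free_ring"
  assumes "of_nat k * x = of_nat k * y" "0 < k"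
  shows "x = y"
proof -
  obtain m where "k = Suc m" using assms(2) gr0_implies_Suc by blast
  then have "of_nat (Suc m) * (x - y) = 0" using assms(1) by (simp add: algebra_simps)
  then have "x - y = 0" by (rule torsion_free)
  then show ?thesis by simp
qed

abbreviation (input) pinv :: "('x \<Rightarrow> 'y) \<Rightarrow> 'y \<Rightarrow> 'x" where "pinv \<equiv> inv_into UNIV"

text \<open>Taken for the labels of arrows, the letters of cells and the readings of starting cells.
  The orders of the first and the last of these groups are the multiplicities to be
  cancelled.\<close>

definition aut :: "'x set \<Rightarrow> ('x \<Rightarrow> 'l) \<Rightarrow> ('x \<Rightarrow> 'x) set" where
  "aut A f = {p. p permutes A \<and> (\<forall>x\<in>A. f (p x) = f x)}"

definition merge :: "'x set \<Rightarrow> ('x \<Rightarrow> 'y) \<Rightarrow> ('x \<Rightarrow> 'y) \<Rightarrow> 'x \<Rightarrow> 'y" where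
  "merge A F H = (\<lambda>x. if x \<in> A then F x else H x)"

lemma sum_PiE_Un:
  assumes "A \<inter> B = {}"
  shows "(\<Sum>F\<in>PiE (A \<union> B) X. \<Psi> F) = (\<Sum>F\<in>PiE A X. \<Sum>H\<in>PiE B X. \<Psi> (merge A F H))"
proof -
  have eq: "merge A (restrict F A) (restrict F B) = F" if "F \<in> PiE (A \<union> B) X" for F
    using that by (auto simp: merge_def PiE_iff extensional_def fun_eq_iff restrict_def)
  have "(\<Sum>F\<in>PiE (A \<union> B) X. \<Psi> F) = (\<Sum>(F, H)\<in>PiE A X \<times> PiE B X. \<Psi> (merge A F H))"
    by (rule sum.reindex_bij_witness[where i = "\<lambda>(F, H). merge A F H"
          and j = "\<lambda>F. (restrict F A, restrict F B)"])
      (use assms eq in \<open>auto simp: merge_def PiE_iff extensional_def fun_eq_iff restrict_def\<close>)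
  then show ?thesis by (simp add: sum.cartesian_product)
qed

lemma sum_PiE_insert:
  assumes "a \<notin> A"
  shows "(\<Sum>F\<in>PiE (insert a A) X. \<Psi> F) = (\<Sum>y\<in>X a. \<Sum>F\<in>PiE A X. \<Psi> (F(a := y)))"
proof -
  have "(\<Sum>F\<in>PiE (insert a A) X. \<Psi> F) = (\<Sum>(y, F)\<in>X a \<times> PiE A X. \<Psi> (F(a := y)))"
    unfolding PiE_insert_eq
    by (subst sum.reindex) (use inj_combinator[OF assms, of X] in \<open>auto simp: case_prod_unfold\<close>)
  then show ?thesis by (simp add: sum.cartesian_product)
qed

lemma sign_comp_permutes:
  assumes "finite A" "finite B" "p permutes A" "q permutes B"
  shows "sign (p \<circ> q) = sign p * sign q"
  using assms by (meson permutation_permutes sign_compose)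

text \<open>Equal labels never occur on both sides, so a label-preserving permutation of the union
  maps each side to itself and is the product of its restrictions. Orders of such groups and sums
  over them therefore factor over label classes.\<close>

lemma aut_split:
  assumes disj: "A \<inter> B = {}" and lab: "f ` A \<inter> f ` B = {}"
  shows "bij_betw (\<lambda>(p, q). p \<circ> q) (aut A f \<times> aut B f) (aut (A \<union> B) f)"
proof (rule bij_betw_byWitness[where f' = "\<lambda>p. (restrict_id p A, restrict_id p B)"])
  have p: "p x \<in> A \<longleftrightarrow> x \<in> A" "p x \<notin> A \<Longrightarrow> p x = x" "x \<notin> A \<Longrightarrow> p x = x" if "p \<in> aut A f" for p x
    using that by (auto simp: aut_def permutes_in_image permutes_not_in)
  have q: "q x \<in> B \<longleftrightarrow> x \<in> B" "x \<notin> B \<Longrightarrow> q x = x" if "q \<in> aut B f" for q x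
    using that by (auto simp: aut_def permutes_in_image permutes_not_in)
  show "\<forall>a\<in>aut A f \<times> aut B f. (restrict_id ((\<lambda>(p, q). p \<circ> q) a) A, restrict_id ((\<lambda>(p, q). p \<circ> q) a) B) = a"
  proof (clarify, intro conjI ext)
    fix p q x assume pq: "p \<in> aut A f" "q \<in> aut B f"
    show "restrict_id (p \<circ> q) A x = p x"
      using p[OF pq(1), of x] q[OF pq(2), of x] disj by (auto simp: restrict_id_def)
    show "restrict_id (p \<circ> q) B x = q x"
      using p[OF pq(1), of "q x"] q[OF pq(2), of x] disj by (auto simp: restrict_id_def)
  qed
  have stay: "p x \<in> A" if "p \<in> aut (A \<union> B) f" "x \<in> A" for p x
  proof -
    have "p x \<in> A \<union> B" "f (p x) = f x" using that by (auto simp: aut_def dest: permutes_in_image)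
    then show ?thesis using lab that(2) by (metis IntI Un_iff empty_iff image_eqI)
  qed
  have stay': "p x \<in> B" if "p \<in> aut (A \<union> B) f" "x \<in> B" for p x
  proof -
    have "p x \<in> A \<union> B" "f (p x) = f x" using that by (auto simp: aut_def dest: permutes_in_image)
    then show ?thesis using lab that(2) by (metis IntI Un_iff empty_iff image_eqI)
  qed
  show "\<forall>a'\<in>aut (A \<union> B) f. (\<lambda>(p, q). p \<circ> q) (restrict_id a' A, restrict_id a' B) = a'"
  proof (clarify, intro ext, simp)
    fix p x assume pp: "p \<in> aut (A \<union> B) f"
    have "p x = x" if "x \<notin> A" "x \<notin> B" using pp that by (auto simp: aut_def permutes_not_in)
    then show "restrict_id p A (restrict_id p B x) = p x"
      using stay'[OF pp] disj by (auto simp: restrict_id_def)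
  qed
  show "(\<lambda>(p, q). p \<circ> q) ` (aut A f \<times> aut B f) \<subseteq> aut (A \<union> B) f"
  proof clarify
    fix p q assume pq: "p \<in> aut A f" "q \<in> aut B f"
    have "p permutes A \<union> B" "q permutes A \<union> B"
      using pq by (auto simp: aut_def intro: permutes_subset)
    moreover have "f (p (q x)) = f x" if "x \<in> A \<union> B" for x
      using that pq p[OF pq(1), of "q x"] q[OF pq(2), of x] disj by (auto simp: aut_def)
    ultimately show "p \<circ> q \<in> aut (A \<union> B) f" by (simp add: aut_def permutes_compose)
  qed
  show "(\<lambda>p. (restrict_id p A, restrict_id p B)) ` aut (A \<union> B) f \<subseteq> aut A f \<times> aut B f"
  proof (rule image_subsetI)
    fix p assume pp: "p \<in> aut (A \<union> B) f"
    then have perm: "p permutes (A \<union> B)" and inj: "inj p" by (auto simp: aut_def permutes_inj)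
    obtain p' where p': "p' = pinv p" by simp
    have p'aut: "p' \<in> aut (A \<union> B) f"
      unfolding aut_def p' using permutes_inv[OF perm] pp perm
      by (auto simp: aut_def) (metis Un_iff permutes_in_image permutes_inverses(1))+
    have "bij_betw p A A"
      by (rule bij_betw_byWitness[where f' = p'])
        (use stay[OF pp] stay[OF p'aut] permutes_inverses[OF perm] p' in auto)
    moreover have "bij_betw p B B"
      by (rule bij_betw_byWitness[where f' = p'])
        (use stay'[OF pp] stay'[OF p'aut] permutes_inverses[OF perm] p' in auto)
    ultimately show "(restrict_id p A, restrict_id p B) \<in> aut A f \<times> aut B f"
      using pp by (auto simp: aut_def permutes_restrict_id)
  qed
qed

lemma sum_aut_Un:
  assumes "A \<inter> B = {}" "f ` A \<inter> f ` B = {}"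
  shows "(\<Sum>p\<in>aut (A \<union> B) f. \<Psi> p) = (\<Sum>p\<in>aut A f. \<Sum>q\<in>aut B f. \<Psi> (p \<circ> q))"
  by (simp add: sum.cartesian_product sum.reindex_bij_betw[OF aut_split[OF assms], symmetric]
      case_prod_unfold)

lemma card_aut_Un:
  assumes "A \<inter> B = {}" "f ` A \<inter> f ` B = {}"
  shows "card (aut (A \<union> B) f) = card (aut A f) * card (aut B f)"
  using bij_betw_same_card[OF aut_split[OF assms]] by (simp add: card_cartesian_product)

lemma finite_aut: "finite A \<Longrightarrow> finite (aut A f)"
  unfolding aut_def by (rule finite_subset[OF _ finite_permutations]) auto

lemma aut_const:
  assumes "\<And>x. x \<in> A \<Longrightarrow> f x = v"
  shows "aut A f = {p. p permutes A}"
  using assms by (auto simp: aut_def permutes_in_image)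

lemma id_aut: "id \<in> aut A f"
  by (auto simp: aut_def)

lemma card_aut_pos: "finite A \<Longrightarrow> 0 < card (aut A f)"
  using id_aut finite_aut by (metis card_gt_0_iff emptyE)

lemma aut_comp: "p \<in> aut A f \<Longrightarrow> q \<in> aut A f \<Longrightarrow> p \<circ> q \<in> aut A f"
  by (auto simp: aut_def permutes_compose permutes_in_image)

lemma aut_inv:
  assumes "p \<in> aut A f"
  shows "pinv p \<in> aut A f"
proof -
  have p: "p permutes A" using assms by (simp add: aut_def)
  have "f (pinv p x) = f x" if "x \<in> A" for x
  proof -
    have "pinv p x \<in> A" using that permutes_in_image[OF permutes_inv[OF p]] by simp
    then have "f (p (pinv p x)) = f (pinv p x)" using assms by (auto simp: aut_def)
    then show ?thesis by (simp add: permutes_inverses[OF p])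
  qed
  then show ?thesis using permutes_inv[OF p] by (simp add: aut_def)
qed

section \<open>Signed sums over permutations and principal minors\<close>

lemma sum_sign_not_inj:
  fixes \<Phi> :: "('x \<Rightarrow> 'y) \<Rightarrow> 'a::torsion_free_ring"
  assumes "finite S" "\<not> inj_on f S"
  shows "(\<Sum>\<rho> | \<rho> permutes S. of_int (sign \<rho>) * \<Phi> (\<lambda>x. f (\<rho> x))) = 0"
proof -
  obtain a b where ab: "a \<in> S" "b \<in> S" "a \<noteq> b" "f a = f b"
    using assms(2) by (auto simp: inj_on_def)
  let ?t = "transpose a b"
  have t: "?t permutes S" by (rule permutes_swap_id[OF ab(1,2)])
  have ft: "f (?t x) = f x" for x using ab by (auto simp: transpose_def)
  let ?s = "\<Sum>\<rho> | \<rho> permutes S. of_int (sign \<rho>) * \<Phi> (\<lambda>x. f (\<rho> x))"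
  \<comment> \<open>Composing with the transposition of two points of equal value reverses the sign
    and changes nothing else, so the sum is its own negative. Torsion-freeness removes the resulting
    factor 2.\<close>
  have "?s = (\<Sum>\<rho> | \<rho> permutes S. of_int (sign (?t \<circ> \<rho>)) * \<Phi> (\<lambda>x. f ((?t \<circ> \<rho>) x)))"
    by (rule setum_permutations_compose_left[OF t])
  also have "\<dots> = (\<Sum>\<rho> | \<rho> permutes S. - (of_int (sign \<rho>) * \<Phi> (\<lambda>x. f (\<rho> x))))"
    by (rule sum.cong) (use ab in \<open>auto simp: ft sign_comp_permutes[OF assms(1) assms(1) t] sign_swap_id\<close>)
  finally have "?s = - ?s" by (simp add: sum_negf)
  then have "of_nat (Suc 1) * ?s = 0" by (simp add: eq_neg_iff_add_eq_0)
  then show ?thesis by (rule torsion_free)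
qed

text \<open>After exchanging the two sums every non-injective f contributes 0. This passes between
  injective index functions, which come from permutations and minors, and arbitrary ones, over which
  matrix products can be formed.\<close>

lemma sum_sign_inj:
  fixes \<Phi> :: "('x \<Rightarrow> 'y) \<Rightarrow> ('x \<Rightarrow> 'y) \<Rightarrow> 'a::torsion_free_ring"
  assumes "finite S" "finite E"
  shows "(\<Sum>\<rho> | \<rho> permutes S. of_int (sign \<rho>) * (\<Sum>f\<in>S \<rightarrow>\<^sub>E E. \<Phi> f (\<lambda>x. f (\<rho> x)))) =
    (\<Sum>f\<in>{f \<in> S \<rightarrow>\<^sub>E E. inj_on f S}. \<Sum>\<rho> | \<rho> permutes S. of_int (sign \<rho>) * \<Phi> f (\<lambda>x. f (\<rho> x)))"
proof -
  have fin: "finite (S \<rightarrow>\<^sub>E E)" by (simp add: finite_PiE assms)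
  have "(\<Sum>\<rho> | \<rho> permutes S. of_int (sign \<rho>) * (\<Sum>f\<in>S \<rightarrow>\<^sub>E E. \<Phi> f (\<lambda>x. f (\<rho> x)))) =
    (\<Sum>f\<in>S \<rightarrow>\<^sub>E E. \<Sum>\<rho> | \<rho> permutes S. of_int (sign \<rho>) * \<Phi> f (\<lambda>x. f (\<rho> x)))"
    unfolding sum_distrib_left by (rule sum.swap)
  also have "\<dots> = (\<Sum>f\<in>{f \<in> S \<rightarrow>\<^sub>E E. inj_on f S}. \<Sum>\<rho> | \<rho> permutes S. of_int (sign \<rho>) * \<Phi> f (\<lambda>x. f (\<rho> x)))"
    by (rule sum.mono_neutral_right[OF fin]) (auto intro!: sum_sign_not_inj[OF assms(1)])
  finally show ?thesis .
qed

text \<open>Each entry of the characteristic matrix is a constant, plus the variable on the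
  diagonal. Expanding every product over the set A of positions where the constant is taken leaves
  the permutations p that fix the complement of A, with the power n - card A of the
  variable.\<close>

lemma char_poly_coeff_minors:
  fixes Y :: "'a::comm_ring_1 mat"
  assumes Y: "Y \<in> carrier_mat n n" and k: "k \<le> n"
  shows "coeff (char_poly Y) (n - k) = (- 1) ^ k *
    (\<Sum>A | A \<subseteq> {..<n} \<and> card A = k. \<Sum>p | p permutes A. of_int (sign p) * (\<Prod>i\<in>A. Y $$ (i, p i)))"
proof -
  let ?N = "{0..<n}"
  have pr: "(\<Prod>i\<in>?N. char_poly_matrix Y $$ (i, p i)) =
    (\<Sum>A\<in>Pow ?N. [:(- 1) ^ card A * (\<Prod>i\<in>A. Y $$ (i, p i)):] *
       (if p permutes A then monom 1 (n - card A) else 0))" if p: "p permutes ?N" for p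
  proof -
    have "(\<Prod>i\<in>?N. char_poly_matrix Y $$ (i, p i)) =
      (\<Prod>i\<in>?N. [:- Y $$ (i, p i):] + (if p i = i then monom 1 1 else 0))"
    proof (rule prod.cong[OF refl])
      fix i assume i: "i \<in> ?N"
      then have "p i < n" using permutes_in_image[OF p, of i] by simp
      then show "char_poly_matrix Y $$ (i, p i) = [:- Y $$ (i, p i):] + (if p i = i then monom 1 1 else 0)"
        using Y i by (cases "p i = i") (simp_all add: char_poly_matrix_def monom_Suc monom_0)
    qed
    also have "\<dots> = (\<Sum>A\<in>Pow ?N. (\<Prod>i\<in>A. [:- Y $$ (i, p i):]) * (\<Prod>i\<in>?N - A. if p i = i then monom 1 1 else 0))"
      by (rule prod_add) simp
    also have "\<dots> = (\<Sum>A\<in>Pow ?N. [:(- 1) ^ card A * (\<Prod>i\<in>A. Y $$ (i, p i)):] *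
       (if p permutes A then monom 1 (n - card A) else 0))"
    proof (rule sum.cong[OF refl], rule arg_cong2[where f = "(*)"])
      fix A assume A: "A \<in> Pow ?N"
      then have fin: "finite A" using finite_subset by auto
      show "(\<Prod>i\<in>A. [:- Y $$ (i, p i):]) = [:(- 1) ^ card A * (\<Prod>i\<in>A. Y $$ (i, p i)):]"
        using fin by (induction A rule: finite_induct) (simp_all add: algebra_simps)
      \<comment> \<open>The factor of a position outside A is nonzero only if p fixes that position,
        so the whole product vanishes unless p fixes the complement of A pointwise.\<close>
      have iff: "p permutes A \<longleftrightarrow> (\<forall>i\<in>?N - A. p i = i)"
        using p A permutes_superset[of p ?N A] by (auto simp: permutes_not_in)
      have c: "card (?N - A) = n - card A" using A fin by (subst card_Diff_subset) auto
      show "(\<Prod>i\<in>?N - A. if p i = i then monom 1 1 else 0) = (if p permutes A then monom (1::'a) (n - card A) else 0)"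
      proof (cases "p permutes A")
        case True
        then have "(\<Prod>i\<in>?N - A. if p i = i then monom (1::'a) 1 else 0) = (\<Prod>i\<in>?N - A. monom 1 1)"
          using iff by (intro prod.cong) auto
        then show ?thesis using True c by (simp add: monom_power)
      next
        case False
        then show ?thesis using iff by (auto intro!: prod_zero)
      qed
    qed
    finally show ?thesis .
  qed
  have c1: "coeff ([:a:] * (if P then monom 1 (n - card A) else 0)) (n - k) =
      (if P \<and> card A = k then a else 0)" if "A \<in> Pow ?N" for a :: 'a and P A
  proof -
    have "card A \<le> n" using that card_mono[of ?N A] by auto
    then show ?thesis using k by auto
  qed
  have "coeff (char_poly Y) (n - k) = (\<Sum>p | p permutes ?N. coeff (of_int (sign p) *
      (\<Prod>i\<in>?N. char_poly_matrix Y $$ (i, p i))) (n - k))"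
    unfolding char_poly_def using Y by (subst det_def'[where n = n]) (auto simp: coeff_sum)
  also have "\<dots> = (\<Sum>p | p permutes ?N. of_int (sign p) *
      (\<Sum>A\<in>Pow ?N. if p permutes A \<and> card A = k then (- 1) ^ card A * (\<Prod>i\<in>A. Y $$ (i, p i)) else 0))"
  proof (rule sum.cong[OF refl])
    fix p assume "p \<in> {p. p permutes ?N}"
    then have p: "p permutes ?N" by simp
    have s: "coeff (of_int (sign p) * q) m = of_int (sign p) * coeff q m" for q :: "'a poly" and m
      by (cases p rule: sign_cases) auto
    show "coeff (of_int (sign p) * (\<Prod>i\<in>?N. char_poly_matrix Y $$ (i, p i))) (n - k) = of_int (sign p) *
      (\<Sum>A\<in>Pow ?N. if p permutes A \<and> card A = k then (- 1) ^ card A * (\<Prod>i\<in>A. Y $$ (i, p i)) else 0)"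
      unfolding s pr[OF p] coeff_sum by (intro arg_cong2[where f = "(*)"] refl sum.cong c1)
  qed
  also have "\<dots> = (\<Sum>p | p permutes ?N. \<Sum>A | A \<subseteq> {..<n} \<and> card A = k.
      if p permutes A then (- 1) ^ k * (of_int (sign p) * (\<Prod>i\<in>A. Y $$ (i, p i))) else 0)"
  proof (rule sum.cong[OF refl])
    fix p
    have fin: "finite (Pow ?N)" by simp
    show "of_int (sign p) *
      (\<Sum>A\<in>Pow ?N. if p permutes A \<and> card A = k then (- 1) ^ card A * (\<Prod>i\<in>A. Y $$ (i, p i)) else 0) =
      (\<Sum>A | A \<subseteq> {..<n} \<and> card A = k.
      if p permutes A then (- 1) ^ k * (of_int (sign p) * (\<Prod>i\<in>A. Y $$ (i, p i))) else 0)"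
      unfolding sum_distrib_left
      by (rule sum.mono_neutral_cong_right[OF fin]) (auto simp: lessThan_atLeast0)
  qed
  also have "\<dots> = (\<Sum>A | A \<subseteq> {..<n} \<and> card A = k. \<Sum>p | p permutes ?N.
      if p permutes A then (- 1) ^ k * (of_int (sign p) * (\<Prod>i\<in>A. Y $$ (i, p i))) else 0)"
    by (rule sum.swap)
  also have "\<dots> = (\<Sum>A | A \<subseteq> {..<n} \<and> card A = k. \<Sum>p | p permutes A.
      (- 1) ^ k * (of_int (sign p) * (\<Prod>i\<in>A. Y $$ (i, p i))))"
  proof (rule sum.cong[OF refl])
    fix A assume "A \<in> {A. A \<subseteq> {..<n} \<and> card A = k}"
    then have A: "A \<subseteq> ?N" by (auto simp: lessThan_atLeast0)
    have fin: "finite {p. p permutes ?N}" by (simp add: finite_permutations)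
    show "(\<Sum>p | p permutes ?N.
      if p permutes A then (- 1) ^ k * (of_int (sign p) * (\<Prod>i\<in>A. Y $$ (i, p i))) else 0) =
      (\<Sum>p | p permutes A. (- 1) ^ k * (of_int (sign p) * (\<Prod>i\<in>A. Y $$ (i, p i))))"
      by (rule sum.mono_neutral_cong_right[OF fin]) (auto intro: permutes_subset[OF _ A])
  qed
  finally show ?thesis by (simp add: sum_distrib_left)
qed

lemma sigma_minors:
  fixes Y :: "'a::comm_ring_1 mat"
  assumes Y: "Y \<in> carrier_mat n n" and k: "k \<le> n"
  shows "sigma k Y =
    (\<Sum>A | A \<subseteq> {..<n} \<and> card A = k. \<Sum>p | p permutes A. of_int (sign p) * (\<Prod>i\<in>A. Y $$ (i, p i)))"
proof (cases "k = 0")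
  case True
  have "{A. A \<subseteq> {..<n} \<and> card A = 0} = {{}}" using finite_subset by fastforce
  then show ?thesis using True by (simp add: sigma_def)
next
  case False
  then show ?thesis using char_poly_coeff_minors[OF assms] Y k
    by (simp add: sigma_def)
qed

text \<open>Only injective f contribute, and transporting \<rho> along f turns the inner sum into
  the principal minor on the image of f. Each subset of the right size is the image of as many
  injections as the factorial tells. If S has more than n elements, both sides vanish.\<close>

lemma sum_sign_cycles_eq_sigma:
  fixes Y :: "'a::torsion_free_ring mat"
  assumes Y: "Y \<in> carrier_mat n n" and S: "finite S"
  shows "(\<Sum>\<rho> | \<rho> permutes S. of_int (sign \<rho>) * (\<Sum>f\<in>S \<rightarrow>\<^sub>E {..<n}. \<Prod>s\<in>S. Y $$ (f s, f (\<rho> s)))) =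
    of_nat (fact (card S)) * sigma (card S) Y"
proof -
  let ?I = "{f \<in> S \<rightarrow>\<^sub>E {..<n}. inj_on f S}"
  define g where "g A = (\<Sum>p | p permutes A. of_int (sign p) * (\<Prod>i\<in>A. Y $$ (i, p i)))" for A
  have finI: "finite ?I" using S by (intro finite_subset[OF _ finite_PiE[of S "\<lambda>_. {..<n}"]]) auto
  have "(\<Sum>\<rho> | \<rho> permutes S. of_int (sign \<rho>) * (\<Sum>f\<in>S \<rightarrow>\<^sub>E {..<n}. \<Prod>s\<in>S. Y $$ (f s, f (\<rho> s)))) =
     (\<Sum>f\<in>?I. \<Sum>\<rho> | \<rho> permutes S. of_int (sign \<rho>) * (\<Prod>s\<in>S. Y $$ (f s, f (\<rho> s))))"
    using sum_sign_inj[OF S, of "{..<n}" "\<lambda>f h. \<Prod>s\<in>S. Y $$ (f s, h s)"] by simp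
  also have "\<dots> = (\<Sum>f\<in>?I. g (f ` S))"
  proof (rule sum.cong[OF refl])
    fix f assume f: "f \<in> ?I"
    then have bij: "bij_betw f S (f ` S)" by (auto simp: bij_betw_def)
    have bp: "bij_betw (map_permutation S f) {p. p permutes S} {p. p permutes f ` S}"
    proof -
      have "map_permutation S f = (\<lambda>\<pi> x. if x \<in> f ` S then f (\<pi> (inv_into S f x)) else x)"
        by (auto simp: map_permutation_def restrict_id_def fun_eq_iff)
      then show ?thesis using bij_betw_permutations[OF bij] by simp
    qed
    have inj: "inj_on f S" using f by simp
    have app: "map_permutation S f p (f s) = f (p s)" if "s \<in> S" for p s
      by (rule map_permutation_apply[OF inj that])
    have "(\<Sum>\<rho> | \<rho> permutes S. of_int (sign \<rho>) * (\<Prod>s\<in>S. Y $$ (f s, f (\<rho> s)))) =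
      (\<Sum>\<rho> | \<rho> permutes S. of_int (sign (map_permutation S f \<rho>)) * (\<Prod>i\<in>f ` S. Y $$ (i, map_permutation S f \<rho> i)))"
    proof (rule sum.cong[OF refl])
      fix p assume "p \<in> {p. p permutes S}"
      then have p: "p permutes S" by simp
      have "(\<Prod>i\<in>f ` S. Y $$ (i, map_permutation S f p i)) = (\<Prod>s\<in>S. Y $$ (f s, f (p s)))"
        by (subst prod.reindex[OF inj]) (simp add: app)
      then show "of_int (sign p) * (\<Prod>s\<in>S. Y $$ (f s, f (p s))) =
        of_int (sign (map_permutation S f p)) * (\<Prod>i\<in>f ` S. Y $$ (i, map_permutation S f p i))"
        by (simp add: sign_map_permutation[OF inj p S])
    qed
    also have "\<dots> = g (f ` S)"
      unfolding g_def by (rule sum.reindex_bij_betw[OF bp])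
    finally show "(\<Sum>\<rho> | \<rho> permutes S. of_int (sign \<rho>) * (\<Prod>s\<in>S. Y $$ (f s, f (\<rho> s)))) = g (f ` S)" .
  qed
  also have "\<dots> = (\<Sum>A\<in>(\<lambda>f. f ` S) ` ?I. \<Sum>f\<in>{f \<in> ?I. f ` S = A}. g (f ` S))"
    by (rule sum.image_gen[OF finI])
  also have "\<dots> = (\<Sum>A\<in>(\<lambda>f. f ` S) ` ?I. of_nat (fact (card S)) * g A)"
  proof (rule sum.cong[OF refl])
    fix A assume "A \<in> (\<lambda>f. f ` S) ` ?I"
    then have A: "A \<subseteq> {..<n}" "card A = card S" "finite A"
      using card_image S by (auto simp: card_image)
    have surj: "f ` S = A" if "f \<in> S \<rightarrow>\<^sub>E A" "inj_on f S" for f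
      using that A by (intro card_subset_eq[OF A(3)]) (auto simp: card_image PiE_iff)
    have eq: "{f \<in> ?I. f ` S = A} = {f \<in> S \<rightarrow>\<^sub>E A. inj_on f S}"
      using A surj by (auto simp: PiE_iff)
    have "card {f \<in> ?I. f ` S = A} = fact (card S)"
      unfolding eq card_inj_on_subset_funcset[OF S A(3) subset_refl] A(2) fact_prod_rev by simp
    then show "(\<Sum>f\<in>{f \<in> ?I. f ` S = A}. g (f ` S)) = of_nat (fact (card S)) * g A"
      by simp
  qed
  also have "(\<lambda>f. f ` S) ` ?I = {A. A \<subseteq> {..<n} \<and> card A = card S}"
  proof (intro equalityI subsetI)
    fix A assume "A \<in> {A. A \<subseteq> {..<n} \<and> card A = card S}"
    then have A: "A \<subseteq> {..<n}" "card A = card S" by auto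
    then have "finite A" using finite_subset by auto
    then obtain h where h: "bij_betw h S A" using S A(2) finite_same_card_bij by metis
    then have "restrict h S \<in> ?I" "restrict h S ` S = A"
      using A by (auto simp: bij_betw_def inj_on_def)
    then show "A \<in> (\<lambda>f. f ` S) ` ?I" by (metis (no_types, lifting) imageI)
  qed (auto simp: card_image)
  also have "(\<Sum>A | A \<subseteq> {..<n} \<and> card A = card S. of_nat (fact (card S)) * g A) =
     of_nat (fact (card S)) * sigma (card S) Y"
  proof (cases "card S \<le> n")
    case True
    then show ?thesis by (simp add: sigma_minors[OF Y] g_def sum_distrib_left)
  next
    case False
    have "{A. A \<subseteq> {..<n} \<and> card A = card S} = {}"
    proof -
      have "card A \<le> n" if "A \<subseteq> {..<n}" for A using card_mono[OF _ that] by simp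
      then show ?thesis using False by (metis (mono_tags, lifting) Collect_empty_eq)
    qed
    moreover have "sigma (card S) Y = 0" using False Y by (simp add: sigma_def)
    ultimately show ?thesis by (simp only: sum.empty mult_zero_right)
  qed
  finally show ?thesis .
qed

text \<open>A label-preserving permutation acts in each label class separately, so the sum is a
  product with one factor per label, and the factorials multiply to the order of the group. Labels
  of V that do not occur contribute \<open>sigma 0\<close>, which is 1 for a matrix of any
  shape.\<close>

lemma sum_aut_eq_prod_sigma:
  fixes Y :: "'v \<Rightarrow> 'a::torsion_free_ring mat"
  assumes "finite S" "finite V" "lab ` S \<subseteq> V"
    and "\<And>v. v \<in> lab ` S \<Longrightarrow> Y v \<in> carrier_mat n n"
  shows "(\<Sum>\<rho>\<in>aut S lab. of_int (sign \<rho>) * (\<Sum>f\<in>S \<rightarrow>\<^sub>E {..<n}. \<Prod>s\<in>S. Y (lab s) $$ (f s, f (\<rho> s)))) =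
    of_nat (card (aut S lab)) * (\<Prod>v\<in>V. sigma (card {s \<in> S. lab s = v}) (Y v))"
  using assms(2,1,3,4)
proof (induction V arbitrary: S rule: finite_induct)
  case empty
  then have "aut S lab = {id}" by (auto simp: aut_def)
  then show ?case using empty by simp
next
  case (insert v V)
  define A where "A = {s \<in> S. lab s = v}"
  define B where "B = {s \<in> S. lab s \<noteq> v}"
  have AB: "S = A \<union> B" "A \<inter> B = {}" "lab ` A \<inter> lab ` B = {}" "finite A" "finite B"
    using insert.prems by (auto simp: A_def B_def)
  let ?t = "\<lambda>S \<rho>. of_int (sign \<rho>) * (\<Sum>f\<in>S \<rightarrow>\<^sub>E {..<n}. \<Prod>s\<in>S. Y (lab s) $$ (f s, f (\<rho> s)))"
  have autA: "aut A lab = {p. p permutes A}" by (rule aut_const[of _ _ v]) (simp add: A_def)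
  have IH: "(\<Sum>\<rho>\<in>aut B lab. ?t B \<rho>) =
    of_nat (card (aut B lab)) * (\<Prod>v\<in>V. sigma (card {s \<in> B. lab s = v}) (Y v))"
    using insert.prems by (intro insert.IH) (auto simp: B_def)
  have A1: "(\<Sum>\<rho>\<in>aut A lab. ?t A \<rho>) = of_nat (card (aut A lab)) * sigma (card A) (Y v)"
  proof (cases "A = {}")
    case True
    have "aut {} lab = {id}" by (auto simp: aut_def)
    then show ?thesis using True by (simp add: sigma_def)
  next
    case False
    then have "Y v \<in> carrier_mat n n" using insert.prems(3) by (auto simp: A_def)
    from sum_sign_cycles_eq_sigma[OF this AB(4)]
    have "(\<Sum>\<rho>\<in>aut A lab. of_int (sign \<rho>) * (\<Sum>f\<in>A \<rightarrow>\<^sub>E {..<n}. \<Prod>s\<in>A. Y v $$ (f s, f (\<rho> s)))) =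
      of_nat (card (aut A lab)) * sigma (card A) (Y v)"
      by (simp add: autA card_permutations[OF refl AB(4)])
    moreover have "(\<Prod>s\<in>A. Y (lab s) $$ (f s, f (\<rho> s))) = (\<Prod>s\<in>A. Y v $$ (f s, f (\<rho> s)))" for f \<rho>
      by (rule prod.cong) (auto simp: A_def)
    ultimately show ?thesis by simp
  qed
  have split: "?t S (p \<circ> q) = ?t A p * ?t B q" if p: "p \<in> aut A lab" and q: "q \<in> aut B lab" for p q
  proof -
    have pA: "p permutes A" and qB: "q permutes B" using p q by (auto simp: aut_def)
    have "(\<Prod>s\<in>S. Y (lab s) $$ (merge A F H s, merge A F H ((p \<circ> q) s))) =
      (\<Prod>s\<in>A. Y (lab s) $$ (F s, F (p s))) * (\<Prod>s\<in>B. Y (lab s) $$ (H s, H (q s)))" for F H :: "_ \<Rightarrow> nat"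
    proof -
      have "(\<Prod>s\<in>A. Y (lab s) $$ (merge A F H s, merge A F H ((p \<circ> q) s))) = (\<Prod>s\<in>A. Y (lab s) $$ (F s, F (p s)))"
      proof (rule prod.cong[OF refl])
        fix s assume s: "s \<in> A"
        then have "s \<notin> B" using AB by auto
        then have "q s = s" "p s \<in> A" using permutes_not_in[OF qB] permutes_in_image[OF pA] s by auto
        then show "Y (lab s) $$ (merge A F H s, merge A F H ((p \<circ> q) s)) = Y (lab s) $$ (F s, F (p s))"
          using s by (simp add: merge_def)
      qed
      moreover have "(\<Prod>s\<in>B. Y (lab s) $$ (merge A F H s, merge A F H ((p \<circ> q) s))) = (\<Prod>s\<in>B. Y (lab s) $$ (H s, H (q s)))"
      proof (rule prod.cong[OF refl])
        fix s assume s: "s \<in> B"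
        then have "q s \<in> B" using permutes_in_image[OF qB] by auto
        then have "q s \<notin> A" "s \<notin> A" using AB s by auto
        then have "p (q s) = q s" using permutes_not_in[OF pA] by auto
        then show "Y (lab s) $$ (merge A F H s, merge A F H ((p \<circ> q) s)) = Y (lab s) $$ (H s, H (q s))"
          using \<open>q s \<notin> A\<close> \<open>s \<notin> A\<close> by (simp add: merge_def)
      qed
      ultimately show ?thesis unfolding AB(1) by (subst prod.union_disjoint) (use AB in auto)
    qed
    moreover have "(\<Sum>f\<in>S \<rightarrow>\<^sub>E {..<n}. \<Prod>s\<in>S. Y (lab s) $$ (f s, f ((p \<circ> q) s))) =
      (\<Sum>F\<in>A \<rightarrow>\<^sub>E {..<n}. \<Sum>H\<in>B \<rightarrow>\<^sub>E {..<n}.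
        \<Prod>s\<in>S. Y (lab s) $$ (merge A F H s, merge A F H ((p \<circ> q) s)))"
      unfolding AB(1) by (rule sum_PiE_Un[OF AB(2)])
    ultimately have "(\<Sum>f\<in>S \<rightarrow>\<^sub>E {..<n}. \<Prod>s\<in>S. Y (lab s) $$ (f s, f ((p \<circ> q) s))) =
      (\<Sum>F\<in>A \<rightarrow>\<^sub>E {..<n}. \<Prod>s\<in>A. Y (lab s) $$ (F s, F (p s))) *
      (\<Sum>H\<in>B \<rightarrow>\<^sub>E {..<n}. \<Prod>s\<in>B. Y (lab s) $$ (H s, H (q s)))"
      unfolding sum_product by (simp only:)
    then show ?thesis
      by (simp add: sign_comp_permutes[OF AB(4,5) pA qB] algebra_simps)
  qed
  have card: "card {s \<in> S. lab s = w} = card {s \<in> B. lab s = w}" if "w \<in> V" for w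
    using that insert.hyps(2) by (intro arg_cong[where f = card]) (auto simp: B_def)
  have "(\<Sum>\<rho>\<in>aut S lab. ?t S \<rho>) = (\<Sum>p\<in>aut A lab. \<Sum>q\<in>aut B lab. ?t S (p \<circ> q))"
    by (subst AB(1)) (rule sum_aut_Un[OF AB(2,3)])
  also have "\<dots> = (\<Sum>p\<in>aut A lab. \<Sum>q\<in>aut B lab. ?t A p * ?t B q)"
    by (intro sum.cong refl split)
  also have "\<dots> = of_nat (card (aut A lab)) * sigma (card A) (Y v) *
     (of_nat (card (aut B lab)) * (\<Prod>v\<in>V. sigma (card {s \<in> B. lab s = v}) (Y v)))"
    unfolding A1[symmetric] IH[symmetric] sum_product ..
  also have "\<dots> = of_nat (card (aut S lab)) * (\<Prod>v\<in>insert v V. sigma (card {s \<in> S. lab s = v}) (Y v))"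
  proof -
    have "card (aut S lab) = card (aut A lab) * card (aut B lab)"
      by (subst AB(1)) (rule card_aut_Un[OF AB(2,3)])
    moreover have "card {s \<in> S. lab s = v} = card A" by (simp add: A_def)
    ultimately show ?thesis using insert.hyps card by (simp add: mult_ac)
  qed
  finally show ?case .
qed

section \<open>The sum over all column permutations\<close>

definition col_perm :: "(cell \<Rightarrow> cell) \<Rightarrow> nat \<Rightarrow> nat \<Rightarrow> nat" where
  "col_perm p i k = snd (p (i, k))"

lemma finite_cells: "finite (cells ns)"
proof (rule finite_subset)
  show "cells ns \<subseteq> (\<Union>i<length ns. Pair i ` {..<ns ! i})" by (auto simp: cells_def)
qed auto

lemma col_perm_permutes:
  assumes p: "p permutes cells ns" and col: "\<And>c. c \<in> cells ns \<Longrightarrow> fst (p c) = fst c" and i: "i < length ns"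
  shows "col_perm p i permutes {..<ns ! i}"
proof (rule inj_imp_permutes)
  have pc: "p (i, k) = (i, col_perm p i k)" if "k < ns ! i" for k
    using col[of "(i, k)"] that i by (simp add: col_perm_def cells_def prod_eq_iff)
  show "inj_on (col_perm p i) {..<ns ! i}"
  proof (rule inj_onI)
    fix k l assume kl: "k \<in> {..<ns ! i}" "l \<in> {..<ns ! i}" "col_perm p i k = col_perm p i l"
    then have "p (i, k) = p (i, l)" using pc by simp
    then show "k = l" using permutes_inj[OF p] by (auto dest: injD)
  qed
  show "finite {..<ns ! i}" by simp
  fix k
  show "col_perm p i k \<in> {..<ns ! i}" if "k \<in> {..<ns ! i}"
    using permutes_in_image[OF p, of "(i, k)"] pc[of k] that i by (simp add: cells_def)
  show "col_perm p i k = k" if "k \<notin> {..<ns ! i}"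
    using permutes_not_in[OF p, of "(i, k)"] that by (simp add: cells_def col_perm_def)
qed

lemma col_perm_eq:
  assumes "\<And>c. c \<in> cells ns \<Longrightarrow> fst (p c) = fst c" "(i, k) \<in> cells ns"
  shows "p (i, k) = (i, col_perm p i k)"
  using assms(1)[OF assms(2)] by (simp add: col_perm_def prod_eq_iff)

text \<open>A permutation of the cells that keeps the columns is the product of its restrictions to
  the columns. The induction restricts p to the first j columns and adds one column at a
  time.\<close>

lemma sign_eq_prod_col_perm:
  assumes p: "p permutes cells ns" and col: "\<And>c. c \<in> cells ns \<Longrightarrow> fst (p c) = fst c"
  shows "sign p = (\<Prod>i<length ns. sign (col_perm p i))"
proof -
  let ?A = "\<lambda>j. {c \<in> cells ns. fst c < j}"
  let ?B = "\<lambda>j. {c \<in> cells ns. fst c = j}"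
  have fin: "finite (cells ns)" by (rule finite_cells)
  have pc: "p c \<in> cells ns" if "c \<in> cells ns" for c using permutes_in_image[OF p] that by simp
  have perm: "restrict_id p {c \<in> cells ns. P (fst c)} permutes {c \<in> cells ns. P (fst c)}" for P
  proof (rule permutes_restrict_id, rule bij_betwI')
    fix c d assume "c \<in> {c \<in> cells ns. P (fst c)}" "d \<in> {c \<in> cells ns. P (fst c)}"
    then show "(p c = p d) = (c = d)" using permutes_inj[OF p] by (auto dest: injD)
  next
    fix c assume "c \<in> {c \<in> cells ns. P (fst c)}"
    then show "p c \<in> {c \<in> cells ns. P (fst c)}" using pc col by auto
  next
    fix d assume d: "d \<in> {c \<in> cells ns. P (fst c)}"
    have "p (pinv p d) = d" by (rule permutes_inverses(1)[OF p])
    moreover have "pinv p d \<in> cells ns" using permutes_in_image[OF permutes_inv[OF p]] d by simp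
    moreover from this have "fst (pinv p d) = fst d" using col[of "pinv p d"] permutes_inverses(1)[OF p, of d] by simp
    ultimately show "\<exists>c\<in>{c \<in> cells ns. P (fst c)}. d = p c" using d by (intro bexI[of _ "pinv p d"]) auto
  qed
  have "sign (restrict_id p (?A j)) = (\<Prod>i<j. sign (col_perm p i))" if "j \<le> length ns" for j
    using that
  proof (induction j)
    case 0
    have "restrict_id p (?A 0) = id" by (auto simp: restrict_id_def)
    then show ?case by simp
  next
    case (Suc j)
    have "restrict_id p (?A (Suc j)) = restrict_id p (?A j) \<circ> restrict_id p (?B j)"
    proof
      fix c
      show "restrict_id p (?A (Suc j)) c = (restrict_id p (?A j) \<circ> restrict_id p (?B j)) c"
        using pc[of c] col[of c] col[of "p c"] by (auto simp: restrict_id_def less_Suc_eq)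
    qed
    then have "sign (restrict_id p (?A (Suc j))) = sign (restrict_id p (?A j)) * sign (restrict_id p (?B j))"
      using sign_comp_permutes[OF _ _ perm[of "\<lambda>i. i < j"] perm[of "\<lambda>i. i = j"]] fin by simp
    also have "restrict_id p (?B j) = map_permutation {..<ns ! j} (Pair j) (col_perm p j)"
    proof
      fix c
      have im: "Pair j ` {..<ns ! j} = ?B j" using Suc.prems by (auto simp: cells_def)
      show "restrict_id p (?B j) c = map_permutation {..<ns ! j} (Pair j) (col_perm p j) c"
      proof (cases "c \<in> ?B j")
        case True
        then obtain k where k: "c = (j, k)" "k < ns ! j" using im by blast
        have "map_permutation {..<ns ! j} (Pair j) (col_perm p j) (Pair j k) = Pair j (col_perm p j k)"
          by (rule map_permutation_apply) (use k in \<open>auto simp: inj_on_def\<close>)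
        then show ?thesis using True k col_perm_eq[of ns p j k] col by (simp add: restrict_id_def)
      next
        case False
        then show ?thesis unfolding map_permutation_def im by (auto simp: restrict_id_def)
      qed
    qed
    also have "sign \<dots> = sign (col_perm p j)"
      by (rule sign_map_permutation) (use Suc.prems in \<open>auto simp: inj_on_def intro!: col_perm_permutes[OF p col]\<close>)
    finally show ?case using Suc by simp
  qed
  from this[of "length ns"] have "sign (restrict_id p (?A (length ns))) = (\<Prod>i<length ns. sign (col_perm p i))"
    by simp
  moreover have "restrict_id p (?A (length ns)) = p"
    using permutes_not_in[OF p] by (auto simp: restrict_id_def fun_eq_iff cells_def)
  ultimately show ?thesis by simp
qed

text \<open>What the count of label-preserving permutations uses of a tableau. It is verified for T
  and for T-tilde, so that \<open>card_aut_mult_bpf\<close> serves both ends of the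
  computation.\<close>

definition arrows_ok :: "nat list \<Rightarrow> 'l arrow set \<Rightarrow> bool" where
  "arrows_ok ns T \<longleftrightarrow> finite T \<and> (\<forall>a\<in>T. tail a \<in> cells ns \<and> head a \<in> cells ns \<and> tail a \<noteq> head a) \<and>
     (\<forall>a\<in>T. \<forall>b\<in>T. {tail a, head a} \<inter> {tail b, head b} \<noteq> {} \<longrightarrow> a = b) \<and>
     (\<forall>a\<in>T. \<forall>b\<in>T. label a = label b \<longrightarrow> head_col a = head_col b \<and> tail_col a = tail_col b)"

definition col_perms :: "nat list \<Rightarrow> (nat \<Rightarrow> nat \<Rightarrow> nat) set" where
  "col_perms ns = (\<Pi>\<^sub>E i\<in>{..<length ns}. {p. p permutes {..<ns ! i}})"

definition arrow_weight :: "('l \<Rightarrow> 'a::comm_ring_1 mat) \<Rightarrow> 'l arrow set \<Rightarrow> (cell \<Rightarrow> nat) \<Rightarrow> 'a" where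
  "arrow_weight X T G = (\<Prod>a\<in>T. X (label a) $$ (G (tail a), G (head a)))"

definition bpf_full :: "nat list \<Rightarrow> 'l arrow set \<Rightarrow> ('l \<Rightarrow> 'a::comm_ring_1 mat) \<Rightarrow> 'a" where
  "bpf_full ns T X = (\<Sum>\<pi>\<in>col_perms ns. (\<Prod>i<length ns. of_int (sign (\<pi> i))) * arrow_weight X T (\<lambda>c. \<pi> (fst c) (snd c)))"

text \<open>Tails and heads are disjoint sets of cells, so the two factors commute. Writing the
  action as a product of two copies of g makes its sign visible as the square of the sign of
  g.\<close>

definition cell_action :: "'l arrow set \<Rightarrow> ('l arrow \<Rightarrow> 'l arrow) \<Rightarrow> cell \<Rightarrow> cell" where
  "cell_action T g = map_permutation T tail g \<circ> map_permutation T head g"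

context
  fixes ns :: "nat list" and T :: "'l arrow set"
  assumes ok: "arrows_ok ns T"
begin

lemma fin_T: "finite T"
  and cells_T: "\<And>a. a \<in> T \<Longrightarrow> tail a \<in> cells ns" "\<And>a. a \<in> T \<Longrightarrow> head a \<in> cells ns"
  and cols_T: "\<And>a b. a \<in> T \<Longrightarrow> b \<in> T \<Longrightarrow> label a = label b \<Longrightarrow> tail_col a = tail_col b"
    "\<And>a b. a \<in> T \<Longrightarrow> b \<in> T \<Longrightarrow> label a = label b \<Longrightarrow> head_col a = head_col b"
  using ok unfolding arrows_ok_def by blast+

lemma arrow_unique: "a \<in> T \<Longrightarrow> b \<in> T \<Longrightarrow> {tail a, head a} \<inter> {tail b, head b} \<noteq> {} \<Longrightarrow> a = b"
  using ok unfolding arrows_ok_def by blast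

lemma inj_tail: "inj_on tail T" and inj_head: "inj_on head T"
  by (auto intro!: inj_onI arrow_unique)

lemma tail_notin_heads: "a \<in> T \<Longrightarrow> tail a \<notin> head ` T" and head_notin_tails: "a \<in> T \<Longrightarrow> head a \<notin> tail ` T"
proof -
  have ne: "tail a \<noteq> head b" if "a \<in> T" "b \<in> T" for a b
  proof
    assume eq: "tail a = head b"
    then have "a = b" using that by (intro arrow_unique) auto
    then show False using eq that ok unfolding arrows_ok_def by blast
  qed
  show "a \<in> T \<Longrightarrow> tail a \<notin> head ` T" "a \<in> T \<Longrightarrow> head a \<notin> tail ` T" using ne by (auto, metis)
qed

lemma cell_action_simps:
  assumes "g \<in> aut T f" "a \<in> T"
  shows "cell_action T g (tail a) = tail (g a)" "cell_action T g (head a) = head (g a)"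
proof -
  have g: "g permutes T" using assms by (simp add: aut_def)
  have "g a \<in> T" using permutes_in_image[OF g] assms by simp
  then have "map_permutation T tail g (head (g a)) = head (g a)" "map_permutation T head g (tail a) = tail a"
    using tail_notin_heads[OF assms(2)] head_notin_tails by (simp_all add: map_permutation_def restrict_id_def)
  then show "cell_action T g (tail a) = tail (g a)" "cell_action T g (head a) = head (g a)"
    using map_permutation_apply[OF inj_tail assms(2), of g] map_permutation_apply[OF inj_head assms(2), of g]
    by (simp_all add: cell_action_def)
qed

lemma cell_action_other: "c \<notin> tail ` T \<Longrightarrow> c \<notin> head ` T \<Longrightarrow> cell_action T g c = c"
  by (simp add: cell_action_def map_permutation_def restrict_id_def)

lemma cell_action_permutes:
  assumes "g \<in> aut T f"
  shows "cell_action T g permutes cells ns"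
proof -
  have g: "g permutes T" using assms by (simp add: aut_def)
  have "map_permutation T tail g permutes cells ns" "map_permutation T head g permutes cells ns"
    by (rule permutes_subset[OF map_permutation_permutes[of _ _ "tail ` T"]];
        use g inj_tail cells_T in \<open>auto simp: bij_betw_def\<close>)
      (rule permutes_subset[OF map_permutation_permutes[of _ _ "head ` T"]];
        use g inj_head cells_T in \<open>auto simp: bij_betw_def\<close>)
  then show ?thesis unfolding cell_action_def by (rule permutes_compose[rotated])
qed

lemma cell_action_col:
  assumes "g \<in> aut T label"
  shows "fst (cell_action T g c) = fst c"
proof -
  consider a where "a \<in> T" "c = tail a" | a where "a \<in> T" "c = head a" | "c \<notin> tail ` T" "c \<notin> head ` T"
    by blast
  then show ?thesis
  proof cases
    case (1 a)
    have "g a \<in> T" "label (g a) = label a" using assms 1 by (auto simp: aut_def permutes_in_image)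
    then show ?thesis using 1 cols_T(1)[of "g a" a] by (simp add: cell_action_simps[OF assms])
  next
    case (2 a)
    have "g a \<in> T" "label (g a) = label a" using assms 2 by (auto simp: aut_def permutes_in_image)
    then show ?thesis using 2 cols_T(2)[of "g a" a] by (simp add: cell_action_simps[OF assms])
  qed (simp add: cell_action_other)
qed

lemma sign_cell_action:
  assumes "g \<in> aut T f"
  shows "sign (cell_action T g) = 1"
proof -
  have g: "g permutes T" using assms by (simp add: aut_def)
  have "map_permutation T tail g permutes tail ` T" "map_permutation T head g permutes head ` T"
    by (rule map_permutation_permutes[OF inj_on_imp_bij_betw[OF inj_tail] g] map_permutation_permutes[OF inj_on_imp_bij_betw[OF inj_head] g])+
  then have "sign (cell_action T g) = sign g * sign g"
    unfolding cell_action_def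
    by (subst sign_comp_permutes[of "tail ` T" "head ` T"])
      (auto simp: fin_T sign_map_permutation[OF inj_tail g fin_T] sign_map_permutation[OF inj_head g fin_T])
  then show ?thesis by simp
qed

lemma prod_sign_cell_action:
  assumes "g \<in> aut T label"
  shows "(\<Prod>i<length ns. sign (col_perm (cell_action T g) i)) = 1"
  using sign_eq_prod_col_perm[OF cell_action_permutes[OF assms]] cell_action_col[OF assms] sign_cell_action[OF assms]
  by simp

lemma cell_action_comp:
  assumes "g \<in> aut T f" "h \<in> aut T f"
  shows "cell_action T (g \<circ> h) = cell_action T g \<circ> cell_action T h"
proof
  fix c
  have h: "h permutes T" using assms by (simp add: aut_def)
  consider a where "a \<in> T" "c = tail a" | a where "a \<in> T" "c = head a" | "c \<notin> tail ` T" "c \<notin> head ` T"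
    by blast
  then show "cell_action T (g \<circ> h) c = (cell_action T g \<circ> cell_action T h) c"
    by cases (use permutes_in_image[OF h] in \<open>simp_all add: cell_action_simps[OF assms(1)] cell_action_simps[OF assms(2)]
        cell_action_simps[OF aut_comp[OF assms]] cell_action_other\<close>)
qed

lemma arrow_weight_cell_action:
  assumes "g \<in> aut T label"
  shows "arrow_weight X T (G \<circ> cell_action T g) = arrow_weight X T G"
proof -
  have g: "g permutes T" using assms by (simp add: aut_def)
  have "arrow_weight X T (G \<circ> cell_action T g) = (\<Prod>a\<in>T. X (label (g a)) $$ (G (tail (g a)), G (head (g a))))"
    unfolding arrow_weight_def
    by (rule prod.cong) (use assms in \<open>auto simp: cell_action_simps[OF assms] aut_def\<close>)
  also have "\<dots> = arrow_weight X T G"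
    unfolding arrow_weight_def by (rule prod.permute[OF g, unfolded comp_def, symmetric])
  finally show ?thesis .
qed

definition col_action :: "(nat \<Rightarrow> nat \<Rightarrow> nat) \<Rightarrow> ('l arrow \<Rightarrow> 'l arrow) \<Rightarrow> nat \<Rightarrow> nat \<Rightarrow> nat" where
  "col_action \<pi> g = (\<lambda>i\<in>{..<length ns}. \<pi> i \<circ> col_perm (cell_action T g) i)"

lemma col_action_in:
  assumes "\<pi> \<in> col_perms ns" "g \<in> aut T label"
  shows "col_action \<pi> g \<in> col_perms ns"
  using assms(1) col_perm_permutes[OF cell_action_permutes[OF assms(2)] cell_action_col[OF assms(2)]]
  by (auto simp: col_perms_def col_action_def PiE_iff intro!: permutes_compose)

lemma col_action_apply:
  assumes "c \<in> cells ns" "g \<in> aut T label"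
  shows "col_action \<pi> g (fst c) (snd c) = \<pi> (fst c) (snd (cell_action T g c))"
  using assms by (auto simp: col_action_def col_perm_def cells_def)

lemma col_action_comp:
  assumes \<pi>: "\<pi> \<in> col_perms ns" and g: "g \<in> aut T label" and h: "h \<in> aut T label"
  shows "col_action (col_action \<pi> g) h = col_action \<pi> (g \<circ> h)"
proof (intro ext)
  fix i k
  have "(i, snd (cell_action T h (i, k))) = cell_action T h (i, k)"
    using cell_action_col[OF h, of "(i, k)"] by (simp add: prod_eq_iff)
  then show "col_action (col_action \<pi> g) h i k = col_action \<pi> (g \<circ> h) i k"
    by (simp add: col_action_def col_perm_def cell_action_comp[OF g h])
qed

lemma col_action_id: "\<pi> \<in> col_perms ns \<Longrightarrow> col_action \<pi> id = \<pi>"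
proof (intro ext)
  fix i k assume "\<pi> \<in> col_perms ns"
  moreover have "cell_action T id c = c" for c
    by (simp add: cell_action_def map_permutation_id' inj_tail inj_head)
  ultimately show "col_action \<pi> id i k = \<pi> i k"
    by (auto simp: col_action_def col_perm_def col_perms_def PiE_iff extensional_def)
qed

text \<open>The action on the cells permutes the factors belonging to arrows of equal label, and the
  signs it adds in the columns multiply to the sign of the action, which is 1.\<close>

lemma bpf_term_col_action:
  assumes \<pi>: "\<pi> \<in> col_perms ns" and g: "g \<in> aut T label"
  shows "(\<Prod>i<length ns. of_int (sign (col_action \<pi> g i))) * arrow_weight X T (\<lambda>c. col_action \<pi> g (fst c) (snd c)) =
    (\<Prod>i<length ns. of_int (sign (\<pi> i))) * arrow_weight X T (\<lambda>c. \<pi> (fst c) (snd c))"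
proof -
  have "(\<Prod>i<length ns. sign (col_action \<pi> g i)) = (\<Prod>i<length ns. sign (\<pi> i) * sign (col_perm (cell_action T g) i))"
  proof (rule prod.cong[OF refl])
    fix i assume i: "i \<in> {..<length ns}"
    then show "sign (col_action \<pi> g i) = sign (\<pi> i) * sign (col_perm (cell_action T g) i)"
      using sign_comp_permutes[of "{..<ns ! i}" "{..<ns ! i}"] \<pi>
        col_perm_permutes[OF cell_action_permutes[OF g] cell_action_col[OF g], of i]
      by (auto simp: col_action_def col_perms_def)
  qed
  then have "(\<Prod>i<length ns. sign (col_action \<pi> g i)) = (\<Prod>i<length ns. sign (\<pi> i))"
    by (simp add: prod.distrib prod_sign_cell_action[OF g])
  then have s: "(\<Prod>i<length ns. of_int (sign (col_action \<pi> g i))) = (\<Prod>i<length ns. of_int (sign (\<pi> i)) :: 'a)"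
    by (metis of_int_prod)
  have "arrow_weight X T (\<lambda>c. col_action \<pi> g (fst c) (snd c)) = arrow_weight X T ((\<lambda>c. \<pi> (fst c) (snd c)) \<circ> cell_action T g)"
    unfolding arrow_weight_def
    by (rule prod.cong) (auto simp: col_action_apply[OF cells_T(1) g] col_action_apply[OF cells_T(2) g] cell_action_col[OF g])
  then show ?thesis using s by (simp add: arrow_weight_cell_action[OF g])
qed

definition increasing_perms :: "(nat \<Rightarrow> nat \<Rightarrow> nat) set" where
  "increasing_perms = {\<pi> \<in> col_perms ns. \<forall>a\<in>T. \<forall>b\<in>T. label a = label b \<and> snd (tail a) < snd (tail b) \<longrightarrow>
      \<pi> (tail_col a) (snd (tail a)) < \<pi> (tail_col a) (snd (tail b))}"

lemma tail_row_inj: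
  assumes "a \<in> T" "b \<in> T" "label a = label b" "snd (tail a) = snd (tail b)"
  shows "a = b"
  using assms cols_T(1)[of a b] by (intro arrow_unique) (auto simp: prod_eq_iff)

text \<open>If both \<pi> and its translate by g are increasing, then g preserves the order of the
  tail rows within each label class, and a monotone permutation of a finite chain is the
  identity.\<close>

lemma increasing_unique:
  assumes \<pi>: "\<pi> \<in> increasing_perms" and g: "g \<in> aut T label" and \<pi>g: "col_action \<pi> g \<in> increasing_perms"
  shows "g = id"
proof
  have gp: "g permutes T" and gl: "\<And>a. a \<in> T \<Longrightarrow> label (g a) = label a" using g by (auto simp: aut_def)
  have gT: "g a \<in> T" if "a \<in> T" for a using permutes_in_image[OF gp] that by simp
  let ?u = "\<lambda>a :: 'l arrow. snd (tail a)"
  let ?v = "\<lambda>a :: 'l arrow. \<pi> (tail_col a) (snd (tail a))"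
  have \<pi>v: "?v a < ?v b" if "a \<in> T" "b \<in> T" "label a = label b" "?u a < ?u b" for a b
    using \<pi> that cols_T(1)[OF that(1-3)] by (auto simp: increasing_perms_def)
  have vg: "?v (g a) < ?v (g b)" if "a \<in> T" "b \<in> T" "label a = label b" "?u a < ?u b" for a b
  proof -
    have "col_action \<pi> g (tail_col a) (?u a) < col_action \<pi> g (tail_col a) (?u b)"
      using \<pi>g that by (auto simp: increasing_perms_def)
    then show ?thesis
      using col_action_apply[OF cells_T(1)[OF that(1)] g, of \<pi>] col_action_apply[OF cells_T(1)[OF that(2)] g, of \<pi>]
        that cols_T(1)[OF that(1-3)] cols_T(1)[OF gT[OF that(1)] that(1)] cols_T(1)[OF gT[OF that(2)] that(2)]
      by (simp add: cell_action_simps[OF g] gl)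
  qed
  \<comment> \<open>If g reversed two arrows of one class, then \<pi>, being increasing, would give
    their images values in the reversed order, while the translate of \<pi> asks for the original
    order.\<close>
  have mono: "?u (g a) < ?u (g b)" if ab: "a \<in> T" "b \<in> T" "label a = label b" "?u a < ?u b" for a b
  proof (rule ccontr)
    assume n: "\<not> ?thesis"
    have l: "label (g a) = label (g b)" using ab gl by simp
    have "g a \<noteq> g b" using ab permutes_inj[OF gp] by (auto dest: injD)
    then have "?u (g b) < ?u (g a)" using n tail_row_inj[OF gT gT l] ab by (meson linorder_neqE_nat)
    then have "?v (g b) < ?v (g a)" using \<pi>v[of "g b" "g a"] gT ab l by simp
    then show False using vg[OF ab] by simp
  qed
  fix a
  show "g a = id a"
  proof (cases "a \<in> T")
    case True
    then show ?thesis
    \<comment> \<open>Take a moved arrow in the lowest row. Its preimage b lies higher, so by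
      monotonicity the image of a lies lower than a and is therefore fixed, which contradicts
      injectivity.\<close>
    proof (induction "?u a" arbitrary: a rule: less_induct)
      case less
      note IH = less.hyps
      show ?case
      proof (rule ccontr)
        assume ne: "g a \<noteq> id a"
        define b where "b = pinv g a"
        have gb: "g b = a" "b \<in> T"
          using permutes_inverses(1)[OF gp] permutes_in_image[OF permutes_inv[OF gp]] less.prems by (auto simp: b_def)
        have lb: "label b = label a" using gl[OF gb(2)] gb(1) by simp
        have "b \<noteq> a" using gb ne by auto
        then have "?u b \<noteq> ?u a" using tail_row_inj[OF gb(2) less.prems lb] by blast
        moreover have "\<not> ?u b < ?u a" using IH[of b] gb \<open>b \<noteq> a\<close> by auto
        ultimately have "?u a < ?u b" by simp
        from mono[OF less.prems gb(2) lb[symmetric] this] have "?u (g a) < ?u a" using gb by simp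
        from IH[OF this gT[OF less.prems]] have "g (g a) = g a" by simp
        then show False using ne permutes_inj[OF gp] by (auto dest: injD)
      qed
    qed
  qed (use permutes_not_in[OF gp] in simp)
qed

lemma increasing_exists:
  assumes \<pi>: "\<pi> \<in> col_perms ns"
  shows "\<exists>g\<in>aut T label. col_action \<pi> g \<in> increasing_perms"
proof -
  let ?u = "\<lambda>a :: 'l arrow. snd (tail a)"
  let ?v = "\<lambda>a :: 'l arrow. \<pi> (tail_col a) (snd (tail a))"
  let ?F = "\<lambda>l. {a \<in> T. label a = l}"
  have "\<exists>h. bij_betw h (?F l) (?F l) \<and> (\<forall>a\<in>?F l. \<forall>b\<in>?F l. ?u a < ?u b \<longrightarrow> ?v (h a) < ?v (h b))" for l
  proof -
    have fin: "finite (?F l)" using fin_T by simp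
    have iu: "inj_on ?u (?F l)" by (auto intro!: inj_onI tail_row_inj)
    have iv: "inj_on ?v (?F l)"
    proof (rule inj_onI)
      fix a b assume ab: "a \<in> ?F l" "b \<in> ?F l" "?v a = ?v b"
      then have c: "tail_col a = tail_col b" using cols_T(1) by simp
      have "tail_col a < length ns" using cells_T(1)[of a] ab by (auto simp: cells_def)
      then have perm: "\<pi> (tail_col a) permutes {..<ns ! tail_col a}" using \<pi> by (simp add: col_perms_def PiE_iff)
      have "\<pi> (tail_col a) (?u a) = \<pi> (tail_col a) (?u b)" using ab(3) c by simp
      then have "?u a = ?u b" by (rule injD[OF permutes_inj[OF perm]])
      then show "a = b" using ab by (intro tail_row_inj) simp_all
    qed
    let ?m = "card (?F l)"
    obtain hu where hu: "bij_betw hu {..<?m} (?u ` ?F l)" "strict_mono_on {..<?m} hu"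
      using ex_bij_betw_strict_mono_card[OF finite_imageI[OF fin, of ?u]] unfolding card_image[OF iu] by blast
    obtain hv where hv: "bij_betw hv {..<?m} (?v ` ?F l)" "strict_mono_on {..<?m} hv"
      using ex_bij_betw_strict_mono_card[OF finite_imageI[OF fin, of ?v]] unfolding card_image[OF iv] by blast
    \<comment> \<open>Sorting within one label class: the arrow whose tail row has rank k is sent to
      the arrow whose value under \<pi> has rank k.\<close>
    define h where "h = inv_into (?F l) ?v \<circ> hv \<circ> inv_into {..<?m} hu \<circ> ?u"
    have bu: "bij_betw ?u (?F l) (?u ` ?F l)" and bv: "bij_betw ?v (?F l) (?v ` ?F l)"
      using iu iv by (auto simp: bij_betw_def)
    have "bij_betw h (?F l) (?F l)"
      unfolding h_def
      by (rule bij_betw_trans[OF bu bij_betw_trans[OF bij_betw_inv_into[OF hu(1)]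
          bij_betw_trans[OF hv(1) bij_betw_inv_into[OF bv]]]])
    moreover have "?v (h a) < ?v (h b)" if ab: "a \<in> ?F l" "b \<in> ?F l" "?u a < ?u b" for a b
    proof -
      let ?r = "\<lambda>a. inv_into {..<?m} hu (?u a)"
      have r: "?r c \<in> {..<?m}" "hu (?r c) = ?u c" if "c \<in> ?F l" for c
      proof -
        have "?u c \<in> hu ` {..<?m}" using hu(1) that by (simp add: bij_betw_def)
        then show "?r c \<in> {..<?m}" and "hu (?r c) = ?u c" by (rule inv_into_into f_inv_into_f)+
      qed
      have v: "?v (h c) = hv (?r c)" if "c \<in> ?F l" for c
      proof -
        have "hv (?r c) \<in> ?v ` ?F l" by (rule bij_betw_apply[OF hv(1) r(1)[OF that]])
        then have "?v (inv_into (?F l) ?v (hv (?r c))) = hv (?r c)" by (rule f_inv_into_f)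
        then show ?thesis by (simp add: h_def)
      qed
      have "?r a < ?r b"
      proof (rule ccontr)
        assume "\<not> ?thesis"
        then have "hu (?r b) \<le> hu (?r a)"
          using strict_mono_onD[OF hu(2), of "?r b" "?r a"] r(1)[OF ab(1)] r(1)[OF ab(2)] by (cases "?r a = ?r b") auto
        then show False using r(2)[OF ab(1)] r(2)[OF ab(2)] ab(3) by linarith
      qed
      then have "hv (?r a) < hv (?r b)" using strict_mono_onD[OF hv(2)] r(1)[OF ab(1)] r(1)[OF ab(2)] by blast
      then show ?thesis by (simp only: v[OF ab(1)] v[OF ab(2)])
    qed
    ultimately show ?thesis by (intro exI[of _ h]) simp
  qed
  then obtain h where h': "\<And>l. bij_betw (h l) (?F l) (?F l) \<and> (\<forall>a\<in>?F l. \<forall>b\<in>?F l. ?u a < ?u b \<longrightarrow> ?v (h l a) < ?v (h l b))"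
    using choice[of "\<lambda>l h. bij_betw h (?F l) (?F l) \<and> (\<forall>a\<in>?F l. \<forall>b\<in>?F l. ?u a < ?u b \<longrightarrow> ?v (h a) < ?v (h b))"]
    by blast
  have h: "\<And>l. bij_betw (h l) (?F l) (?F l)"
    "\<And>l a b. a \<in> ?F l \<Longrightarrow> b \<in> ?F l \<Longrightarrow> ?u a < ?u b \<Longrightarrow> ?v (h l a) < ?v (h l b)"
    using h' by simp_all
  define g where "g = restrict_id (\<lambda>a. h (label a) a) T"
  have hT: "h (label a) a \<in> T" "label (h (label a) a) = label a" if "a \<in> T" for a
    using h(1)[of "label a"] that by (auto simp: bij_betw_def)
  have inj: "inj_on (\<lambda>a. h (label a) a) T"
  proof (rule inj_onI)
    fix a b assume ab: "a \<in> T" "b \<in> T" "h (label a) a = h (label b) b"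
    then have "label a = label b" using hT(2) by metis
    then show "a = b" using ab h(1)[of "label a"] by (auto simp: bij_betw_def inj_on_def)
  qed
  have "g permutes T"
    unfolding g_def
    using inj hT endo_inj_surj[OF fin_T _ inj] by (intro permutes_restrict_id) (simp add: bij_betw_def image_subset_iff)
  then have g: "g \<in> aut T label" using hT by (auto simp: aut_def g_def restrict_id_def)
  have "col_action \<pi> g \<in> increasing_perms"
    unfolding increasing_perms_def
  proof (intro CollectI conjI ballI impI col_action_in[OF \<pi> g])
    fix a b assume ab: "a \<in> T" "b \<in> T" "label a = label b \<and> ?u a < ?u b"
    have gl: "g a \<in> T" "g b \<in> T" "label (g a) = label a" "label (g b) = label b"
      using g ab by (auto simp: aut_def permutes_in_image)
    have "?v (g a) < ?v (g b)" using h(2)[of a "label a" b] ab by (simp add: g_def restrict_id_def)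
    then show "col_action \<pi> g (tail_col a) (?u a) < col_action \<pi> g (tail_col a) (?u b)"
      using col_action_apply[OF cells_T(1)[OF ab(1)] g, of \<pi>] col_action_apply[OF cells_T(1)[OF ab(2)] g, of \<pi>]
        ab cols_T(1)[of a b] cols_T(1)[of "g a" a] cols_T(1)[of "g b" b] gl
      by (simp add: cell_action_simps[OF g])
  qed
  then show ?thesis using g by blast
qed

text \<open>By \<open>increasing_exists\<close> and \<open>increasing_unique\<close> every orbit of
  the free action on column permutations contains exactly one increasing member, and the summand is
  constant on orbits.\<close>

lemma card_aut_mult_sum_increasing:
  "of_nat (card (aut T label)) * (\<Sum>\<pi>\<in>increasing_perms.
      (\<Prod>i<length ns. of_int (sign (\<pi> i))) * arrow_weight X T (\<lambda>c. \<pi> (fst c) (snd c))) = bpf_full ns T X"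
proof -
  let ?\<Psi> = "\<lambda>\<pi>. (\<Prod>i<length ns. of_int (sign (\<pi> i))) * arrow_weight X T (\<lambda>c. \<pi> (fst c) (snd c))"
  have inc: "\<pi> \<in> col_perms ns" if "\<pi> \<in> increasing_perms" for \<pi> using that by (simp add: increasing_perms_def)
  have cancel: "g \<circ> pinv g = id" "pinv g \<circ> g = id" if "g \<in> aut T label" for g
  proof -
    have "g permutes T" using that by (simp add: aut_def)
    then show "g \<circ> pinv g = id" "pinv g \<circ> g = id" by (rule permutes_inv_o)+
  qed
  have bij: "bij_betw (\<lambda>(g, \<pi>). col_action \<pi> g) (aut T label \<times> increasing_perms) (col_perms ns)"
    unfolding bij_betw_def
  proof (intro conjI equalityI subsetI)
    show "inj_on (\<lambda>(g, \<pi>). col_action \<pi> g) (aut T label \<times> increasing_perms)"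
    proof (rule inj_onI)
      fix x y assume x: "x \<in> aut T label \<times> increasing_perms" and y: "y \<in> aut T label \<times> increasing_perms"
        and xy: "(case x of (g, \<pi>) \<Rightarrow> col_action \<pi> g) = (case y of (g, \<pi>) \<Rightarrow> col_action \<pi> g)"
      obtain g \<pi> h \<pi>' where xe: "x = (g, \<pi>)" and ye: "y = (h, \<pi>')" by (metis surj_pair)
      have gh: "g \<in> aut T label" "h \<in> aut T label" and p: "\<pi> \<in> increasing_perms" "\<pi>' \<in> increasing_perms"
        and eq: "col_action \<pi> g = col_action \<pi>' h"
        using x y xy unfolding xe ye by simp_all
      have "col_action \<pi> (g \<circ> pinv h) = col_action (col_action \<pi>' h) (pinv h)"
        by (simp add: eq[symmetric] col_action_comp[OF inc[OF p(1)] gh(1) aut_inv[OF gh(2)]])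
      also have "\<dots> = \<pi>'"
        by (simp add: col_action_comp[OF inc[OF p(2)] gh(2) aut_inv[OF gh(2)]] cancel gh col_action_id[OF inc[OF p(2)]])
      finally have e: "col_action \<pi> (g \<circ> pinv h) = \<pi>'" .
      have "g \<circ> pinv h = id"
        by (rule increasing_unique[OF p(1) aut_comp[OF gh(1) aut_inv[OF gh(2)]]]) (simp add: e p)
      then have "g \<circ> (pinv h \<circ> h) = h" by (simp add: comp_assoc[symmetric])
      then have "g = h" by (simp add: cancel gh)
      then show "x = y" unfolding xe ye using e cancel[OF gh(2)] col_action_id[OF inc[OF p(1)]] by simp
    qed
  next
    fix \<pi> assume \<pi>: "\<pi> \<in> col_perms ns"
    obtain g where g: "g \<in> aut T label" "col_action \<pi> g \<in> increasing_perms" using increasing_exists[OF \<pi>] by blast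
    have "col_action (col_action \<pi> g) (pinv g) = \<pi>"
      by (simp add: col_action_comp[OF \<pi> g(1) aut_inv[OF g(1)]] cancel g col_action_id[OF \<pi>])
    then show "\<pi> \<in> (\<lambda>(g, \<pi>). col_action \<pi> g) ` (aut T label \<times> increasing_perms)"
      using g aut_inv[OF g(1)] by (intro image_eqI[of _ _ "(pinv g, col_action \<pi> g)"]) auto
  qed (auto intro: col_action_in inc)
  have "bpf_full ns T X = (\<Sum>(g, \<pi>)\<in>aut T label \<times> increasing_perms. ?\<Psi> (col_action \<pi> g))"
    unfolding bpf_full_def by (subst sum.reindex_bij_betw[OF bij, symmetric]) (simp add: case_prod_unfold)
  also have "\<dots> = (\<Sum>(g, \<pi>)\<in>aut T label \<times> increasing_perms. ?\<Psi> \<pi>)"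
    by (rule sum.cong[OF refl]) (auto simp: bpf_term_col_action[OF inc])
  also have "\<dots> = of_nat (card (aut T label)) * (\<Sum>\<pi>\<in>increasing_perms. ?\<Psi> \<pi>)"
    by (simp add: sum.cartesian_product[symmetric])
  finally show ?thesis ..
qed

end

lemma card_aut_mult_bpf:
  assumes "arrows_ok ns T"
  shows "of_nat (card (aut T label)) * bpf ns T Xs = bpf_full ns T ((!) Xs)"
proof -
  have "bpf_perms ns T = increasing_perms ns T"
    unfolding bpf_perms_def increasing_perms_def[OF assms] col_perms_def ..
  then show ?thesis
    using card_aut_mult_sum_increasing[OF assms, of "(!) Xs"] by (simp add: bpf_def arrow_weight_def)
qed

section \<open>Joinings and readings\<close>

text \<open>
  In the application \<open>th c\<close> is the other end of the arrow at the cell \<open>c\<close>, \<open>lam c\<close> the letter read when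
  this arrow is traversed from \<open>c\<close>, and \<open>B\<close> the set of cells of the columns \<open>q1\<close> and \<open>q2\<close>. A step
  \<open>nx J\<close> traverses an arrow and then a joint, \<open>al J k c\<close> says that \<open>k\<close> steps are possible from \<open>c\<close>, and
  the reading \<open>R J c\<close> is \<open>None\<close> after the end of the string. The cells satisfying \<open>E\<close> are the ends of
  open strings and the cells on cycles.
\<close>

locale joinable =
  fixes C :: "'c set" and th :: "'c \<Rightarrow> 'c" and lam :: "'c \<Rightarrow> 'l" and tr :: "'l \<Rightarrow> 'l"
    and B :: "'c set" and col :: "'c \<Rightarrow> nat"
  assumes fin_C: "finite C"
    and th_C: "c \<in> C \<Longrightarrow> th c \<in> C"
    and th_th: "c \<in> C \<Longrightarrow> th (th c) = c"
    and lam_th: "c \<in> C \<Longrightarrow> lam (th c) = tr (lam c)"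
    and tr_tr: "tr (tr l) = l"
    and tr_neq: "tr l \<noteq> l"
    and B_C: "B \<subseteq> C"
    and lam_B: "c \<in> C \<Longrightarrow> d \<in> C \<Longrightarrow> lam c = lam d \<Longrightarrow> c \<in> B \<longleftrightarrow> d \<in> B"
    and lam_col: "c \<in> C \<Longrightarrow> d \<in> C \<Longrightarrow> lam c = lam d \<Longrightarrow> col c = col d"
begin

definition joinings :: "('c \<Rightarrow> 'c) set" where
  "joinings = {J. J permutes B \<and> (\<forall>u\<in>B. J (J u) = u \<and> col (J u) \<noteq> col u)}"

definition nx :: "('c \<Rightarrow> 'c) \<Rightarrow> 'c \<Rightarrow> 'c" where
  "nx J c = J (th c)"

definition al :: "('c \<Rightarrow> 'c) \<Rightarrow> nat \<Rightarrow> 'c \<Rightarrow> bool" where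
  "al J k c \<longleftrightarrow> (\<forall>j<k. th ((nx J ^^ j) c) \<in> B)"

definition R :: "('c \<Rightarrow> 'c) \<Rightarrow> 'c \<Rightarrow> nat \<Rightarrow> 'l option" where
  "R J c k = (if al J k c then Some (lam ((nx J ^^ k) c)) else None)"

definition E :: "('c \<Rightarrow> 'c) \<Rightarrow> 'c \<Rightarrow> bool" where
  "E J c \<longleftrightarrow> c \<notin> B \<or> (\<forall>k. al J k c)"

lemma finite_B: "finite B" using B_C fin_C finite_subset by blast

lemma finite_joinings: "finite joinings"
  by (rule finite_subset[OF _ finite_permutations[OF finite_B]]) (auto simp: joinings_def)

lemma joinings_B: "J \<in> joinings \<Longrightarrow> u \<in> B \<Longrightarrow> J u \<in> B"
  by (simp add: joinings_def permutes_in_image)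

lemma joinings_invol: "J \<in> joinings \<Longrightarrow> J (J u) = u"
  using permutes_not_in[of J B u] by (cases "u \<in> B") (simp_all add: joinings_def)

lemma joinings_col: "J \<in> joinings \<Longrightarrow> u \<in> B \<Longrightarrow> col (J u) \<noteq> col u"
  by (simp add: joinings_def)

lemma al_0 [simp]: "al J 0 c" by (simp add: al_def)

lemma al_Suc: "al J (Suc k) c \<longleftrightarrow> al J k c \<and> th ((nx J ^^ k) c) \<in> B"
  by (auto simp: al_def less_Suc_eq)

lemma al_mono: "al J k c \<Longrightarrow> j \<le> k \<Longrightarrow> al J j c"
  by (simp add: al_def)

lemma al_add: "al J (i + j) c \<longleftrightarrow> al J i c \<and> al J j ((nx J ^^ i) c)"
  by (induction j) (auto simp: al_Suc funpow_add funpow_swap1 add.commute[of i])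

lemma nx_add: "(nx J ^^ j) ((nx J ^^ i) c) = (nx J ^^ (i + j)) c"
  by (metis add.commute comp_apply funpow_add)

lemma al_Suc_left: "al J (Suc k) c \<longleftrightarrow> th c \<in> B \<and> al J k (nx J c)"
  using al_add[of J 1 k c] by (simp add: al_Suc[of J 0])

lemma R_al: "R J c k \<noteq> None \<longleftrightarrow> al J k c"
  by (simp add: R_def)

lemma R_0: "R J c 0 = Some (lam c)" by (simp add: R_def)

lemma R_shift: "al J k c \<Longrightarrow> R J ((nx J ^^ k) c) i = R J c (k + i)"
  by (simp add: R_def al_add nx_add)

lemma R_Suc: "R J c (Suc k) = (if th c \<in> B then R J (nx J c) k else None)"
  by (simp add: R_def al_Suc_left funpow_swap1)

lemma R_eq_al: "R J c = R J' c' \<Longrightarrow> al J k c \<longleftrightarrow> al J' k c'"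
  by (metis R_al)

lemma R_eq_shift: "R J c = R J' c' \<Longrightarrow> al J k c \<Longrightarrow> R J ((nx J ^^ k) c) = R J' ((nx J' ^^ k) c')"
  by (rule ext) (simp add: R_shift R_eq_al[of J c J' c'])

lemma R_eq_lam: "R J c = R J' c' \<Longrightarrow> al J k c \<Longrightarrow> lam ((nx J ^^ k) c) = lam ((nx J' ^^ k) c')"
  using R_eq_al[of J c J' c' k] by (metis R_def option.inject)

lemma E_R_eq:
  assumes "c \<in> C" "c' \<in> C" "R J c = R J' c'"
  shows "E J c \<longleftrightarrow> E J' c'"
  using R_eq_al[OF assms(3)] lam_B[OF assms(1,2)] R_eq_lam[OF assms(3), of 0] by (simp add: E_def)

context
  fixes J assumes J: "J \<in> joinings"
begin

lemma nx_B: "th c \<in> B \<Longrightarrow> nx J c \<in> B"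
  by (simp add: nx_def joinings_B[OF J])

lemma nx_pow_C: "c \<in> C \<Longrightarrow> al J k c \<Longrightarrow> (nx J ^^ k) c \<in> C"
  using B_C nx_B by (induction k) (auto simp: al_Suc)

lemma nx_pow_B: "al J k c \<Longrightarrow> 0 < k \<Longrightarrow> (nx J ^^ k) c \<in> B"
  using nx_B by (cases k) (auto simp: al_Suc)

lemma nx_rev: "c \<in> C \<Longrightarrow> th c \<in> B \<Longrightarrow> nx J (th (nx J c)) = th c"
  using nx_B[of c] B_C th_th[of "nx J c"] joinings_invol[OF J] by (auto simp: nx_def)

text \<open>Joints are involutions and \<open>th\<close> swaps the ends of an arrow, so a walk can
  be run backwards: it starts at the far end of the last arrow and meets the far ends of the arrows
  passed before.\<close>

lemma nx_pow_rev:
  assumes "c \<in> C" "al J k c" "i \<le> k"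
  shows "(nx J ^^ i) (th ((nx J ^^ k) c)) = th ((nx J ^^ (k - i)) c) \<and> al J i (th ((nx J ^^ k) c))"
  using assms(3)
proof (induction i)
  case (Suc i)
  then have IH: "(nx J ^^ i) (th ((nx J ^^ k) c)) = th ((nx J ^^ (k - i)) c)" "al J i (th ((nx J ^^ k) c))"
    by auto
  obtain m where m: "k - i = Suc m" "k - Suc i = m" using Suc.prems by (metis Suc_diff_Suc Suc_le_lessD)
  have al: "al J (Suc m) c" using al_mono[OF assms(2), of "k - i"] m by simp
  then have B': "th ((nx J ^^ m) c) \<in> B" "al J m c" by (auto simp: al_Suc)
  have C': "(nx J ^^ m) c \<in> C" by (rule nx_pow_C[OF assms(1) B'(2)])
  have "nx J (th (nx J ((nx J ^^ m) c))) = th ((nx J ^^ m) c)" by (rule nx_rev[OF C' B'(1)])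
  moreover have "th (th (nx J ((nx J ^^ m) c))) \<in> B"
    using nx_B[OF B'(1)] B_C th_th[of "nx J ((nx J ^^ m) c)"] by auto
  ultimately show ?case using IH m by (simp add: al_Suc)
qed simp

lemma nx_pow_rev_all:
  assumes "c \<in> C" "al J k c"
  shows "(nx J ^^ k) (th ((nx J ^^ k) c)) = th c" "al J k (th ((nx J ^^ k) c))"
  using nx_pow_rev[OF assms, of k] by simp_all

lemma nx_pow_inj:
  assumes "c \<in> C" "d \<in> C" "al J k c" "al J k d" "(nx J ^^ k) c = (nx J ^^ k) d"
  shows "c = d"
proof -
  have "th c = th d" using nx_pow_rev_all(1)[OF assms(1,3)] nx_pow_rev_all(1)[OF assms(2,4)] assms(5) by simp
  then show ?thesis using th_th assms(1,2) by metis
qed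

lemma nx_pow_cancel:
  assumes "c \<in> C" "d \<in> C" "al J i c" "al J j d" "i \<le> j" "(nx J ^^ i) c = (nx J ^^ j) d"
  shows "c = (nx J ^^ (j - i)) d"
proof (rule nx_pow_inj)
  have a: "al J (j - i) d" "al J i ((nx J ^^ (j - i)) d)" using assms(4,5) al_add[of J "j - i" i d] by simp_all
  show "(nx J ^^ (j - i)) d \<in> C" by (rule nx_pow_C[OF assms(2) a(1)])
  show "al J i ((nx J ^^ (j - i)) d)" by (rule a(2))
  show "(nx J ^^ i) c = (nx J ^^ i) ((nx J ^^ (j - i)) d)" using assms(5,6) by (simp add: nx_add)
qed (use assms in simp_all)

text \<open>The walk stays in a finite set and each step is injective, so a repetition at two
  different times can be cancelled down to a return to c itself.\<close>

lemma period_exists: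
  assumes "c \<in> C" "\<And>k. al J k c"
  shows "\<exists>L>0. (nx J ^^ L) c = c"
proof -
  have "\<not> inj (\<lambda>k. (nx J ^^ k) c)"
  proof
    assume inj: "inj (\<lambda>k. (nx J ^^ k) c)"
    have "range (\<lambda>k. (nx J ^^ k) c) \<subseteq> C" using nx_pow_C[OF assms(1) assms(2)] by auto
    then have "finite (range (\<lambda>k. (nx J ^^ k) c))" using fin_C finite_subset by blast
    then show False using finite_imageD[OF _ inj] by simp
  qed
  then obtain i j where ij: "i \<noteq> j" "(nx J ^^ i) c = (nx J ^^ j) c" by (auto simp: inj_def)
  show ?thesis
  proof (cases "i < j")
    case True
    then have "c = (nx J ^^ (j - i)) c" using nx_pow_cancel[of c c i j] assms ij by simp
    then show ?thesis using True by (metis zero_less_diff)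
  next
    case False
    then have "j < i" using ij by simp
    moreover from this have "c = (nx J ^^ (i - j)) c" using nx_pow_cancel[of c c j i] assms ij by simp
    ultimately show ?thesis by (metis zero_less_diff)
  qed
qed

lemma period_mult: "(nx J ^^ L) c = c \<Longrightarrow> (nx J ^^ (m * L)) c = c"
  by (induction m) (simp_all add: funpow_add)

lemma al_immortal:
  assumes "al J k c" "\<And>i. al J i ((nx J ^^ k) c)"
  shows "al J i c"
proof -
  have "al J (k + i) c" using assms al_add by simp
  then show ?thesis by (rule al_mono) simp
qed

lemma al_pow_immortal: "(\<And>i. al J i c) \<Longrightarrow> al J i ((nx J ^^ k) c)"
  using al_add by blast

lemma R_rev:
  assumes "c \<in> C" "al J k c" "i \<le> k"
  shows "R J (th ((nx J ^^ k) c)) i = Some (tr (lam ((nx J ^^ (k - i)) c)))"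
proof -
  have "(nx J ^^ (k - i)) c \<in> C" using al_mono[OF assms(2)] by (intro nx_pow_C assms(1)) simp
  then show ?thesis using nx_pow_rev[OF assms] by (simp add: R_def lam_th)
qed

text \<open>Compare the middle of the word with the middle of its transpose: a joint in the middle
  would connect a column with itself.\<close>

lemma R_not_palindrome:
  assumes "c \<in> C" "al J k c"
  shows "R J c \<noteq> R J (th ((nx J ^^ k) c))"
proof
  assume eq: "R J c = R J (th ((nx J ^^ k) c))"
  have l: "lam ((nx J ^^ i) c) = tr (lam ((nx J ^^ (k - i)) c))" if "i \<le> k" for i
    using R_rev[OF assms that] fun_cong[OF eq, of i] al_mono[OF assms(2) that] by (simp add: R_def)
  show False
  proof (cases "even k")
    case True
    then obtain i where "k = 2 * i" by blast
    then have "lam ((nx J ^^ i) c) = tr (lam ((nx J ^^ i) c))" using l[of i] by simp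
    then show False using tr_neq by metis
  next
    case False
    then obtain i where i: "k = 2 * i + 1" by (elim oddE)
    define a where "a = (nx J ^^ i) c"
    have "al J (Suc i) c" using al_mono[OF assms(2)] i by simp
    then have a: "al J i c" "th a \<in> B" by (auto simp: al_Suc a_def)
    have aC: "a \<in> C" unfolding a_def by (rule nx_pow_C[OF assms(1) a(1)])
    have "k - i = Suc i" using i by simp
    then have "lam a = tr (lam (nx J a))" using l[of i] i by (simp add: a_def)
    then have "lam (nx J a) = lam (th a)" by (simp add: lam_th[OF aC] tr_tr)
    then have "col (nx J a) = col (th a)" using nx_B[OF a(2)] a(2) B_C by (intro lam_col) auto
    then show False using joinings_col[OF J a(2)] by (simp add: nx_def)
  qed
qed

end

text \<open>As long as the reversed walk stays within the part already read, its letters are the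
  transposes of letters of the forward reading. Beyond c it stops if c is an outer end; if c lies on
  a cycle, going round before turning back makes the known part as long as required. This is where
  \<open>E J c\<close> enters: inside an open string the forward reading does not determine what
  lies behind.\<close>

lemma R_rev_eq:
  assumes J: "J \<in> joinings" and J': "J' \<in> joinings" and c: "c \<in> C" and c': "c' \<in> C"
    and EJ: "E J c" and eq: "R J c = R J' c'" and al: "al J k c"
  shows "R J (th ((nx J ^^ k) c)) = R J' (th ((nx J' ^^ k) c'))"
proof
  fix i
  have al': "al J' k c'" using R_eq_al[OF eq] al by simp
  have small: "R J (th ((nx J ^^ k) c)) i = R J' (th ((nx J' ^^ k) c')) i"
    if "i \<le> k" "al J k c" "al J' k c'" for k i
    using R_rev[OF J c that(2,1)] R_rev[OF J' c' that(3,1)] R_eq_lam[OF eq, of "k - i"] al_mono[OF that(2), of "k - i"]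
    by simp
  show "R J (th ((nx J ^^ k) c)) i = R J' (th ((nx J' ^^ k) c')) i"
  proof (cases "i \<le> k")
    case False
    show ?thesis
    proof (cases "c \<in> B")
      case False
      then have nB: "c' \<notin> B" using lam_B[OF c c'] R_eq_lam[OF eq, of 0] by simp
      have "\<not> al J (Suc k) (th ((nx J ^^ k) c))" "\<not> al J' (Suc k) (th ((nx J' ^^ k) c'))"
        using nx_pow_rev_all(1)[OF J c al] nx_pow_rev_all(1)[OF J' c' al'] th_th[OF c] th_th[OF c'] False nB
        by (simp_all add: al_Suc)
      then have "\<not> al J i (th ((nx J ^^ k) c))" "\<not> al J' i (th ((nx J' ^^ k) c'))"
        using al_mono[of J i _ "Suc k"] al_mono[of J' i _ "Suc k"] \<open>\<not> i \<le> k\<close> by auto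
      then show ?thesis by (simp add: R_def)
    next
      case True
      then have im: "\<And>k. al J k c" using EJ by (simp add: E_def)
      then have im': "\<And>k. al J' k c'" using R_eq_al[OF eq] by simp
      obtain L L' where L: "0 < L" "(nx J ^^ L) c = c" "0 < L'" "(nx J' ^^ L') c' = c'"
        using period_exists[OF J c im] period_exists[OF J' c' im'] by blast
      \<comment> \<open>A common multiple of both periods that is at least i: adding m steps moves
        neither turning point but lengthens the part already read beyond i.\<close>
      define m where "m = i * L * L'"
      have "(nx J ^^ m) c = c" using period_mult[OF J L(2), of "i * L'"] by (simp add: m_def mult_ac)
      then have e: "(nx J ^^ (m + k)) c = (nx J ^^ k) c" using nx_add[of k J m c] by simp
      have "(nx J' ^^ m) c' = c'" using period_mult[OF J' L(4), of "i * L"] by (simp add: m_def)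
      then have e': "(nx J' ^^ (m + k)) c' = (nx J' ^^ k) c'" using nx_add[of k J' m c'] by simp
      have "i * 1 * 1 \<le> m" unfolding m_def using L by (intro mult_le_mono) auto
      then have "i \<le> m + k" by simp
      from small[OF this im im'] show ?thesis by (simp add: e e')
    qed
  qed (use small al al' in simp)
qed

text \<open>On a cycle the partner of v is the far end of the arrow just before v, which is reached
  by walking one step less than a period. A common period of both cycles lets
  \<open>R_rev_eq\<close> compare the two.\<close>

lemma R_join_eq:
  assumes J: "J \<in> joinings" and v: "v \<in> B" "v' \<in> B" and im: "\<And>k. al J k v" and eq: "R J v = R J v'"
  shows "R J (J v) = R J (J v')"
proof -
  have vC: "v \<in> C" "v' \<in> C" using v B_C by auto
  have im': "\<And>k. al J k v'" using R_eq_al[OF eq] im by simp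
  obtain L L' where L: "0 < L" "(nx J ^^ L) v = v" "0 < L'" "(nx J ^^ L') v' = v'"
    using period_exists[OF J vC(1) im] period_exists[OF J vC(2) im'] by blast
  obtain m where m: "L * L' = Suc m" using L by (metis gr0_implies_Suc nat_0_less_mult_iff)
  have "(nx J ^^ Suc m) v = v" "(nx J ^^ Suc m) v' = v'"
    using period_mult[OF J L(2), of L'] period_mult[OF J L(4), of L] m by (simp_all add: mult.commute)
  then have "J v = th ((nx J ^^ m) v)" "J v' = th ((nx J ^^ m) v')"
    using joinings_invol[OF J] by (simp_all add: nx_def) (metis)+
  then show ?thesis using R_rev_eq[OF J J vC _ eq im] im by (simp add: E_def)
qed

text \<open>The readings in \<open>W\<close> select one direction of every string, and one starting cell in each period of
  a cycle.\<close>

definition good :: "('c \<Rightarrow> 'c) \<Rightarrow> (nat \<Rightarrow> 'l option) set \<Rightarrow> bool" where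
  "good J W \<longleftrightarrow> W \<subseteq> R J ` {c \<in> C. E J c} \<and>
     (\<forall>c\<in>C. E J c \<longrightarrow>
        (\<exists>k. al J k c \<and> R J ((nx J ^^ k) c) \<in> W) \<noteq> (\<exists>k. al J k c \<and> R J (th ((nx J ^^ k) c)) \<in> W)) \<and>
     (\<forall>c\<in>C. \<forall>k. R J c \<in> W \<and> al J k c \<and> R J ((nx J ^^ k) c) \<in> W \<longrightarrow> R J ((nx J ^^ k) c) = R J c)"

lemma good_return:
  "good J W \<Longrightarrow> c \<in> C \<Longrightarrow> R J c \<in> W \<Longrightarrow> al J k c \<Longrightarrow> R J ((nx J ^^ k) c) \<in> W \<Longrightarrow> R J ((nx J ^^ k) c) = R J c"
  by (simp add: good_def)

text \<open>Only the numbers of ends and of cycle cells with each reading are compared, so two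
  joinings may be related although their cycles have different lengths. This is the relation that
  equivalence of quadruples turns out to be.\<close>

definition same :: "('c \<Rightarrow> 'c) \<Rightarrow> ('c \<Rightarrow> 'c) \<Rightarrow> bool" where
  "same J J' \<longleftrightarrow> (\<forall>r. card {c \<in> C. E J c \<and> R J c = r} = card {c \<in> C. E J' c \<and> R J' c = r})"

lemma same_sym: "same J J' \<Longrightarrow> same J' J" by (simp add: same_def)

lemma sameD:
  assumes "same J J'" "c \<in> C" "E J c"
  obtains c' where "c' \<in> C" "E J' c'" "R J c = R J' c'"
proof -
  have "0 < card {d \<in> C. E J d \<and> R J d = R J c}" using assms(2,3) fin_C by (intro card_gt_0_iff[THEN iffD2]) auto
  then have "0 < card {d \<in> C. E J' d \<and> R J' d = R J c}" using assms(1) unfolding same_def by metis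
  then show thesis using that by (metis (mono_tags, lifting) card_gt_0_iff empty_Collect_eq)
qed

text \<open>Every clause of \<open>good\<close> speaks of readings only: those ahead of c are shifts
  of its reading, those of the reversed walk are determined by it through
  \<open>R_rev_eq\<close>.\<close>

lemma good_same:
  assumes J: "J \<in> joinings" and J': "J' \<in> joinings" and g: "good J W" and s: "same J J'"
  shows "good J' W"
  unfolding good_def
proof (intro conjI ballI allI impI)
  show "W \<subseteq> R J' ` {c \<in> C. E J' c}"
  proof
    fix r assume "r \<in> W"
    then obtain c where "c \<in> C" "E J c" "r = R J c" using g by (auto simp: good_def)
    with sameD[OF s] show "r \<in> R J' ` {c \<in> C. E J' c}" by (metis (mono_tags, lifting) image_eqI mem_Collect_eq)
  qed
next
  fix c' assume c': "c' \<in> C" "E J' c'"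
  obtain c where c: "c \<in> C" "E J c" "R J' c' = R J c" using sameD[OF same_sym[OF s] c'] by blast
  have eq: "R J c = R J' c'" using c(3) by simp
  have al: "al J k c \<longleftrightarrow> al J' k c'" for k by (rule R_eq_al[OF eq])
  have f: "R J ((nx J ^^ k) c) = R J' ((nx J' ^^ k) c')" if "al J k c" for k by (rule R_eq_shift[OF eq that])
  have b: "R J (th ((nx J ^^ k) c)) = R J' (th ((nx J' ^^ k) c'))" if "al J k c" for k
    by (rule R_rev_eq[OF J J' c(1) c'(1) c(2) eq that])
  have "(\<exists>k. al J k c \<and> R J ((nx J ^^ k) c) \<in> W) \<noteq> (\<exists>k. al J k c \<and> R J (th ((nx J ^^ k) c)) \<in> W)"
    using g c(1,2) by (simp add: good_def)
  moreover have "(\<exists>k. al J k c \<and> R J ((nx J ^^ k) c) \<in> W) \<longleftrightarrow> (\<exists>k. al J' k c' \<and> R J' ((nx J' ^^ k) c') \<in> W)"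
    using f al by metis
  moreover have "(\<exists>k. al J k c \<and> R J (th ((nx J ^^ k) c)) \<in> W) \<longleftrightarrow> (\<exists>k. al J' k c' \<and> R J' (th ((nx J' ^^ k) c')) \<in> W)"
    using b al by metis
  ultimately show "(\<exists>k. al J' k c' \<and> R J' ((nx J' ^^ k) c') \<in> W) \<noteq> (\<exists>k. al J' k c' \<and> R J' (th ((nx J' ^^ k) c')) \<in> W)"
    by simp
next
  fix c' k assume c': "c' \<in> C" and k: "R J' c' \<in> W \<and> al J' k c' \<and> R J' ((nx J' ^^ k) c') \<in> W"
  obtain c where c: "c \<in> C" "R J c = R J' c'" using k g by (auto simp: good_def)
  have "al J k c" using k R_eq_al[OF c(2)] by simp
  moreover from R_eq_shift[OF c(2) this] have "R J ((nx J ^^ k) c) = R J' ((nx J' ^^ k) c')" .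
  ultimately show "R J' ((nx J' ^^ k) c') = R J' c'"
    using good_return[OF g c(1), of k] c k by simp
qed

definition St :: "('c \<Rightarrow> 'c) \<Rightarrow> (nat \<Rightarrow> 'l option) set \<Rightarrow> 'c set" where
  "St J W = {c \<in> C. R J c \<in> W}"

text \<open>The number of letters of a reading that stops, and the minimal period of a periodic one.
  The second may be a proper divisor of the length of the cycle.\<close>

definition len :: "(nat \<Rightarrow> 'l option) \<Rightarrow> nat" where
  "len r = (LEAST k. 0 < k \<and> (r k = None \<or> (\<forall>i. r (k + i) = r i)))"

text \<open>Coordinates consisting of a start and an offset. Decoding them gives one end of every
  arrow exactly once, which is the index set for all later products of matrix entries.\<close>

definition Dp :: "('c \<Rightarrow> 'c) \<Rightarrow> (nat \<Rightarrow> 'l option) set \<Rightarrow> ('c \<times> nat) set" where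
  "Dp J W = {(s, k). s \<in> St J W \<and> k < len (R J s)}"

definition dec :: "('c \<Rightarrow> 'c) \<Rightarrow> 'c \<times> nat \<Rightarrow> 'c" where
  "dec J = (\<lambda>(s, k). (nx J ^^ k) s)"

lemma St_C: "s \<in> St J W \<Longrightarrow> s \<in> C" by (simp add: St_def)

lemma finite_St: "finite (St J W)" using fin_C by (simp add: St_def)

lemma len_le:
  assumes "0 < k" "r k = None \<or> (\<forall>i. r (k + i) = r i)"
  shows "len r \<le> k"
  unfolding len_def by (rule Least_le) (use assms in simp)

context
  fixes J W assumes J: "J \<in> joinings" and good: "good J W"
begin

lemma St_E: "s \<in> St J W \<Longrightarrow> E J s"
proof -
  assume s: "s \<in> St J W"
  then obtain c where "c \<in> C" "E J c" "R J s = R J c" using good by (auto simp: good_def St_def)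
  then show "E J s" using E_R_eq[of s c J J] s by (simp add: St_def)
qed

lemma len_St:
  assumes "s \<in> St J W"
  shows "0 < len (R J s)" "R J s (len (R J s)) = None \<or> (\<forall>i. R J s (len (R J s) + i) = R J s i)"
proof -
  have "\<exists>k. 0 < k \<and> (R J s k = None \<or> (\<forall>i. R J s (k + i) = R J s i))"
  proof (cases "\<forall>k. al J k s")
    case True
    then obtain L where L: "L > 0" "(nx J ^^ L) s = s" using period_exists[OF J St_C[OF assms]] by blast
    then have "R J s (L + i) = R J s i" for i using R_shift[of J L s i] True by simp
    then show ?thesis using L by blast
  next
    case False
    then obtain k where "\<not> al J k s" by blast
    moreover from this have "0 < k" by (cases k) auto
    ultimately show ?thesis by (auto simp: R_def)
  qed
  from LeastI_ex[OF this] show "0 < len (R J s)" "R J s (len (R J s)) = None \<or> (\<forall>i. R J s (len (R J s) + i) = R J s i)"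
    unfolding len_def by auto
qed

lemma al_less_len: "k < len (R J s) \<Longrightarrow> al J k s"
  using len_le[of k "R J s"] R_al[of J s k] by (cases "k = 0"; cases "R J s k = None") simp_all

lemma return_W:
  assumes "s \<in> St J W" "al J k s" "(nx J ^^ k) s \<in> St J W"
  shows "R J ((nx J ^^ k) s) = R J s"
  using good_return[OF good, of s k] assms by (simp add: St_def)

lemma return_ge_len:
  assumes "s \<in> St J W" "al J k s" "(nx J ^^ k) s \<in> St J W" "0 < k"
  shows "len (R J s) \<le> k"
  using return_W[OF assms(1-3)] R_shift[OF assms(2)] by (intro len_le assms(4)) auto

text \<open>Cancelling the common number of steps, one start is reached from the other in fewer
  steps than its length. A return to a start repeats the reading, so it takes at least a full period
  unless it takes no step.\<close>

lemma dec_inj: "inj_on (dec J) (Dp J W)"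
proof -
  have aux: "s = s' \<and> k = k'" if "s \<in> St J W" "s' \<in> St J W" "k < len (R J s)" "k' < len (R J s')"
    "(nx J ^^ k) s = (nx J ^^ k') s'" "k \<le> k'" for s s' k k'
  proof -
    have a: "al J k s" "al J k' s'" using that al_less_len by auto
    have e: "s = (nx J ^^ (k' - k)) s'"
      by (rule nx_pow_cancel[OF J St_C[OF that(1)] St_C[OF that(2)] a that(6,5)])
    have "k' - k = 0"
    proof (rule ccontr)
      assume n: "k' - k \<noteq> 0"
      have "al J (k' - k) s'" using a(2) by (rule al_mono) simp
      then have "len (R J s') \<le> k' - k" using return_ge_len[OF that(2)] e that(1) n by simp
      then show False using that(4) by simp
    qed
    then show ?thesis using e that(6) by simp
  qed
  show ?thesis
  proof (rule inj_onI)
    fix x y assume "x \<in> Dp J W" "y \<in> Dp J W" "dec J x = dec J y"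
    then show "x = y"
      using aux[of "fst x" "fst y" "snd x" "snd y"] aux[of "fst y" "fst x" "snd y" "snd x"]
      by (cases "snd x \<le> snd y") (auto simp: Dp_def dec_def case_prod_unfold prod_eq_iff)
  qed
qed

text \<open>The offset can be reduced by whole periods. After a period the walk is at a start with
  the same reading, though possibly at a different start, so the reduction also changes s.\<close>

lemma dec_Dp_eq: "dec J ` Dp J W = {(nx J ^^ k) s | s k. s \<in> St J W \<and> al J k s}"
proof (intro equalityI subsetI)
  fix c assume "c \<in> dec J ` Dp J W"
  then show "c \<in> {(nx J ^^ k) s | s k. s \<in> St J W \<and> al J k s}" using al_less_len by (auto simp: Dp_def dec_def)
next
  fix c assume "c \<in> {(nx J ^^ k) s | s k. s \<in> St J W \<and> al J k s}"
  then obtain s k where sk: "s \<in> St J W" "al J k s" "c = (nx J ^^ k) s" by blast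
  then show "c \<in> dec J ` Dp J W"
  proof (induction k arbitrary: s rule: less_induct)
    case (less k)
    show ?case
    proof (cases "k < len (R J s)")
      case True
      then show ?thesis using less.prems by (auto simp: Dp_def dec_def intro!: image_eqI[of _ _ "(s, k)"])
    next
      case False
      let ?L = "len (R J s)"
      have L: "?L \<le> k" using False by simp
      have a: "al J ?L s" using al_mono[OF less.prems(2) L] .
      then have "R J s ?L \<noteq> None" by (rule R_al[THEN iffD2])
      then have "\<forall>i. R J s (?L + i) = R J s i" using len_St(2)[OF less.prems(1)] by metis
      then have "R J ((nx J ^^ ?L) s) = R J s" by (intro ext) (simp add: R_shift[OF a])
      then have S: "(nx J ^^ ?L) s \<in> St J W"
        using less.prems(1) nx_pow_C[OF J St_C[OF less.prems(1)] a] by (simp add: St_def)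
      have "al J (k - ?L) ((nx J ^^ ?L) s)" using less.prems(2) al_add[of J ?L "k - ?L" s] L by simp
      moreover have "c = (nx J ^^ (k - ?L)) ((nx J ^^ ?L) s)" using less.prems(3) L by (simp add: nx_add)
      ultimately show ?thesis using less.IH[of "k - ?L", OF _ S] len_St(1)[OF less.prems(1)] L by simp
    qed
  qed
qed

lemma immortal_of_B: "s \<in> St J W \<Longrightarrow> s \<in> B \<Longrightarrow> al J k s"
  using St_E by (auto simp: E_def)

text \<open>Together with \<open>span_fwd\<close> this translates the alternative in
  \<open>good\<close> into the statement that exactly one of c and th c is decoded.\<close>

lemma span_back:
  assumes "d \<in> C"
  shows "th d \<in> dec J ` Dp J W \<longleftrightarrow> (\<exists>k. al J k d \<and> R J (th ((nx J ^^ k) d)) \<in> W)"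
proof
  assume "th d \<in> dec J ` Dp J W"
  then obtain s k where s: "s \<in> St J W" "al J k s" "th d = (nx J ^^ k) s" unfolding dec_Dp_eq by blast
  have e: "th ((nx J ^^ k) s) = d" using s(3) th_th[OF assms] by metis
  from nx_pow_rev_all[OF J St_C[OF s(1)] s(2)] have "(nx J ^^ k) d = th s" "al J k d" unfolding e by auto
  then show "\<exists>k. al J k d \<and> R J (th ((nx J ^^ k) d)) \<in> W"
    using s(1) th_th[OF St_C[OF s(1)]] by (intro exI[of _ k]) (simp add: St_def)
next
  assume "\<exists>k. al J k d \<and> R J (th ((nx J ^^ k) d)) \<in> W"
  then obtain k where k: "al J k d" "R J (th ((nx J ^^ k) d)) \<in> W" by blast
  let ?s = "th ((nx J ^^ k) d)"
  have "?s \<in> St J W" using k th_C[OF nx_pow_C[OF J assms k(1)]] by (simp add: St_def)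
  then show "th d \<in> dec J ` Dp J W"
    unfolding dec_Dp_eq using nx_pow_rev_all[OF J assms k(1)] by (metis (mono_tags, lifting) mem_Collect_eq)
qed

lemma span_fwd:
  assumes d: "d \<in> C" "E J d"
  shows "d \<in> dec J ` Dp J W \<longleftrightarrow> (\<exists>k. al J k d \<and> R J ((nx J ^^ k) d) \<in> W)"
proof
  assume "d \<in> dec J ` Dp J W"
  then obtain s k where s: "s \<in> St J W" "al J k s" "d = (nx J ^^ k) s" unfolding dec_Dp_eq by blast
  show "\<exists>k. al J k d \<and> R J ((nx J ^^ k) d) \<in> W"
  proof (cases "k = 0")
    case True
    then show ?thesis using s by (intro exI[of _ 0]) (simp add: St_def)
  next
    case False
    then have "d \<in> B" using nx_pow_B[OF J s(2)] s(3) by simp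
    then have im: "al J i d" for i using d(2) by (simp add: E_def)
    then have ims: "al J i s" for i using al_immortal[OF J s(2)] s(3) by simp
    \<comment> \<open>On a cycle one cannot step back to s, but going forward round the cycle
      reaches it as well.\<close>
    obtain L where L: "0 < L" "(nx J ^^ L) s = s" using period_exists[OF J St_C[OF s(1)] ims] by blast
    have "(nx J ^^ (k * L)) s = s" using period_mult[OF J L(2)] .
    moreover have "k \<le> k * L" using L by simp
    ultimately have "(nx J ^^ (k * L - k)) d = s" using s(3) by (simp add: nx_add)
    then show ?thesis using im s(1) by (intro exI[of _ "k * L - k"]) (simp add: St_def)
  qed
next
  assume "\<exists>k. al J k d \<and> R J ((nx J ^^ k) d) \<in> W"
  then obtain k where k: "al J k d" "R J ((nx J ^^ k) d) \<in> W" by blast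
  let ?s = "(nx J ^^ k) d"
  have S: "?s \<in> St J W" using k nx_pow_C[OF J d(1) k(1)] by (simp add: St_def)
  show "d \<in> dec J ` Dp J W"
  proof (cases "k = 0")
    case True
    then show ?thesis unfolding dec_Dp_eq using S
      by (intro CollectI exI[of _ d] exI[of _ 0]) simp
  next
    case False
    then have "?s \<in> B" using nx_pow_B[OF J k(1)] by simp
    then have ims: "al J i ?s" for i using immortal_of_B[OF S] by simp
    then have im: "al J i d" for i using al_immortal[OF J k(1)] by simp
    obtain L where L: "0 < L" "(nx J ^^ L) d = d" using period_exists[OF J d(1) im] by blast
    have "(nx J ^^ (k * L)) d = d" using period_mult[OF J L(2)] .
    moreover have "k \<le> k * L" using L by simp
    ultimately have "(nx J ^^ (k * L - k)) ?s = d" by (simp add: nx_add)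
    then show ?thesis unfolding dec_Dp_eq using S ims by (metis (mono_tags, lifting) mem_Collect_eq)
  qed
qed

lemma half_E:
  assumes "d \<in> C" "E J d"
  shows "d \<in> dec J ` Dp J W \<longleftrightarrow> th d \<notin> dec J ` Dp J W"
  using good assms unfolding good_def span_back[OF assms(1)] span_fwd[OF assms] by blast

lemma span_step: "c \<in> dec J ` Dp J W \<Longrightarrow> al J k c \<Longrightarrow> (nx J ^^ k) c \<in> dec J ` Dp J W"
  unfolding dec_Dp_eq using al_add[of J _ k] nx_add[of k J] by fastforce

lemma span_unstep:
  assumes c: "c \<in> C" "al J k c" and n: "(nx J ^^ k) c \<in> dec J ` Dp J W" and mort: "\<exists>i. \<not> al J i c"
  shows "c \<in> dec J ` Dp J W"
proof -
  obtain s i where s: "s \<in> St J W" "al J i s" "(nx J ^^ k) c = (nx J ^^ i) s" using n unfolding dec_Dp_eq by blast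
  show ?thesis
  proof (cases "k \<le> i")
    case True
    have "c = (nx J ^^ (i - k)) s" by (rule nx_pow_cancel[OF J c(1) St_C[OF s(1)] c(2) s(2) True s(3)])
    moreover have "al J (i - k) s" using s(2) by (rule al_mono) simp
    ultimately show ?thesis unfolding dec_Dp_eq using s(1) by blast
  next
    case False
    have e: "s = (nx J ^^ (k - i)) c"
      by (rule nx_pow_cancel[OF J St_C[OF s(1)] c(1) s(2) c(2) _ s(3)[symmetric]]) (use False in simp)
    have a: "al J (k - i) c" using c(2) by (rule al_mono) simp
    then have "s \<in> B" using nx_pow_B[OF J a] e False by simp
    then have "al J j ((nx J ^^ (k - i)) c)" for j using immortal_of_B[OF s(1)] e by simp
    then show ?thesis using al_immortal[OF J a] mort by blast
  qed
qed

text \<open>For ends and cycle cells this is the alternative in \<open>good\<close>. A cell inside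
  an open string is joined by the walk to the outer end behind it, and membership in the decoded
  half does not change along the walk in either direction.\<close>

lemma half:
  assumes c: "c \<in> C"
  shows "c \<in> dec J ` Dp J W \<longleftrightarrow> th c \<notin> dec J ` Dp J W"
proof (cases "E J c")
  case False
  then have cB: "c \<in> B" and mort: "\<exists>i. \<not> al J i c" by (auto simp: E_def)
  \<comment> \<open>An endless walk from th c would run on a cycle, and the reversed cycle would
    make the walk from c endless too.\<close>
  have mort': "\<exists>i. \<not> al J i (th c)"
  proof (rule ccontr)
    assume "\<not> ?thesis"
    then have im: "al J i (th c)" for i by blast
    obtain L where L: "0 < L" "(nx J ^^ L) (th c) = th c" using period_exists[OF J th_C[OF c] im] by blast
    have "(nx J ^^ L) c = c" "al J L c"
      using nx_pow_rev_all[OF J th_C[OF c] im, of L] L(2) th_th[OF c] by simp_all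
    moreover from this have "al J (m * L) c" for m
    proof (induction m)
      case (Suc m)
      then show ?case using al_add[of J L "m * L" c] by simp
    qed simp
    moreover have "i \<le> i * L" for i using L by simp
    ultimately show False using mort al_mono by blast
  qed
  \<comment> \<open>The walk from th c stops after m steps. The far end e of the arrow reached there
    is an outer cell, and m steps from e lead back to c.\<close>
  define k where "k = (LEAST i. \<not> al J i (th c))"
  have k: "\<not> al J k (th c)" using LeastI_ex[OF mort'] by (simp add: k_def)
  then obtain m where m: "k = Suc m" by (cases k) auto
  have am: "al J m (th c)" using not_less_Least[of m "\<lambda>i. \<not> al J i (th c)"] m by (auto simp: k_def[symmetric])
  define e where "e = th ((nx J ^^ m) (th c))"
  have eB: "e \<notin> B" using k am by (simp add: m al_Suc e_def)
  have pC: "(nx J ^^ m) (th c) \<in> C" by (rule nx_pow_C[OF J th_C[OF c] am])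
  have eC: "e \<in> C" using th_C[OF pC] by (simp add: e_def)
  have ec: "(nx J ^^ m) e = c" "al J m e"
    using nx_pow_rev_all[OF J th_C[OF c] am] th_th[OF c] by (simp_all add: e_def)
  have the: "th e = (nx J ^^ m) (th c)" using th_th[OF pC] by (simp add: e_def)
  have h: "e \<in> dec J ` Dp J W \<longleftrightarrow> th e \<notin> dec J ` Dp J W" using half_E[OF eC] eB by (simp add: E_def)
  have mort_e: "\<exists>i. \<not> al J i e"
  proof -
    obtain i where "\<not> al J i c" using mort by blast
    then have "\<not> al J (m + i) e" using al_add[of J m i e] ec by simp
    then show ?thesis by blast
  qed
  have 1: "c \<in> dec J ` Dp J W \<longleftrightarrow> e \<in> dec J ` Dp J W"
    using span_step[OF _ ec(2)] span_unstep[OF eC ec(2) _ mort_e] ec(1) by auto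
  have 2: "th c \<in> dec J ` Dp J W \<longleftrightarrow> th e \<in> dec J ` Dp J W"
    using span_step[OF _ am] span_unstep[OF th_C[OF c] am _ mort'] the by auto
  show ?thesis using h 1 2 by simp
qed (rule half_E[OF c])

end

section \<open>Relabelling cells and reconnecting closed strings\<close>

definition labelled_perms :: "('c \<Rightarrow> 'c) set" where
  "labelled_perms = {g \<in> aut C lam. \<forall>c\<in>C. g (th c) = th (g c)}"

text \<open>The joining transported along g. If g commutes with \<open>th\<close>, this relabels the
  whole picture; if g only permutes starts with equal readings, it reconnects the closed strings
  among each other.\<close>

definition cj :: "('c \<Rightarrow> 'c) \<Rightarrow> ('c \<Rightarrow> 'c) \<Rightarrow> 'c \<Rightarrow> 'c" where
  "cj g J = g \<circ> J \<circ> pinv g"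

lemma aut_C:
  assumes "g \<in> aut C lam"
  shows "g permutes C" "c \<in> C \<Longrightarrow> g c \<in> C" "c \<in> C \<Longrightarrow> lam (g c) = lam c" "pinv g (g c) = c" "g (pinv g c) = c"
    "c \<in> C \<Longrightarrow> g c \<in> B \<longleftrightarrow> c \<in> B" "c \<in> C \<Longrightarrow> col (g c) = col c" "c \<notin> C \<Longrightarrow> g c = c"
proof -
  show p: "g permutes C" and l: "c \<in> C \<Longrightarrow> lam (g c) = lam c" using assms by (auto simp: aut_def)
  show gc: "c \<in> C \<Longrightarrow> g c \<in> C" using permutes_in_image[OF p] by simp
  show "pinv g (g c) = c" "g (pinv g c) = c" by (rule permutes_inverses[OF p])+
  show "c \<in> C \<Longrightarrow> g c \<in> B \<longleftrightarrow> c \<in> B" "c \<in> C \<Longrightarrow> col (g c) = col c"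
    using lam_B[OF gc _ l] lam_col[OF gc _ l] by simp_all
  show "c \<notin> C \<Longrightarrow> g c = c" by (rule permutes_not_in[OF p])
qed

lemma cj_apply: "g \<in> aut C lam \<Longrightarrow> cj g J (g c) = g (J c)"
  by (simp add: cj_def aut_C)

text \<open>Equal letters lie in the same column, so a letter-preserving permutation maps B to
  itself and keeps the two cells of a joint in different columns.\<close>

lemma cj_joinings:
  assumes g: "g \<in> aut C lam" and J: "J \<in> joinings"
  shows "cj g J \<in> joinings"
proof -
  have gp: "g permutes C" by (rule aut_C(1)[OF g])
  have Jp: "J permutes B" using J by (simp add: joinings_def)
  note gi = aut_C[OF aut_inv[OF g]]
  have inj: "cj g J x = cj g J y \<Longrightarrow> x = y" for x y
    using permutes_inj[OF gp] permutes_inj[OF Jp] permutes_inj[OF permutes_inv[OF gp]] by (simp add: cj_def inj_eq)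
  have B: "cj g J u \<in> B" if "u \<in> B" for u
  proof -
    have "pinv g u \<in> B" using gi(6)[of u] that B_C by auto
    then have "J (pinv g u) \<in> B" by (rule joinings_B[OF J])
    then show ?thesis using aut_C(6)[OF g, of "J (pinv g u)"] B_C by (auto simp: cj_def)
  qed
  have out: "cj g J u = u" if "u \<notin> B" for u
  proof -
    have "pinv g u \<notin> B"
      using gi(6)[of u] that gi(8)[of u] B_C by (cases "u \<in> C") auto
    then show ?thesis using permutes_not_in[OF Jp] by (simp add: cj_def aut_C[OF g])
  qed
  have "cj g J permutes B"
    by (rule inj_imp_permutes) (auto intro: inj_onI inj B out finite_B)
  moreover have "cj g J (cj g J u) = u" for u by (simp add: cj_def aut_C[OF g] joinings_invol[OF J])
  moreover have "col (cj g J u) \<noteq> col u" if "u \<in> B" for u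
  proof -
    have u: "pinv g u \<in> B" "pinv g u \<in> C" using gi(2)[of u] gi(6)[of u] that B_C by auto
    have "col (cj g J u) = col (J (pinv g u))"
      using aut_C(7)[OF g, of "J (pinv g u)"] joinings_B[OF J u(1)] B_C by (auto simp: cj_def)
    moreover have "col u = col (pinv g u)" using gi(7)[of u] that B_C by auto
    ultimately show ?thesis using joinings_col[OF J u(1)] by simp
  qed
  ultimately show ?thesis by (simp add: joinings_def)
qed

lemma cj_comp: "g \<in> aut C lam \<Longrightarrow> h \<in> aut C lam \<Longrightarrow> cj g (cj h J) = cj (g \<circ> h) J"
  by (simp add: cj_def fun_eq_iff o_inv_distrib permutes_bij[OF aut_C(1)])

lemma labelled_aut: "g \<in> labelled_perms \<Longrightarrow> g \<in> aut C lam"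
  by (simp add: labelled_perms_def)

lemma labelled_inv:
  assumes "g \<in> labelled_perms"
  shows "pinv g \<in> labelled_perms"
proof -
  note g = labelled_aut[OF assms]
  note gi = aut_C[OF aut_inv[OF g]]
  have "pinv g (th c) = th (pinv g c)" if "c \<in> C" for c
  proof -
    have "g (th (pinv g c)) = th (g (pinv g c))" using assms gi(2)[OF that] by (simp add: labelled_perms_def)
    then have "g (th (pinv g c)) = th c" by (simp add: aut_C[OF g])
    then show ?thesis using aut_C(4)[OF g, of "th (pinv g c)"] by simp
  qed
  then show ?thesis using aut_inv[OF g] by (simp add: labelled_perms_def)
qed

lemma labelled_nx:
  assumes g: "g \<in> labelled_perms" and c: "c \<in> C"
  shows "nx (cj g J) (g c) = g (nx J c)" "th (g c) \<in> B \<longleftrightarrow> th c \<in> B"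
proof -
  have t: "th (g c) = g (th c)" using g c by (simp add: labelled_perms_def)
  show "nx (cj g J) (g c) = g (nx J c)" by (simp add: nx_def t cj_apply[OF labelled_aut[OF g]])
  show "th (g c) \<in> B \<longleftrightarrow> th c \<in> B" using aut_C(6)[OF labelled_aut[OF g] th_C[OF c]] by (simp add: t)
qed

lemma labelled_nx_pow:
  assumes g: "g \<in> labelled_perms" and J: "J \<in> joinings" and c: "c \<in> C"
  shows "al (cj g J) k (g c) \<longleftrightarrow> al J k c" "al J k c \<Longrightarrow> (nx (cj g J) ^^ k) (g c) = g ((nx J ^^ k) c)"
proof (induction k)
  case (Suc k)
  { case 1
    show ?case using Suc labelled_nx(2)[OF g nx_pow_C[OF J c]] by (auto simp: al_Suc)
  next
    case 2
    then show ?case using Suc labelled_nx(1)[OF g nx_pow_C[OF J c], of k J] by (auto simp: al_Suc) }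
qed simp_all

lemma labelled_R:
  assumes g: "g \<in> labelled_perms" and J: "J \<in> joinings" and c: "c \<in> C"
  shows "R (cj g J) (g c) = R J c"
  using labelled_nx_pow[OF assms] aut_C(3)[OF labelled_aut[OF g] nx_pow_C[OF J c]] by (auto simp: R_def)

lemma same_labelled:
  assumes g: "g \<in> labelled_perms" and J: "J \<in> joinings"
  shows "same J (cj g J)"
  unfolding same_def
proof
  fix r
  note a = aut_C[OF labelled_aut[OF g]]
  note gi = aut_C[OF aut_inv[OF labelled_aut[OF g]]]
  have E: "E (cj g J) (g c) \<longleftrightarrow> E J c" if "c \<in> C" for c
    using labelled_nx_pow(1)[OF g J that] a(6)[OF that] by (simp add: E_def)
  have "bij_betw g {c \<in> C. E J c \<and> R J c = r} {c \<in> C. E (cj g J) c \<and> R (cj g J) c = r}"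
  proof (rule bij_betw_byWitness[where f' = "pinv g"])
    show "\<forall>c\<in>{c \<in> C. E J c \<and> R J c = r}. pinv g (g c) = c" "\<forall>c\<in>{c \<in> C. E (cj g J) c \<and> R (cj g J) c = r}. g (pinv g c) = c"
      by (simp_all add: a)
    show "g ` {c \<in> C. E J c \<and> R J c = r} \<subseteq> {c \<in> C. E (cj g J) c \<and> R (cj g J) c = r}"
      using labelled_R[OF g J] E a(2) by auto
    show "pinv g ` {c \<in> C. E (cj g J) c \<and> R (cj g J) c = r} \<subseteq> {c \<in> C. E J c \<and> R J c = r}"
    proof (rule image_subsetI)
      fix c assume c: "c \<in> {c \<in> C. E (cj g J) c \<and> R (cj g J) c = r}"
      then have p: "pinv g c \<in> C" using gi(2) by simp
      show "pinv g c \<in> {c \<in> C. E J c \<and> R J c = r}"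
        using c p E[OF p] labelled_R[OF g J p] by (simp add: a)
    qed
  qed
  then show "card {c \<in> C. E J c \<and> R J c = r} = card {c \<in> C. E (cj g J) c \<and> R (cj g J) c = r}"
    by (rule bij_betw_same_card)
qed

lemma aut_starts:
  assumes J: "J \<in> joinings" and \<rho>: "\<rho> \<in> aut A (R J)" and A: "A \<subseteq> C"
  shows "\<rho> \<in> aut C lam" "c \<in> C \<Longrightarrow> R J (\<rho> c) = R J c"
proof -
  have p: "\<rho> permutes A" and r: "\<And>c. c \<in> A \<Longrightarrow> R J (\<rho> c) = R J c" using \<rho> by (auto simp: aut_def)
  have rr: "R J (\<rho> c) = R J c" for c using r permutes_not_in[OF p] by (cases "c \<in> A") auto
  then have "lam (\<rho> c) = lam c" for c using R_0[of J c] R_0[of J "\<rho> c"] by simp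
  then show "\<rho> \<in> aut C lam" using permutes_subset[OF p A] by (simp add: aut_def)
  show "R J (\<rho> c) = R J c" by (rule rr)
qed

text \<open>The walk after a changed joint continues at \<rho> applied to the partner of the
  \<rho>-preimage of v. By \<open>R_join_eq\<close> passing to the preimage does not change the
  reading of the partner, and \<rho> preserves readings as well. Induction on the number of letters
  then shows that no reading changes anywhere.\<close>

lemma R_cj_starts:
  assumes J: "J \<in> joinings" and A: "A \<subseteq> B" "\<And>c k. c \<in> A \<Longrightarrow> al J k c" and \<rho>: "\<rho> \<in> aut A (R J)" and c: "c \<in> C"
  shows "R (cj \<rho> J) c = R J c"
proof -
  have AC: "A \<subseteq> C" using A B_C by auto
  have \<rho>p: "\<rho> permutes A" using \<rho> by (simp add: aut_def)
  note a = aut_starts[OF J \<rho> AC]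
  note p = aut_C[OF a(1)]
  note pi = aut_C[OF aut_inv[OF a(1)]]
  have "R (cj \<rho> J) c k = R J c k" if "c \<in> C" for c k
    using that
  proof (induction k arbitrary: c)
    case 0
    then show ?case by (simp add: R_0)
  next
    case (Suc k)
    show ?case
    proof (cases "th c \<in> B")
      case True
      define v where "v = th c"
      define v' where "v' = pinv \<rho> v"
      have v: "v \<in> B" "v \<in> C" "v' \<in> B" using True pi(6)[of v] B_C by (auto simp: v_def v'_def)
      have Jv: "R J (J v') = R J (J v)"
      proof (cases "v' = v")
        case False
        have vA: "v' \<in> A" "v \<in> A"
        proof -
          have "\<rho> v' \<noteq> v'" using False p(5)[of v] by (simp add: v'_def)
          then show "v' \<in> A" using permutes_not_in[OF \<rho>p] by blast
          then show "v \<in> A" using permutes_in_image[OF \<rho>p, of v'] p(5)[of v] by (simp add: v'_def)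
        qed
        have "R J v' = R J v" using a(2)[of v'] v B_C p(5)[of v] by (auto simp: v'_def)
        then show ?thesis using R_join_eq[OF J v(3,1) A(2)[OF vA(1)]] by simp
      qed simp
      have C': "nx (cj \<rho> J) c \<in> C"
        using nx_B[OF cj_joinings[OF a(1) J] True] B_C by auto
      have n: "nx (cj \<rho> J) c = \<rho> (J v')" by (simp add: nx_def cj_def v'_def v_def)
      have "R (cj \<rho> J) (nx (cj \<rho> J) c) k = R J (nx (cj \<rho> J) c) k" by (rule Suc.IH[OF C'])
      also have "\<dots> = R J (J v') k" using a(2)[of "J v'"] joinings_B[OF J v(3)] B_C by (auto simp: n)
      also have "\<dots> = R J (nx J c) k" using Jv by (simp add: nx_def v_def)
      finally show ?thesis using True by (simp add: R_Suc)
    qed (simp add: R_Suc)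
  qed
  then show ?thesis using c by (intro ext)
qed

lemma E_cong: "R J c = R J' c \<Longrightarrow> E J c = E J' c"
  using R_eq_al[of J c J' c] by (simp add: E_def)

lemma same_cong:
  assumes "\<And>c. c \<in> C \<Longrightarrow> R J' c = R J c"
  shows "same J J'"
  unfolding same_def
proof
  fix r
  have "{c \<in> C. E J c \<and> R J c = r} = {c \<in> C. E J' c \<and> R J' c = r}"
    using assms E_cong[of J _ J'] by auto
  then show "card {c \<in> C. E J c \<and> R J c = r} = card {c \<in> C. E J' c \<and> R J' c = r}" by simp
qed

lemma same_trans: "same J J' \<Longrightarrow> same J' J'' \<Longrightarrow> same J J''"
  by (simp add: same_def)

text \<open>The starts on cycles, one for each period. They are the places where closed strings may
  be reconnected without changing a reading.\<close>

definition clo :: "('c \<Rightarrow> 'c) \<Rightarrow> (nat \<Rightarrow> 'l option) set \<Rightarrow> 'c set" where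
  "clo J W = St J W \<inter> B"

definition iso :: "('c \<Rightarrow> 'c) \<Rightarrow> ('c \<Rightarrow> 'c) \<Rightarrow> (nat \<Rightarrow> 'l option) set \<Rightarrow> ('c \<Rightarrow> 'c) set" where
  "iso J0 J W = {h \<in> extensional (St J0 W). bij_betw h (St J0 W) (St J W) \<and> (\<forall>s\<in>St J0 W. R J (h s) = R J0 s)}"

text \<open>Equality of the counts in \<open>same\<close> yields a bijection for each reading in W.
  Gluing these gives one isomorphism \<open>h0\<close>, and every other one is \<open>h0\<close>
  after a unique reading-preserving permutation of the starts of \<open>J0\<close>.\<close>

lemma card_iso:
  assumes J0: "J0 \<in> joinings" and J: "J \<in> joinings" and good: "good J0 W" and same: "same J0 J"
  shows "card (iso J0 J W) = card (aut (St J0 W) (R J0))" "finite (iso J0 J W)"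
proof -
  let ?S = "St J0 W" and ?S' = "St J W"
  have goodJ: "good J W" by (rule good_same[OF J0 J good same])
  have fib: "{c \<in> St K W. R K c = r} = {c \<in> C. E K c \<and> R K c = r}" if "K \<in> joinings" "good K W" "r \<in> W" for K r
    using St_E[OF that(1,2)] that(3) by (auto simp: St_def)
  have "\<exists>b. bij_betw b {c \<in> ?S. R J0 c = r} {c \<in> ?S'. R J c = r}" if "r \<in> W" for r
  proof (rule finite_same_card_bij)
    show "card {c \<in> ?S. R J0 c = r} = card {c \<in> ?S'. R J c = r}"
      unfolding fib[OF J0 good that] fib[OF J goodJ that] using same by (simp add: same_def)
  qed (simp_all add: finite_St)
  then have "\<forall>r. \<exists>b. r \<in> W \<longrightarrow> bij_betw b {c \<in> ?S. R J0 c = r} {c \<in> ?S'. R J c = r}" by blast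
  from choice[OF this] obtain b where
    b: "\<And>r. r \<in> W \<Longrightarrow> bij_betw (b r) {c \<in> ?S. R J0 c = r} {c \<in> ?S'. R J c = r}" by blast
  define h0 where "h0 c = b (R J0 c) c" for c
  have W: "R J0 c \<in> W" if "c \<in> ?S" for c using that by (simp add: St_def)
  have W': "R J c \<in> W" if "c \<in> ?S'" for c using that by (simp add: St_def)
  have h0: "h0 c \<in> ?S'" "R J (h0 c) = R J0 c" if "c \<in> ?S" for c
    using bij_betwE[OF b[OF W[OF that]]] that by (auto simp: h0_def)
  have bij: "bij_betw h0 ?S ?S'"
  proof (rule bij_betwI')
    fix c d assume cd: "c \<in> ?S" "d \<in> ?S"
    show "(h0 c = h0 d) = (c = d)"
    proof
      assume eq: "h0 c = h0 d"
      then have r: "R J0 c = R J0 d" using h0(2)[OF cd(1)] h0(2)[OF cd(2)] by simp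
      then have "b (R J0 c) c = b (R J0 c) d" using eq by (simp add: h0_def)
      then show "c = d"
        using bij_betw_imp_inj_on[OF b[OF W[OF cd(1)]]] cd r by (auto dest: inj_onD)
    qed simp
  next
    fix d assume d: "d \<in> ?S'"
    then have "d \<in> b (R J d) ` {c \<in> ?S. R J0 c = R J d}"
      using bij_betw_imp_surj_on[OF b[OF W'[OF d]]] by auto
    then obtain x where "d = b (R J d) x" "x \<in> ?S" "R J0 x = R J d" by blast
    then show "\<exists>c\<in>?S. d = h0 c" by (intro bexI[of _ x]) (simp_all add: h0_def)
  qed (rule h0(1))
  define h1 where "h1 = inv_into ?S h0"
  have h1: "h1 d \<in> ?S" "h0 (h1 d) = d" "R J0 (h1 d) = R J d" if "d \<in> ?S'" for d
  proof -
    have "d \<in> h0 ` ?S" using bij that by (simp add: bij_betw_def)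
    then show "h1 d \<in> ?S" and e: "h0 (h1 d) = d" unfolding h1_def by (rule inv_into_into, rule f_inv_into_f)
    then show "R J0 (h1 d) = R J d" using h0(2)[of "h1 d"] by simp
  qed
  have h10: "h1 (h0 c) = c" if "c \<in> ?S" for c
    unfolding h1_def by (rule inv_into_f_f[OF bij_betw_imp_inj_on[OF bij] that])
  have bb: "bij_betw (\<lambda>\<sigma>. restrict (h0 \<circ> \<sigma>) ?S) (aut ?S (R J0)) (iso J0 J W)"
  proof (rule bij_betw_byWitness[where f' = "\<lambda>h. restrict_id (h1 \<circ> h) ?S"])
    show "\<forall>\<sigma>\<in>aut ?S (R J0). restrict_id (h1 \<circ> restrict (h0 \<circ> \<sigma>) ?S) ?S = \<sigma>"
    proof (intro ballI ext)
      fix \<sigma> c assume \<sigma>: "\<sigma> \<in> aut ?S (R J0)"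
      then have p: "\<sigma> permutes ?S" by (simp add: aut_def)
      show "restrict_id (h1 \<circ> restrict (h0 \<circ> \<sigma>) ?S) ?S c = \<sigma> c"
        using h10[of "\<sigma> c"] permutes_in_image[OF p, of c] permutes_not_in[OF p, of c] by (auto simp: restrict_id_def)
    qed
    show "\<forall>h\<in>iso J0 J W. restrict (h0 \<circ> restrict_id (h1 \<circ> h) ?S) ?S = h"
    proof (intro ballI ext)
      fix h c assume h: "h \<in> iso J0 J W"
      show "restrict (h0 \<circ> restrict_id (h1 \<circ> h) ?S) ?S c = h c"
        using h bij_betwE[of h ?S ?S'] h1(2)[of "h c"] by (auto simp: iso_def restrict_id_def extensional_def)
    qed
    show "(\<lambda>\<sigma>. restrict (h0 \<circ> \<sigma>) ?S) ` aut ?S (R J0) \<subseteq> iso J0 J W"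
    proof (rule image_subsetI)
      fix \<sigma> assume \<sigma>: "\<sigma> \<in> aut ?S (R J0)"
      then have p: "\<sigma> permutes ?S" by (simp add: aut_def)
      have "bij_betw (h0 \<circ> \<sigma>) ?S ?S'" by (rule bij_betw_trans[OF permutes_imp_bij[OF p] bij])
      then have "bij_betw (restrict (h0 \<circ> \<sigma>) ?S) ?S ?S'" by (subst bij_betw_restrict_eq)
      moreover have "R J (h0 (\<sigma> s)) = R J0 s" if "s \<in> ?S" for s
        using h0(2)[of "\<sigma> s"] permutes_in_image[OF p, of s] \<sigma> that by (simp add: aut_def)
      ultimately show "restrict (h0 \<circ> \<sigma>) ?S \<in> iso J0 J W" by (simp add: iso_def)
    qed
    show "(\<lambda>h. restrict_id (h1 \<circ> h) ?S) ` iso J0 J W \<subseteq> aut ?S (R J0)"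
    proof (rule image_subsetI)
      fix h assume h: "h \<in> iso J0 J W"
      then have hb: "bij_betw h ?S ?S'" by (simp add: iso_def)
      have "bij_betw h1 ?S' ?S" unfolding h1_def by (rule bij_betw_inv_into[OF bij])
      from bij_betw_trans[OF hb this] have "restrict_id (h1 \<circ> h) ?S permutes ?S" by (rule permutes_restrict_id)
      moreover have "R J0 (h1 (h s)) = R J0 s" if "s \<in> ?S" for s
        using h1(3)[OF bij_betwE[OF hb, rule_format, OF that]] h that by (simp add: iso_def)
      ultimately show "restrict_id (h1 \<circ> h) ?S \<in> aut ?S (R J0)" by (simp add: aut_def)
    qed
  qed
  show "card (iso J0 J W) = card (aut ?S (R J0))" using bij_betw_same_card[OF bb] by simp
  show "finite (iso J0 J W)" by (rule iffD1[OF bij_betw_finite[OF bb] finite_aut[OF finite_St]])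
qed

context
  fixes J0 W assumes J0: "J0 \<in> joinings" and good0: "good J0 W"
begin

lemma clo_B: "clo J0 W \<subseteq> B" "clo J0 W \<subseteq> C" "clo J0 W \<subseteq> St J0 W"
  using B_C by (auto simp: clo_def)

lemma clo_immortal: "s \<in> clo J0 W \<Longrightarrow> al J0 k s"
  by (rule immortal_of_B[OF J0 good0]) (auto simp: clo_def)

lemma rho_facts:
  assumes "\<rho> \<in> aut (clo J0 W) (R J0)"
  shows "\<rho> \<in> aut C lam" "cj \<rho> J0 \<in> joinings" "c \<in> C \<Longrightarrow> R (cj \<rho> J0) c = R J0 c" "same J0 (cj \<rho> J0)"
proof -
  show a: "\<rho> \<in> aut C lam" by (rule aut_starts(1)[OF J0 assms clo_B(2)])
  show "cj \<rho> J0 \<in> joinings" by (rule cj_joinings[OF a J0])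
  show R: "R (cj \<rho> J0) c = R J0 c" if "c \<in> C" for c by (rule R_cj_starts[OF J0 clo_B(1) clo_immortal assms that])
  show "same J0 (cj \<rho> J0)" by (rule same_cong) (rule R)
qed

lemma next_in_D:
  assumes "c \<in> dec J0 ` Dp J0 W" "th c \<in> B"
  shows "nx J0 c \<in> dec J0 ` Dp J0 W" "th c \<notin> dec J0 ` Dp J0 W"
proof -
  have "al J0 1 c" using assms(2) by (simp add: al_Suc)
  then show "nx J0 c \<in> dec J0 ` Dp J0 W" using span_step[OF J0 good0 assms(1), of 1] by simp
  have "c \<in> C" using assms(1) dec_Dp_eq[OF J0 good0] nx_pow_C[OF J0 St_C] by auto
  then show "th c \<notin> dec J0 ` Dp J0 W" using half[OF J0 good0] assms(1) by simp
qed

lemma D_C: "c \<in> dec J0 ` Dp J0 W \<Longrightarrow> c \<in> C"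
  using dec_Dp_eq[OF J0 good0] nx_pow_C[OF J0 St_C] by auto

lemma St_D: "s \<in> St J0 W \<Longrightarrow> s \<in> dec J0 ` Dp J0 W"
  using dec_Dp_eq[OF J0 good0] by (auto intro!: exI[of _ s] exI[of _ 0])

text \<open>If u is not decoded, then the other end of its arrow is, and one step from there leads
  to the partner of u. If both were decoded, the step arriving at the partner would come from the
  other end of the arrow at u, against \<open>half\<close>.\<close>

lemma D_joint:
  assumes "u \<in> B"
  shows "u \<in> dec J0 ` Dp J0 W \<longleftrightarrow> J0 u \<notin> dec J0 ` Dp J0 W"
proof -
  have aux: "J0 u \<in> dec J0 ` Dp J0 W" if "u \<in> B" "u \<notin> dec J0 ` Dp J0 W" for u
  proof -
    have uC: "u \<in> C" using that B_C by auto
    then have "th u \<in> dec J0 ` Dp J0 W" using half[OF J0 good0 uC] that by simp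
    from next_in_D(1)[OF this] show ?thesis using that th_th[OF uC] by (simp add: nx_def)
  qed
  have "\<not> (u \<in> dec J0 ` Dp J0 W \<and> J0 u \<in> dec J0 ` Dp J0 W)"
  proof
    assume a: "u \<in> dec J0 ` Dp J0 W \<and> J0 u \<in> dec J0 ` Dp J0 W"
    have JB: "J0 u \<in> B" "J0 u \<in> C" "u \<in> C" using joinings_B[OF J0 assms] assms B_C by auto
    let ?v = "J0 u"
    have n: "th u \<notin> dec J0 ` Dp J0 W" "th ?v \<notin> dec J0 ` Dp J0 W" using half[OF J0 good0] a JB by auto
    obtain s k where s: "s \<in> St J0 W" "al J0 k s" "?v = (nx J0 ^^ k) s"
      using a unfolding dec_Dp_eq[OF J0 good0] by blast
    \<comment> \<open>At offset 0 the cell is a start on a cycle. Going once round the cycle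
      rewrites it with a positive offset, so that there is a last step to look at.\<close>
    have "\<exists>s k. s \<in> St J0 W \<and> al J0 (Suc k) s \<and> ?v = (nx J0 ^^ Suc k) s"
    proof (cases k)
      case 0
      then have sv: "s = ?v" using s by simp
      have im: "al J0 i s" for i using immortal_of_B[OF J0 good0 s(1)] sv JB(1) by simp
      obtain L where L: "0 < L" "(nx J0 ^^ L) s = s" using period_exists[OF J0 St_C[OF s(1)] im] by blast
      then obtain m where "L = Suc m" by (metis gr0_implies_Suc)
      then show ?thesis using s(1) im L sv by metis
    next
      case (Suc m)
      then show ?thesis using s by blast
    qed
    then obtain s k where s: "s \<in> St J0 W" "al J0 (Suc k) s" "?v = nx J0 ((nx J0 ^^ k) s)" by auto
    let ?w = "(nx J0 ^^ k) s"
    have al: "al J0 k s" using s(2) by (rule al_mono) simp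
    have "J0 ?v = th ?w" using s(3) joinings_invol[OF J0] by (simp add: nx_def)
    then have "th u = ?w" using joinings_invol[OF J0] th_th[OF nx_pow_C[OF J0 St_C[OF s(1)] al]] by simp
    moreover have "?w \<in> dec J0 ` Dp J0 W" unfolding dec_Dp_eq[OF J0 good0] using s(1) al by blast
    ultimately show False using n by simp
  qed
  then show ?thesis using aux[OF assms] by blast
qed

lemma rho_apply:
  assumes "\<rho> \<in> aut (clo J0 W) (R J0)"
  shows "v \<notin> clo J0 W \<Longrightarrow> \<rho> v = v" "v \<in> clo J0 W \<Longrightarrow> \<rho> v \<in> clo J0 W" "v \<in> clo J0 W \<Longrightarrow> \<rho> (J0 v) = J0 v"
proof -
  have p: "\<rho> permutes clo J0 W" using assms by (simp add: aut_def)
  show out: "v \<notin> clo J0 W \<Longrightarrow> \<rho> v = v" for v by (rule permutes_not_in[OF p])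
  show "v \<in> clo J0 W \<Longrightarrow> \<rho> v \<in> clo J0 W" using permutes_in_image[OF p] by simp
  show "\<rho> (J0 v) = J0 v" if "v \<in> clo J0 W"
  proof (rule out)
    have "v \<in> dec J0 ` Dp J0 W" "v \<in> B" using that St_D by (auto simp: clo_def)
    then show "J0 v \<notin> clo J0 W" using D_joint St_D by (auto simp: clo_def)
  qed
qed

lemma cj_rho_inj:
  assumes "\<rho> \<in> aut (clo J0 W) (R J0)" "\<rho>' \<in> aut (clo J0 W) (R J0)" "cj \<rho> J0 = cj \<rho>' J0"
  shows "\<rho> = \<rho>'"
proof
  have val: "cj \<rho> J0 (J0 v) = \<rho> v" if "\<rho> \<in> aut (clo J0 W) (R J0)" "v \<in> clo J0 W" for \<rho> v
    using cj_apply[OF rho_facts(1)[OF that(1)], of J0 "J0 v"] rho_apply(3)[OF that] joinings_invol[OF J0] by simp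
  fix v
  show "\<rho> v = \<rho>' v"
    using val[OF assms(1), of v] val[OF assms(2), of v] rho_apply(1)[OF assms(1), of v] rho_apply(1)[OF assms(2), of v] assms(3)
    by (cases "v \<in> clo J0 W") simp_all
qed

text \<open>The partners of the cyclic starts lie outside the decoded half and are therefore fixed
  by \<rho>. Hence \<rho> can be read off as the value of J1 at the partner of v. The hypothesis
  \<open>fixed\<close> says that all other joints agree with those of \<open>J0\<close>.\<close>

lemma cj_rho_exists:
  assumes J1: "J1 \<in> joinings"
    and fixed: "\<And>v. v \<in> dec J0 ` Dp J0 W \<Longrightarrow> v \<in> B \<Longrightarrow> v \<notin> clo J0 W \<Longrightarrow> J1 (J0 v) = v"
    and moved: "\<And>v. v \<in> clo J0 W \<Longrightarrow> J1 (J0 v) \<in> clo J0 W \<and> R J0 (J1 (J0 v)) = R J0 v"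
  shows "\<exists>\<rho>\<in>aut (clo J0 W) (R J0). J1 = cj \<rho> J0"
proof -
  let ?D = "dec J0 ` Dp J0 W" and ?K = "clo J0 W"
  define \<rho> where "\<rho> = restrict_id (\<lambda>v. J1 (J0 v)) ?K"
  have i1: "J1 x = J1 y \<longleftrightarrow> x = y" and i0: "J0 x = J0 y \<longleftrightarrow> x = y" for x y
    using joinings_invol[OF J1] joinings_invol[OF J0] by metis+
  have fin: "finite ?K" using finite_St by (simp add: clo_def)
  have "\<rho> permutes ?K"
    by (rule inj_imp_permutes) (use moved fin i1 i0 in \<open>auto simp: \<rho>_def restrict_id_def intro!: inj_onI\<close>)
  then have \<rho>: "\<rho> \<in> aut ?K (R J0)" using moved by (auto simp: aut_def \<rho>_def restrict_id_def)
  have KD: "w \<in> ?D" if "w \<in> ?K" for w using that St_D by (simp add: clo_def)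
  have main: "J1 (\<rho> w) = \<rho> (J0 w)" if w: "w \<in> B" for w
  proof (cases "w \<in> ?K")
    case True
    then show ?thesis using rho_apply(3)[OF \<rho> True] joinings_invol[OF J1] by (simp add: \<rho>_def restrict_id_def)
  next
    case False
    then have \<rho>w: "\<rho> w = w" by (rule rho_apply(1)[OF \<rho>])
    show ?thesis
    proof (cases "J0 w \<in> ?K")
      case True
      then show ?thesis using \<rho>w joinings_invol[OF J0] by (simp add: \<rho>_def restrict_id_def)
    next
      case nK: False
      have "J1 w = J0 w"
      proof (cases "w \<in> ?D")
        case True
        from fixed[OF True w False] show ?thesis using joinings_invol[OF J1] by metis
      next
        case False
        then have "J0 w \<in> ?D" using D_joint[OF w] by simp
        from fixed[OF this joinings_B[OF J0 w] nK] show ?thesis using joinings_invol[OF J0] by simp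
      qed
      then show ?thesis using \<rho>w rho_apply(1)[OF \<rho> nK] by simp
    qed
  qed
  note a = aut_C[OF rho_facts(1)[OF \<rho>]]
  have "J1 u = cj \<rho> J0 u" for u
  proof (cases "u \<in> B")
    case True
    have "pinv \<rho> u \<in> B" using aut_C(6)[OF aut_inv[OF rho_facts(1)[OF \<rho>]], of u] True B_C by auto
    from main[OF this] show ?thesis using a(5)[of u] by (simp add: cj_def)
  next
    case False
    have "J1 permutes B" "cj \<rho> J0 permutes B" using J1 rho_facts(2)[OF \<rho>] by (simp_all add: joinings_def)
    then show ?thesis using False permutes_not_in by metis
  qed
  then show ?thesis using \<rho> by blast
qed

lemma inner_not_start:
  assumes "s \<in> St J0 W" "Suc k < len (R J0 s)"
  shows "(nx J0 ^^ Suc k) s \<notin> St J0 W"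
proof
  assume S: "(nx J0 ^^ Suc k) s \<in> St J0 W"
  have "(s, Suc k) \<in> Dp J0 W" "((nx J0 ^^ Suc k) s, 0) \<in> Dp J0 W"
    using assms S len_St(1)[OF J0 good0 S] by (simp_all add: Dp_def)
  then have "(s, Suc k) = ((nx J0 ^^ Suc k) s, 0)"
    by (rule inj_onD[OF dec_inj[OF J0 good0], rotated]) (simp add: dec_def)
  then show False by simp
qed

lemma in_D: "s \<in> St J0 W \<Longrightarrow> k < len (R J0 s) \<Longrightarrow> (nx J0 ^^ k) s \<in> dec J0 ` Dp J0 W"
  by (auto simp: Dp_def dec_def intro!: image_eqI[of _ _ "(s, k)"])

lemma nx_rho:
  assumes \<rho>: "\<rho> \<in> aut (clo J0 W) (R J0)" and c: "c \<in> dec J0 ` Dp J0 W" "th c \<in> B"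
  shows "nx (cj \<rho> J0) c = \<rho> (nx J0 c)"
proof -
  have "th c \<notin> clo J0 W" using next_in_D(2)[OF c] St_D clo_B(3) by blast
  then have "\<rho> (th c) = th c" by (rule rho_apply(1)[OF \<rho>])
  then show ?thesis using cj_apply[OF rho_facts(1)[OF \<rho>], of J0 "th c"] by (simp add: nx_def)
qed

text \<open>Strictly inside a period no start is met, so no joint changed by \<rho> is used. The
  relabelling is therefore visible from its values at the starts, which gives injectivity in
  \<open>sum_same_joinings\<close>.\<close>

lemma labelled_strings:
  assumes g: "g \<in> labelled_perms" and \<rho>: "\<rho> \<in> aut (clo J0 W) (R J0)" and s: "s \<in> St J0 W" "k < len (R J0 s)"
  shows "g ((nx J0 ^^ k) s) = (nx (cj g (cj \<rho> J0)) ^^ k) (g s)"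
  using s(2)
proof (induction k)
  case (Suc k)
  let ?c = "(nx J0 ^^ k) s"
  have cD: "?c \<in> dec J0 ` Dp J0 W" using in_D[OF s(1)] Suc.prems by simp
  have "al J0 (Suc k) s" using al_less_len[OF J0 good0 Suc.prems] .
  then have cB: "th ?c \<in> B" by (simp add: al_Suc)
  have "(nx J0 ^^ Suc k) s \<notin> clo J0 W" using inner_not_start[OF s(1) Suc.prems] clo_B(3) by blast
  then have "nx (cj \<rho> J0) ?c = nx J0 ?c" using nx_rho[OF \<rho> cD cB] rho_apply(1)[OF \<rho>] by simp
  then show ?case using labelled_nx(1)[OF g D_C[OF cD], of "cj \<rho> J0"] Suc by simp
qed simp

lemma labelled_eq:
  assumes g: "g \<in> labelled_perms" "g' \<in> labelled_perms" and eq: "\<And>c. c \<in> dec J0 ` Dp J0 W \<Longrightarrow> g c = g' c"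
  shows "g = g'"
proof
  fix c
  note a = aut_C[OF labelled_aut[OF g(1)]] aut_C[OF labelled_aut[OF g(2)]]
  show "g c = g' c"
  proof (cases "c \<in> C")
    case True
    show ?thesis
    proof (cases "c \<in> dec J0 ` Dp J0 W")
      case False
      then have "th c \<in> dec J0 ` Dp J0 W" using half[OF J0 good0 True] by simp
      then have "g (th c) = g' (th c)" by (rule eq)
      then have "th (g c) = th (g' c)" using g True by (simp add: labelled_perms_def)
      then show ?thesis using th_th a(2)[OF True] a(10)[OF True] by metis
    qed (rule eq)
  qed (simp add: a)
qed

text \<open>Offsets from the starts transport h to all decoded cells, and equality of the readings
  makes this preserve letters. The relabelling g need not carry \<open>J0\<close> to J, because the
  closings of periods are not compared.\<close>

lemma labelled_extend:
  assumes J: "J \<in> joinings" and same: "same J0 J" and h: "h \<in> iso J0 J W"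
  shows "\<exists>g\<in>labelled_perms. \<forall>s\<in>St J0 W. \<forall>k<len (R J0 s). g ((nx J0 ^^ k) s) = (nx J ^^ k) (h s)"
proof -
  have good: "good J W" by (rule good_same[OF J0 J good0 same])
  have hb: "bij_betw h (St J0 W) (St J W)" and hR: "\<And>s. s \<in> St J0 W \<Longrightarrow> R J (h s) = R J0 s" using h by (auto simp: iso_def)
  let ?DZ = "dec J0 ` Dp J0 W" and ?D = "dec J ` Dp J W"
  have DC: "c \<in> ?D \<Longrightarrow> c \<in> C" for c using dec_Dp_eq[OF J good] nx_pow_C[OF J St_C] by auto
  have hD: "bij_betw (map_prod h id) (Dp J0 W) (Dp J W)"
  proof (rule bij_betwI')
    fix x y assume "x \<in> Dp J0 W" "y \<in> Dp J0 W"
    then show "(map_prod h id x = map_prod h id y) = (x = y)"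
      using bij_betw_imp_inj_on[OF hb] by (auto simp: Dp_def dest: inj_onD)
  next
    fix x assume "x \<in> Dp J0 W"
    then show "map_prod h id x \<in> Dp J W" using bij_betwE[OF hb] hR by (auto simp: Dp_def)
  next
    fix y assume y: "y \<in> Dp J W"
    then obtain s where s: "s \<in> St J0 W" "h s = fst y" using bij_betw_imp_surj_on[OF hb] by (force simp: Dp_def)
    then show "\<exists>x\<in>Dp J0 W. y = map_prod h id x"
      using y hR[OF s(1)] by (intro bexI[of _ "(s, snd y)"]) (auto simp: Dp_def case_prod_unfold)
  qed
  define f where "f = dec J \<circ> map_prod h id \<circ> inv_into (Dp J0 W) (dec J0)"
  have b0: "bij_betw (dec J0) (Dp J0 W) ?DZ" and b1: "bij_betw (dec J) (Dp J W) ?D"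
    using dec_inj[OF J0 good0] dec_inj[OF J good] by (simp_all add: bij_betw_def)
  have fb: "bij_betw f ?DZ ?D"
    unfolding f_def comp_assoc[symmetric]
    by (rule bij_betw_trans[OF bij_betw_inv_into[OF b0] bij_betw_trans[OF hD b1]])
  have fs: "f ((nx J0 ^^ k) s) = (nx J ^^ k) (h s)" if "s \<in> St J0 W" "k < len (R J0 s)" for s k
  proof -
    have "(s, k) \<in> Dp J0 W" using that by (simp add: Dp_def)
    from inv_into_f_f[OF dec_inj[OF J0 good0] this] have "inv_into (Dp J0 W) (dec J0) ((nx J0 ^^ k) s) = (s, k)"
      by (simp add: dec_def)
    then show ?thesis by (simp add: f_def dec_def)
  qed
  have flam: "lam (f c) = lam c" if c: "c \<in> ?DZ" for c
  proof -
    obtain s k where s: "s \<in> St J0 W" "k < len (R J0 s)" "c = (nx J0 ^^ k) s" using c by (auto simp: Dp_def dec_def)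
    have "al J0 k s" by (rule al_less_len[OF J0 good0 s(2)])
    from R_eq_lam[OF hR[OF s(1), symmetric] this] show ?thesis using fs[OF s(1,2)] s(3) by simp
  qed
  \<comment> \<open>The undecoded cells are the other ends of decoded ones, so commuting with
    \<open>th\<close> forces the value there.\<close>
  define g where "g c = (if c \<in> ?DZ then f c else if c \<in> C then th (f (th c)) else c)" for c
  have fD: "f c \<in> ?D" if "c \<in> ?DZ" for c using bij_betwE[OF fb] that by blast
  have fC: "f c \<in> C" if "c \<in> ?DZ" for c by (rule DC[OF fD[OF that]])
  have thD: "th c \<in> ?DZ" if "c \<in> C" "c \<notin> ?DZ" for c using half[OF J0 good0 that(1)] that(2) by simp
  have gC: "g c \<in> C" if "c \<in> C" for c using that fC fC[OF thD] th_C by (simp add: g_def)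
  have gD: "g c \<in> ?D \<longleftrightarrow> c \<in> ?DZ" if "c \<in> C" for c
  proof (cases "c \<in> ?DZ")
    case False
    have "f (th c) \<in> ?D" by (rule fD[OF thD[OF that False]])
    then have "th (f (th c)) \<notin> ?D" using half[OF J good DC] by blast
    then show ?thesis using False that by (simp add: g_def)
  qed (simp add: g_def fD)
  have inj: "inj_on g C"
  proof (rule inj_onI)
    fix c d assume cd: "c \<in> C" "d \<in> C" "g c = g d"
    have iff: "c \<in> ?DZ \<longleftrightarrow> d \<in> ?DZ" using gD[OF cd(1)] gD[OF cd(2)] cd(3) by simp
    have fi: "f x = f y \<Longrightarrow> x \<in> ?DZ \<Longrightarrow> y \<in> ?DZ \<Longrightarrow> x = y" for x y
      using bij_betw_imp_inj_on[OF fb] by (rule inj_onD)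
    show "c = d"
    proof (cases "c \<in> ?DZ")
      case True
      then show ?thesis using cd(3) iff fi[of c d] by (simp add: g_def)
    next
      case False
      have t: "th c \<in> ?DZ" "th d \<in> ?DZ" using thD cd(1,2) False iff by simp_all
      have "th (f (th c)) = th (f (th d))" using cd False iff by (simp add: g_def)
      then have "f (th c) = f (th d)" using th_th[OF fC[OF t(1)]] th_th[OF fC[OF t(2)]] by metis
      then have "th c = th d" using fi t by blast
      then show ?thesis using th_th cd(1,2) by metis
    qed
  qed
  have gp: "g permutes C"
  proof (rule inj_imp_permutes[OF inj fin_C gC])
    show "g x = x" if "x \<notin> C" for x using that D_C[of x] by (auto simp: g_def)
  qed
  have gl: "lam (g c) = lam c" if "c \<in> C" for c
  proof (cases "c \<in> ?DZ")
    case False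
    have "lam (g c) = tr (lam (f (th c)))" using lam_th[OF fC[OF thD[OF that False]]] False that by (simp add: g_def)
    also have "\<dots> = lam c" using flam[OF thD[OF that False]] lam_th[OF that] by (simp add: tr_tr)
    finally show ?thesis .
  qed (simp add: g_def flam)
  have gt: "g (th c) = th (g c)" if "c \<in> C" for c
  proof (cases "c \<in> ?DZ")
    case True
    then have "th c \<notin> ?DZ" using half[OF J0 good0 that] by simp
    then show ?thesis using True th_C[OF that] th_th[OF that] by (simp add: g_def)
  next
    case False
    then show ?thesis using thD[OF that False] th_th[OF fC[OF thD[OF that False]]] that by (simp add: g_def)
  qed
  have "g \<in> labelled_perms" using gp gl gt by (simp add: labelled_perms_def aut_def)
  moreover have "g ((nx J0 ^^ k) s) = (nx J ^^ k) (h s)" if "s \<in> St J0 W" "k < len (R J0 s)" for s k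
    using fs[OF that] in_D[OF that] by (simp add: g_def)
  ultimately show ?thesis by blast
qed

text \<open>Pull J back along the relabelling that extends h. The result shares all joints with
  \<open>J0\<close> inside the strings and can differ only where a period of a closed string is
  closed up; that difference is a permutation of cyclic starts with equal readings.\<close>

lemma iso_factor:
  assumes J: "J \<in> joinings" and same: "same J0 J" and h: "h \<in> iso J0 J W"
  shows "\<exists>g\<in>labelled_perms. \<exists>\<rho>\<in>aut (clo J0 W) (R J0). J = cj g (cj \<rho> J0) \<and> h = restrict g (St J0 W)"
proof -
  have good: "good J W" by (rule good_same[OF J0 J good0 same])
  have hb: "bij_betw h (St J0 W) (St J W)" and hR: "\<And>s. s \<in> St J0 W \<Longrightarrow> R J (h s) = R J0 s" and he: "h \<in> extensional (St J0 W)"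
    using h by (auto simp: iso_def)
  obtain g where g: "g \<in> labelled_perms"
    and gs: "\<And>s k. s \<in> St J0 W \<Longrightarrow> k < len (R J0 s) \<Longrightarrow> g ((nx J0 ^^ k) s) = (nx J ^^ k) (h s)"
    using labelled_extend[OF assms] by blast
  note a = aut_C[OF labelled_aut[OF g]]
  have gi: "pinv g \<in> labelled_perms" by (rule labelled_inv[OF g])
  define J1 where "J1 = cj (pinv g) J"
  have J1: "J1 \<in> joinings" unfolding J1_def by (rule cj_joinings[OF labelled_aut[OF gi] J])
  have JJ1: "J = cj g J1"
    unfolding J1_def cj_comp[OF labelled_aut[OF g] labelled_aut[OF gi]] permutes_inv_o(1)[OF a(1)] by (simp add: cj_def inv_id)
  have g0: "g s = h s" if "s \<in> St J0 W" for s using gs[OF that, of 0] len_St(1)[OF J0 good0 that] by simp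
  have key: "(J1 (J0 v) = v \<and> v \<notin> clo J0 W) \<or> (v \<in> clo J0 W \<and> J1 (J0 v) \<in> clo J0 W \<and> R J0 (J1 (J0 v)) = R J0 v)"
    if v: "v \<in> dec J0 ` Dp J0 W" "v \<in> B" for v
  proof -
    have vC: "v \<in> C" using v B_C by auto
    have uB: "J0 v \<in> B" "J0 v \<in> C" using joinings_B[OF J0 v(2)] B_C by auto
    \<comment> \<open>The decoded cell whose step under \<open>J0\<close> arrives at v. Comparing
      the steps of \<open>J0\<close> and J1 from w compares the two joints at the partner of
      v.\<close>
    define w where "w = th (J0 v)"
    have "J0 v \<notin> dec J0 ` Dp J0 W" using D_joint[OF v(2)] v(1) by simp
    then have wD: "w \<in> dec J0 ` Dp J0 W" using half[OF J0 good0 uB(2)] by (simp add: w_def)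
    have thw: "th w = J0 v" using th_th[OF uB(2)] by (simp add: w_def)
    have nw: "nx J0 w = v" using joinings_invol[OF J0] by (simp add: nx_def thw)
    obtain s k where s: "s \<in> St J0 W" "k < len (R J0 s)" "w = (nx J0 ^^ k) s" using wD by (auto simp: Dp_def dec_def)
    have v_eq: "v = (nx J0 ^^ Suc k) s" using nw s(3) by simp
    have "nx J (g w) = g (nx J1 w)" using labelled_nx(1)[OF g D_C[OF wD], of J1] JJ1 by simp
    moreover have "nx J1 w = J1 (J0 v)" by (simp add: nx_def thw)
    moreover have "g w = (nx J ^^ k) (h s)" using gs[OF s(1,2)] s(3) by simp
    ultimately have gJ: "g (J1 (J0 v)) = (nx J ^^ Suc k) (h s)" by simp
    show ?thesis
    proof (cases "Suc k < len (R J0 s)")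
      case True
      then have "g (J1 (J0 v)) = g v" using gJ gs[OF s(1) True] v_eq by simp
      then have "J1 (J0 v) = v" using a(4) by metis
      moreover have "v \<notin> clo J0 W" using inner_not_start[OF s(1) True] v_eq clo_B(3) by blast
      ultimately show ?thesis by simp
    next
      \<comment> \<open>Here v is reached after a full period. Under J the walk from h s then also
        arrives at a start with the same reading, and its g-preimage is the new cell joined to the
        partner of v.\<close>
      case False
      then have L: "len (R J0 s) = Suc k" using s(2) by simp
      have al0: "al J0 (Suc k) s" using al_less_len[OF J0 good0 s(2)] s(3) thw uB by (simp add: al_Suc)
      then have "R J0 s (Suc k) \<noteq> None" by (rule R_al[THEN iffD2])
      then have per: "\<forall>i. R J0 s (Suc k + i) = R J0 s i" using len_St(2)[OF J0 good0 s(1)] unfolding L by (elim disjE) simp_all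
      have Rv: "R J0 v = R J0 s" unfolding v_eq by (intro ext) (simp only: R_shift[OF al0] per)
      have alh: "al J (Suc k) (h s)" using R_eq_al[OF hR[OF s(1)], of "Suc k"] al0 by simp
      define z where "z = (nx J ^^ Suc k) (h s)"
      have hsC: "h s \<in> C" by (rule St_C[OF bij_betw_apply[OF hb s(1)]])
      have Rz: "R J z = R J0 s" unfolding z_def by (intro ext) (simp only: R_shift[OF alh] hR[OF s(1)] per)
      have zS: "z \<in> St J W" using nx_pow_C[OF J hsC alh] Rz s(1) by (simp add: St_def z_def)
      then have "z \<in> h ` St J0 W" using hb by (simp add: bij_betw_def)
      then obtain s' where s': "s' \<in> St J0 W" "h s' = z" by blast
      have "g (J1 (J0 v)) = g s'" using gJ g0[OF s'(1)] s'(2) by (simp add: z_def)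
      then have e: "J1 (J0 v) = s'" using a(4) by metis
      have R': "R J0 s' = R J0 v" using hR[OF s'(1)] s'(2) Rz Rv by simp
      have "v \<in> clo J0 W" using Rv s(1) vC v(2) by (simp add: clo_def St_def)
      moreover have "s' \<in> B" using e joinings_B[OF J1 uB(1)] by simp
      ultimately show ?thesis using e R' s'(1) by (simp add: clo_def)
    qed
  qed
  have "\<exists>\<rho>\<in>aut (clo J0 W) (R J0). J1 = cj \<rho> J0"
  proof (rule cj_rho_exists[OF J1])
    show "J1 (J0 v) = v" if "v \<in> dec J0 ` Dp J0 W" "v \<in> B" "v \<notin> clo J0 W" for v using key[OF that(1,2)] that(3) by blast
    show "J1 (J0 v) \<in> clo J0 W \<and> R J0 (J1 (J0 v)) = R J0 v" if "v \<in> clo J0 W" for v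
      using key[of v] that St_D by (auto simp: clo_def)
  qed
  moreover have "h = restrict g (St J0 W)" using he g0 by (auto simp: extensional_def restrict_def)
  ultimately show ?thesis using g JJ1 by blast
qed

text \<open>Double counting of pairs of a joining of the class and an isomorphism of starts. For a
  fixed joining their number is given by \<open>card_iso\<close>; on the other hand
  \<open>iso_factor\<close> writes each pair in a unique way by a relabelling g, under which U is
  invariant, and a reconnection \<rho>.\<close>

theorem sum_same_joinings:
  fixes U :: "('c \<Rightarrow> 'c) \<Rightarrow> 'a::comm_ring_1"
  assumes inv: "\<And>g J. g \<in> labelled_perms \<Longrightarrow> J \<in> joinings \<Longrightarrow> U (cj g J) = U J"
  shows "of_nat (card (aut (St J0 W) (R J0))) * (\<Sum>J\<in>{J \<in> joinings. same J0 J}. U J) =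
    of_nat (card labelled_perms) * (\<Sum>\<rho>\<in>aut (clo J0 W) (R J0). U (cj \<rho> J0))"
proof -
  let ?K = "{J \<in> joinings. same J0 J}" and ?A = "aut (clo J0 W) (R J0)"
  have fK: "finite ?K" using finite_joinings by simp
  have bij: "bij_betw (\<lambda>(g, \<rho>). (cj g (cj \<rho> J0), restrict g (St J0 W))) (labelled_perms \<times> ?A) (Sigma ?K (\<lambda>J. iso J0 J W))"
    unfolding bij_betw_def
  proof (intro conjI equalityI subsetI)
    show "inj_on (\<lambda>(g, \<rho>). (cj g (cj \<rho> J0), restrict g (St J0 W))) (labelled_perms \<times> ?A)"
    proof (rule inj_onI)
      fix x y assume x: "x \<in> labelled_perms \<times> ?A" and y: "y \<in> labelled_perms \<times> ?A"
        and xy: "(case x of (g, \<rho>) \<Rightarrow> (cj g (cj \<rho> J0), restrict g (St J0 W))) = (case y of (g, \<rho>) \<Rightarrow> (cj g (cj \<rho> J0), restrict g (St J0 W)))"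
      obtain g \<rho> g' \<rho>' where xe: "x = (g, \<rho>)" and ye: "y = (g', \<rho>')" by (metis surj_pair)
      have g: "g \<in> labelled_perms" "g' \<in> labelled_perms" and \<rho>: "\<rho> \<in> ?A" "\<rho>' \<in> ?A"
        and e: "cj g (cj \<rho> J0) = cj g' (cj \<rho>' J0)" and r: "restrict g (St J0 W) = restrict g' (St J0 W)"
        using x y xy by (simp_all add: xe ye)
      have "g s = g' s" if "s \<in> St J0 W" for s using fun_cong[OF r, of s] that by simp
      then have "g c = g' c" if "c \<in> dec J0 ` Dp J0 W" for c
        using that labelled_strings[OF g(1) \<rho>(1)] labelled_strings[OF g(2) \<rho>(2)] e by (auto simp: Dp_def dec_def)
      then have gg: "g = g'" by (rule labelled_eq[OF g])
      have "cj (pinv g) (cj g J) = J" for J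
        unfolding cj_comp[OF labelled_aut[OF labelled_inv[OF g(1)]] labelled_aut[OF g(1)]]
          permutes_inv_o(2)[OF aut_C(1)[OF labelled_aut[OF g(1)]]] by (simp add: cj_def inv_id)
      then have "cj \<rho> J0 = cj \<rho>' J0" using e gg by metis
      then show "x = y" using cj_rho_inj[OF \<rho>] gg by (simp add: xe ye)
    qed
  next
    fix z assume "z \<in> (\<lambda>(g, \<rho>). (cj g (cj \<rho> J0), restrict g (St J0 W))) ` (labelled_perms \<times> ?A)"
    then obtain g \<rho> where g: "g \<in> labelled_perms" and \<rho>: "\<rho> \<in> ?A" and z: "z = (cj g (cj \<rho> J0), restrict g (St J0 W))"
      by auto
    let ?Jr = "cj \<rho> J0" let ?J = "cj g ?Jr"
    note rf = rho_facts[OF \<rho>] and a = aut_C[OF labelled_aut[OF g]] and ai = aut_C[OF aut_inv[OF labelled_aut[OF g]]]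
    have J: "?J \<in> joinings" by (rule cj_joinings[OF labelled_aut[OF g] rf(2)])
    have same: "same J0 ?J" by (rule same_trans[OF rf(4) same_labelled[OF g rf(2)]])
    have R: "R ?J (g c) = R J0 c" if "c \<in> C" for c using labelled_R[OF g rf(2) that] rf(3)[OF that] by simp
    have "bij_betw g (St J0 W) (St ?J W)"
    proof (rule bij_betw_byWitness[where f' = "pinv g"])
      show "\<forall>c\<in>St J0 W. pinv g (g c) = c" "\<forall>c\<in>St ?J W. g (pinv g c) = c" by (simp_all add: a)
      show "g ` St J0 W \<subseteq> St ?J W" using R a(2) by (auto simp: St_def)
      show "pinv g ` St ?J W \<subseteq> St J0 W"
      proof (rule image_subsetI)
        fix c assume c: "c \<in> St ?J W"
        then have p: "pinv g c \<in> C" using ai(2) by (simp add: St_def)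
        show "pinv g c \<in> St J0 W" using c p R[OF p] by (simp add: St_def a)
      qed
    qed
    then have "bij_betw (restrict g (St J0 W)) (St J0 W) (St ?J W)" by (subst bij_betw_restrict_eq)
    then have "restrict g (St J0 W) \<in> iso J0 ?J W" using R St_C by (simp add: iso_def)
    then show "z \<in> Sigma ?K (\<lambda>J. iso J0 J W)" using J same z by simp
  next
    fix z assume "z \<in> Sigma ?K (\<lambda>J. iso J0 J W)"
    then obtain J h where z: "z = (J, h)" "J \<in> joinings" "same J0 J" "h \<in> iso J0 J W" by auto
    from iso_factor[OF z(2-4)] obtain g \<rho> where "g \<in> labelled_perms" "\<rho> \<in> ?A" "J = cj g (cj \<rho> J0)" "h = restrict g (St J0 W)"
      by blast
    then show "z \<in> (\<lambda>(g, \<rho>). (cj g (cj \<rho> J0), restrict g (St J0 W))) ` (labelled_perms \<times> ?A)"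
      using z(1) by (intro image_eqI[of _ _ "(g, \<rho>)"]) auto
  qed
  have "of_nat (card (aut (St J0 W) (R J0))) * (\<Sum>J\<in>?K. U J) = (\<Sum>J\<in>?K. \<Sum>h\<in>iso J0 J W. U J)"
    unfolding sum_distrib_left
    by (rule sum.cong[OF refl]) (auto simp: card_iso(1)[OF J0 _ good0])
  also have "\<dots> = (\<Sum>(J, h)\<in>Sigma ?K (\<lambda>J. iso J0 J W). U J)"
    by (rule sum.Sigma[OF fK]) (auto intro: card_iso(2)[OF J0 _ good0])
  also have "\<dots> = (\<Sum>(g, \<rho>)\<in>labelled_perms \<times> ?A. U (cj g (cj \<rho> J0)))"
    by (subst sum.reindex_bij_betw[OF bij, symmetric]) (simp add: case_prod_unfold)
  also have "\<dots> = (\<Sum>(g, \<rho>)\<in>labelled_perms \<times> ?A. U (cj \<rho> J0))"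
    by (rule sum.cong[OF refl]) (auto intro: inv rho_facts(2))
  also have "\<dots> = of_nat (card labelled_perms) * (\<Sum>\<rho>\<in>?A. U (cj \<rho> J0))"
    by (simp add: sum.cartesian_product[symmetric])
  finally show ?thesis .
qed

end

end

section \<open>Joinings whose cycles have the period of their readings\<close>

context joinable
begin

text \<open>The cycles close up after a single minimal period, so their words are primitive. Such
  joinings are the ones that admissible quadruples describe.\<close>

definition prim :: "('c \<Rightarrow> 'c) \<Rightarrow> bool" where
  "prim J \<longleftrightarrow> (\<forall>c\<in>C. (\<forall>i. al J i c) \<longrightarrow> (nx J ^^ len (R J c)) c = c)"

context
  fixes J assumes J: "J \<in> joinings"
begin

lemma R_period_iff:
  assumes "\<And>i. al J i c"
  shows "R J ((nx J ^^ k) c) = R J c \<longleftrightarrow> (\<forall>i. R J c (k + i) = R J c i)"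
  using R_shift[OF assms, of k] by (auto simp: fun_eq_iff)

lemma len_immortal:
  assumes c: "c \<in> C" and im: "\<And>i. al J i c"
  shows "0 < len (R J c)" "R J ((nx J ^^ len (R J c)) c) = R J c"
    and "\<And>k. 0 < k \<Longrightarrow> R J ((nx J ^^ k) c) = R J c \<Longrightarrow> len (R J c) \<le> k"
proof -
  obtain L where L: "0 < L" "(nx J ^^ L) c = c" using period_exists[OF J c im] by blast
  then have "R J ((nx J ^^ L) c) = R J c" by simp
  then have "0 < L \<and> (R J c L = None \<or> (\<forall>i. R J c (L + i) = R J c i))"
    using L(1) R_period_iff[OF im, of L] by simp
  then have ex: "\<exists>k. 0 < k \<and> (R J c k = None \<or> (\<forall>i. R J c (k + i) = R J c i))" by blast
  have l: "0 < len (R J c) \<and> (R J c (len (R J c)) = None \<or> (\<forall>i. R J c (len (R J c) + i) = R J c i))"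
    unfolding len_def by (rule LeastI_ex[OF ex])
  show "0 < len (R J c)" using l by simp
  have "R J c (len (R J c)) \<noteq> None" by (rule R_al[THEN iffD2, OF im])
  then have "\<forall>i. R J c (len (R J c) + i) = R J c i" using l by (elim conjE disjE) simp_all
  then show "R J ((nx J ^^ len (R J c)) c) = R J c" by (rule R_period_iff[OF im, THEN iffD2])
  show "\<And>k. 0 < k \<Longrightarrow> R J ((nx J ^^ k) c) = R J c \<Longrightarrow> len (R J c) \<le> k"
    using R_period_iff[OF im] by (intro len_le) simp_all
qed

lemma prim_return:
  assumes prim: "prim J" and c: "c \<in> C" and im: "\<And>i. al J i c" and eq: "R J ((nx J ^^ k) c) = R J c"
  shows "(nx J ^^ k) c = c"
proof -
  let ?L = "len (R J c)"
  have L: "(nx J ^^ ?L) c = c" using prim c im by (simp add: prim_def)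
  have "(nx J ^^ (k div ?L * ?L)) c = c" by (rule period_mult[OF J L])
  then have e: "(nx J ^^ (k mod ?L)) c = (nx J ^^ k) c"
    using nx_add[of "k mod ?L" J "k div ?L * ?L" c] by simp
  have "k mod ?L = 0"
  proof (rule ccontr)
    assume "k mod ?L \<noteq> 0"
    then have "?L \<le> k mod ?L" using len_immortal(3)[OF c im, of "k mod ?L"] e eq by simp
    then show False using mod_less_divisor[OF len_immortal(1)[OF c im], of k] by linarith
  qed
  then show ?thesis using e by simp
qed

lemma rev_period:
  assumes c: "c \<in> C" and im: "\<And>i. al J i c"
  shows "al J i (th c)" "(nx J ^^ k) c = c \<Longrightarrow> (nx J ^^ k) (th c) = th c"
    "R J ((nx J ^^ k) c) = R J c \<Longrightarrow> R J ((nx J ^^ k) (th c)) = R J (th c)"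
proof -
  obtain L where L: "0 < L" "(nx J ^^ L) c = c" using period_exists[OF J c im] by blast
  show imt: "al J i (th c)" for i
  proof -
    have "(nx J ^^ (i * L)) c = c" by (rule period_mult[OF J L(2)])
    then have "al J (i * L) (th c)" using nx_pow_rev_all(2)[OF J c im, of "i * L"] by simp
    then show "al J i (th c)" by (rule al_mono) (use L in simp)
  qed
  show "(nx J ^^ k) c = c \<Longrightarrow> (nx J ^^ k) (th c) = th c"
    using nx_pow_rev_all(1)[OF J c im, of k] by simp
  assume eq: "R J ((nx J ^^ k) c) = R J c"
  have C': "(nx J ^^ k) c \<in> C" by (rule nx_pow_C[OF J c im])
  have e: "R J (th c) = R J (th ((nx J ^^ k) c))"
    using R_rev_eq[OF J J c C' _ eq[symmetric], of 0] im by (simp add: E_def)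
  have "R J ((nx J ^^ k) (th c)) = R J ((nx J ^^ k) (th ((nx J ^^ k) c)))"
    by (rule R_eq_shift[OF e imt])
  also have "\<dots> = R J (th c)" using nx_pow_rev_all(1)[OF J c im, of k] by simp
  finally show "R J ((nx J ^^ k) (th c)) = R J (th c)" .
qed

lemma shift_period:
  assumes c: "c \<in> C" and im: "\<And>i. al J i c" and eq: "R J ((nx J ^^ k) c) = R J c"
  shows "R J ((nx J ^^ k) ((nx J ^^ i) c)) = R J ((nx J ^^ i) c)"
  using R_eq_shift[OF eq, of i] al_pow_immortal[OF J im] by (simp add: nx_add add.commute)

text \<open>A period of the reading at one cell is a period at every cell of the cycle and for the
  reversed walk, so the minimal periods agree along the cycle in both directions.\<close>

lemma len_orbit:
  assumes x: "x \<in> C" and im: "\<And>i. al J i x" and per: "(nx J ^^ len (R J x)) x = x"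
    and c: "c = (nx J ^^ j) x \<or> c = th ((nx J ^^ j) x)"
  shows "c \<in> C" "al J i c" "(nx J ^^ len (R J c)) c = c"
proof -
  let ?L = "len (R J x)" and ?y = "(nx J ^^ j) x"
  have y: "?y \<in> C" "\<And>i. al J i ?y" using nx_pow_C[OF J x im] al_pow_immortal[OF J im] by auto
  have yL: "(nx J ^^ ?L) ?y = ?y" using per by (metis add.commute nx_add)
  have cC: "c \<in> C" and ci: "\<And>i. al J i c" and cL: "(nx J ^^ ?L) c = c"
    using c y yL th_C[OF y(1)] rev_period(1,2)[OF y] by auto
  show "c \<in> C" "al J i c" by fact+
  let ?M = "len (R J c)"
  note lc = len_immortal[OF cC ci] and lx = len_immortal[OF x im]
  have M_le: "?M \<le> ?L" using lc(3)[OF lx(1)] cL by simp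
  have "R J ((nx J ^^ ?M) ?y) = R J ?y"
    using c lc(2) rev_period(3)[OF cC ci lc(2)] th_th[OF y(1)] by auto
  moreover obtain m where "(nx J ^^ m) ?y = x"
  proof
    have "(nx J ^^ (j * ?L)) x = x" by (rule period_mult[OF J per])
    moreover have "j \<le> j * ?L" using lx(1) by simp
    ultimately show "(nx J ^^ (j * ?L - j)) ?y = x" by (simp add: nx_add)
  qed
  ultimately have "R J ((nx J ^^ ?M) x) = R J x" using shift_period[OF y] by metis
  then have "?L \<le> ?M" using lx(3)[OF lc(1)] by simp
  then show "(nx J ^^ ?M) c = c" using M_le cL by simp
qed

text \<open>After one minimal period the walk from c is at another cell d with the same reading.
  Exchanging c and d in the joints closes the walk from c right there, changes no reading by
  \<open>R_cj_starts\<close>, and leaves untouched the cycles that already close after one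
  period.\<close>

lemma split_cycle:
  assumes c: "c \<in> C" and im: "\<And>i. al J i c" and np: "(nx J ^^ len (R J c)) c \<noteq> c"
  shows "\<exists>J'\<in>joinings. (\<forall>x\<in>C. R J' x = R J x) \<and>
    card {x \<in> C. (\<forall>i. al J i x) \<and> (nx J ^^ len (R J x)) x = x} <
    card {x \<in> C. (\<forall>i. al J' i x) \<and> (nx J' ^^ len (R J' x)) x = x}"
proof -
  let ?L = "len (R J c)"
  define d where "d = (nx J ^^ ?L) c"
  note lc = len_immortal[OF c im]
  have d: "d \<in> C" "\<And>i. al J i d" "R J d = R J c" "d \<noteq> c"
    using nx_pow_C[OF J c im] al_pow_immortal[OF J im] lc(2) np by (auto simp: d_def)
  have dB: "d \<in> B" unfolding d_def by (rule nx_pow_B[OF J im lc(1)])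
  have cB: "c \<in> B" using lam_B[OF c d(1)] R_eq_lam[OF d(3), of 0] dB by simp
  define \<rho> where "\<rho> = transpose c d"
  have "\<rho> \<in> aut {c, d} (R J)" using d(3) permutes_swap_id[of c "{c, d}" d] by (auto simp: aut_def \<rho>_def)
  note \<rho> = this
  have im2: "\<And>u k. u \<in> {c, d} \<Longrightarrow> al J k u" using im d(2) by auto
  have cdB: "{c, d} \<subseteq> B" using cB dB by simp
  define J' where "J' = cj \<rho> J"
  have lamC: "\<rho> \<in> aut C lam" using aut_starts(1)[OF J \<rho>] c d(1) by simp
  have J': "J' \<in> joinings" unfolding J'_def by (rule cj_joinings[OF lamC J])
  have R': "R J' x = R J x" if "x \<in> C" for x unfolding J'_def by (rule R_cj_starts[OF J cdB im2 \<rho> that])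
  have al': "al J' k x \<longleftrightarrow> al J k x" if "x \<in> C" for k x by (rule R_eq_al[OF R'[OF that]])
  have \<rho>x: "\<rho> x = x" if "x \<notin> {c, d}" for x using that by (simp add: \<rho>_def transpose_def)
  have step: "nx J' x = \<rho> (nx J x)" if "th x \<notin> {c, d}" for x
    using cj_apply[OF lamC, of J "th x"] \<rho>x[OF that] by (simp add: nx_def J'_def)
  have steps: "(nx J' ^^ k) x = (nx J ^^ k) x"
    if "\<And>i. i \<le> k \<Longrightarrow> 0 < i \<Longrightarrow> (nx J ^^ i) x \<notin> {c, d}" "\<And>i. i < k \<Longrightarrow> th ((nx J ^^ i) x) \<notin> {c, d}" for k x
    using that
  proof (induction k)
    case (Suc k)
    have "(nx J' ^^ k) x = (nx J ^^ k) x" by (rule Suc.IH) (use Suc.prems in auto)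
    then show ?case using step[OF Suc.prems(2)[of k]] \<rho>x[OF Suc.prems(1)[of "Suc k"]] by simp
  qed simp
  let ?P = "{x \<in> C. (\<forall>i. al J i x) \<and> (nx J ^^ len (R J x)) x = x}"
  let ?P' = "{x \<in> C. (\<forall>i. al J' i x) \<and> (nx J' ^^ len (R J' x)) x = x}"
  have "?P \<subseteq> ?P'"
  proof
    fix x assume "x \<in> ?P"
    then have x: "x \<in> C" "\<And>i. al J i x" "(nx J ^^ len (R J x)) x = x" by auto
    \<comment> \<open>If the orbit of x or its reverse met c or d, the cycle through that cell would
      close after one period by \<open>len_orbit\<close>, and then so would the one through
      c.\<close>
    have notc: "z \<notin> {c, d}" if z: "z = (nx J ^^ j) x \<or> z = th ((nx J ^^ j) x)" for z j
    proof
      assume zcd: "z \<in> {c, d}"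
      note o = len_orbit[OF x z]
      have L: "len (R J z) = ?L" using zcd d(3) by auto
      then have "(nx J ^^ ?L) z = z" using o(3) by simp
      moreover have "(nx J ^^ ?L) c = c" if "(nx J ^^ ?L) d = d"
      proof -
        have "(nx J ^^ ?L) ((nx J ^^ ?L) c) = (nx J ^^ ?L) c" using that by (simp add: d_def)
        then show ?thesis using nx_pow_inj[OF J _ c _ im, of "(nx J ^^ ?L) c" ?L] d by (simp add: d_def)
      qed
      ultimately show False using zcd np by auto
    qed
    have "(nx J' ^^ len (R J x)) x = (nx J ^^ len (R J x)) x"
      by (rule steps; rule notc) blast+
    then show "x \<in> ?P'" using x al'[OF x(1)] R'[OF x(1)] by simp
  qed
  moreover have "c \<in> ?P'"
  proof -
    \<comment> \<open>The first m steps meet neither c nor d by minimality of the period, and no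
      arrow passed has its far end in c or d, since a reversed reading never equals the reading of
      c. So only the last joint is changed.\<close>
    obtain m where m: "?L = Suc m" using lc(1) by (metis gr0_implies_Suc)
    have a: "(nx J ^^ i) c \<notin> {c, d}" if "i \<le> m" "0 < i" for i
    proof
      assume "(nx J ^^ i) c \<in> {c, d}"
      then have "R J ((nx J ^^ i) c) = R J c" using d(3) by auto
      then show False using lc(3)[OF that(2)] that(1) m by simp
    qed
    have b: "th ((nx J ^^ i) c) \<notin> {c, d}" for i using R_not_palindrome[OF J c im, of i] d(3) by auto
    have "(nx J' ^^ m) c = (nx J ^^ m) c" by (rule steps) (use a b in auto)
    then have "(nx J' ^^ ?L) c = \<rho> d" using step[OF b, of m] by (simp add: m d_def)
    also have "\<dots> = c" by (simp add: \<rho>_def)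
    finally show ?thesis using c im al'[OF c] R'[OF c] by simp
  qed
  moreover have "c \<notin> ?P" using np by simp
  ultimately have "?P \<subset> ?P'" by blast
  then have "card ?P < card ?P'" by (rule psubset_card_mono[rotated]) (use fin_C in simp)
  then show ?thesis using J' R' by blast
qed

end

lemma prim_exists:
  assumes "J \<in> joinings"
  shows "\<exists>J'\<in>joinings. (\<forall>c\<in>C. R J' c = R J c) \<and> prim J'"
  using assms
proof (induction "card C - card {x \<in> C. (\<forall>i. al J i x) \<and> (nx J ^^ len (R J x)) x = x}" arbitrary: J rule: less_induct)
  case (less J)
  show ?case
  proof (cases "prim J")
    case True
    then show ?thesis using less.prems by blast
  next
    case False
    then obtain c where c: "c \<in> C" "\<And>i. al J i c" "(nx J ^^ len (R J c)) c \<noteq> c" by (auto simp: prim_def)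
    from split_cycle[OF less.prems c] obtain J' where J': "J' \<in> joinings" "\<forall>x\<in>C. R J' x = R J x"
      and lt: "card {x \<in> C. (\<forall>i. al J i x) \<and> (nx J ^^ len (R J x)) x = x} <
        card {x \<in> C. (\<forall>i. al J' i x) \<and> (nx J' ^^ len (R J' x)) x = x}" by blast
    have "card {x \<in> C. (\<forall>i. al J' i x) \<and> (nx J' ^^ len (R J' x)) x = x} \<le> card C"
      by (rule card_mono[OF fin_C]) auto
    with lt have "card C - card {x \<in> C. (\<forall>i. al J' i x) \<and> (nx J' ^^ len (R J' x)) x = x} <
      card C - card {x \<in> C. (\<forall>i. al J i x) \<and> (nx J ^^ len (R J x)) x = x}" by simp
    from less.hyps[OF this J'(1)] obtain J'' where "J'' \<in> joinings" "\<forall>c\<in>C. R J'' c = R J' c" "prim J''" by blast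
    then show ?thesis using J'(2) by (metis (no_types, lifting))
  qed
qed

end

section \<open>The joinings of a tableau\<close>

locale tableau_cols =
  fixes ns :: "nat list" and T :: "nat arrow set" and Xs :: "'a::torsion_free_ring mat list" and q1 q2 n :: nat
  assumes tab: "tableau_with_subst ns T Xs"
    and q12: "q1 < q2" and q2: "q2 < length ns" and nq1: "ns ! q1 = n" and nq2: "ns ! q2 = n"
begin

abbreviation C :: "cell set" where "C \<equiv> cells ns"

definition arr :: "cell \<Rightarrow> letter arrow" where
  "arr c = (THE x. x \<in> arrows_t T \<and> tail x = c)"

definition th :: "cell \<Rightarrow> cell" where "th c = head (arr c)"

definition lam :: "cell \<Rightarrow> letter" where "lam c = label (arr c)"

definition B :: "cell set" where "B = {c \<in> C. fst c \<in> {q1, q2}}"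

lemma arr_eq:
  assumes "x \<in> arrows_t T"
  shows "arr (tail x) = x"
  unfolding arr_def
  by (rule the_equality) (use assms arrows_t_tail_inj[OF tab _ assms] in auto)

lemma arrows_t_C: "x \<in> arrows_t T \<Longrightarrow> tail x \<in> C" "x \<in> arrows_t T \<Longrightarrow> head x \<in> C"
  using tableau_arrow[OF tab] by (auto simp: arrows_t_def)

lemma arr:
  assumes "c \<in> C"
  shows "arr c \<in> arrows_t T" "tail (arr c) = c"
proof -
  have "\<exists>!a. a \<in> T \<and> (tail a = c \<or> head a = c)"
    using tab assms unfolding tableau_with_subst_def by (elim conjE) (rule bspec)
  then obtain a where a: "a \<in> T" "tail a = c \<or> head a = c" by blast
  then have "\<exists>x\<in>arrows_t T. tail x = c"
  proof (elim disjE)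
    assume "tail a = c"
    then show ?thesis using a(1) by (intro bexI[of _ "letter_arrow a"]) (auto simp: arrows_t_def)
  next
    assume "head a = c"
    then show ?thesis using a(1) by (intro bexI[of _ "arrow_transp (letter_arrow a)"]) (auto simp: arrows_t_def)
  qed
  then obtain x where "x \<in> arrows_t T" "tail x = c" by blast
  then show "arr c \<in> arrows_t T" "tail (arr c) = c" using arr_eq by auto
qed

lemma th_in_C: "c \<in> C \<Longrightarrow> th c \<in> C"
  using arr arrows_t_C by (simp add: th_def)

lemma arr_th: "c \<in> C \<Longrightarrow> arr (th c) = arrow_transp (arr c)"
  using arr_eq[OF arrow_transp_arrows_t[OF arr(1)]] by (simp add: th_def)

lemma lam_cols:
  assumes "c \<in> C" "d \<in> C" "lam c = lam d"
  shows "fst c = fst d" "fst (th c) = fst (th d)"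
proof -
  have "tail_col (arr c) = tail_col (arr d) \<and> head_col (arr c) = head_col (arr d)"
  proof (rule arrows_t_cases[OF arr(1)[OF assms(1)]]; rule arrows_t_cases[OF arr(1)[OF assms(2)]])
    fix a b assume ab: "a \<in> T" "b \<in> T"
    note l = tableau_same_label[OF tab ab]
    show ?thesis if "arr c = letter_arrow a" "arr d = letter_arrow b" using that assms(3) l by (simp add: lam_def)
    show ?thesis if "arr c = letter_arrow a" "arr d = arrow_transp (letter_arrow b)" using that assms(3) by (simp add: lam_def)
    show ?thesis if "arr c = arrow_transp (letter_arrow a)" "arr d = letter_arrow b" using that assms(3) by (simp add: lam_def)
    show ?thesis if "arr c = arrow_transp (letter_arrow a)" "arr d = arrow_transp (letter_arrow b)"
      using that assms(3) l by (simp add: lam_def)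
  qed
  then show "fst c = fst d" "fst (th c) = fst (th d)" using arr assms by (simp_all add: th_def)
qed

sublocale joinable C th lam letter_transp B fst
proof
  show "finite C" by (rule finite_cells)
  show "\<And>c. c \<in> C \<Longrightarrow> th c \<in> C" by (rule th_in_C)
  show "th (th c) = c" if "c \<in> C" for c using arr_th[OF that] arr[OF that] by (simp add: th_def)
  show "lam (th c) = letter_transp (lam c)" if "c \<in> C" for c using arr_th[OF that] by (simp add: lam_def)
  show "letter_transp (letter_transp l) = l" "letter_transp l \<noteq> l" for l
    using letter_transp_neq[of l] by simp_all
  show "B \<subseteq> C" by (auto simp: B_def)
  fix c d assume cd: "c \<in> C" "d \<in> C" "lam c = lam d"
  show "(c \<in> B) = (d \<in> B)" using cd lam_cols(1)[OF cd] by (simp add: B_def)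
  show "fst c = fst d" by (rule lam_cols(1)[OF cd])
qed

lemma T_ok: "arrows_ok ns T"
  unfolding arrows_ok_def
proof (intro conjI ballI impI)
  show "finite T"
  proof (rule finite_imageD[of tail], rule finite_subset[OF _ finite_cells])
    show "tail ` T \<subseteq> cells ns" using tableau_arrow[OF tab] by blast
    show "inj_on tail T" by (rule inj_onI) (rule tableau_cell_unique[OF tab], auto)
  qed
  fix a assume a: "a \<in> T"
  show "tail a \<in> C" "head a \<in> C" "tail a \<noteq> head a" by (rule tableau_arrow[OF tab a])+
  fix b assume b: "b \<in> T"
  show "{tail a, head a} \<inter> {tail b, head b} \<noteq> {} \<Longrightarrow> a = b" using tableau_cell_unique[OF tab a b] by blast
  show "label a = label b \<Longrightarrow> head_col a = head_col b" "label a = label b \<Longrightarrow> tail_col a = tail_col b"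
    using tableau_same_label[OF tab a b] by simp_all
qed

lemma arr_T:
  assumes "a \<in> T"
  shows "th (tail a) = head a" "th (head a) = tail a" "lam (tail a) = Letter (label a)" "lam (head a) = Letter_t (label a)"
proof -
  have x: "letter_arrow a \<in> arrows_t T" "arrow_transp (letter_arrow a) \<in> arrows_t T" using assms by (auto simp: arrows_t_def)
  show "th (tail a) = head a" "th (head a) = tail a" "lam (tail a) = Letter (label a)" "lam (head a) = Letter_t (label a)"
    using arr_eq[OF x(1)] arr_eq[OF x(2)] by (simp_all add: th_def lam_def)
qed

lemma cell_cases:
  assumes "c \<in> C"
  obtains a where "a \<in> T" "c = tail a" | a where "a \<in> T" "c = head a"
  using arr[OF assms] by (elim arrows_t_cases) auto

text \<open>The letter of a cell tells whether it is the tail or the head of its arrow. A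
  letter-preserving permutation that commutes with \<open>th\<close> thus maps tail-head pairs to
  tail-head pairs and comes from a permutation of the arrows.\<close>

lemma labelled_perms_eq: "labelled_perms = cell_action T ` aut T label"
proof (intro equalityI subsetI)
  fix p assume "p \<in> cell_action T ` aut T label"
  then obtain g where g: "g \<in> aut T label" and p: "p = cell_action T g" by blast
  note cs = cell_action_simps[OF T_ok g]
  have gT: "g a \<in> T" "label (g a) = label a" if "a \<in> T" for a using g that by (auto simp: aut_def permutes_in_image)
  have "lam (p c) = lam c \<and> p (th c) = th (p c)" if "c \<in> C" for c
    using that by (cases rule: cell_cases) (use arr_T gT in \<open>auto simp: p cs\<close>)
  then show "p \<in> labelled_perms"
    using cell_action_permutes[OF T_ok g] by (simp add: labelled_perms_def aut_def p)
next
  fix p assume p: "p \<in> labelled_perms"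
  note pa = aut_C[OF labelled_aut[OF p]]
  have pth: "p (th c) = th (p c)" if "c \<in> C" for c using p that by (simp add: labelled_perms_def)
  have "\<exists>b\<in>T. tail b = p (tail a) \<and> head b = p (head a) \<and> label b = label a" if a: "a \<in> T" for a
  proof -
    have tC: "tail a \<in> C" using tableau_arrow[OF tab a] by simp
    have l: "lam (p (tail a)) = Letter (label a)" using pa(3)[OF tC] arr_T(3)[OF a] by simp
    show ?thesis using pa(2)[OF tC]
    proof (cases rule: cell_cases)
      case (1 b)
      then show ?thesis using l arr_T[OF 1(1)] pth[OF tC] arr_T(1)[OF a] by (intro bexI[of _ b]) auto
    next
      case (2 b)
      then show ?thesis using l arr_T(4)[OF 2(1)] by simp
    qed
  qed
  then have "\<forall>a\<in>T. \<exists>b. b \<in> T \<and> tail b = p (tail a) \<and> head b = p (head a) \<and> label b = label a" by blast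
  from bchoice[OF this] obtain g0
    where g0: "\<And>a. a \<in> T \<Longrightarrow> g0 a \<in> T \<and> tail (g0 a) = p (tail a) \<and> head (g0 a) = p (head a) \<and> label (g0 a) = label a"
    by blast
  define g where "g = restrict_id g0 T"
  have "inj_on g0 T"
  proof (rule inj_onI)
    fix a b assume ab: "a \<in> T" "b \<in> T" "g0 a = g0 b"
    then have "p (tail a) = p (tail b)" using g0 by metis
    then have "tail a = tail b" using pa(4) by metis
    then show "a = b" using tableau_cell_unique[OF tab ab(1,2), of "tail a"] by simp
  qed
  then have "g permutes T"
    by (intro inj_imp_permutes) (use g0 fin_T[OF T_ok] in \<open>auto simp: g_def restrict_id_def inj_on_def\<close>)
  then have g: "g \<in> aut T label" using g0 by (auto simp: aut_def g_def restrict_id_def)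
  have "p = cell_action T g"
  proof
    fix c
    show "p c = cell_action T g c"
    proof (cases "c \<in> C")
      case True
      then show ?thesis
      proof (cases rule: cell_cases)
        case (1 a)
        then show ?thesis using cell_action_simps[OF T_ok g 1(1)] g0[OF 1(1)] by (simp add: g_def restrict_id_def)
      next
        case (2 a)
        then show ?thesis using cell_action_simps[OF T_ok g 2(1)] g0[OF 2(1)] by (simp add: g_def restrict_id_def)
      qed
    next
      case False
      then show ?thesis using pa(8) permutes_not_in[OF cell_action_permutes[OF T_ok g]] by simp
    qed
  qed
  then show "p \<in> cell_action T ` aut T label" using g by blast
qed

lemma card_labelled_perms: "card labelled_perms = card (aut T label)"
  unfolding labelled_perms_eq
proof (rule card_image, rule inj_onI)
  fix g h assume g: "g \<in> aut T label" and h: "h \<in> aut T label" and eq: "cell_action T g = cell_action T h"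
  have gp: "g permutes T" "h permutes T" using g h by (auto simp: aut_def)
  show "g = h"
  proof
    fix a
    show "g a = h a"
    proof (cases "a \<in> T")
      case True
      then have "tail (g a) = tail (h a)" using cell_action_simps(1)[OF T_ok g True] cell_action_simps(1)[OF T_ok h True] eq by simp
      then show ?thesis using inj_tail[OF T_ok] permutes_in_image[OF gp(1)] permutes_in_image[OF gp(2)] True by (auto dest: inj_onD)
    next
      case False
      then show ?thesis using permutes_not_in[OF gp(1)] permutes_not_in[OF gp(2)] by simp
    qed
  qed
qed

text \<open>Row k of column \<open>q2\<close> is joined to row \<xi> k of column \<open>q1\<close>.
  This is the orientation in which \<open>permute_tableau q2 \<xi>\<close> puts joined cells into
  the same row, as the definition of successive arrows requires.\<close>

definition jn :: "(nat \<Rightarrow> nat) \<Rightarrow> cell \<Rightarrow> cell" where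
  "jn \<xi> c = (if c \<in> B then if fst c = q1 then (q2, pinv \<xi> (snd c)) else (q1, \<xi> (snd c)) else c)"

definition jperm :: "(cell \<Rightarrow> cell) \<Rightarrow> nat \<Rightarrow> nat" where
  "jperm J k = (if k < n then snd (J (q2, k)) else k)"

lemma B_iff: "(i, k) \<in> B \<longleftrightarrow> i \<in> {q1, q2} \<and> k < n"
  using q12 q2 nq1 nq2 by (auto simp: B_def cells_def)

lemma permutes_lt:
  assumes "\<xi> permutes {..<n}"
  shows "\<xi> k < n \<longleftrightarrow> k < n" "pinv \<xi> k < n \<longleftrightarrow> k < n"
  using permutes_in_image[OF assms] permutes_in_image[OF permutes_inv[OF assms]] by simp_all

lemma jn_joinings:
  assumes "\<xi> permutes {..<n}"
  shows "jn \<xi> \<in> joinings"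
proof -
  have B: "jn \<xi> u \<in> B" if "u \<in> B" for u
    using that permutes_lt[OF assms] by (cases u) (auto simp: jn_def B_iff)
  have inv: "jn \<xi> (jn \<xi> u) = u" for u
  proof (cases "u \<in> B")
    case True
    then show ?thesis
      using B[OF True] permutes_inverses[OF assms] q12 by (cases u) (auto simp: jn_def B_iff)
  qed (simp add: jn_def)
  have col: "fst (jn \<xi> u) \<noteq> fst u" if "u \<in> B" for u
    using that q12 by (cases u) (auto simp: jn_def B_iff)
  have "jn \<xi> permutes B"
  proof (rule inj_imp_permutes[OF _ finite_B B])
    show "inj_on (jn \<xi>) B" by (rule inj_on_inverseI[of _ "jn \<xi>"]) (rule inv)
  qed (simp_all add: jn_def)
  then show ?thesis using inv col by (simp add: joinings_def)
qed

lemma joinings_q2: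
  assumes "J \<in> joinings" "k < n"
  shows "J (q2, k) = (q1, jperm J k)" "jperm J k < n"
proof -
  have b: "(q2, k) \<in> B" using assms(2) by (simp add: B_iff)
  have "J (q2, k) \<in> B" "fst (J (q2, k)) \<noteq> q2" using joinings_B[OF assms(1) b] joinings_col[OF assms(1) b] by simp_all
  then show "J (q2, k) = (q1, jperm J k)" "jperm J k < n" using assms(2)
    by (cases "J (q2, k)"; auto simp: B_iff jperm_def)+
qed

lemma joinings_q1:
  assumes "J \<in> joinings" "k < n"
  obtains l where "l < n" "J (q1, k) = (q2, l)" "jperm J l = k"
proof -
  have b: "(q1, k) \<in> B" using assms(2) by (simp add: B_iff)
  have J: "J (q1, k) \<in> B" "fst (J (q1, k)) \<noteq> q1" using joinings_B[OF assms(1) b] joinings_col[OF assms(1) b] by simp_all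
  then obtain l where l: "J (q1, k) = (q2, l)" "l < n" by (cases "J (q1, k)") (auto simp: B_iff)
  have "J (q2, l) = (q1, k)" using joinings_invol[OF assms(1), of "(q1, k)"] l by simp
  then have "jperm J l = k" using l by (simp add: jperm_def)
  then show thesis using that l by blast
qed

lemma jperm_permutes:
  assumes "J \<in> joinings"
  shows "jperm J permutes {..<n}"
proof (rule inj_imp_permutes)
  show "inj_on (jperm J) {..<n}"
  proof (rule inj_onI)
    fix k l assume "k \<in> {..<n}" "l \<in> {..<n}" "jperm J k = jperm J l"
    then have "J (q2, k) = J (q2, l)" using joinings_q2(1)[OF assms] by simp
    then have "J (J (q2, k)) = J (J (q2, l))" by simp
    then show "k = l" by (simp add: joinings_invol[OF assms])
  qed
qed (use joinings_q2(2)[OF assms] in \<open>auto simp: jperm_def[of _ k for k]\<close>)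

lemma jperm_jn: "\<xi> permutes {..<n} \<Longrightarrow> jperm (jn \<xi>) = \<xi>"
  using permutes_not_in[of \<xi> "{..<n}"] q12 by (auto simp: fun_eq_iff jperm_def jn_def B_iff)

lemma jn_jperm:
  assumes J: "J \<in> joinings"
  shows "jn (jperm J) = J"
proof
  fix c :: cell
  obtain i k where c: "c = (i, k)" by (cases c)
  have p: "jperm J permutes {..<n}" by (rule jperm_permutes[OF J])
  show "jn (jperm J) c = J c"
  proof (cases "c \<in> B")
    case True
    then have k: "k < n" "i = q1 \<or> i = q2" by (auto simp: c B_iff)
    show ?thesis
    proof (cases "i = q1")
      case True
      obtain l where l: "J (q1, k) = (q2, l)" "jperm J l = k" using joinings_q1[OF J k(1)] .
      then have "pinv (jperm J) k = l" using permutes_inverses(2)[OF p] by metis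
      then show ?thesis using True l \<open>c \<in> B\<close> by (simp add: jn_def c)
    next
      case False
      then show ?thesis using k joinings_q2(1)[OF J k(1)] \<open>c \<in> B\<close> q12 by (simp add: jn_def c)
    qed
  next
    case False
    have "J permutes B" using J by (simp add: joinings_def)
    then show ?thesis using permutes_not_in[of J B c] False by (simp add: jn_def)
  qed
qed

lemma bij_jn: "bij_betw jn {\<xi>. \<xi> permutes {..<n}} joinings"
  by (rule bij_betw_byWitness[where f' = jperm])
    (use jn_joinings jperm_permutes jn_jperm jperm_jn in auto)

text \<open>Conjugation by p multiplies the permutation of the joining by the action of p on column
  \<open>q1\<close> from the left and by the inverse of its action on column \<open>q2\<close> from
  the right; a sign equals the sign of the inverse.\<close>

lemma jperm_cj:
  assumes p: "p \<in> aut C lam" and J: "J \<in> joinings"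
  shows "sign (jperm (cj p J)) = sign (jperm J) * sign (col_perm p q1) * sign (col_perm p q2)"
proof -
  note a = aut_C[OF p] and ai = aut_C[OF aut_inv[OF p]]
  have lt: "q1 < length ns" "q2 < length ns" using q12 q2 by auto
  have P: "col_perm p q1 permutes {..<n}" "col_perm p q2 permutes {..<n}"
    using col_perm_permutes[OF a(1) a(7) lt(1)] col_perm_permutes[OF a(1) a(7) lt(2)] nq1 nq2 by simp_all
  have Jp: "jperm J permutes {..<n}" by (rule jperm_permutes[OF J])
  have "jperm (cj p J) \<circ> col_perm p q2 = col_perm p q1 \<circ> jperm J"
  proof
    fix k
    show "(jperm (cj p J) \<circ> col_perm p q2) k = (col_perm p q1 \<circ> jperm J) k"
    proof (cases "k < n")
      case True
      have b: "(q2, k) \<in> C" "(q1, jperm J k) \<in> C" using True joinings_q2(2)[OF J True] B_iff B_C by blast+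
      have e: "(q2, col_perm p q2 k) = p (q2, k)" using a(7)[OF b(1)] by (simp add: col_perm_def prod_eq_iff)
      have "col_perm p q2 k < n" using permutes_lt(1)[OF P(2)] True by simp
      then have "jperm (cj p J) (col_perm p q2 k) = snd (cj p J (p (q2, k)))" by (simp add: jperm_def e)
      also have "\<dots> = snd (p (q1, jperm J k))" by (simp add: cj_apply[OF p] joinings_q2(1)[OF J True])
      finally show ?thesis by (simp add: col_perm_def)
    next
      case False
      then show ?thesis using permutes_not_in[OF P(1)] permutes_not_in[OF P(2)] by (simp add: jperm_def)
    qed
  qed
  then have "sign (jperm (cj p J)) * sign (col_perm p q2) = sign (col_perm p q1) * sign (jperm J)"
    using sign_comp_permutes[OF _ _ jperm_permutes[OF cj_joinings[OF p J]] P(2)] sign_comp_permutes[OF _ _ P(1) Jp] by simp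
  then have "sign (jperm (cj p J)) * (sign (col_perm p q2) * sign (col_perm p q2)) =
     sign (jperm J) * sign (col_perm p q1) * sign (col_perm p q2)" by (metis mult.assoc mult.commute)
  then show ?thesis by simp
qed

definition Oc :: "nat set" where "Oc = {..<length ns} - {q1, q2}"

definition Operms :: "(nat \<Rightarrow> nat \<Rightarrow> nat) set" where
  "Operms = (\<Pi>\<^sub>E i\<in>Oc. {p. p permutes {..<ns ! i}})"

definition glue :: "(nat \<Rightarrow> nat \<Rightarrow> nat) \<Rightarrow> (cell \<Rightarrow> nat) \<Rightarrow> cell \<Rightarrow> nat" where
  "glue \<pi> F c = (if c \<in> B then F c else \<pi> (fst c) (snd c))"

definition Finv :: "(cell \<Rightarrow> cell) \<Rightarrow> (cell \<Rightarrow> nat) set" where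
  "Finv J = {F \<in> B \<rightarrow>\<^sub>E {..<n}. \<forall>u\<in>B. F (J u) = F u}"

text \<open>The index functions on B are arbitrary apart from being constant on the joints. The
  injectivity lost in columns \<open>q1\<close> and \<open>q2\<close> is restored only by the signed
  sum over all joinings.\<close>

definition V :: "(cell \<Rightarrow> cell) \<Rightarrow> 'a" where
  "V J = (\<Sum>\<pi>\<in>Operms. (\<Prod>i\<in>Oc. of_int (sign (\<pi> i))) * (\<Sum>F\<in>Finv J. arrow_weight ((!) Xs) T (glue \<pi> F)))"

definition U :: "(cell \<Rightarrow> cell) \<Rightarrow> 'a" where
  "U J = of_int (sign (jperm J)) * V J"

lemma Oc_col_perm_permutes:
  assumes "p \<in> aut C lam" "i \<in> Oc"
  shows "col_perm p i permutes {..<ns ! i}"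
  using col_perm_permutes[OF aut_C(1)[OF assms(1)] aut_C(7)[OF assms(1)], of i] assms(2) by (simp add: Oc_def)

text \<open>A label-preserving permutation of the arrows moves tails and heads alike, so its sign on the
  cells is 1; the signs of the outer columns and of the joint cancel.\<close>

lemma U_cj:
  assumes g: "g \<in> labelled_perms" and J: "J \<in> joinings"
  shows "U (cj g J) = U J"
proof -
  have gl: "g \<in> aut C lam" by (rule labelled_aut[OF g])
  note a = aut_C[OF gl] and ai = aut_C[OF aut_inv[OF gl]]
  obtain h where h: "h \<in> aut T label" and gh: "g = cell_action T h" using g labelled_perms_eq by blast
  let ?J = "cj g J"
  have s1: "(\<Prod>i<length ns. sign (col_perm g i)) = 1" using prod_sign_cell_action[OF T_ok h] gh by simp
  have "{..<length ns} = insert q1 (insert q2 Oc)" using q12 q2 by (auto simp: Oc_def)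
  moreover have "q1 \<notin> insert q2 Oc" "q2 \<notin> Oc" "finite Oc" using q12 by (auto simp: Oc_def)
  ultimately have s2: "sign (col_perm g q1) * (sign (col_perm g q2) * (\<Prod>i\<in>Oc. sign (col_perm g i))) = 1"
    using s1 by simp
  have gc: "g (i, k) = (i, col_perm g i k)" if "(i, k) \<in> C" for i k
    using a(7)[OF that] by (simp add: col_perm_def prod_eq_iff)
  \<comment> \<open>The permutations of the outer columns are translated by g, and the index
    functions on B are carried along by \<open>sh\<close>. After both substitutions the weight
    differs from the old one only by the action of g on the cells.\<close>
  define act where "act \<pi> = (\<lambda>i\<in>Oc. \<pi> i \<circ> col_perm g i)" for \<pi> :: "nat \<Rightarrow> nat \<Rightarrow> nat"
  have bact: "bij_betw act Operms Operms"
  proof (rule bij_betw_byWitness[where f' = "\<lambda>\<pi>. \<lambda>i\<in>Oc. \<pi> i \<circ> pinv (col_perm g i)"])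
    have i1: "col_perm g i \<circ> pinv (col_perm g i) = id" "pinv (col_perm g i) \<circ> col_perm g i = id" if "i \<in> Oc" for i
      using permutes_inv_o[OF Oc_col_perm_permutes[OF gl that]] by simp_all
    show "\<forall>\<pi>\<in>Operms. (\<lambda>i\<in>Oc. act \<pi> i \<circ> pinv (col_perm g i)) = \<pi>"
      using i1 by (auto simp: act_def Operms_def PiE_iff extensional_def comp_assoc restrict_def intro!: ext)
    show "\<forall>\<pi>\<in>Operms. act (\<lambda>i\<in>Oc. \<pi> i \<circ> pinv (col_perm g i)) = \<pi>"
      using i1 by (auto simp: act_def Operms_def PiE_iff extensional_def comp_assoc restrict_def intro!: ext)
    show "act ` Operms \<subseteq> Operms"
      using Oc_col_perm_permutes[OF gl] by (auto simp: act_def Operms_def PiE_iff intro!: permutes_compose)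
    show "(\<lambda>\<pi>. \<lambda>i\<in>Oc. \<pi> i \<circ> pinv (col_perm g i)) ` Operms \<subseteq> Operms"
      using Oc_col_perm_permutes[OF gl] by (auto simp: Operms_def PiE_iff intro!: permutes_compose permutes_inv)
  qed
  have ginB: "g u \<in> B \<longleftrightarrow> u \<in> B" for u using a(6)[of u] a(8)[of u] by (cases "u \<in> C") auto
  have giinB: "pinv g u \<in> B \<longleftrightarrow> u \<in> B" for u using ai(6)[of u] ai(8)[of u] by (cases "u \<in> C") auto
  define sh where "sh F = restrict (F \<circ> g) B" for F :: "cell \<Rightarrow> nat"
  have bsh: "bij_betw sh (Finv ?J) (Finv J)"
  proof (rule bij_betw_byWitness[where f' = "\<lambda>F. restrict (F \<circ> pinv g) B"])
    show "\<forall>F\<in>Finv ?J. restrict (sh F \<circ> pinv g) B = F"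
      using giinB by (auto simp: sh_def Finv_def fun_eq_iff PiE_iff extensional_def a)
    show "\<forall>F\<in>Finv J. sh (restrict (F \<circ> pinv g) B) = F"
      using ginB by (auto simp: sh_def Finv_def fun_eq_iff PiE_iff extensional_def a)
    show "sh ` Finv ?J \<subseteq> Finv J"
    proof (rule image_subsetI)
      fix F assume F: "F \<in> Finv ?J"
      have "F (g (J u)) = F (g u)" if "u \<in> B" for u
      proof -
        have "F (?J (g u)) = F (g u)" using F ginB[of u] that by (simp add: Finv_def)
        then show ?thesis by (simp add: cj_apply[OF gl])
      qed
      then show "sh F \<in> Finv J" using F ginB joinings_B[OF J] by (auto simp: sh_def Finv_def PiE_iff)
    qed
    show "(\<lambda>F. restrict (F \<circ> pinv g) B) ` Finv J \<subseteq> Finv ?J"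
    proof (rule image_subsetI)
      fix F assume F: "F \<in> Finv J"
      have "F (pinv g (?J u)) = F (pinv g u)" if "u \<in> B" for u
        using F giinB[of u] that by (simp add: Finv_def cj_def a)
      then show "restrict (F \<circ> pinv g) B \<in> Finv ?J"
        using F giinB joinings_B[OF cj_joinings[OF gl J]] by (auto simp: Finv_def PiE_iff)
    qed
  qed
  have w: "arrow_weight ((!) Xs) T (glue (act \<pi>) (sh F)) = arrow_weight ((!) Xs) T (glue \<pi> F)" for \<pi> F
  proof -
    have "glue (act \<pi>) (sh F) c = (glue \<pi> F \<circ> cell_action T h) c" if "c \<in> C" for c
    proof (cases "c \<in> B")
      case True
      then show ?thesis using ginB by (simp add: glue_def sh_def gh[symmetric])
    next
      case False
      obtain i k where c: "c = (i, k)" by (cases c)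
      have "i \<in> Oc" using False that by (auto simp: c Oc_def B_def cells_def)
      then show ?thesis using False gc[of i k] that ginB[of c] by (simp add: glue_def act_def gh[symmetric] c)
    qed
    then have "arrow_weight ((!) Xs) T (glue (act \<pi>) (sh F)) = arrow_weight ((!) Xs) T (glue \<pi> F \<circ> cell_action T h)"
      unfolding arrow_weight_def using cells_T[OF T_ok] by (intro prod.cong) simp_all
    then show ?thesis by (simp add: arrow_weight_cell_action[OF T_ok h])
  qed
  have sg: "(\<Prod>i\<in>Oc. sign (act \<pi> i)) = (\<Prod>i\<in>Oc. sign (\<pi> i)) * (\<Prod>i\<in>Oc. sign (col_perm g i))" if "\<pi> \<in> Operms" for \<pi>
    unfolding prod.distrib[symmetric]
  proof (rule prod.cong[OF refl])
    fix i assume i: "i \<in> Oc"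
    then have p: "\<pi> i permutes {..<ns ! i}" using that by (simp add: Operms_def PiE_iff)
    show "sign (act \<pi> i) = sign (\<pi> i) * sign (col_perm g i)"
      using sign_comp_permutes[OF _ _ p Oc_col_perm_permutes[OF gl i]] i by (simp add: act_def)
  qed
  let ?s = "of_int (\<Prod>i\<in>Oc. sign (col_perm g i)) :: 'a"
  have "V J = (\<Sum>\<pi>\<in>Operms. of_int (\<Prod>i\<in>Oc. sign (act \<pi> i)) * (\<Sum>F\<in>Finv J. arrow_weight ((!) Xs) T (glue (act \<pi>) F)))"
    unfolding V_def by (subst sum.reindex_bij_betw[OF bact, symmetric]) simp
  also have "\<dots> = (\<Sum>\<pi>\<in>Operms. ?s * (of_int (\<Prod>i\<in>Oc. sign (\<pi> i)) * (\<Sum>F\<in>Finv ?J. arrow_weight ((!) Xs) T (glue \<pi> F))))"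
  proof (rule sum.cong[OF refl])
    fix \<pi> assume \<pi>: "\<pi> \<in> Operms"
    have "(\<Sum>F\<in>Finv J. arrow_weight ((!) Xs) T (glue (act \<pi>) F)) = (\<Sum>F\<in>Finv ?J. arrow_weight ((!) Xs) T (glue \<pi> F))"
      by (subst sum.reindex_bij_betw[OF bsh, symmetric]) (simp add: w)
    then show "of_int (\<Prod>i\<in>Oc. sign (act \<pi> i)) * (\<Sum>F\<in>Finv J. arrow_weight ((!) Xs) T (glue (act \<pi>) F)) =
      ?s * (of_int (\<Prod>i\<in>Oc. sign (\<pi> i)) * (\<Sum>F\<in>Finv ?J. arrow_weight ((!) Xs) T (glue \<pi> F)))"
      unfolding sg[OF \<pi>] by (simp only: of_int_mult mult_ac)
  qed
  also have "\<dots> = ?s * V ?J" unfolding V_def by (simp add: sum_distrib_left)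
  finally have VJ: "V J = ?s * V ?J" .
  have "sign (jperm J) * (\<Prod>i\<in>Oc. sign (col_perm g i)) = sign (jperm ?J)"
  proof -
    let ?a = "sign (col_perm g q1)" and ?b = "sign (col_perm g q2)" and ?c = "\<Prod>i\<in>Oc. sign (col_perm g i)"
    have "(?a * ?b) * (?a * (?b * ?c)) = ?a * ?b" using s2 by simp
    moreover have "(?a * ?b) * (?a * (?b * ?c)) = (?a * ?a) * ((?b * ?b) * ?c)" by (simp only: mult_ac)
    ultimately have "?c = ?a * ?b" by simp
    then show ?thesis by (simp add: jperm_cj[OF gl J])
  qed
  then have "of_int (sign (jperm J)) * ?s = (of_int (sign (jperm ?J)) :: 'a)" by (metis of_int_mult)
  then show ?thesis unfolding U_def VJ by (simp only: mult.assoc[symmetric])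
qed

end

section \<open>From column permutations to joinings\<close>

context tableau_cols
begin

definition cell_weight :: "(cell \<Rightarrow> nat) \<Rightarrow> cell \<Rightarrow> 'a" where
  "cell_weight G c = letter_mat Xs (lam c) $$ (G c, G (th c))"

lemma carrier_T: "a \<in> T \<Longrightarrow> Xs ! label a \<in> carrier_mat (ns ! tail_col a) (ns ! head_col a)"
  using tab unfolding tableau_with_subst_def by (elim conjE) (rule bspec)

lemma letter_mat_carrier:
  assumes "c \<in> C"
  shows "letter_mat Xs (lam c) \<in> carrier_mat (ns ! fst c) (ns ! fst (th c))"
  using assms by (cases rule: cell_cases) (use carrier_T arr_T in auto)

lemma bij_half:
  assumes D: "D \<subseteq> C" and half: "\<And>c. c \<in> C \<Longrightarrow> c \<in> D \<longleftrightarrow> th c \<notin> D"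
  shows "bij_betw (\<lambda>a. if tail a \<in> D then tail a else head a) T D"
proof (rule bij_betwI')
  fix a b assume ab: "a \<in> T" "b \<in> T"
  show "((if tail a \<in> D then tail a else head a) = (if tail b \<in> D then tail b else head b)) = (a = b)"
  proof
    assume eq: "(if tail a \<in> D then tail a else head a) = (if tail b \<in> D then tail b else head b)"
    show "a = b"
      by (rule tableau_cell_unique[OF tab ab, of "if tail a \<in> D then tail a else head a"], simp, unfold eq, simp)
  qed simp
next
  fix a assume a: "a \<in> T"
  then have "tail a \<in> C" using tableau_arrow[OF tab a] by simp
  then show "(if tail a \<in> D then tail a else head a) \<in> D" using half[of "tail a"] arr_T(1)[OF a] by auto
next
  fix c assume c: "c \<in> D"
  then have "c \<in> C" using D by auto
  then show "\<exists>a\<in>T. c = (if tail a \<in> D then tail a else head a)"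
  proof (cases rule: cell_cases)
    case (1 a)
    then show ?thesis using c by auto
  next
    case (2 a)
    then have "tail a \<notin> D" using half[of c] c D arr_T(2)[OF 2(1)] by auto
    then show ?thesis using 2 by auto
  qed
qed

text \<open>Traversing an arrow backwards reads the transposed matrix at exchanged indices, which is
  the same entry. So the product over arrows may be taken over any set containing one end of each
  arrow.\<close>

lemma arrow_weight_half:
  assumes D: "D \<subseteq> C" and half: "\<And>c. c \<in> C \<Longrightarrow> c \<in> D \<longleftrightarrow> th c \<notin> D"
    and G: "\<And>c. c \<in> C \<Longrightarrow> G c < ns ! fst c"
  shows "arrow_weight ((!) Xs) T G = (\<Prod>c\<in>D. cell_weight G c)"
proof -
  have "arrow_weight ((!) Xs) T G = (\<Prod>a\<in>T. cell_weight G (if tail a \<in> D then tail a else head a))"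
    unfolding arrow_weight_def
  proof (rule prod.cong[OF refl])
    fix a assume a: "a \<in> T"
    have "tail a \<in> C" "head a \<in> C" using tableau_arrow[OF tab a] by auto
    then show "Xs ! label a $$ (G (tail a), G (head a)) = cell_weight G (if tail a \<in> D then tail a else head a)"
      using arr_T[OF a] G carrier_T[OF a] by (auto simp: cell_weight_def)
  qed
  also have "\<dots> = (\<Prod>c\<in>D. cell_weight G c)"
    by (rule prod.reindex_bij_betw[OF bij_half[OF D half]])
  finally show ?thesis .
qed

lemma permutes_eq_inj: "bij_betw (\<lambda>p. restrict p {..<n}) {p. p permutes {..<n}} {f \<in> {..<n} \<rightarrow>\<^sub>E {..<n}. inj_on f {..<n}}"
proof (rule bij_betw_byWitness[where f' = "\<lambda>f. restrict_id f {..<n}"])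
  show "\<forall>p\<in>{p. p permutes {..<n}}. restrict_id (restrict p {..<n}) {..<n} = p"
  proof (intro ballI ext)
    fix p x assume "p \<in> {p. p permutes {..<n}}"
    then show "restrict_id (restrict p {..<n}) {..<n} x = p x"
      using permutes_not_in[of p "{..<n}" x] by (auto simp: restrict_id_def)
  qed
  show "\<forall>f\<in>{f \<in> {..<n} \<rightarrow>\<^sub>E {..<n}. inj_on f {..<n}}. restrict (restrict_id f {..<n}) {..<n} = f"
    by (auto simp: restrict_id_def fun_eq_iff PiE_iff extensional_def)
  show "(\<lambda>p. restrict p {..<n}) ` {p. p permutes {..<n}} \<subseteq> {f \<in> {..<n} \<rightarrow>\<^sub>E {..<n}. inj_on f {..<n}}"
  proof (rule image_subsetI)
    fix p assume "p \<in> {p. p permutes {..<n}}"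
    then have p: "p permutes {..<n}" by simp
    show "restrict p {..<n} \<in> {f \<in> {..<n} \<rightarrow>\<^sub>E {..<n}. inj_on f {..<n}}"
      using permutes_lt(1)[OF p] permutes_inj_on[OF p, of "{..<n}"] by (simp add: restrict_PiE_iff)
  qed
  show "(\<lambda>f. restrict_id f {..<n}) ` {f \<in> {..<n} \<rightarrow>\<^sub>E {..<n}. inj_on f {..<n}} \<subseteq> {p. p permutes {..<n}}"
  proof clarify
    fix f assume f: "f \<in> {..<n} \<rightarrow>\<^sub>E {..<n}" "inj_on f {..<n}"
    then have "f ` {..<n} \<subseteq> {..<n}" by auto
    then have "bij_betw f {..<n} {..<n}" using f(2) by (simp add: bij_betw_def endo_inj_surj)
    then show "restrict_id f {..<n} permutes {..<n}" by (rule permutes_restrict_id)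
  qed
qed

text \<open>The terms of a non-injective index function cancel.\<close>

lemma sum_two_perms:
  fixes \<Phi> :: "(nat \<Rightarrow> nat) \<Rightarrow> (nat \<Rightarrow> nat) \<Rightarrow> 'b::torsion_free_ring"
  assumes cong: "\<And>f f' g g'. (\<And>k. k < n \<Longrightarrow> f k = f' k) \<Longrightarrow> (\<And>k. k < n \<Longrightarrow> g k = g' k) \<Longrightarrow> \<Phi> f g = \<Phi> f' g'"
  shows "(\<Sum>p | p permutes {..<n}. \<Sum>q | q permutes {..<n}. of_int (sign p) * of_int (sign q) * \<Phi> p q) =
    (\<Sum>\<xi> | \<xi> permutes {..<n}. of_int (sign \<xi>) * (\<Sum>f\<in>{..<n} \<rightarrow>\<^sub>E {..<n}. \<Phi> f (\<lambda>k. f (\<xi> k))))"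
proof -
  let ?S = "{..<n}"
  have "(\<Sum>\<xi> | \<xi> permutes ?S. of_int (sign \<xi>) * (\<Sum>f\<in>?S \<rightarrow>\<^sub>E ?S. \<Phi> f (\<lambda>k. f (\<xi> k)))) =
    (\<Sum>f\<in>{f \<in> ?S \<rightarrow>\<^sub>E ?S. inj_on f ?S}. \<Sum>\<xi> | \<xi> permutes ?S. of_int (sign \<xi>) * \<Phi> f (\<lambda>k. f (\<xi> k)))"
    by (rule sum_sign_inj) simp_all
  also have "\<dots> = (\<Sum>p | p permutes ?S. \<Sum>\<xi> | \<xi> permutes ?S. of_int (sign \<xi>) * \<Phi> (restrict p ?S) (\<lambda>k. restrict p ?S (\<xi> k)))"
    by (subst sum.reindex_bij_betw[OF permutes_eq_inj, symmetric]) simp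
  also have "\<dots> = (\<Sum>p | p permutes ?S. \<Sum>q | q permutes ?S. of_int (sign p) * of_int (sign q) * \<Phi> p q)"
  proof (rule sum.cong[OF refl])
    fix p assume "p \<in> {p. p permutes ?S}"
    then have p: "p permutes ?S" by simp
    \<comment> \<open>Substituting q = p o \<xi>: the two columns use the same values p, with \<xi>
      telling which rows share an index. The two signs combine to the sign of \<xi>.\<close>
    have "(\<Sum>q | q permutes ?S. of_int (sign p) * of_int (sign q) * \<Phi> p q) =
      (\<Sum>\<xi> | \<xi> permutes ?S. of_int (sign p) * of_int (sign (p \<circ> \<xi>)) * \<Phi> p (p \<circ> \<xi>))"
      by (rule setum_permutations_compose_left[OF p])
    also have "\<dots> = (\<Sum>\<xi> | \<xi> permutes ?S. of_int (sign \<xi>) * \<Phi> (restrict p ?S) (\<lambda>k. restrict p ?S (\<xi> k)))"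
    proof (rule sum.cong[OF refl])
      fix \<xi> assume "\<xi> \<in> {\<xi>. \<xi> permutes ?S}"
      then have \<xi>: "\<xi> permutes ?S" by simp
      have "\<Phi> p (p \<circ> \<xi>) = \<Phi> (restrict p ?S) (\<lambda>k. restrict p ?S (\<xi> k))"
        by (rule cong) (use permutes_lt(1)[OF \<xi>] in auto)
      moreover have "sign p * sign (p \<circ> \<xi>) = sign \<xi>" by (simp add: sign_comp_permutes[OF _ _ p \<xi>])
      then have "of_int (sign p) * of_int (sign (p \<circ> \<xi>)) = (of_int (sign \<xi>) :: 'b)" by (simp only: of_int_mult[symmetric])
      ultimately show "of_int (sign p) * of_int (sign (p \<circ> \<xi>)) * \<Phi> p (p \<circ> \<xi>) =
        of_int (sign \<xi>) * \<Phi> (restrict p ?S) (\<lambda>k. restrict p ?S (\<xi> k))" by simp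
    qed
    finally show "(\<Sum>\<xi> | \<xi> permutes ?S. of_int (sign \<xi>) * \<Phi> (restrict p ?S) (\<lambda>k. restrict p ?S (\<xi> k))) =
      (\<Sum>q | q permutes ?S. of_int (sign p) * of_int (sign q) * \<Phi> p q)" ..
  qed
  finally show ?thesis ..
qed

definition spread :: "(nat \<Rightarrow> nat) \<Rightarrow> (nat \<Rightarrow> nat) \<Rightarrow> cell \<Rightarrow> nat" where
  "spread f g c = (if fst c = q1 then f (snd c) else g (snd c))"

text \<open>A function constant on the joints is free on column \<open>q1\<close> and forced on
  column \<open>q2\<close>, where it is the composition with \<xi>.\<close>

lemma bij_Finv:
  assumes \<xi>: "\<xi> permutes {..<n}"
  shows "bij_betw (\<lambda>f. restrict (spread f (\<lambda>k. f (\<xi> k))) B) ({..<n} \<rightarrow>\<^sub>E {..<n}) (Finv (jn \<xi>))"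
proof (rule bij_betw_byWitness[where f' = "\<lambda>F. \<lambda>k\<in>{..<n}. F (q1, k)"])
  note lt = permutes_lt[OF \<xi>]
  show "\<forall>f\<in>{..<n} \<rightarrow>\<^sub>E {..<n}. (\<lambda>k\<in>{..<n}. restrict (spread f (\<lambda>k. f (\<xi> k))) B (q1, k)) = f"
    by (auto simp: fun_eq_iff PiE_iff extensional_def B_iff spread_def restrict_def)
  have q: "F (q1, \<xi> k) = F (q2, k)" if "F \<in> Finv (jn \<xi>)" "k < n" for F k
  proof -
    have "F (jn \<xi> (q2, k)) = F (q2, k)" using that by (simp add: Finv_def B_iff)
    then show ?thesis using that(2) q12 by (simp add: jn_def B_iff)
  qed
  show "\<forall>F\<in>Finv (jn \<xi>). restrict (spread (\<lambda>k\<in>{..<n}. F (q1, k)) (\<lambda>k. (\<lambda>k\<in>{..<n}. F (q1, k)) (\<xi> k))) B = F"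
  proof (intro ballI ext)
    fix F and c :: cell assume F: "F \<in> Finv (jn \<xi>)"
    obtain i k where c: "c = (i, k)" by (cases c)
    show "restrict (spread (\<lambda>k\<in>{..<n}. F (q1, k)) (\<lambda>k. (\<lambda>k\<in>{..<n}. F (q1, k)) (\<xi> k))) B c = F c"
    proof (cases "c \<in> B")
      case True
      then have k: "k < n" "i = q1 \<or> i = q2" by (auto simp: c B_iff)
      have "(q1, k) \<in> B" "(q2, k) \<in> B" using k(1) by (simp_all add: B_iff)
      then show ?thesis using k lt(1)[of k] q[OF F k(1)] q12 by (elim disjE) (simp_all add: c spread_def)
    next
      case False
      have "F \<in> extensional B" using F by (simp add: Finv_def PiE_def)
      then have "F c = undefined" using False by (rule extensional_arb)
      then show ?thesis using False by simp
    qed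
  qed
  show "(\<lambda>f. restrict (spread f (\<lambda>k. f (\<xi> k))) B) ` ({..<n} \<rightarrow>\<^sub>E {..<n}) \<subseteq> Finv (jn \<xi>)"
  proof (rule image_subsetI)
    fix f :: "nat \<Rightarrow> nat" assume f: "f \<in> {..<n} \<rightarrow>\<^sub>E {..<n}"
    let ?F = "restrict (spread f (\<lambda>k. f (\<xi> k))) B"
    have "?F (jn \<xi> u) = ?F u" if u: "u \<in> B" for u
    proof -
      obtain i k where ik: "u = (i, k)" "k < n" "i = q1 \<or> i = q2" using u by (cases u) (auto simp: B_iff)
      have "jn \<xi> u \<in> B" by (rule joinings_B[OF jn_joinings[OF \<xi>] u])
      moreover have "jn \<xi> u = (if i = q1 then (q2, pinv \<xi> k) else (q1, \<xi> k))" using u by (simp add: jn_def ik(1))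
      ultimately show ?thesis using ik(3) u q12 by (elim disjE) (simp_all add: spread_def ik(1) permutes_inverses(1)[OF \<xi>])
    qed
    moreover have "?F \<in> B \<rightarrow>\<^sub>E {..<n}" unfolding restrict_PiE_iff
    proof
      fix u assume "u \<in> B"
      then obtain i k where "u = (i, k)" "k < n" by (cases u) (simp add: B_iff)
      then show "spread f (\<lambda>k. f (\<xi> k)) u \<in> {..<n}" using PiE_mem[OF f, of k] PiE_mem[OF f, of "\<xi> k"] lt(1)[of k] by (simp add: spread_def)
    qed
    ultimately show "?F \<in> Finv (jn \<xi>)" by (simp add: Finv_def)
  qed
  show "(\<lambda>F. \<lambda>k\<in>{..<n}. F (q1, k)) ` Finv (jn \<xi>) \<subseteq> {..<n} \<rightarrow>\<^sub>E {..<n}"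
  proof (rule image_subsetI)
    fix F assume "F \<in> Finv (jn \<xi>)"
    then have "F \<in> B \<rightarrow>\<^sub>E {..<n}" by (simp add: Finv_def)
    then show "(\<lambda>k\<in>{..<n}. F (q1, k)) \<in> {..<n} \<rightarrow>\<^sub>E {..<n}"
      unfolding restrict_PiE_iff using PiE_mem[of F B "\<lambda>_. {..<n}"] B_iff by blast
  qed
qed

text \<open>Splitting off the columns \<open>q1\<close> and \<open>q2\<close> leaves a double signed
  sum to which \<open>sum_two_perms\<close> applies for each choice in the outer columns. The single
  signed sum it yields is indexed by \<xi>, hence by joinings through \<open>bij_jn\<close>.\<close>

lemma bpf_full_eq_sum_U: "bpf_full ns T ((!) Xs) = (\<Sum>J\<in>joinings. U J)"
proof -
  let ?X = "\<lambda>i. {p. p permutes {..<ns ! i}}"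
  let ?w = "arrow_weight ((!) Xs) T"
  have ins: "{..<length ns} = insert q1 (insert q2 Oc)" "q1 \<notin> insert q2 Oc" "q2 \<notin> Oc" "finite Oc" "q1 \<notin> Oc"
    using q12 q2 by (auto simp: Oc_def)
  define \<Phi> where "\<Phi> f g = (\<Sum>\<pi>\<in>Operms. (\<Prod>i\<in>Oc. of_int (sign (\<pi> i))) * ?w (glue \<pi> (spread f g)))" for f g
  have cong: "\<Phi> f g = \<Phi> f' g'" if "\<And>k. k < n \<Longrightarrow> f k = f' k" "\<And>k. k < n \<Longrightarrow> g k = g' k" for f f' g g'
  proof -
    have "glue \<pi> (spread f g) c = glue \<pi> (spread f' g') c" for \<pi> c
      using that by (cases c) (auto simp: glue_def spread_def B_iff)
    then have "glue \<pi> (spread f g) = glue \<pi> (spread f' g')" for \<pi> by blast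
    then show ?thesis by (simp add: \<Phi>_def)
  qed
  have "bpf_full ns T ((!) Xs) = (\<Sum>p\<in>?X q1. \<Sum>q\<in>?X q2. \<Sum>\<pi>\<in>Operms.
      (\<Prod>i<length ns. of_int (sign ((\<pi>(q2 := q, q1 := p)) i))) * ?w (\<lambda>c. (\<pi>(q2 := q, q1 := p)) (fst c) (snd c)))"
    unfolding bpf_full_def col_perms_def Operms_def ins(1)
    by (simp only: sum_PiE_insert[OF ins(2)] sum_PiE_insert[OF ins(3)])
  also have "\<dots> = (\<Sum>p\<in>?X q1. \<Sum>q\<in>?X q2. of_int (sign p) * of_int (sign q) * \<Phi> p q)"
  proof (intro sum.cong refl)
    fix p q
    have "(\<Prod>i<length ns. of_int (sign ((\<pi>(q2 := q, q1 := p)) i))) * ?w (\<lambda>c. (\<pi>(q2 := q, q1 := p)) (fst c) (snd c)) =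
      of_int (sign p) * of_int (sign q) * ((\<Prod>i\<in>Oc. of_int (sign (\<pi> i))) * ?w (glue \<pi> (spread p q)))" for \<pi>
    proof -
      have "(\<Prod>i\<in>Oc. of_int (sign ((\<pi>(q2 := q, q1 := p)) i))) = (\<Prod>i\<in>Oc. of_int (sign (\<pi> i)) :: 'a)"
        using ins by (intro prod.cong) auto
      then have s: "(\<Prod>i<length ns. of_int (sign ((\<pi>(q2 := q, q1 := p)) i))) =
          of_int (sign p) * (of_int (sign q) * (\<Prod>i\<in>Oc. of_int (sign (\<pi> i)) :: 'a))"
        unfolding ins(1) using ins(2-4) q12 by simp
      have "?w (\<lambda>c. (\<pi>(q2 := q, q1 := p)) (fst c) (snd c)) = ?w (glue \<pi> (spread p q))"
      proof -
        have "(\<pi>(q2 := q, q1 := p)) (fst c) (snd c) = glue \<pi> (spread p q) c" if "c \<in> C" for c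
          using that q12 by (auto simp: glue_def spread_def B_def)
        then show ?thesis
          unfolding arrow_weight_def using cells_T[OF T_ok] by (intro prod.cong) simp_all
      qed
      then show ?thesis unfolding s by (simp only: mult_ac)
    qed
    then show "(\<Sum>\<pi>\<in>Operms. (\<Prod>i<length ns. of_int (sign ((\<pi>(q2 := q, q1 := p)) i))) *
        ?w (\<lambda>c. (\<pi>(q2 := q, q1 := p)) (fst c) (snd c))) = of_int (sign p) * of_int (sign q) * \<Phi> p q"
      by (simp only: \<Phi>_def sum_distrib_left)
  qed
  also have "\<dots> = (\<Sum>\<xi> | \<xi> permutes {..<n}. of_int (sign \<xi>) * (\<Sum>f\<in>{..<n} \<rightarrow>\<^sub>E {..<n}. \<Phi> f (\<lambda>k. f (\<xi> k))))"
    unfolding nq1 nq2 by (rule sum_two_perms) (rule cong)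
  also have "\<dots> = (\<Sum>\<xi> | \<xi> permutes {..<n}. U (jn \<xi>))"
  proof (rule sum.cong[OF refl])
    fix \<xi> assume "\<xi> \<in> {\<xi>. \<xi> permutes {..<n}}"
    then have \<xi>: "\<xi> permutes {..<n}" by simp
    have "(\<Sum>f\<in>{..<n} \<rightarrow>\<^sub>E {..<n}. \<Phi> f (\<lambda>k. f (\<xi> k))) = (\<Sum>\<pi>\<in>Operms. \<Sum>f\<in>{..<n} \<rightarrow>\<^sub>E {..<n}.
        (\<Prod>i\<in>Oc. of_int (sign (\<pi> i))) * ?w (glue \<pi> (spread f (\<lambda>k. f (\<xi> k)))))"
      unfolding \<Phi>_def by (rule sum.swap)
    also have "\<dots> = V (jn \<xi>)"
      unfolding V_def
    proof (rule sum.cong[OF refl])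
      fix \<pi>
      have g: "glue \<pi> (restrict F B) = glue \<pi> F" for F by (auto simp: glue_def fun_eq_iff)
      show "(\<Sum>f\<in>{..<n} \<rightarrow>\<^sub>E {..<n}. (\<Prod>i\<in>Oc. of_int (sign (\<pi> i))) * ?w (glue \<pi> (spread f (\<lambda>k. f (\<xi> k))))) =
        (\<Prod>i\<in>Oc. of_int (sign (\<pi> i))) * (\<Sum>F\<in>Finv (jn \<xi>). ?w (glue \<pi> F))"
        unfolding sum_distrib_left[symmetric]
        by (subst sum.reindex_bij_betw[OF bij_Finv[OF \<xi>], symmetric]) (simp only: g)
    qed
    finally show "of_int (sign \<xi>) * (\<Sum>f\<in>{..<n} \<rightarrow>\<^sub>E {..<n}. \<Phi> f (\<lambda>k. f (\<xi> k))) = U (jn \<xi>)"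
      by (simp add: U_def jperm_jn[OF \<xi>])
  qed
  also have "\<dots> = (\<Sum>J\<in>joinings. U J)" by (rule sum.reindex_bij_betw[OF bij_jn])
  finally show ?thesis .
qed

end

text \<open>Generalized distributivity: the blocks are disjoint and the factor of s depends only on
  A and its own block, so with the values on A fixed the sum over each block can be moved into its
  factor. The induction absorbs one finished factor at a time into \<psi>.\<close>

lemma sum_PiE_UN_prod:
  fixes \<phi> :: "'s \<Rightarrow> ('x \<Rightarrow> 'y) \<Rightarrow> 'a::comm_ring_1"
  assumes "finite S"
    and "\<And>s. s \<in> S \<Longrightarrow> A \<inter> Bs s = {}" and "\<And>s t. s \<in> S \<Longrightarrow> t \<in> S \<Longrightarrow> s \<noteq> t \<Longrightarrow> Bs s \<inter> Bs t = {}"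
    and "\<And>F F'. (\<And>x. x \<in> A \<Longrightarrow> F x = F' x) \<Longrightarrow> \<psi> F = \<psi> F'"
    and "\<And>s F F'. s \<in> S \<Longrightarrow> (\<And>x. x \<in> A \<union> Bs s \<Longrightarrow> F x = F' x) \<Longrightarrow> \<phi> s F = \<phi> s F'"
  shows "(\<Sum>F\<in>(A \<union> (\<Union>s\<in>S. Bs s)) \<rightarrow>\<^sub>E E. \<psi> F * (\<Prod>s\<in>S. \<phi> s F)) =
    (\<Sum>F\<in>A \<rightarrow>\<^sub>E E. \<psi> F * (\<Prod>s\<in>S. \<Sum>H\<in>Bs s \<rightarrow>\<^sub>E E. \<phi> s (merge (Bs s) H F)))"
  using assms
proof (induction S arbitrary: \<psi> rule: finite_induct)
  case empty
  show ?case by simp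
next
  case (insert s S)
  let ?A = "A \<union> (\<Union>s\<in>S. Bs s)"
  have disj: "?A \<inter> Bs s = {}" 
  proof -
    have "A \<inter> Bs s = {}" by (rule insert.prems(1)) simp
    moreover have "Bs t \<inter> Bs s = {}" if "t \<in> S" for t by (rule insert.prems(2)) (use that insert.hyps(2) in auto)
    ultimately show ?thesis by blast
  qed
  have eq: "A \<union> (\<Union>s\<in>insert s S. Bs s) = ?A \<union> Bs s" by auto
  define \<psi>' where "\<psi>' F = \<psi> F * (\<Sum>H\<in>Bs s \<rightarrow>\<^sub>E E. \<phi> s (merge (Bs s) H F))" for F
  have "(\<Sum>F\<in>(A \<union> (\<Union>s\<in>insert s S. Bs s)) \<rightarrow>\<^sub>E E. \<psi> F * (\<Prod>s\<in>insert s S. \<phi> s F)) =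
    (\<Sum>F\<in>?A \<rightarrow>\<^sub>E E. \<Sum>H\<in>Bs s \<rightarrow>\<^sub>E E. \<psi> (merge ?A F H) * (\<Prod>s\<in>insert s S. \<phi> s (merge ?A F H)))"
    unfolding eq by (rule sum_PiE_Un[OF disj])
  also have "\<dots> = (\<Sum>F\<in>?A \<rightarrow>\<^sub>E E. \<Sum>H\<in>Bs s \<rightarrow>\<^sub>E E. (\<psi> F * (\<Prod>s\<in>S. \<phi> s F)) * \<phi> s (merge (Bs s) H F))"
  proof (intro sum.cong refl)
    fix F H assume F: "F \<in> ?A \<rightarrow>\<^sub>E E" and H: "H \<in> Bs s \<rightarrow>\<^sub>E E"
    have "\<psi> (merge ?A F H) = \<psi> F" by (rule insert.prems(3)) (simp add: merge_def)
    moreover have "\<phi> t (merge ?A F H) = \<phi> t F" if "t \<in> S" for t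
      by (rule insert.prems(4)) (use that in \<open>auto simp: merge_def\<close>)
    moreover have "\<phi> s (merge ?A F H) = \<phi> s (merge (Bs s) H F)"
      by (rule insert.prems(4)) (use disj in \<open>auto simp: merge_def\<close>)
    ultimately show "\<psi> (merge ?A F H) * (\<Prod>s\<in>insert s S. \<phi> s (merge ?A F H)) =
      (\<psi> F * (\<Prod>s\<in>S. \<phi> s F)) * \<phi> s (merge (Bs s) H F)"
      using insert.hyps by (simp add: mult_ac)
  qed
  also have "\<dots> = (\<Sum>F\<in>?A \<rightarrow>\<^sub>E E. \<psi>' F * (\<Prod>s\<in>S. \<phi> s F))"
    unfolding sum_distrib_left[symmetric] \<psi>'_def by (intro sum.cong refl) (simp only: mult_ac)
  also have "\<dots> = (\<Sum>F\<in>A \<rightarrow>\<^sub>E E. \<psi>' F * (\<Prod>s\<in>S. \<Sum>H\<in>Bs s \<rightarrow>\<^sub>E E. \<phi> s (merge (Bs s) H F)))"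
  proof (rule insert.IH)
    fix F F' :: "'x \<Rightarrow> 'y" assume FF: "\<And>x. x \<in> A \<Longrightarrow> F x = F' x"
    have "\<phi> s (merge (Bs s) H F) = \<phi> s (merge (Bs s) H F')" for H
      by (rule insert.prems(4)) (use FF in \<open>auto simp: merge_def\<close>)
    then show "\<psi>' F = \<psi>' F'" using insert.prems(3)[of F F'] FF by (simp add: \<psi>'_def)
  next
 fix t and F F' :: "'x \<Rightarrow> 'y" assume "t \<in> S" "\<And>x. x \<in> A \<union> Bs t \<Longrightarrow> F x = F' x"
    then show "\<phi> t F = \<phi> t F'" by (intro insert.prems(4)) auto
  next
    show "A \<inter> Bs t = {}" if "t \<in> S" for t by (rule insert.prems(1)) (use that in simp)
    show "Bs t \<inter> Bs u = {}" if "t \<in> S" "u \<in> S" "t \<noteq> u" for t u by (rule insert.prems(2)) (use that in simp_all)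
  qed
  also have "\<dots> = (\<Sum>F\<in>A \<rightarrow>\<^sub>E E. \<psi> F * (\<Prod>s\<in>insert s S. \<Sum>H\<in>Bs s \<rightarrow>\<^sub>E E. \<phi> s (merge (Bs s) H F)))"
    unfolding prod.insert[OF insert.hyps] \<psi>'_def by (simp only: mult.assoc)
  finally show ?case .
qed

section \<open>Contracting strings to matrices of words\<close>

context tableau_cols
begin

text \<open>The final column index j is a parameter, because it comes from an outer cell for an open
  string and from the start of the next closed string under \<rho> for a closed one.\<close>

definition string_weight :: "cell list \<Rightarrow> (cell \<Rightarrow> nat) \<Rightarrow> nat \<Rightarrow> 'a" where
  "string_weight cs G j = (\<Prod>k<length cs. letter_mat Xs (lam (cs ! k)) $$
     (G (cs ! k), if Suc k < length cs then G (cs ! Suc k) else j))"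

lemma string_weight_simps:
  "string_weight [c] G j = letter_mat Xs (lam c) $$ (G c, j)"
  "string_weight (c # d # cs) G j = letter_mat Xs (lam c) $$ (G c, G d) * string_weight (d # cs) G j"
proof -
  show "string_weight (c # d # cs) G j = letter_mat Xs (lam c) $$ (G c, G d) * string_weight (d # cs) G j"
    unfolding string_weight_def length_Cons by (subst prod.lessThan_Suc_shift) simp
qed (simp add: string_weight_def)

lemma string_weight_cong: "(\<And>c. c \<in> set cs \<Longrightarrow> G c = G' c) \<Longrightarrow> string_weight cs G j = string_weight cs G' j"
  unfolding string_weight_def by (rule prod.cong) simp_all

text \<open>Summing over the indices of the cells after the first is matrix multiplication. The
  joints passed lie in columns with n cells, so all products in \<open>word_mat\<close> are defined;
  the sizes are carried through the induction together with the entries.\<close>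

lemma word_mat_string:
  assumes "set (s # ts) \<subseteq> C" "set ts \<subseteq> B" "\<And>k. k < length ts \<Longrightarrow> th ((s # ts) ! k) \<in> B"
  shows "word_mat Xs (map lam (s # ts)) \<in> carrier_mat (ns ! fst s) (ns ! fst (th (last (s # ts))))"
    (is ?carrier)
    and "distinct (s # ts) \<Longrightarrow> G s < ns ! fst s \<Longrightarrow> j < ns ! fst (th (last (s # ts))) \<Longrightarrow>
      (\<Sum>H\<in>set ts \<rightarrow>\<^sub>E {..<n}. string_weight (s # ts) (merge (set ts) H G) j) = word_mat Xs (map lam (s # ts)) $$ (G s, j)"
proof -
  have "word_mat Xs (map lam (s # ts)) \<in> carrier_mat (ns ! fst s) (ns ! fst (th (last (s # ts)))) \<and>
    (distinct (s # ts) \<longrightarrow> G s < ns ! fst s \<longrightarrow> j < ns ! fst (th (last (s # ts))) \<longrightarrow>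
      (\<Sum>H\<in>set ts \<rightarrow>\<^sub>E {..<n}. string_weight (s # ts) (merge (set ts) H G) j) = word_mat Xs (map lam (s # ts)) $$ (G s, j))"
    using assms
proof (induction ts arbitrary: s G)
  case Nil
  then show ?case using letter_mat_carrier[of s] by (simp add: merge_def string_weight_simps)
next
  case (Cons d ts)
  have sub: "set (d # ts) \<subseteq> C" "set ts \<subseteq> B" "\<And>k. k < length ts \<Longrightarrow> th ((d # ts) ! k) \<in> B"
    using Cons.prems(1,2) Cons.prems(3)[of "Suc k" for k] by auto
  note IH = Cons.IH[OF sub]
  let ?A = "letter_mat Xs (lam s)" and ?M = "word_mat Xs (map lam (d # ts))"
  have "th s \<in> B" using Cons.prems(3)[of 0] by simp
  then have ths: "ns ! fst (th s) = n" and nd: "ns ! fst d = n" using Cons.prems(2) nq1 nq2 by (auto simp: B_def)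
  have A: "?A \<in> carrier_mat (ns ! fst s) n" using letter_mat_carrier[of s] Cons.prems(1) ths by simp
  have M: "?M \<in> carrier_mat n (ns ! fst (th (last (d # ts))))" using IH nd by simp
  have wm: "word_mat Xs (map lam (s # d # ts)) = ?A * ?M" using A M by (simp add: Let_def)
  have car: "?A * ?M \<in> carrier_mat (ns ! fst s) (ns ! fst (th (last (s # d # ts))))" using mult_carrier_mat[OF A M] by simp
  have "(\<Sum>H\<in>set (d # ts) \<rightarrow>\<^sub>E {..<n}. string_weight (s # d # ts) (merge (set (d # ts)) H G) j) = (?A * ?M) $$ (G s, j)"
    if dist: "distinct (s # d # ts)" and G: "G s < ns ! fst s" and j: "j < ns ! fst (th (last (s # d # ts)))"
  proof -
    have "(\<Sum>H\<in>set (d # ts) \<rightarrow>\<^sub>E {..<n}. string_weight (s # d # ts) (merge (set (d # ts)) H G) j) =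
      (\<Sum>m<n. \<Sum>H\<in>set ts \<rightarrow>\<^sub>E {..<n}. string_weight (s # d # ts) (merge (set (d # ts)) (H(d := m)) G) j)"
      using dist by (simp add: sum_PiE_insert)
    also have "\<dots> = (\<Sum>m<n. \<Sum>H\<in>set ts \<rightarrow>\<^sub>E {..<n}. ?A $$ (G s, m) * string_weight (d # ts) (merge (set ts) H (G(d := m))) j)"
    proof (intro sum.cong refl)
      fix m H
      have "string_weight (d # ts) (merge (set (d # ts)) (H(d := m)) G) j = string_weight (d # ts) (merge (set ts) H (G(d := m))) j"
        by (rule string_weight_cong) (use dist in \<open>auto simp: merge_def\<close>)
      then show "string_weight (s # d # ts) (merge (set (d # ts)) (H(d := m)) G) j =
        ?A $$ (G s, m) * string_weight (d # ts) (merge (set ts) H (G(d := m))) j"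
        using dist by (simp add: merge_def string_weight_simps)
    qed
    also have "\<dots> = (\<Sum>m<n. ?A $$ (G s, m) * ?M $$ (m, j))"
    proof (intro sum.cong refl)
      fix m assume m: "m \<in> {..<n}"
      have "(\<Sum>H\<in>set ts \<rightarrow>\<^sub>E {..<n}. string_weight (d # ts) (merge (set ts) H (G(d := m))) j) = ?M $$ ((G(d := m)) d, j)"
      proof -
        from IH[of "G(d := m)"] have i: "distinct (d # ts) \<Longrightarrow> (G(d := m)) d < ns ! fst d \<Longrightarrow> j < ns ! fst (th (last (d # ts))) \<Longrightarrow>
          (\<Sum>H\<in>set ts \<rightarrow>\<^sub>E {..<n}. string_weight (d # ts) (merge (set ts) H (G(d := m))) j) = ?M $$ ((G(d := m)) d, j)" by blast
        show ?thesis by (rule i) (use dist j m nd in simp_all)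
      qed
      then show "(\<Sum>H\<in>set ts \<rightarrow>\<^sub>E {..<n}. ?A $$ (G s, m) * string_weight (d # ts) (merge (set ts) H (G(d := m))) j) =
        ?A $$ (G s, m) * ?M $$ (m, j)" by (simp add: sum_distrib_left[symmetric])
    qed
    also have "\<dots> = (?A * ?M) $$ (G s, j)"
      using A M G j by (simp add: scalar_prod_def lessThan_atLeast0)
    finally show ?thesis .
  qed
  then show ?case using car unfolding wm by blast
qed
  then show ?carrier and "distinct (s # ts) \<Longrightarrow> G s < ns ! fst s \<Longrightarrow> j < ns ! fst (th (last (s # ts))) \<Longrightarrow>
      (\<Sum>H\<in>set ts \<rightarrow>\<^sub>E {..<n}. string_weight (s # ts) (merge (set ts) H G) j) = word_mat Xs (map lam (s # ts)) $$ (G s, j)"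
    by blast+
qed

definition word_of :: "(nat \<Rightarrow> letter option) \<Rightarrow> word" where
  "word_of r = map (\<lambda>k. the (r k)) [0..<len r]"

text \<open>The last arrow of a string is entered after len - 1 steps, and its far end is the end of
  the string. On a cycle of a primitive joining this is the cell joined to s.\<close>

definition end_cell :: "(cell \<Rightarrow> cell) \<Rightarrow> cell \<Rightarrow> cell" where
  "end_cell J s = th ((nx J ^^ (len (R J s) - 1)) s)"

definition cell_string :: "(cell \<Rightarrow> cell) \<Rightarrow> cell \<Rightarrow> cell list" where
  "cell_string J s = map (\<lambda>k. (nx J ^^ k) s) [0..<len (R J s)]"

definition outer_value :: "(nat \<Rightarrow> nat \<Rightarrow> nat) \<Rightarrow> cell \<Rightarrow> nat" where
  "outer_value \<pi> c = \<pi> (fst c) (snd c)"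

context
  fixes J0 W assumes J0: "J0 \<in> joinings" and good0: "good J0 W" and prim0: "prim J0"
begin

abbreviation "D \<equiv> dec J0 ` Dp J0 W"
abbreviation "K \<equiv> clo J0 W"
abbreviation "S \<equiv> St J0 W"
abbreviation "inner s \<equiv> set (tl (cell_string J0 s))"

lemma string_Cons:
  assumes "s \<in> S"
  shows "cell_string J0 s = s # map (\<lambda>k. (nx J0 ^^ Suc k) s) [0..<len (R J0 s) - 1]"
proof -
  obtain m where m: "len (R J0 s) = Suc m" using len_St(1)[OF J0 good0 assms] by (metis gr0_implies_Suc)
  show ?thesis unfolding cell_string_def m by (simp add: map_upt_Suc del: upt_Suc)
qed

lemma inner_eq: "s \<in> S \<Longrightarrow> inner s = {(nx J0 ^^ k) s | k. 0 < k \<and> k < len (R J0 s)}"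
proof -
  assume s: "s \<in> S"
  have "inner s = (\<lambda>k. (nx J0 ^^ Suc k) s) ` {..<len (R J0 s) - 1}"
    unfolding string_Cons[OF s] by (simp add: lessThan_atLeast0)
  also have "\<dots> = {(nx J0 ^^ k) s | k. 0 < k \<and> k < len (R J0 s)}"
  proof (intro equalityI subsetI)
    fix x assume "x \<in> {(nx J0 ^^ k) s | k. 0 < k \<and> k < len (R J0 s)}"
    then obtain k where k: "x = (nx J0 ^^ k) s" "0 < k" "k < len (R J0 s)" by blast
    then show "x \<in> (\<lambda>k. (nx J0 ^^ Suc k) s) ` {..<len (R J0 s) - 1}" by (intro image_eqI[of _ _ "k - 1"]) auto
  next
    fix x assume "x \<in> (\<lambda>k. (nx J0 ^^ Suc k) s) ` {..<len (R J0 s) - 1}"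
    then obtain k where "k < len (R J0 s) - 1" "x = (nx J0 ^^ Suc k) s" by blast
    then show "x \<in> {(nx J0 ^^ k) s | k. 0 < k \<and> k < len (R J0 s)}" by (intro CollectI exI[of _ "Suc k"]) simp
  qed
  finally show ?thesis .
qed

lemma distinct_string: "s \<in> S \<Longrightarrow> distinct (cell_string J0 s)"
proof -
  assume s: "s \<in> S"
  have "inj_on (\<lambda>k. (nx J0 ^^ k) s) {0..<len (R J0 s)}"
  proof (rule inj_onI)
    fix k l assume kl: "k \<in> {0..<len (R J0 s)}" "l \<in> {0..<len (R J0 s)}" "(nx J0 ^^ k) s = (nx J0 ^^ l) s"
    have "(s, k) = (s, l)"
      by (rule inj_onD[OF dec_inj[OF J0 good0]]) (use kl s in \<open>auto simp: Dp_def dec_def\<close>)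
    then show "k = l" by simp
  qed
  then show ?thesis by (simp add: cell_string_def distinct_map)
qed

lemma string_al: "s \<in> S \<Longrightarrow> k < len (R J0 s) \<Longrightarrow> al J0 k s"
  by (rule al_less_len[OF J0 good0])

lemma string_C: "s \<in> S \<Longrightarrow> k < len (R J0 s) \<Longrightarrow> (nx J0 ^^ k) s \<in> C"
  using nx_pow_C[OF J0 St_C string_al] .

lemma inner_B: "s \<in> S \<Longrightarrow> inner s \<subseteq> B"
  unfolding inner_eq using nx_pow_B[OF J0 string_al] by blast

lemma word_of_string: "s \<in> S \<Longrightarrow> word_of (R J0 s) = map lam (cell_string J0 s)"
  unfolding word_of_def cell_string_def by (simp add: R_def string_al)

lemma return_start: "s \<in> K \<Longrightarrow> (nx J0 ^^ len (R J0 s)) s = s"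
proof -
  assume s: "s \<in> K"
  have "s \<in> C" using clo_B(2)[OF J0 good0] s by blast
  moreover have "\<forall>k. al J0 k s" using clo_immortal[OF J0 good0 s] by blast
  ultimately show ?thesis using prim0 unfolding prim_def by blast
qed

text \<open>If the string could be continued past its length, its reading would be periodic and the
  first letter would recur at a cell of B. Since the letter determines membership in B, the start
  lies in B as well.\<close>

lemma end_B: "s \<in> S \<Longrightarrow> end_cell J0 s \<in> B \<longleftrightarrow> s \<in> B"
proof -
  assume s: "s \<in> S"
  let ?L = "len (R J0 s)"
  have L: "0 < ?L" by (rule len_St(1)[OF J0 good0 s])
  then obtain m where m: "?L = Suc m" by (metis gr0_implies_Suc)
  have al: "al J0 ?L s \<longleftrightarrow> end_cell J0 s \<in> B" using string_al[OF s, of m] by (simp add: m al_Suc end_cell_def)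
  show ?thesis
  proof
    assume "s \<in> B"
    then show "end_cell J0 s \<in> B" using immortal_of_B[OF J0 good0 s] al by simp
  next
    assume "end_cell J0 s \<in> B"
    then have a: "al J0 ?L s" using al by simp
    have "R J0 s ?L \<noteq> None" by (rule R_al[THEN iffD2, OF a])
    then have "\<forall>i. R J0 s (?L + i) = R J0 s i" using len_St(2)[OF J0 good0 s] by (elim disjE) simp_all
    then have "R J0 s (?L + 0) = R J0 s 0" by blast
    then have "lam ((nx J0 ^^ ?L) s) = lam s" using a by (simp add: R_def)
    moreover have "(nx J0 ^^ ?L) s \<in> B" by (rule nx_pow_B[OF J0 a L])
    ultimately show "s \<in> B" using lam_B[OF nx_pow_C[OF J0 St_C[OF s] a] St_C[OF s]] by simp
  qed
qed

lemma D_B_eq: "D \<inter> B = K \<union> (\<Union>s\<in>S. inner s)"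
proof (intro equalityI subsetI)
  fix c assume c: "c \<in> D \<inter> B"
  then obtain s k where s: "s \<in> S" "k < len (R J0 s)" "c = (nx J0 ^^ k) s" by (auto simp: Dp_def dec_def)
  show "c \<in> K \<union> (\<Union>s\<in>S. inner s)"
  proof (cases k)
    case 0
    then show ?thesis using s c by (simp add: clo_def)
  next
    case (Suc m)
    then have "c \<in> inner s" unfolding inner_eq[OF s(1)] using s by blast
    then show ?thesis using s(1) by blast
  qed
next
  fix c assume "c \<in> K \<union> (\<Union>s\<in>S. inner s)"
  then show "c \<in> D \<inter> B"
  proof
    assume "c \<in> K"
    then show ?thesis using St_D[OF J0 good0] by (simp add: clo_def)
  next
    assume "c \<in> (\<Union>s\<in>S. inner s)"
    then obtain s where s: "s \<in> S" "c \<in> inner s" by blast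
    then show ?thesis using inner_B[OF s(1)] inner_eq[OF s(1)] in_D[OF J0 good0 s(1)] by auto
  qed
qed

lemma inner_disjoint:
  shows "s \<in> S \<Longrightarrow> K \<inter> inner s = {}" "s \<in> S \<Longrightarrow> t \<in> S \<Longrightarrow> s \<noteq> t \<Longrightarrow> inner s \<inter> inner t = {}"
proof -
  have inj: "(s, k) = (t, l)" if "s \<in> S" "t \<in> S" "k < len (R J0 s)" "l < len (R J0 t)" "(nx J0 ^^ k) s = (nx J0 ^^ l) t" for s t k l
    by (rule inj_onD[OF dec_inj[OF J0 good0]]) (use that in \<open>auto simp: Dp_def dec_def\<close>)
  show "s \<in> S \<Longrightarrow> t \<in> S \<Longrightarrow> s \<noteq> t \<Longrightarrow> inner s \<inter> inner t = {}"
    unfolding inner_eq using inj[of s t] by blast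
  show "s \<in> S \<Longrightarrow> K \<inter> inner s = {}"
  proof -
    assume s: "s \<in> S"
    have "False" if t: "t \<in> K" "t \<in> inner s" for t
    proof -
      obtain k where k: "t = (nx J0 ^^ k) s" "0 < k" "k < len (R J0 s)" using t(2) unfolding inner_eq[OF s] by blast
      have tS: "t \<in> S" using t(1) by (simp add: clo_def)
      from inj[OF s tS k(3) len_St(1)[OF J0 good0 tS]] k show False by simp
    qed
    then show ?thesis by blast
  qed
qed

lemma rho_D:
  assumes \<rho>: "\<rho> \<in> aut K (R J0)"
  shows "\<rho> c \<in> D \<longleftrightarrow> c \<in> D"
proof (cases "c \<in> K")
  case True
  then show ?thesis using rho_apply(2)[OF J0 good0 \<rho> True] D_B_eq by blast
qed (simp add: rho_apply(1)[OF J0 good0 \<rho>])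

lemma joint_D_cj:
  assumes \<rho>: "\<rho> \<in> aut K (R J0)" and u: "u \<in> B"
  shows "u \<in> D \<longleftrightarrow> cj \<rho> J0 u \<notin> D"
proof -
  note a = aut_C[OF rho_facts(1)[OF J0 good0 \<rho>]]
  have "pinv \<rho> u \<in> B" using aut_C(6)[OF aut_inv[OF rho_facts(1)[OF J0 good0 \<rho>]], of u] u B_C by auto
  from D_joint[OF J0 good0 this] have "pinv \<rho> u \<in> D \<longleftrightarrow> J0 (pinv \<rho> u) \<notin> D" .
  then show ?thesis using rho_D[OF \<rho>, of "pinv \<rho> u"] rho_D[OF \<rho>, of "J0 (pinv \<rho> u)"] by (simp add: cj_def a)
qed

text \<open>Each joint has exactly one cell in the decoded half, also after reconnecting by \<rho>,
  so a function constant on joints is the same as a free function on the decoded cells of B.\<close>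

lemma bij_Finv_D:
  assumes \<rho>: "\<rho> \<in> aut K (R J0)"
  shows "bij_betw (\<lambda>F. restrict F (D \<inter> B)) (Finv (cj \<rho> J0)) (D \<inter> B \<rightarrow>\<^sub>E {..<n})"
proof -
  let ?J = "cj \<rho> J0"
  have J: "?J \<in> joinings" by (rule rho_facts(2)[OF J0 good0 \<rho>])
  note h = joint_D_cj[OF \<rho>]
  define xt where "xt H = (\<lambda>u\<in>B. if u \<in> D then H u else H (?J u))" for H :: "cell \<Rightarrow> nat"
  show ?thesis
  proof (rule bij_betw_byWitness[where f' = xt])
    show "\<forall>F\<in>Finv ?J. xt (restrict F (D \<inter> B)) = F"
    proof (intro ballI ext)
      fix F and u :: cell assume F: "F \<in> Finv ?J"
      have e: "F \<in> extensional B" "\<And>u. u \<in> B \<Longrightarrow> F (?J u) = F u" using F by (auto simp: Finv_def PiE_def)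
      show "xt (restrict F (D \<inter> B)) u = F u"
      proof (cases "u \<in> B")
        case True
        then show ?thesis using h[OF True] joinings_B[OF J True] e(2)[OF True] by (auto simp: xt_def)
      next
        case False
        then show ?thesis using extensional_arb[OF e(1) False] by (simp add: xt_def)
      qed
    qed
    show "\<forall>H\<in>D \<inter> B \<rightarrow>\<^sub>E {..<n}. restrict (xt H) (D \<inter> B) = H"
    proof (intro ballI ext)
      fix H and u :: cell assume "H \<in> D \<inter> B \<rightarrow>\<^sub>E {..<n}"
      then have "H \<in> extensional (D \<inter> B)" by (simp add: PiE_def)
      from extensional_arb[OF this] show "restrict (xt H) (D \<inter> B) u = H u" by (simp add: xt_def restrict_def)
    qed
    show "(\<lambda>F. restrict F (D \<inter> B)) ` Finv ?J \<subseteq> D \<inter> B \<rightarrow>\<^sub>E {..<n}"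
    proof (rule image_subsetI)
      fix F assume "F \<in> Finv ?J"
      then have "F \<in> B \<rightarrow>\<^sub>E {..<n}" by (simp add: Finv_def)
      from PiE_mem[OF this] show "restrict F (D \<inter> B) \<in> D \<inter> B \<rightarrow>\<^sub>E {..<n}" unfolding restrict_PiE_iff by blast
    qed
    show "xt ` (D \<inter> B \<rightarrow>\<^sub>E {..<n}) \<subseteq> Finv ?J"
    proof (rule image_subsetI)
      fix H assume "H \<in> D \<inter> B \<rightarrow>\<^sub>E {..<n}"
      note Hm = PiE_mem[OF this]
      have "xt H \<in> B \<rightarrow>\<^sub>E {..<n}"
        unfolding xt_def restrict_PiE_iff
      proof
        fix u assume u: "u \<in> B"
        show "(if u \<in> D then H u else H (?J u)) \<in> {..<n}" using Hm[of u] Hm[of "?J u"] h[OF u] joinings_B[OF J u] u by simp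
      qed
      moreover have "xt H (?J u) = xt H u" if u: "u \<in> B" for u
        using h[OF u] joinings_B[OF J u] joinings_invol[OF J, of u] u by (simp add: xt_def)
      ultimately show "xt H \<in> Finv ?J" by (simp add: Finv_def)
    qed
  qed
qed

lemma outer_value_lt:
  assumes "\<pi> \<in> Operms" "c \<in> C" "c \<notin> B"
  shows "outer_value \<pi> c < ns ! fst c"
proof -
  have "fst c \<in> Oc" "snd c < ns ! fst c" using assms(2,3) by (auto simp: Oc_def B_def cells_def)
  then show ?thesis using assms(1) permutes_in_image[of "\<pi> (fst c)" "{..<ns ! fst c}" "snd c"]
    by (simp add: Operms_def PiE_iff outer_value_def)
qed

lemma B_size: "c \<in> B \<Longrightarrow> ns ! fst c = n"
  using nq1 nq2 by (auto simp: B_def)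

lemma end_C: "s \<in> S \<Longrightarrow> end_cell J0 s \<in> C"
  unfolding end_cell_def using string_C[of s "len (R J0 s) - 1"] len_St(1)[OF J0 good0, of s] th_C by simp

text \<open>The decoded half has one end of each arrow, and the coordinates of \<open>Dp\<close>
  group its cells into strings. Inside a string the joints are those of \<open>J0\<close>; the
  reconnection enters only as the index \<rho> s at which a closed string ends.\<close>

lemma arrow_weight_strings:
  assumes \<pi>: "\<pi> \<in> Operms" and \<rho>: "\<rho> \<in> aut K (R J0)" and F: "F \<in> Finv (cj \<rho> J0)"
  shows "arrow_weight ((!) Xs) T (glue \<pi> F) = (\<Prod>s\<in>S. string_weight (cell_string J0 s) (glue \<pi> F)
    (if s \<in> B then F (\<rho> s) else outer_value \<pi> (end_cell J0 s)))"
proof -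
  let ?J = "cj \<rho> J0" and ?G = "glue \<pi> F"
  have J: "?J \<in> joinings" by (rule rho_facts(2)[OF J0 good0 \<rho>])
  have FB: "F \<in> B \<rightarrow>\<^sub>E {..<n}" and FJ: "\<And>u. u \<in> B \<Longrightarrow> F (?J u) = F u" using F by (auto simp: Finv_def)
  have Glt: "?G c < ns ! fst c" if "c \<in> C" for c
  proof (cases "c \<in> B")
    case True
    then show ?thesis using PiE_mem[OF FB True] B_size[OF True] by (simp add: glue_def)
  next
    case False
    then show ?thesis using outer_value_lt[OF \<pi> that False] by (simp add: glue_def outer_value_def)
  qed
  have DC: "D \<subseteq> C" using D_C[OF J0 good0] by blast
  have Sg: "Dp J0 W = Sigma S (\<lambda>s. {..<len (R J0 s)})" by (auto simp: Dp_def)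
  have "arrow_weight ((!) Xs) T ?G = (\<Prod>c\<in>D. cell_weight ?G c)"
    by (rule arrow_weight_half[OF DC half[OF J0 good0] Glt])
  also have "\<dots> = (\<Prod>x\<in>Dp J0 W. cell_weight ?G (dec J0 x))"
    by (rule prod.reindex[OF dec_inj[OF J0 good0], unfolded comp_def])
  also have "\<dots> = (\<Prod>s\<in>S. \<Prod>k<len (R J0 s). cell_weight ?G ((nx J0 ^^ k) s))"
    unfolding Sg by (subst prod.Sigma) (simp_all add: finite_St dec_def case_prod_unfold)
  also have "\<dots> = (\<Prod>s\<in>S. string_weight (cell_string J0 s) ?G
    (if s \<in> B then F (\<rho> s) else outer_value \<pi> (end_cell J0 s)))"
  proof (rule prod.cong[OF refl])
    fix s assume s: "s \<in> S"
    let ?L = "len (R J0 s)"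
    have len: "length (cell_string J0 s) = ?L" by (simp add: cell_string_def)
    have nth: "cell_string J0 s ! k = (nx J0 ^^ k) s" if "k < ?L" for k using that by (simp add: cell_string_def)
    show "(\<Prod>k<?L. cell_weight ?G ((nx J0 ^^ k) s)) = string_weight (cell_string J0 s) ?G
      (if s \<in> B then F (\<rho> s) else outer_value \<pi> (end_cell J0 s))"
      unfolding string_weight_def len
    proof (rule prod.cong[OF refl])
      fix k assume "k \<in> {..<?L}"
      then have k: "k < ?L" by simp
      let ?c = "(nx J0 ^^ k) s"
      have cD: "?c \<in> D" by (rule in_D[OF J0 good0 s k])
      \<comment> \<open>The joining \<open>cj \<rho> J0\<close> links the far end of the arrow to
        the \<rho>-image of the old next cell, and F takes equal values on both cells of a
        joint.\<close>
      have step: "?G (th ?c) = F (\<rho> (nx J0 ?c))" if t: "th ?c \<in> B"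
      proof -
        have "F (?J (th ?c)) = F (th ?c)" by (rule FJ[OF t])
        moreover have "?J (th ?c) = \<rho> (nx J0 ?c)" using nx_rho[OF J0 good0 \<rho> cD t] by (simp add: nx_def)
        ultimately show ?thesis using t by (simp add: glue_def)
      qed
      have "?G (th ?c) = (if Suc k < ?L then ?G ((nx J0 ^^ Suc k) s)
          else if s \<in> B then F (\<rho> s) else outer_value \<pi> (end_cell J0 s))"
      proof (cases "Suc k < ?L")
        case True
        have "al J0 (Suc k) s" by (rule string_al[OF s True])
        then have t: "th ?c \<in> B" by (simp add: al_Suc)
        have "(nx J0 ^^ Suc k) s \<notin> K" using inner_not_start[OF J0 good0 s True] clo_B(3)[OF J0 good0] by blast
        then have "\<rho> (nx J0 ?c) = (nx J0 ^^ Suc k) s" using rho_apply(1)[OF J0 good0 \<rho>] by simp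
        moreover have "(nx J0 ^^ Suc k) s \<in> B" by (rule nx_pow_B[OF J0 string_al[OF s True]]) simp
        ultimately show ?thesis using step[OF t] True by (simp add: glue_def)
      next
        case False
        then have L: "?L = Suc k" using k by simp
        have e: "end_cell J0 s = th ?c" by (simp add: end_cell_def L)
        show ?thesis
        proof (cases "s \<in> B")
          case True
          then have sK: "s \<in> K" using s by (simp add: clo_def)
          have t: "th ?c \<in> B" using end_B[OF s] True e by simp
          have "nx J0 ?c = s" using return_start[OF sK] by (simp add: L)
          then show ?thesis using step[OF t] False True by simp
        next
          case nB: False
          then have "th ?c \<notin> B" using end_B[OF s] e by simp
          then show ?thesis using False nB e by (simp add: glue_def outer_value_def)
        qed
      qed
      then show "cell_weight ?G ?c = letter_mat Xs (lam (cell_string J0 s ! k)) $$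
        (?G (cell_string J0 s ! k), if Suc k < ?L then ?G (cell_string J0 s ! Suc k)
           else if s \<in> B then F (\<rho> s) else outer_value \<pi> (end_cell J0 s))"
        using nth[OF k] nth[of "Suc k"] by (simp add: cell_weight_def)
    qed
  qed
  finally show ?thesis .
qed

lemma word_mat_cell_string:
  assumes s: "s \<in> S"
  shows "word_mat Xs (word_of (R J0 s)) \<in> carrier_mat (ns ! fst s) (ns ! fst (end_cell J0 s))"
    and "G s < ns ! fst s \<Longrightarrow> j < ns ! fst (end_cell J0 s) \<Longrightarrow>
      (\<Sum>H\<in>inner s \<rightarrow>\<^sub>E {..<n}. string_weight (cell_string J0 s) (merge (inner s) H G) j) =
      word_mat Xs (word_of (R J0 s)) $$ (G s, j)"
proof -
  let ?L = "len (R J0 s)"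
  define ts where "ts = map (\<lambda>k. (nx J0 ^^ Suc k) s) [0..<?L - 1]"
  have L: "0 < ?L" by (rule len_St(1)[OF J0 good0 s])
  have cs: "cell_string J0 s = s # ts" unfolding ts_def by (rule string_Cons[OF s])
  have len: "length (cell_string J0 s) = ?L" by (simp add: cell_string_def)
  have nth: "cell_string J0 s ! k = (nx J0 ^^ k) s" if "k < ?L" for k using that by (simp add: cell_string_def)
  have in_ts: "inner s = set ts" by (simp add: cs)
  have C': "set (s # ts) \<subseteq> C" unfolding cs[symmetric] cell_string_def using string_C[OF s] by auto
  have B': "set ts \<subseteq> B" using inner_B[OF s] in_ts by simp
  have th': "th ((s # ts) ! k) \<in> B" if "k < length ts" for k
  proof -
    have k: "Suc k < ?L" using that len by (simp add: cs)
    have "al J0 (Suc k) s" by (rule string_al[OF s k])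
    then show ?thesis using nth[of k] k by (simp add: cs[symmetric] al_Suc)
  qed
  have lst: "th (last (s # ts)) = end_cell J0 s"
  proof -
    have "last (cell_string J0 s) = cell_string J0 s ! (?L - 1)" using L len by (subst last_conv_nth) auto
    then show ?thesis using nth[of "?L - 1"] L by (simp add: cs end_cell_def)
  qed
  have dist: "distinct (s # ts)" using distinct_string[OF s] by (simp add: cs)
  note w = word_mat_string[OF C' B' th']
  show "word_mat Xs (word_of (R J0 s)) \<in> carrier_mat (ns ! fst s) (ns ! fst (end_cell J0 s))"
    using w(1) unfolding word_of_string[OF s] cs lst .
  show "G s < ns ! fst s \<Longrightarrow> j < ns ! fst (end_cell J0 s) \<Longrightarrow>
      (\<Sum>H\<in>inner s \<rightarrow>\<^sub>E {..<n}. string_weight (cell_string J0 s) (merge (inner s) H G) j) =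
      word_mat Xs (word_of (R J0 s)) $$ (G s, j)"
    unfolding in_ts unfolding word_of_string[OF s] cs by (rule w(2)[OF _ dist]) (simp_all only: lst)
qed

text \<open>With the indices of the cyclic starts fixed, the inner indices of different strings are
  independent. Summing them out replaces each string by the matrix of its word, with outer indices
  for the open strings and those of s and \<rho> s for the closed ones.\<close>

lemma sum_Finv:
  assumes \<pi>: "\<pi> \<in> Operms" and \<rho>: "\<rho> \<in> aut K (R J0)"
  shows "(\<Sum>F\<in>Finv (cj \<rho> J0). arrow_weight ((!) Xs) T (glue \<pi> F)) =
    (\<Prod>s\<in>S - B. word_mat Xs (word_of (R J0 s)) $$ (outer_value \<pi> s, outer_value \<pi> (end_cell J0 s))) *
    (\<Sum>f\<in>K \<rightarrow>\<^sub>E {..<n}. \<Prod>s\<in>K. word_mat Xs (word_of (R J0 s)) $$ (f s, f (\<rho> s)))"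
proof -
  let ?M = "\<lambda>s. word_mat Xs (word_of (R J0 s))"
  define \<phi> where "\<phi> s F = string_weight (cell_string J0 s) (glue \<pi> F)
    (if s \<in> B then F (\<rho> s) else outer_value \<pi> (end_cell J0 s))" for s F
  have \<rho>K: "\<rho> s \<in> K" if "s \<in> K" for s by (rule rho_apply(2)[OF J0 good0 \<rho> that])
  have SB: "s \<in> K" if "s \<in> S" "s \<in> B" for s using that by (simp add: clo_def)
  have set_cs: "set (cell_string J0 s) = insert s (inner s)" if "s \<in> S" for s unfolding string_Cons[OF that] by simp
  have cong: "\<phi> s F = \<phi> s F'" if s: "s \<in> S" and eq: "\<And>x. x \<in> K \<union> inner s \<Longrightarrow> F x = F' x" for s F F'
  proof -
    have "glue \<pi> F c = glue \<pi> F' c" if "c \<in> set (cell_string J0 s)" for c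
    proof (cases "c \<in> B")
      case True
      then have "c \<in> K \<union> inner s" using that SB[OF s] unfolding set_cs[OF s] by blast
      then show ?thesis using True eq by (simp add: glue_def)
    qed (simp add: glue_def)
    then have "string_weight (cell_string J0 s) (glue \<pi> F) j = string_weight (cell_string J0 s) (glue \<pi> F') j" for j
      by (rule string_weight_cong)
    moreover have "F (\<rho> s) = F' (\<rho> s)" if "s \<in> B" using eq \<rho>K[OF SB[OF s that]] by simp
    ultimately show ?thesis by (simp add: \<phi>_def)
  qed
  have "(\<Sum>F\<in>Finv (cj \<rho> J0). arrow_weight ((!) Xs) T (glue \<pi> F)) = (\<Sum>F\<in>Finv (cj \<rho> J0). \<Prod>s\<in>S. \<phi> s F)"
    unfolding \<phi>_def by (rule sum.cong[OF refl]) (rule arrow_weight_strings[OF \<pi> \<rho>])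
  also have "\<dots> = (\<Sum>F\<in>Finv (cj \<rho> J0). \<Prod>s\<in>S. \<phi> s (restrict F (D \<inter> B)))"
  proof (intro sum.cong prod.cong refl)
    fix F s assume "s \<in> S"
    then show "\<phi> s F = \<phi> s (restrict F (D \<inter> B))" by (intro cong) (auto simp: D_B_eq)
  qed
  also have "\<dots> = (\<Sum>F\<in>D \<inter> B \<rightarrow>\<^sub>E {..<n}. \<Prod>s\<in>S. \<phi> s F)"
    by (rule sum.reindex_bij_betw[OF bij_Finv_D[OF \<rho>]])
  also have "\<dots> = (\<Sum>F\<in>(K \<union> (\<Union>s\<in>S. inner s)) \<rightarrow>\<^sub>E {..<n}. 1 * (\<Prod>s\<in>S. \<phi> s F))" unfolding D_B_eq by simp
  also have "\<dots> = (\<Sum>F\<in>K \<rightarrow>\<^sub>E {..<n}. 1 * (\<Prod>s\<in>S. \<Sum>H\<in>inner s \<rightarrow>\<^sub>E {..<n}. \<phi> s (merge (inner s) H F)))"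
    by (rule sum_PiE_UN_prod[OF finite_St inner_disjoint(1) inner_disjoint(2) _ cong]) simp_all
  also have "\<dots> = (\<Sum>F\<in>K \<rightarrow>\<^sub>E {..<n}.
      (\<Prod>s\<in>S - B. ?M s $$ (outer_value \<pi> s, outer_value \<pi> (end_cell J0 s))) * (\<Prod>s\<in>K. ?M s $$ (F s, F (\<rho> s))))"
  proof (rule sum.cong[OF refl])
    fix F assume F: "F \<in> K \<rightarrow>\<^sub>E {..<n}"
    have val: "(\<Sum>H\<in>inner s \<rightarrow>\<^sub>E {..<n}. \<phi> s (merge (inner s) H F)) =
      ?M s $$ (glue \<pi> F s, if s \<in> B then F (\<rho> s) else outer_value \<pi> (end_cell J0 s))" if s: "s \<in> S" for s
    proof -
      have g: "glue \<pi> (merge (inner s) H F) = merge (inner s) H (glue \<pi> F)" for H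
        using inner_B[OF s] by (auto simp: glue_def merge_def fun_eq_iff)
      have r: "merge (inner s) H F (\<rho> s) = F (\<rho> s)" if "s \<in> B" for H
        using \<rho>K[OF SB[OF s that]] inner_disjoint(1)[OF s] by (auto simp: merge_def)
      have "\<phi> s (merge (inner s) H F) = string_weight (cell_string J0 s) (merge (inner s) H (glue \<pi> F))
        (if s \<in> B then F (\<rho> s) else outer_value \<pi> (end_cell J0 s))" for H
        unfolding \<phi>_def g by (cases "s \<in> B") (simp_all add: r)
      moreover have "(\<Sum>H\<in>inner s \<rightarrow>\<^sub>E {..<n}. string_weight (cell_string J0 s) (merge (inner s) H (glue \<pi> F))
        (if s \<in> B then F (\<rho> s) else outer_value \<pi> (end_cell J0 s))) =
        ?M s $$ (glue \<pi> F s, if s \<in> B then F (\<rho> s) else outer_value \<pi> (end_cell J0 s))"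
      proof (rule word_mat_cell_string(2)[OF s])
        show "glue \<pi> F s < ns ! fst s"
          using PiE_mem[OF F SB[OF s]] B_size[of s] outer_value_lt[OF \<pi> St_C[OF s]]
          by (cases "s \<in> B") (simp_all add: glue_def outer_value_def)
        show "(if s \<in> B then F (\<rho> s) else outer_value \<pi> (end_cell J0 s)) < ns ! fst (end_cell J0 s)"
          using PiE_mem[OF F \<rho>K[OF SB[OF s]]] B_size[of "end_cell J0 s"] outer_value_lt[OF \<pi> end_C[OF s]] end_B[OF s]
          by (cases "s \<in> B") simp_all
      qed
      ultimately show ?thesis by simp
    qed
    have SS: "S = (S - B) \<union> K" "(S - B) \<inter> K = {}" "finite (S - B)" "finite K"
      using finite_St by (auto simp: clo_def)
    have "(\<Prod>s\<in>S. \<Sum>H\<in>inner s \<rightarrow>\<^sub>E {..<n}. \<phi> s (merge (inner s) H F)) =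
      (\<Prod>s\<in>S. ?M s $$ (glue \<pi> F s, if s \<in> B then F (\<rho> s) else outer_value \<pi> (end_cell J0 s)))"
      by (rule prod.cong[OF refl]) (rule val)
    also have "\<dots> = (\<Prod>s\<in>S - B. ?M s $$ (glue \<pi> F s, if s \<in> B then F (\<rho> s) else outer_value \<pi> (end_cell J0 s))) *
      (\<Prod>s\<in>K. ?M s $$ (glue \<pi> F s, if s \<in> B then F (\<rho> s) else outer_value \<pi> (end_cell J0 s)))"
      by (subst SS(1)) (rule prod.union_disjoint[OF SS(3,4,2)])
    also have "(\<Prod>s\<in>S - B. ?M s $$ (glue \<pi> F s, if s \<in> B then F (\<rho> s) else outer_value \<pi> (end_cell J0 s))) =
      (\<Prod>s\<in>S - B. ?M s $$ (outer_value \<pi> s, outer_value \<pi> (end_cell J0 s)))"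
      by (rule prod.cong[OF refl]) (simp add: glue_def outer_value_def)
    also have "(\<Prod>s\<in>K. ?M s $$ (glue \<pi> F s, if s \<in> B then F (\<rho> s) else outer_value \<pi> (end_cell J0 s))) =
      (\<Prod>s\<in>K. ?M s $$ (F s, F (\<rho> s)))"
      by (rule prod.cong[OF refl]) (simp add: glue_def clo_def)
    finally show "1 * (\<Prod>s\<in>S. \<Sum>H\<in>inner s \<rightarrow>\<^sub>E {..<n}. \<phi> s (merge (inner s) H F)) =
      (\<Prod>s\<in>S - B. ?M s $$ (outer_value \<pi> s, outer_value \<pi> (end_cell J0 s))) * (\<Prod>s\<in>K. ?M s $$ (F s, F (\<rho> s)))"
      by simp
  qed
  finally show ?thesis by (simp only: sum_distrib_left)
qed

text \<open>Reconnecting by \<rho> multiplies the sign of the joining by the sign of \<rho>. The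
  open strings do not depend on \<rho> and come out of the sum, and what is left over the closed
  ones is the signed sum of \<open>sum_aut_eq_prod_sigma\<close>.\<close>

theorem sum_rho_U:
  assumes Rs: "finite Rs" "R J0 ` K \<subseteq> Rs"
  shows "(\<Sum>\<rho>\<in>aut K (R J0). U (cj \<rho> J0)) = of_int (sign (jperm J0)) *
    (\<Sum>\<pi>\<in>Operms. (\<Prod>i\<in>Oc. of_int (sign (\<pi> i))) *
       (\<Prod>s\<in>S - B. word_mat Xs (word_of (R J0 s)) $$ (outer_value \<pi> s, outer_value \<pi> (end_cell J0 s)))) *
    (of_nat (card (aut K (R J0))) * (\<Prod>r\<in>Rs. sigma (card {s \<in> K. R J0 s = r}) (word_mat Xs (word_of r))))"
proof -
  let ?M = "\<lambda>s. word_mat Xs (word_of (R J0 s))"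
  let ?O = "\<Sum>\<pi>\<in>Operms. (\<Prod>i\<in>Oc. of_int (sign (\<pi> i))) *
       (\<Prod>s\<in>S - B. ?M s $$ (outer_value \<pi> s, outer_value \<pi> (end_cell J0 s)))"
  let ?c = "\<lambda>\<rho>. \<Sum>f\<in>K \<rightarrow>\<^sub>E {..<n}. \<Prod>s\<in>K. ?M s $$ (f s, f (\<rho> s))"
  have fK: "finite K" using finite_St by (simp add: clo_def)
  have U_eq: "U (cj \<rho> J0) = of_int (sign (jperm J0)) * ?O * (of_int (sign \<rho>) * ?c \<rho>)" if \<rho>: "\<rho> \<in> aut K (R J0)" for \<rho>
  proof -
    have V_eq: "V (cj \<rho> J0) = ?O * ?c \<rho>"
      unfolding V_def sum_distrib_right
    proof (rule sum.cong[OF refl])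
      fix \<pi> assume "\<pi> \<in> Operms"
      then show "(\<Prod>i\<in>Oc. of_int (sign (\<pi> i))) * (\<Sum>F\<in>Finv (cj \<rho> J0). arrow_weight ((!) Xs) T (glue \<pi> F)) =
        (\<Prod>i\<in>Oc. of_int (sign (\<pi> i))) * (\<Prod>s\<in>S - B. ?M s $$ (outer_value \<pi> s, outer_value \<pi> (end_cell J0 s))) * ?c \<rho>"
        by (simp only: sum_Finv[OF _ \<rho>] mult.assoc)
    qed
    have \<rho>C: "\<rho> \<in> aut C lam" by (rule rho_facts(1)[OF J0 good0 \<rho>])
    \<comment> \<open>Cyclic starts lie in columns \<open>q1\<close> and \<open>q2\<close>, so
      \<rho> acts trivially on the outer columns and its sign is the product of its signs on these
      two.\<close>
    have "col_perm \<rho> i = id" if "i \<in> Oc" for i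
    proof
      fix k
      have "(i, k) \<notin> K" using that clo_B(1)[OF J0 good0] B_iff[of i k] by (auto simp: Oc_def)
      then show "col_perm \<rho> i k = id k" using rho_apply(1)[OF J0 good0 \<rho>] by (simp add: col_perm_def)
    qed
    then have "(\<Prod>i\<in>Oc. sign (col_perm \<rho> i)) = 1" by simp
    moreover have "{..<length ns} = insert q1 (insert q2 Oc)" "q1 \<notin> insert q2 Oc" "q2 \<notin> Oc" "finite Oc"
      using q12 q2 by (auto simp: Oc_def)
    ultimately have "sign \<rho> = sign (col_perm \<rho> q1) * sign (col_perm \<rho> q2)"
      using sign_eq_prod_col_perm[OF aut_C(1)[OF \<rho>C] aut_C(7)[OF \<rho>C]] by simp
    then have "sign (jperm (cj \<rho> J0)) = sign (jperm J0) * sign \<rho>"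
      unfolding jperm_cj[OF \<rho>C J0] by (simp only: mult.assoc)
    then show ?thesis unfolding U_def V_eq by (simp only: of_int_mult mult_ac)
  qed
  have "(\<Sum>\<rho>\<in>aut K (R J0). U (cj \<rho> J0)) = (\<Sum>\<rho>\<in>aut K (R J0). of_int (sign (jperm J0)) * ?O * (of_int (sign \<rho>) * ?c \<rho>))"
    by (rule sum.cong[OF refl]) (rule U_eq)
  also have "\<dots> = of_int (sign (jperm J0)) * ?O * (\<Sum>\<rho>\<in>aut K (R J0). of_int (sign \<rho>) * ?c \<rho>)"
    by (rule sum_distrib_left[symmetric])
  also have "(\<Sum>\<rho>\<in>aut K (R J0). of_int (sign \<rho>) * ?c \<rho>) =
    of_nat (card (aut K (R J0))) * (\<Prod>r\<in>Rs. sigma (card {s \<in> K. R J0 s = r}) (word_mat Xs (word_of r)))"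
  proof (rule sum_aut_eq_prod_sigma[OF fK Rs])
    fix r assume "r \<in> R J0 ` K"
    then obtain s where s: "s \<in> K" "r = R J0 s" by blast
    then have sS: "s \<in> S" "s \<in> B" by (auto simp: clo_def)
    show "word_mat Xs (word_of r) \<in> carrier_mat n n"
      using word_mat_cell_string(1)[OF sS(1)] B_size[OF sS(2)] B_size[of "end_cell J0 s"] end_B[OF sS(1)] sS(2) s(2) by simp
  qed
  finally show ?thesis .
qed

end

end

section \<open>Readings and words\<close>

lemma concat_replicate_nth:
  assumes "i < k * length v"
  shows "concat (replicate k v) ! i = v ! (i mod length v)"
  using assms
proof (induction k arbitrary: i)
  case (Suc k)
  show ?case
  proof (cases "i < length v")
    case False
    then have "concat (replicate k v) ! (i - length v) = v ! ((i - length v) mod length v)"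
      using Suc.prems by (intro Suc.IH) simp
    then show ?thesis using False by (simp add: nth_append le_mod_geq)
  qed (simp add: nth_append)
qed simp

context tableau_cols
begin

text \<open>This and \<open>per_reading\<close> recover a reading from its word, for strings
  starting outside B and for cycles respectively. They let the counts by readings be exchanged with
  counts by words.\<close>

definition fin_reading :: "word \<Rightarrow> nat \<Rightarrow> letter option" where
  "fin_reading w i = (if i < length w then Some (w ! i) else None)"

definition per_reading :: "word \<Rightarrow> nat \<Rightarrow> letter option" where
  "per_reading w i = Some (w ! (i mod length w))"

text \<open>Ends of strings with at least two arrows, as in the definition of an open path. Arrows
  with both ends outside B are kept apart in \<open>isolated\<close>.\<close>

definition opens :: "cell set" where
  "opens = {c \<in> C. c \<notin> B \<and> th c \<in> B}"

definition immortals :: "(cell \<Rightarrow> cell) \<Rightarrow> cell set" where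
  "immortals J = {c \<in> C. \<forall>k. al J k c}"

lemma immortals_B: "J \<in> joinings \<Longrightarrow> immortals J \<subseteq> B"
proof
  fix c assume J: "J \<in> joinings" and c: "c \<in> immortals J"
  then have "c \<in> C" "\<And>k. al J k c" by (auto simp: immortals_def)
  from period_exists[OF J this] obtain L where "0 < L" "(nx J ^^ L) c = c" by blast
  then show "c \<in> B" using nx_pow_B[OF J, of L c] c by (simp add: immortals_def)
qed

text \<open>After a positive number of steps the walk is in B, so the first letter, belonging to a
  cell outside B, never recurs and the reading cannot be periodic. Its \<open>len\<close> is
  therefore the point where the walk stops.\<close>

lemma len_outer:
  assumes J: "J \<in> joinings" and c: "c \<in> C" "c \<notin> B"
  shows "0 < len (R J c)" "al J k c \<longleftrightarrow> k < len (R J c)"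
proof -
  let ?P = "\<lambda>k. 0 < k \<and> (R J c k = None \<or> (\<forall>i. R J c (k + i) = R J c i))"
  have "c \<notin> immortals J" using immortals_B[OF J] c(2) by blast
  then obtain k0 where k0: "\<not> al J k0 c" using c(1) by (auto simp: immortals_def)
  then have "?P k0" by (cases k0) (auto simp: R_def)
  then have L: "?P (len (R J c))" unfolding len_def by (rule LeastI)
  then show pos: "0 < len (R J c)" by blast
  have notal: "\<not> al J (len (R J c)) c"
  proof
    assume a: "al J (len (R J c)) c"
    then have "R J c (len (R J c)) \<noteq> None" by (rule R_al[THEN iffD2])
    then have "\<forall>i. R J c (len (R J c) + i) = R J c i" using L by (elim conjE disjE) simp_all
    then have "R J c (len (R J c) + 0) = R J c 0" by blast
    then have "lam ((nx J ^^ len (R J c)) c) = lam c" using a by (simp add: R_def)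
    then show False using lam_B[OF nx_pow_C[OF J c(1) a] c(1)] nx_pow_B[OF J a pos] c(2) by simp
  qed
  show "al J k c \<longleftrightarrow> k < len (R J c)"
  proof
    assume "al J k c"
    then show "k < len (R J c)" using notal al_mono[of J k c "len (R J c)"] by (meson not_less)
  next
    assume k: "k < len (R J c)"
    show "al J k c"
    proof (rule ccontr)
      assume n: "\<not> al J k c"
      then have "0 < k" by (cases k) auto
      moreover have "R J c k = None" using n by (simp add: R_def)
      ultimately have "len (R J c) \<le> k" by (intro len_le) simp_all
      then show False using k by simp
    qed
  qed
qed

lemma length_word_of [simp]: "length (word_of r) = len r"
  by (simp add: word_of_def)

lemma word_of_nth: "i < len r \<Longrightarrow> word_of r ! i = the (r i)"
  by (simp add: word_of_def)

lemma R_outer: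
  assumes "J \<in> joinings" "c \<in> C" "c \<notin> B"
  shows "R J c = fin_reading (word_of (R J c))"
  using len_outer(2)[OF assms] by (auto simp: fun_eq_iff fin_reading_def word_of_nth R_def)

lemma R_mod:
  assumes J: "J \<in> joinings" and c: "c \<in> immortals J" and L: "0 < L" "R J ((nx J ^^ L) c) = R J c"
  shows "R J c i = R J c (i mod L)"
proof (induction i rule: less_induct)
  case (less i)
  have im: "\<And>k. al J k c" using c by (simp add: immortals_def)
  show ?case
  proof (cases "i < L")
    case False
    have "R J c i = R J c (L + (i - L))" using False by simp
    also have "\<dots> = R J c (i - L)" using R_period_iff[OF J im, of L] L(2) by blast
    also have "\<dots> = R J c ((i - L) mod L)" using False L(1) by (intro less.IH) simp
    also have "(i - L) mod L = i mod L" using False by (simp add: le_mod_geq)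
    finally show ?thesis .
  qed simp
qed

lemma R_immortal:
  assumes J: "J \<in> joinings" and c: "c \<in> immortals J"
  shows "R J c = per_reading (word_of (R J c))"
proof
  fix i
  have cC: "c \<in> C" "\<And>k. al J k c" using c by (auto simp: immortals_def)
  note l = len_immortal[OF J cC]
  have "R J c i = R J c (i mod len (R J c))" by (rule R_mod[OF J c l(1,2)])
  then show "R J c i = per_reading (word_of (R J c)) i"
    using l(1) cC(2) by (simp add: per_reading_def word_of_nth R_def)
qed

definition isolated :: "cell set" where
  "isolated = {c \<in> C. c \<notin> B \<and> th c \<notin> B}"

lemma R_isolated: "c \<in> isolated \<Longrightarrow> R J c = fin_reading [lam c]"
  by (auto simp: isolated_def fun_eq_iff fin_reading_def R_def al_def)

definition ends :: "(nat \<Rightarrow> letter option) \<Rightarrow> bool" where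
  "ends r \<longleftrightarrow> (\<exists>k. r k = None)"

lemma immortals_ends: "c \<in> immortals J \<longleftrightarrow> c \<in> C \<and> \<not> ends (R J c)"
  by (simp add: immortals_def ends_def R_def)

lemma outer_ends: "J \<in> joinings \<Longrightarrow> c \<in> C \<Longrightarrow> c \<notin> B \<Longrightarrow> ends (R J c)"
  using immortals_B[of J] immortals_ends[of c J] by blast

lemma E_ends: "ends (R J c) \<Longrightarrow> E J c \<longleftrightarrow> c \<notin> B"
  by (auto simp: E_def ends_def R_def split: if_splits)

lemma R_1: "R J c (Suc 0) = None \<longleftrightarrow> th c \<notin> B"
  by (simp add: R_def al_Suc)

text \<open>The reading alone tells the kind of its cell: endless on cycles, of one letter on an
  arrow outside the two columns, and otherwise that of an end of an open string.\<close>

lemma E_cases: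
  assumes J: "J \<in> joinings"
  shows "{c \<in> C. E J c \<and> R J c = r} =
    (if ends r then if r (Suc 0) = None then {c \<in> isolated. fin_reading [lam c] = r} else {c \<in> opens. R J c = r}
     else {c \<in> immortals J. R J c = r})"
proof (intro equalityI subsetI)
  fix c assume "c \<in> {c \<in> C. E J c \<and> R J c = r}"
  then have c: "c \<in> C" "E J c" "R J c = r" by auto
  show "c \<in> (if ends r then if r (Suc 0) = None then {c \<in> isolated. fin_reading [lam c] = r} else {c \<in> opens. R J c = r}
     else {c \<in> immortals J. R J c = r})"
  proof (cases "ends r")
    case True
    then have nB: "c \<notin> B" using E_ends[of J c] c by simp
    show ?thesis
    proof (cases "r (Suc 0) = None")
      case T1: True
      then have "c \<in> isolated" using R_1[of J c] c nB by (simp add: isolated_def)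
      then show ?thesis using R_isolated[of c J] c T1 True by simp
    next
      case False
      then show ?thesis using R_1[of J c] c nB True by (simp add: opens_def del: not_None_eq)
    qed
  next
    case False
    then show ?thesis using c immortals_ends[of c J] by simp
  qed
next
  fix c assume a: "c \<in> (if ends r then if r (Suc 0) = None then {c \<in> isolated. fin_reading [lam c] = r} else {c \<in> opens. R J c = r}
     else {c \<in> immortals J. R J c = r})"
  show "c \<in> {c \<in> C. E J c \<and> R J c = r}"
  proof (cases "ends r")
    case True
    show ?thesis
    proof (cases "r (Suc 0) = None")
      case T1: True
      then have "c \<in> isolated" "fin_reading [lam c] = r" using a True by simp_all
      then show ?thesis using R_isolated[of c J] by (simp add: isolated_def E_def)
    next
      case False
      then show ?thesis using a True by (simp add: opens_def E_def del: not_None_eq)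
    qed
  next
    case False
    then show ?thesis using a by (simp add: immortals_def E_def)
  qed
qed

definition count_open :: "(cell \<Rightarrow> cell) \<Rightarrow> word \<Rightarrow> nat" where
  "count_open J w = card {c \<in> opens. word_of (R J c) = w}"

definition count_closed :: "(cell \<Rightarrow> cell) \<Rightarrow> word \<Rightarrow> nat" where
  "count_closed J w = card {c \<in> immortals J. word_of (R J c) = w}"

text \<open>If the word determines the reading through \<Phi>, the cells with a given word are the
  cells with a given reading or there are none, and conversely. The case distinctions handle words
  and readings that do not arise from each other.\<close>

lemma decode_counts:
  assumes "\<And>c. c \<in> X \<Longrightarrow> R J c = \<Phi> (word_of (R J c))"
  shows "{c \<in> X. word_of (R J c) = w} = (if word_of (\<Phi> w) = w then {c \<in> X. R J c = \<Phi> w} else {})"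
    and "{c \<in> X. R J c = r} = (if \<Phi> (word_of r) = r then {c \<in> X. word_of (R J c) = word_of r} else {})"
proof -
  have 1: "R J c = \<Phi> w \<and> word_of (\<Phi> w) = w" if "c \<in> X" "word_of (R J c) = w" for c
  proof -
    have e: "R J c = \<Phi> w" using assms[OF that(1)] unfolding that(2) .
    have "word_of (\<Phi> w) = w" using that(2) unfolding e .
    with e show ?thesis by (rule conjI)
  qed
  show "{c \<in> X. word_of (R J c) = w} = (if word_of (\<Phi> w) = w then {c \<in> X. R J c = \<Phi> w} else {})"
  proof (cases "word_of (\<Phi> w) = w")
    case True
    have "{c \<in> X. word_of (R J c) = w} = {c \<in> X. R J c = \<Phi> w}"
    proof (intro equalityI subsetI)
      fix c assume "c \<in> {c \<in> X. R J c = \<Phi> w}"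
      then have c: "c \<in> X" "R J c = \<Phi> w" by blast+
      have "word_of (R J c) = w" unfolding c(2) by (rule True)
      then show "c \<in> {c \<in> X. word_of (R J c) = w}" using c(1) by blast
    qed (use 1 in blast)
    then show ?thesis using True by (simp only: if_True refl)
  next
    case False
    then have "{c \<in> X. word_of (R J c) = w} = {}" using 1 by blast
    then show ?thesis using False by (simp only: if_False)
  qed
  have 2: "\<Phi> (word_of r) = r" if "c \<in> X" "R J c = r" for c using assms[OF that(1)] unfolding that(2) by (rule sym)
  have 3: "R J c = r" if "c \<in> X" "word_of (R J c) = word_of r" "\<Phi> (word_of r) = r" for c
    using assms[OF that(1)] unfolding that(2,3) .
  show "{c \<in> X. R J c = r} = (if \<Phi> (word_of r) = r then {c \<in> X. word_of (R J c) = word_of r} else {})"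
  proof (cases "\<Phi> (word_of r) = r")
    case True
    have "{c \<in> X. R J c = r} = {c \<in> X. word_of (R J c) = word_of r}"
    proof (intro equalityI subsetI)
      fix c assume "c \<in> {c \<in> X. word_of (R J c) = word_of r}"
      then show "c \<in> {c \<in> X. R J c = r}" using 3[OF _ _ True] by blast
    qed simp
    then show ?thesis using True by (simp only: if_True refl)
  next
    case False
    then have "{c \<in> X. R J c = r} = {}" using 2 by blast
    then show ?thesis using False by (simp only: if_False)
  qed
qed

lemma R_opens: "J \<in> joinings \<Longrightarrow> c \<in> opens \<Longrightarrow> R J c = fin_reading (word_of (R J c))"
  by (rule R_outer) (auto simp: opens_def)

lemma opens_reading:
  assumes "J \<in> joinings" "c \<in> opens"
  shows "ends (R J c) \<and> R J c (Suc 0) \<noteq> None"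
proof -
  have c: "c \<in> C" "c \<notin> B" "th c \<in> B" using assms(2) by (simp_all add: opens_def)
  show ?thesis using outer_ends[OF assms(1) c(1,2)] R_1[of J c] c(3) by (simp del: not_None_eq)
qed

lemma decode_opens:
  assumes J: "J \<in> joinings"
  shows "{c \<in> opens. word_of (R J c) = w} = (if word_of (fin_reading w) = w then {c \<in> opens. R J c = fin_reading w} else {})"
    and "{c \<in> opens. R J c = r} = (if fin_reading (word_of r) = r then {c \<in> opens. word_of (R J c) = word_of r} else {})"
  by (rule decode_counts; rule R_opens[OF J]; assumption)+

lemma decode_immortals:
  assumes J: "J \<in> joinings"
  shows "{c \<in> immortals J. word_of (R J c) = w} = (if word_of (per_reading w) = w then {c \<in> immortals J. R J c = per_reading w} else {})"
    and "{c \<in> immortals J. R J c = r} = (if per_reading (word_of r) = r then {c \<in> immortals J. word_of (R J c) = word_of r} else {})"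
  by (rule decode_counts; rule R_immortal[OF J]; assumption)+

text \<open>Isolated arrows have the same one-letter readings for all joinings, so only open and
  closed strings are left to compare, and there words and readings determine each other.\<close>

lemma same_iff_counts:
  assumes J: "J \<in> joinings" and J': "J' \<in> joinings"
  shows "same J J' \<longleftrightarrow> count_open J = count_open J' \<and> count_closed J = count_closed J'"
proof
  assume c: "count_open J = count_open J' \<and> count_closed J = count_closed J'"
  note co = c[THEN conjunct1, THEN fun_cong, unfolded count_open_def]
  note cc = c[THEN conjunct2, THEN fun_cong, unfolded count_closed_def]
  have op: "card {c \<in> opens. R J c = r} = card {c \<in> opens. R J' c = r}" for r
    unfolding decode_opens(2)[OF J] decode_opens(2)[OF J']
    by (cases "fin_reading (word_of r) = r") (simp_all only: if_True if_False refl co)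
  have im: "card {c \<in> immortals J. R J c = r} = card {c \<in> immortals J'. R J' c = r}" for r
    unfolding decode_immortals(2)[OF J]
      decode_immortals(2)[OF J']
    by (cases "per_reading (word_of r) = r") (simp_all only: if_True if_False refl cc)
  show "same J J'" unfolding same_def
  proof
    fix r
    show "card {c \<in> C. E J c \<and> R J c = r} = card {c \<in> C. E J' c \<and> R J' c = r}"
      unfolding E_cases[OF J] E_cases[OF J'] using op[of r] im[of r]
      by (cases "ends r"; cases "r (Suc 0) = None") (simp_all del: not_None_eq)
  qed
next
  assume "same J J'"
  then have s: "card {c \<in> C. E J c \<and> R J c = r} = card {c \<in> C. E J' c \<and> R J' c = r}" for r unfolding same_def by blast
  have im: "card {c \<in> immortals J. R J c = r} = card {c \<in> immortals J'. R J' c = r}" for r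
  proof (cases "ends r")
    case True
    then have "{c \<in> immortals J. R J c = r} = {}" "{c \<in> immortals J'. R J' c = r} = {}"
      using immortals_ends by blast+
    then show ?thesis by (simp only:)
  next
    case False
    then show ?thesis using s[of r] unfolding E_cases[OF J] E_cases[OF J'] by simp
  qed
  have op: "card {c \<in> opens. R J c = r} = card {c \<in> opens. R J' c = r}" for r
  proof (cases "ends r \<and> r (Suc 0) \<noteq> None")
    case False
    have "{c \<in> opens. R J c = r} = {}" "{c \<in> opens. R J' c = r} = {}"
      using opens_reading[OF J] opens_reading[OF J'] False by blast+
    then show ?thesis by (simp only:)
  next
    case True
    then show ?thesis using s[of r] unfolding E_cases[OF J] E_cases[OF J'] by (simp del: not_None_eq)
  qed
  have "count_open J w = count_open J' w" for w
    unfolding count_open_def decode_opens(1)[OF J]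
      decode_opens(1)[OF J'] by (cases "word_of (fin_reading w) = w") (simp_all only: if_True if_False refl op)
  moreover have "count_closed J w = count_closed J' w" for w
    unfolding count_closed_def decode_immortals(1)[OF J]
      decode_immortals(1)[OF J'] by (cases "word_of (per_reading w) = w") (simp_all only: if_True if_False refl im)
  ultimately show "count_open J = count_open J' \<and> count_closed J = count_closed J'" by (simp add: fun_eq_iff)
qed

end

section \<open>Words up to rotation and transposition\<close>

lemma rotate_back: "\<exists>j. \<forall>u. length u = L \<longrightarrow> rotate j (rotate i u) = u"
proof (intro exI allI impI)
  fix u :: "'b list" assume L: "length u = L"
  show "rotate (L * i - i) (rotate i u) = u"
  proof (cases L)
    case (Suc l)
    have "rotate (L * i - i) (rotate i u) = rotate (L * i) u" unfolding rotate_rotate by (simp add: Suc add.commute)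
    also have "\<dots> = u" by (rule rotate_id) (simp add: L)
    finally show ?thesis .
  qed (use L in simp)
qed

lemma word_transp_rotate: "word_transp tr u = rotate i (word_transp tr (rotate i u))"
proof (induction i)
  case (Suc i)
  have 1: "word_transp tr v = rotate1 (word_transp tr (rotate1 v))" for v by (cases v) (simp_all add: word_transp_def)
  have "rotate (Suc i) (word_transp tr (rotate (Suc i) u)) = rotate i (rotate1 (word_transp tr (rotate1 (rotate i u))))"
    by (simp add: rotate1_rotate_swap)
  also have "\<dots> = rotate i (word_transp tr (rotate i u))" by (simp only: 1[of "rotate i u", symmetric])
  finally show ?case by (rule trans[OF Suc.IH sym])
qed simp

lemma length_word_transp [simp]: "length (word_transp tr u) = length u"
  by (simp add: word_transp_def)

lemma word_transp_rotate_ex: "\<exists>j. word_transp tr (rotate i u) = rotate j (word_transp tr u)"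
proof -
  obtain j where j: "\<And>v :: 'a list. length v = length u \<Longrightarrow> rotate j (rotate i v) = v"
    using rotate_back[of "length u" i] by blast
  have "rotate j (word_transp tr u) = rotate j (rotate i (word_transp tr (rotate i u)))"
    by (simp only: word_transp_rotate[of tr u i, symmetric])
  also have "\<dots> = word_transp tr (rotate i u)" by (rule j) simp
  finally show ?thesis by (intro exI) (rule sym)
qed

text \<open>Reversal turns a rotation into a rotation the other way, so transposition can always be
  performed first. This normal form makes transitivity and the treatment of paths simple.\<close>

lemma eq_ct_iff:
  assumes tr: "\<And>x. tr (tr x) = x"
  shows "eq_ct tr u v \<longleftrightarrow> (\<exists>i. v = rotate i u) \<or> (\<exists>i. v = rotate i (word_transp tr u))"
proof
  assume "eq_ct tr u v"
  then obtain i where "eq_t tr (rotate i u) v" unfolding eq_ct_def by blast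
  then have "v = rotate i u \<or> v = word_transp tr (rotate i u)" by (simp only: eq_t_iff[OF tr])
  then show "(\<exists>i. v = rotate i u) \<or> (\<exists>i. v = rotate i (word_transp tr u))"
    using word_transp_rotate_ex[of tr i u] by blast
next
  assume "(\<exists>i. v = rotate i u) \<or> (\<exists>i. v = rotate i (word_transp tr u))"
  then show "eq_ct tr u v"
  proof
    assume "\<exists>i. v = rotate i u"
    then show ?thesis by (auto simp: eq_ct_def eq_t_def)
  next
    assume "\<exists>i. v = rotate i (word_transp tr u)"
    then obtain i where i: "v = rotate i (word_transp tr u)" by blast
    obtain j where j: "\<And>v :: 'a list. length v = length u \<Longrightarrow> rotate j (rotate i v) = v"
      using rotate_back[of "length u" i] by blast
    have "v = rotate i (rotate j (word_transp tr (rotate j u)))"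
      unfolding i by (simp only: word_transp_rotate[of tr u j, symmetric])
    also have "\<dots> = rotate j (rotate i (word_transp tr (rotate j u)))" by (simp add: rotate_rotate add.commute)
    also have "\<dots> = word_transp tr (rotate j u)" by (rule j) simp
    finally show ?thesis unfolding eq_ct_def eq_t_iff[OF tr] by blast
  qed
qed

lemma eq_ct_refl: "eq_ct tr u u"
  unfolding eq_ct_def by (rule exI[of _ 0]) (simp add: eq_t_def)

lemma eq_ct_sym:
  assumes tr: "\<And>x. tr (tr x) = x" and uv: "eq_ct tr u v"
  shows "eq_ct tr v u"
  using uv unfolding eq_ct_iff[OF tr, of u v]
proof (elim disjE exE)
  fix i assume v: "v = rotate i u"
  obtain j where j: "\<And>v :: 'a list. length v = length u \<Longrightarrow> rotate j (rotate i v) = v"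
    using rotate_back[of "length u" i] by blast
  have "u = rotate j v" unfolding v using j[of u] by simp
  then show ?thesis unfolding eq_ct_iff[OF tr] by blast
next
  fix i assume v: "v = rotate i (word_transp tr u)"
  have "word_transp tr (word_transp tr u) = rotate i (word_transp tr v)" unfolding v by (rule word_transp_rotate)
  then have "u = rotate i (word_transp tr v)" by (simp only: word_transp_invol[OF tr])
  then show ?thesis unfolding eq_ct_iff[OF tr] by blast
qed

lemma eq_ct_trans:
  assumes tr: "\<And>x. tr (tr x) = x" and uv: "eq_ct tr u v" and vw: "eq_ct tr v w"
  shows "eq_ct tr u w"
proof -
  have "\<exists>i. w = rotate i u \<or> w = rotate i (word_transp tr u)"
    using uv[unfolded eq_ct_iff[OF tr]] vw[unfolded eq_ct_iff[OF tr]]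
  proof (elim disjE exE)
    fix i k assume v: "v = rotate i u" "w = rotate k (word_transp tr v)"
    obtain j where "word_transp tr (rotate i u) = rotate j (word_transp tr u)" using word_transp_rotate_ex by blast
    then have "w = rotate (k + j) (word_transp tr u)" by (simp add: v rotate_rotate)
    then show ?thesis by blast
  next
    fix i k assume v: "v = rotate i (word_transp tr u)" "w = rotate k (word_transp tr v)"
    obtain j where "word_transp tr (rotate i (word_transp tr u)) = rotate j (word_transp tr (word_transp tr u))"
      using word_transp_rotate_ex by blast
    then have "w = rotate (k + j) u" by (simp add: v rotate_rotate word_transp_invol[OF tr])
    then show ?thesis by blast
  next
    fix i k assume "v = rotate i u" "w = rotate k v"
    then have "w = rotate (k + i) u" by (simp add: rotate_rotate)
    then show ?thesis by blast
  next
    fix i k assume "v = rotate i (word_transp tr u)" "w = rotate k v"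
    then have "w = rotate (k + i) (word_transp tr u)" by (simp add: rotate_rotate)
    then show ?thesis by blast
  qed
  then show ?thesis unfolding eq_ct_iff[OF tr] by blast
qed

lemma eq_t_sym: "(\<And>x. tr (tr x) = x) \<Longrightarrow> eq_t tr u v \<Longrightarrow> eq_t tr v u"
  using eq_t_iff[of tr u v] by (auto simp: eq_t_def)

lemma eq_t_trans:
  assumes tr: "\<And>x. tr (tr x) = x" and "eq_t tr u v" "eq_t tr v w"
  shows "eq_t tr u w"
  using assms(2,3) unfolding eq_t_def by (auto simp: word_transp_invol[OF tr])

section \<open>Counting equivalence classes\<close>

definition equivalence :: "('b \<Rightarrow> 'b \<Rightarrow> bool) \<Rightarrow> bool" where
  "equivalence S \<longleftrightarrow> (\<forall>x. S x x) \<and> (\<forall>x y. S x y \<longrightarrow> S y x) \<and> (\<forall>x y z. S x y \<longrightarrow> S y z \<longrightarrow> S x z)"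

lemma equivalenceD:
  assumes "equivalence S"
  shows "S x x" "S x y \<Longrightarrow> S y x" "S x y \<Longrightarrow> S y z \<Longrightarrow> S x z"
  using assms unfolding equivalence_def by blast+

lemma equivalence_eq_t:
  assumes tr: "\<And>x. tr (tr x) = x"
  shows "equivalence (eq_t tr)"
  unfolding equivalence_def
proof (intro conjI allI impI)
  show "eq_t tr u u" for u by (simp add: eq_t_def)
  show "eq_t tr v u" if "eq_t tr u v" for u v by (rule eq_t_sym[OF tr that])
  show "eq_t tr u w" if "eq_t tr u v" "eq_t tr v w" for u v w by (rule eq_t_trans[OF tr that])
qed

lemma equivalence_eq_ct:
  assumes tr: "\<And>x. tr (tr x) = x"
  shows "equivalence (eq_ct tr)"
  unfolding equivalence_def
proof (intro conjI allI impI)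
  show "eq_ct tr u u" for u by (rule eq_ct_refl)
  show "eq_ct tr v u" if "eq_ct tr u v" for u v by (rule eq_ct_sym[OF tr that])
  show "eq_ct tr u w" if "eq_ct tr u v" "eq_ct tr v w" for u v w by (rule eq_ct_trans[OF tr that])
qed

lemma equivalence_class_eq: "equivalence S \<Longrightarrow> S x y \<Longrightarrow> S x = S y"
  unfolding equivalence_def by (intro ext iffI; blast)

text \<open>By \<open>up\<close> and \<open>uniq\<close>, a class whose words are equivalent to w
  contains exactly one element with the word w itself. So counting representatives up to equivalence
  of words becomes counting cells with an exact reading, and the factor for directions or rotations
  never appears.\<close>

lemma card_representatives:
  assumes S: "equivalence S" and S': "equivalence S'" and X: "A = \<pi> ` X"
    and reps: "representatives S A P"
    and compat: "\<And>p q. S p q \<Longrightarrow> S' (wd p) (wd q)"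
    and up: "\<And>x. x \<in> X \<Longrightarrow> S' w (wd (\<pi> x)) \<Longrightarrow> \<exists>y\<in>X. S (\<pi> x) (\<pi> y) \<and> wd (\<pi> y) = w"
    and uniq: "\<And>x y. x \<in> X \<Longrightarrow> y \<in> X \<Longrightarrow> wd (\<pi> x) = w \<Longrightarrow> wd (\<pi> y) = w \<Longrightarrow> S (\<pi> x) (\<pi> y) \<Longrightarrow> x = y"
  shows "card {p \<in> P. S' w (wd p)} = card {x \<in> X. wd (\<pi> x) = w}"
proof -
  define rep where "rep x = (THE p. p \<in> P \<and> S (\<pi> x) p)" for x
  have ex: "\<exists>!p. p \<in> P \<and> S (\<pi> x) p" if "x \<in> X" for x
    using reps X that unfolding representatives_def by blast
  have rep: "rep x \<in> P \<and> S (\<pi> x) (rep x)" if "x \<in> X" for x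
    unfolding rep_def by (rule theI'[OF ex[OF that]])
  have rep_eq: "rep x = p" if "x \<in> X" "p \<in> P" "S (\<pi> x) p" for x p
    unfolding rep_def by (rule the1_equality[OF ex[OF that(1)]]) (use that in blast)
  have "bij_betw rep {x \<in> X. wd (\<pi> x) = w} {p \<in> P. S' w (wd p)}"
    unfolding bij_betw_def
  proof (intro conjI equalityI subsetI)
    show "inj_on rep {x \<in> X. wd (\<pi> x) = w}"
    proof (rule inj_onI)
      fix x y assume x: "x \<in> {x \<in> X. wd (\<pi> x) = w}" and y: "y \<in> {x \<in> X. wd (\<pi> x) = w}" and e: "rep x = rep y"
      have "S (\<pi> x) (rep x)" "S (\<pi> y) (rep x)" using rep[of x] rep[of y] x y e by auto
      then have "S (\<pi> x) (\<pi> y)" using equivalenceD(3)[OF S, of "\<pi> x" "rep x" "\<pi> y"] equivalenceD(2)[OF S, of "\<pi> y" "rep x"] by blast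
      then show "x = y" using uniq[of x y] x y by blast
    qed
    fix p assume "p \<in> rep ` {x \<in> X. wd (\<pi> x) = w}"
    then obtain x where x: "x \<in> X" "wd (\<pi> x) = w" "p = rep x" by blast
    show "p \<in> {p \<in> P. S' w (wd p)}" using rep[OF x(1)] compat[of "\<pi> x" "rep x"] x by blast
  next
    fix p assume p: "p \<in> {p \<in> P. S' w (wd p)}"
    then have "p \<in> A" using reps unfolding representatives_def by blast
    then obtain x where x: "x \<in> X" "p = \<pi> x" using X by blast
    obtain y where y: "y \<in> X" "S (\<pi> x) (\<pi> y)" "wd (\<pi> y) = w" using up[OF x(1)] p x(2) by blast
    have "rep y = p" using rep_eq[OF y(1)] p equivalenceD(2)[OF S y(2)] x(2) by blast
    then show "p \<in> rep ` {x \<in> X. wd (\<pi> x) = w}" using y by blast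
  qed
  then show ?thesis by (rule bij_betw_same_card[symmetric])
qed

text \<open>The classes exhaust a multiset, so equal class sizes force equal sizes. Removing one
  whole class from both sides gives the induction, and \<open>mset_equiv\<close> reduces to its
  second clause.\<close>

lemma size_eq_of_classes:
  assumes S: "equivalence S"
  shows "(\<And>x. size (filter_mset (S x) M) = size (filter_mset (S x) N)) \<Longrightarrow> size M = size N"
proof (induction "size M" arbitrary: M N rule: less_induct)
  case less
  show ?case
  proof (cases "M = {#}")
    case True
    have "N = {#}"
    proof (rule ccontr)
      assume "N \<noteq> {#}"
      then obtain y where "y \<in># N" by blast
      then have "y \<in># filter_mset (S y) N" using equivalenceD(1)[OF S] by simp
      then have "size (filter_mset (S y) N) \<noteq> 0" by (metis size_eq_0_iff_empty empty_not_add_mset multi_member_split)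
      then show False using less.prems[of y] True by auto
    qed
    then show ?thesis using True by simp
  next
    case False
    then obtain x where x: "x \<in># M" by blast
    let ?f = "filter_mset (\<lambda>y. \<not> S x y)"
    have sz: "size K = size (filter_mset (S x) K) + size (?f K)" for K
      using multiset_partition[of K "S x"] by (metis size_union)
    have "x \<in># filter_mset (S x) M" using x equivalenceD(1)[OF S] by simp
    then have "size (filter_mset (S x) M) \<noteq> 0" by (metis size_eq_0_iff_empty empty_not_add_mset multi_member_split)
    then have lt: "size (?f M) < size M" using sz[of M] by linarith
    have "size (filter_mset (S y) (?f M)) = size (filter_mset (S y) (?f N))" for y
    proof (cases "S x y")
      case True
      have e: "S y = S x" by (rule equivalence_class_eq[OF S equivalenceD(2)[OF S True]])
      have "filter_mset (S y) (?f K) = {#}" for K unfolding e by (simp add: filter_filter_mset)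
      then show ?thesis by (simp only: size_empty)
    next
      case False
      then have "\<not> S x z" if "S y z" for z using equivalenceD(3)[OF S, of x z y] equivalenceD(2)[OF S that] by blast
      then have "filter_mset (S y) (?f K) = filter_mset (S y) K" for K
        unfolding filter_filter_mset by (intro filter_mset_cong refl) blast
      then show ?thesis by (simp only: less.prems[of y])
    qed
    from less.hyps[OF lt this] show ?thesis using sz[of M] sz[of N] less.prems[of x] by simp
  qed
qed

lemma mset_equiv_iff:
  assumes "equivalence S"
  shows "mset_equiv S M N \<longleftrightarrow> (\<forall>x. size (filter_mset (S x) M) = size (filter_mset (S x) N))"
proof
  assume c: "\<forall>x. size (filter_mset (S x) M) = size (filter_mset (S x) N)"
  have "size M = size N" by (rule size_eq_of_classes[OF assms]) (rule c[THEN spec])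
  with c show "mset_equiv S M N" unfolding mset_equiv_def by blast
qed (simp add: mset_equiv_def)

lemma size_filter_image: "finite P \<Longrightarrow> size (filter_mset Q (image_mset f (mset_set P))) = card {p \<in> P. Q (f p)}"
  by (simp add: filter_mset_image_mset)

lemma size_filter_mult:
  assumes "length \<beta> = length b"
  shows "size (filter_mset Q (mset_with_mult \<beta> b)) = (\<Sum>i<length b. if Q (b ! i) then \<beta> ! i else 0)"
  using assms
proof (induction \<beta> b rule: list_induct2)
  case (Cons x \<beta> y b)
  have "mset_with_mult (x # \<beta>) (y # b) = replicate_mset x y + mset_with_mult \<beta> b"
    by (simp add: mset_with_mult_def)
  moreover have "size (filter_mset Q (replicate_mset x y)) = (if Q y then x else 0)"
    by (induction x) simp_all
  ultimately show ?case using Cons.IH by (simp add: sum.lessThan_Suc_shift del: sum.lessThan_Suc cong: if_cong)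
qed (simp add: mset_with_mult_def)

lemma size_class_mult:
  assumes "length \<beta> = length b" and S: "equivalence S"
    and neq: "\<And>i j. i < j \<Longrightarrow> j < length b \<Longrightarrow> \<not> S (b ! i) (b ! j)"
  shows "j < length b \<Longrightarrow> S w (b ! j) \<Longrightarrow> size (filter_mset (S w) (mset_with_mult \<beta> b)) = \<beta> ! j"
    and "(\<And>j. j < length b \<Longrightarrow> \<not> S w (b ! j)) \<Longrightarrow> size (filter_mset (S w) (mset_with_mult \<beta> b)) = 0"
proof -
  show "size (filter_mset (S w) (mset_with_mult \<beta> b)) = \<beta> ! j" if j: "j < length b" "S w (b ! j)"
  proof -
    have iff: "S w (b ! i) \<longleftrightarrow> i = j" if i: "i < length b" for i
    proof
      assume w: "S w (b ! i)"
      have "S (b ! i) (b ! j)" by (rule equivalenceD(3)[OF S equivalenceD(2)[OF S w] j(2)])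
      moreover have "S (b ! j) (b ! i)" by (rule equivalenceD(3)[OF S equivalenceD(2)[OF S j(2)] w])
      ultimately show "i = j" using neq[of i j] neq[of j i] i j(1) by (cases i j rule: linorder_cases) blast+
    qed (use j in simp)
    have "(\<Sum>i<length b. if S w (b ! i) then \<beta> ! i else 0) = (\<Sum>i<length b. if i = j then \<beta> ! i else 0)"
      by (intro sum.cong refl) (simp add: iff)
    also have "\<dots> = \<beta> ! j" using j by simp
    finally show ?thesis by (simp only: size_filter_mult[OF assms(1)])
  qed
  show "size (filter_mset (S w) (mset_with_mult \<beta> b)) = 0" if "\<And>j. j < length b \<Longrightarrow> \<not> S w (b ! j)"
    unfolding size_filter_mult[OF assms(1)] by (rule sum.neutral) (use that in simp)
qed

lemma concat_replicate_rotate: "\<exists>v'. rotate i (concat (replicate k v)) = concat (replicate k v')"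
proof (induction i)
  case (Suc i)
  then obtain v' where v': "rotate i (concat (replicate k v)) = concat (replicate k v')" by blast
  have "\<exists>v''. rotate1 (concat (replicate k v')) = concat (replicate k v'')"
  proof (cases v')
    case (Cons a x)
    have r: "concat (replicate k (a # x)) @ [a] = a # concat (replicate k (x @ [a]))"
      by (induction k) simp_all
    show ?thesis
    proof (cases k)
      case (Suc k')
      have "rotate1 (concat (replicate k (a # x))) = x @ concat (replicate k' (a # x)) @ [a]" by (simp add: Suc)
      also have "concat (replicate k' (a # x)) @ [a] = a # concat (replicate k' (x @ [a]))" by (induction k') simp_all
      also have "x @ a # concat (replicate k' (x @ [a])) = concat (replicate k (x @ [a]))" by (simp add: Suc)
      finally show ?thesis unfolding Cons by blast
    qed (simp add: Cons)
  qed (auto intro!: exI[of _ "[]"])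
  then show ?case by (simp add: v')
qed auto

lemma word_transp_concat_replicate:
  "word_transp tr (concat (replicate k v)) = concat (replicate k (word_transp tr v))"
  by (simp add: word_transp_def rev_concat map_concat)

lemma primitive_eq_ct:
  assumes "eq_ct letter_transp u v" "primitive v"
  shows "primitive u"
  unfolding primitive_def
proof
  assume "\<exists>x k. 2 \<le> k \<and> u = concat (replicate k x)"
  then obtain x k where k: "2 \<le> k" "u = concat (replicate k x)" by blast
  have "\<exists>y. v = concat (replicate k y)"
    using assms(1) unfolding eq_ct_iff[OF letter_transp_invol] k(2) word_transp_concat_replicate
    using concat_replicate_rotate by blast
  then show False using assms(2) k(1) unfolding primitive_def by blast
qed

lemma eq_ct_path_word:
  assumes "eq_ct arrow_transp p q"
  shows "eq_ct letter_transp (path_word p) (path_word q)"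
proof -
  obtain i where "eq_t arrow_transp (rotate i p) q" using assms unfolding eq_ct_def by blast
  then have "rotate i p = q \<or> rotate i p = word_transp arrow_transp q" by (simp only: eq_t_def)
  then have "path_word (rotate i p) = path_word q \<or> path_word (rotate i p) = path_word (word_transp arrow_transp q)"
    by (elim disjE) simp_all
  then have "eq_t letter_transp (rotate i (path_word p)) (path_word q)"
    by (simp only: eq_t_def rotate_map path_word_transp)
  then show ?thesis unfolding eq_ct_def by blast
qed

section \<open>Reindexing and renumbering\<close>

lemma sum_PiE_reindex:
  assumes "bij_betw \<phi> A B"
  shows "(\<Sum>F\<in>Pi\<^sub>E A (\<lambda>x. E (\<phi> x)). \<Psi> F) = (\<Sum>F\<in>Pi\<^sub>E B E. \<Psi> (restrict (F \<circ> \<phi>) A))"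
proof (rule sum.reindex_bij_witness[where j = "\<lambda>F. restrict (F \<circ> inv_into A \<phi>) B"
        and i = "\<lambda>F. restrict (F \<circ> \<phi>) A"])
  have \<phi>: "\<phi> x \<in> B" "inv_into A \<phi> (\<phi> x) = x" if "x \<in> A" for x
    using assms that by (auto simp: bij_betw_def)
  have \<psi>: "inv_into A \<phi> y \<in> A" "\<phi> (inv_into A \<phi> y) = y" if "y \<in> B" for y
    using assms that by (auto simp: bij_betw_def inv_into_into f_inv_into_f)
  show i: "restrict (restrict (F \<circ> inv_into A \<phi>) B \<circ> \<phi>) A = F" if "F \<in> Pi\<^sub>E A (\<lambda>x. E (\<phi> x))" for F
  proof
    fix x show "restrict (restrict (F \<circ> inv_into A \<phi>) B \<circ> \<phi>) A x = F x"
      by (cases "x \<in> A") (simp_all add: \<phi> PiE_arb[OF that])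
  qed
  show "restrict (restrict (F \<circ> \<phi>) A \<circ> inv_into A \<phi>) B = F" if "F \<in> Pi\<^sub>E B E" for F
  proof
    fix y show "restrict (restrict (F \<circ> \<phi>) A \<circ> inv_into A \<phi>) B y = F y"
      by (cases "y \<in> B") (simp_all add: \<psi> PiE_arb[OF that])
  qed
  show "restrict (F \<circ> \<phi>) A \<in> Pi\<^sub>E A (\<lambda>x. E (\<phi> x))" if "F \<in> Pi\<^sub>E B E" for F
    using PiE_mem[OF that] \<phi>(1) by (intro restrict_PiE_iff[THEN iffD2] ballI) simp
  show "restrict (F \<circ> inv_into A \<phi>) B \<in> Pi\<^sub>E B E" if "F \<in> Pi\<^sub>E A (\<lambda>x. E (\<phi> x))" for F
  proof (intro restrict_PiE_iff[THEN iffD2] ballI)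
    fix y assume y: "y \<in> B"
    show "(F \<circ> inv_into A \<phi>) y \<in> E y" using PiE_mem[OF that \<psi>(1)[OF y]] \<psi>(2)[OF y] by simp
  qed
  show "\<Psi> (restrict (restrict (F \<circ> inv_into A \<phi>) B \<circ> \<phi>) A) = \<Psi> F" if "F \<in> Pi\<^sub>E A (\<lambda>x. E (\<phi> x))" for F
    by (simp only: i[OF that])
qed

lemma card_aut_bij:
  assumes f: "bij_betw f A A'" and gh: "\<And>x y. x \<in> A \<Longrightarrow> y \<in> A \<Longrightarrow> g (f x) = g (f y) \<longleftrightarrow> h x = h y"
  shows "card (aut A h) = card (aut A' g)"
proof -
  let ?F = "\<lambda>\<pi> x. if x \<in> A' then f (\<pi> (inv_into A f x)) else x"
  have bij: "bij_betw ?F {\<pi>. \<pi> permutes A} {\<pi>. \<pi> permutes A'}" by (rule bij_betw_permutations[OF f])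
  have fA: "f x \<in> A'" "inv_into A f (f x) = x" if "x \<in> A" for x using f that by (auto simp: bij_betw_def)
  have img: "A' = f ` A" using f by (simp add: bij_betw_def)
  have iff: "?F p \<in> aut A' g \<longleftrightarrow> p \<in> aut A h" if p: "p permutes A" for p
  proof -
    have "?F p permutes A'" using bij_betwE[OF bij] p by blast
    moreover have "(\<forall>y\<in>A'. g (?F p y) = g y) \<longleftrightarrow> (\<forall>x\<in>A. g (?F p (f x)) = g (f x))" unfolding img by simp
    moreover have "(\<forall>x\<in>A. g (?F p (f x)) = g (f x)) \<longleftrightarrow> (\<forall>x\<in>A. h (p x) = h x)"
    proof (rule ball_cong[OF refl])
      fix x assume x: "x \<in> A"
      have "p x \<in> A" using p x by (simp add: permutes_in_image)
      then show "(g (?F p (f x)) = g (f x)) = (h (p x) = h x)" using gh[OF _ x, of "p x"] fA[OF x] by simp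
    qed
    ultimately show ?thesis using p by (simp add: aut_def)
  qed
  have "bij_betw ?F (aut A h) (aut A' g)"
    unfolding bij_betw_def
  proof (intro conjI equalityI subsetI)
    show "inj_on ?F (aut A h)" by (rule inj_on_subset[OF bij_betw_imp_inj_on[OF bij]]) (simp add: aut_def Collect_mono)
    fix q assume "q \<in> ?F ` aut A h"
    then obtain p where p: "q = ?F p" "p \<in> aut A h" by (rule imageE)
    then have "p permutes A" by (simp add: aut_def)
    from iff[OF this] show "q \<in> aut A' g" unfolding p(1) using p(2) by (rule iffD2)
  next
    fix q assume q: "q \<in> aut A' g"
    then have "q \<in> {\<pi>. \<pi> permutes A'}" by (simp add: aut_def)
    then have "q \<in> ?F ` {\<pi>. \<pi> permutes A}" by (simp only: bij_betw_imp_surj_on[OF bij])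
    then obtain p where p: "q = ?F p" "p permutes A" by (elim imageE CollectE)
    have "p \<in> aut A h" using q unfolding p(1) by (rule iffD1[OF iff[OF p(2)]])
    then show "q \<in> ?F ` aut A h" unfolding p(1) by (rule imageI)
  qed
  then show ?thesis by (rule bij_betw_same_card)
qed

lemma card_below_less:
  assumes "i \<in> A" "i < (m::nat)"
  shows "card {j. j < i \<and> j \<in> A} < card {j. j < m \<and> j \<in> A}"
proof (rule psubset_card_mono)
  show "{j. j < i \<and> j \<in> A} \<subset> {j. j < m \<and> j \<in> A}" using assms by (intro psubsetI) auto
qed simp

text \<open>What makes \<open>renumber\<close> agree with \<open>tilde_dim\<close>: the new number
  of a column counts the remaining columns before it, which is its position in the shortened
  list.\<close>

lemma nths_nth_card:
  assumes "i \<in> A"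
  shows "i < length xs \<Longrightarrow> nths xs A ! card {j. j < i \<and> j \<in> A} = xs ! i"
proof (induction xs rule: rev_induct)
  case (snoc x xs)
  show ?case
  proof (cases "i < length xs")
    case True
    have "card {j. j < i \<and> j \<in> A} < length (nths xs A)" unfolding length_nths by (rule card_below_less[OF assms True])
    then show ?thesis using snoc.IH[OF True] True by (simp add: nths_append nth_append)
  next
    case False
    then have i: "i = length xs" using snoc.prems by simp
    show ?thesis using assms by (simp add: nths_append nth_append length_nths i)
  qed
qed simp

text \<open>The lexicographical order inherits strict linearity from r, and the number of
  predecessors grows strictly along it.\<close>

lemma word_index_inj:
  assumes r: "strict_linear_order r" and W: "finite W"
  shows "inj_on (word_index r W) W" "w \<in> W \<Longrightarrow> word_index r W w < card W"
proof -
  have tr: "trans (lexord r)" and tot: "total (lexord r)" and irr: "\<And>w. (w, w) \<notin> lexord r"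
    using r lexord_transI[of r] total_lexord[of r] lexord_irreflexive[of r]
    by (simp_all add: strict_linear_order_on_def irrefl_def)
  have less: "word_index r W v < word_index r W w" if vw: "v \<in> W" "(v, w) \<in> lexord r" for v w
    unfolding word_index_def
  proof (rule psubset_card_mono)
    have "u \<in> W \<and> (u, w) \<in> lexord r" if "u \<in> W \<and> (u, v) \<in> lexord r" for u
      using transD[OF tr, of u v w] that vw(2) by blast
    then show "{u \<in> W. (u, v) \<in> lexord r} \<subset> {u \<in> W. (u, w) \<in> lexord r}" using vw irr[of v] by blast
  qed (use W in simp)
  show "inj_on (word_index r W) W"
  proof (rule inj_onI, rule ccontr)
    fix v w assume vw: "v \<in> W" "w \<in> W" "word_index r W v = word_index r W w" "v \<noteq> w"
    have "(v, w) \<in> lexord r \<or> (w, v) \<in> lexord r" using tot vw(4) by (simp add: total_on_def)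
    then show False using less[OF vw(1), of w] less[OF vw(2), of v] vw(3) by linarith
  qed
  show "word_index r W w < card W" if "w \<in> W"
    unfolding word_index_def by (rule psubset_card_mono) (use W that irr[of w] in auto)
qed

section \<open>Compatibility with ring homomorphisms\<close>

lemma char_poly_nonsquare:
  assumes "dim_row A \<noteq> dim_col A"
  shows "char_poly A = 0"
proof -
  have "dim_row (char_poly_matrix A) \<noteq> dim_col (char_poly_matrix A)" using assms by (simp add: char_poly_matrix_def)
  then show ?thesis by (simp only: char_poly_def Determinant.det_def if_False)
qed

context comm_ring_hom
begin

lemma sigma_hom: "sigma k (map_mat hom A) = hom (sigma k A)"
proof (cases "dim_row A = dim_col A")
  case True
  then have A: "A \<in> carrier_mat (dim_row A) (dim_row A)" by (intro carrier_matI) simp_all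
  have c: "coeff (char_poly (map_mat hom A)) i = hom (coeff (char_poly A) i)" for i
    unfolding char_poly_hom[OF A] by (rule coeff_map_poly) (rule hom_zero)
  show ?thesis
  proof (cases "k = 0 \<or> \<not> k \<le> dim_row A")
    case True
    then show ?thesis by (elim disjE) (simp_all add: sigma_def)
  next
    case False
    then have "sigma k (map_mat hom A) = (- 1) ^ k * coeff (char_poly (map_mat hom A)) (dim_row A - k)"
      "sigma k A = (- 1) ^ k * coeff (char_poly A) (dim_row A - k)" by (simp_all add: sigma_def)
    then show ?thesis by (simp only: c hom_mult hom_power hom_uminus hom_one)
  qed
next
  case False
  \<comment> \<open>For a non-square matrix both characteristic polynomials are 0 by the convention
    for determinants, so both values of \<open>sigma\<close> are 0 unless k = 0, where they are
    1.\<close>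
  then have "char_poly A = 0" by (rule char_poly_nonsquare)
  moreover have "char_poly (map_mat hom A) = 0" by (rule char_poly_nonsquare) (use False in simp)
  ultimately show ?thesis by (simp add: sigma_def)
qed

lemma letter_mat_hom:
  "letter_index l < length Xs \<Longrightarrow> letter_mat (map (map_mat hom) Xs) l = map_mat hom (letter_mat Xs l)"
  by (cases l) (simp_all add: map_mat_transpose)

lemma word_mat_hom:
  "w \<in> words_over (length Xs) \<Longrightarrow> word_mat (map (map_mat hom) Xs) w = map_mat hom (word_mat Xs w)"
proof (induction w rule: induct_list012)
  case 1
  show ?case by (rule eq_matI) simp_all
next
  case (2 l)
  then show ?case by (simp add: letter_mat_hom words_over_def)
next
  case (3 l l' w)
  let ?A = "letter_mat Xs l" and ?B = "word_mat Xs (l' # w)"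
  have A: "letter_mat (map (map_mat hom) Xs) l = map_mat hom ?A" by (rule letter_mat_hom) (use "3.prems" in \<open>simp add: words_over_def\<close>)
  have B: "word_mat (map (map_mat hom) Xs) (l' # w) = map_mat hom ?B" by (rule "3.IH"(2)) (use "3.prems" in \<open>simp add: words_over_def\<close>)
  show ?case
  proof (cases "dim_col ?A = dim_row ?B")
    case True
    have c: "?A \<in> carrier_mat (dim_row ?A) (dim_row ?B)" "?B \<in> carrier_mat (dim_row ?B) (dim_col ?B)"
      by (intro carrier_matI refl True)+
    have "word_mat (map (map_mat hom) Xs) (l # l' # w) = map_mat hom ?A * map_mat hom ?B"
      by (simp only: word_mat.simps(3) Let_def A B index_map_mat(2,3) True simp_thms if_True)
    moreover have "word_mat Xs (l # l' # w) = ?A * ?B"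
      by (simp only: word_mat.simps(3) Let_def True simp_thms if_True)
    ultimately show ?thesis by (simp only: mat_hom_mult[OF c])
  next
    case False
    have z: "map_mat hom (0\<^sub>m (dim_row ?A) (dim_col ?B)) = 0\<^sub>m (dim_row ?A) (dim_col ?B)" by (rule eq_matI) simp_all
    have "word_mat (map (map_mat hom) Xs) (l # l' # w) = 0\<^sub>m (dim_row ?A) (dim_col ?B)"
      by (simp only: word_mat.simps(3) Let_def A B index_map_mat(2,3) False if_False)
    moreover have "word_mat Xs (l # l' # w) = 0\<^sub>m (dim_row ?A) (dim_col ?B)"
      by (simp only: word_mat.simps(3) Let_def False if_False)
    ultimately show ?thesis by (simp only: z)
  qed
qed

lemma bpf_hom:
  assumes T: "\<And>a. a \<in> T \<Longrightarrow> tail a \<in> cells ns \<and> head a \<in> cells ns \<and> label a < length Xs \<and>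
    Xs ! label a \<in> carrier_mat (ns ! tail_col a) (ns ! head_col a)"
  shows "bpf ns T (map (map_mat hom) Xs) = hom (bpf ns T Xs)"
  unfolding bpf_def hom_sum hom_mult hom_prod hom_of_int
proof (rule sum.cong[OF refl], rule arg_cong[where f = "(*) _"], rule prod.cong[OF refl])
  fix \<pi> a assume \<pi>: "\<pi> \<in> bpf_perms ns T" and a: "a \<in> T"
  have lt: "\<pi> (fst c) (snd c) < ns ! fst c" if c: "c \<in> cells ns" for c
  proof -
    have i: "fst c < length ns" "snd c < ns ! fst c" using c by (auto simp: cells_def)
    have "\<pi> \<in> (\<Pi>\<^sub>E i\<in>{..<length ns}. {p. p permutes {..<ns ! i}})" using \<pi> unfolding bpf_perms_def by (elim CollectE conjE)
    from PiE_mem[OF this lessThan_iff[THEN iffD2, OF i(1)]] have "\<pi> (fst c) permutes {..<ns ! fst c}" by (rule CollectD)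
    from permutes_in_image[OF this, of "snd c"] show ?thesis using i(2) by (simp only: lessThan_iff)
  qed
  note t1 = conjunct1[OF T[OF a]] and t2 = conjunct2[OF T[OF a]]
  note t = t1 conjunct1[OF t2] conjunct1[OF conjunct2[OF t2]] conjunct2[OF conjunct2[OF t2]]
  have e: "map (map_mat hom) Xs ! label a = map_mat hom (Xs ! label a)" by (rule nth_map[OF t(3)])
  show "map (map_mat hom) Xs ! label a $$ (\<pi> (tail_col a) (snd (tail a)), \<pi> (head_col a) (snd (head a))) =
    hom (Xs ! label a $$ (\<pi> (tail_col a) (snd (tail a)), \<pi> (head_col a) (snd (head a))))"
    unfolding e
  proof (rule index_map_mat(1))
    show "\<pi> (tail_col a) (snd (tail a)) < dim_row (Xs ! label a)" unfolding carrier_matD(1)[OF t(4)] by (rule lt[OF t(1)])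
    show "\<pi> (head_col a) (snd (head a)) < dim_col (Xs ! label a)" unfolding carrier_matD(2)[OF t(4)] by (rule lt[OF t(2)])
  qed
qed

end

section \<open>Columns and arrows of the smaller tableau\<close>

context tableau_cols
begin

lemma finite_opens: "finite opens"
  by (rule finite_subset[OF _ fin_C]) (auto simp: opens_def)

lemma finite_immortals: "finite (immortals F)"
  by (rule finite_subset[OF _ fin_C]) (auto simp: immortals_def)

lemma lam_index: "c \<in> C \<Longrightarrow> letter_index (lam c) < length Xs"
proof -
  assume c: "c \<in> C"
  have l: "label a < length Xs" if "a \<in> T" for a
  proof -
    have "label ` T = {..<length Xs}" using tab unfolding tableau_with_subst_def by (elim conjE)
    then show ?thesis using imageI[OF that, of label] by simp
  qed
  from c show ?thesis by (cases rule: cell_cases) (simp_all add: arr_T l)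
qed

definition rk :: "nat \<Rightarrow> nat" where
  "rk i = card {j. j < i \<and> j \<notin> {q1, q2}}"

lemma Oc_A: "i \<in> Oc \<longleftrightarrow> i < length ns \<and> i \<in> - {q1, q2}"
  by (auto simp: Oc_def)

lemma rk_A: "rk i = card {j. j < i \<and> j \<in> - {q1, q2}}"
  by (simp add: rk_def)

lemma rk_nth: "i \<in> Oc \<Longrightarrow> tilde_dim q1 q2 ns ! rk i = ns ! i"
  unfolding Oc_A rk_A tilde_dim_def by (elim conjE) (rule nths_nth_card)

lemma length_tilde_dim: "length (tilde_dim q1 q2 ns) = card Oc"
proof -
  have "{i. i < length ns \<and> i \<in> - {q1, q2}} = Oc" using Oc_A by blast
  then show ?thesis by (simp only: tilde_dim_def length_nths)
qed

lemma rk_less: "i \<in> Oc \<Longrightarrow> i < m \<Longrightarrow> rk i < rk m"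
  unfolding Oc_A rk_A by (elim conjE) (rule card_below_less)

lemma rk_bij: "bij_betw rk Oc {..<length (tilde_dim q1 q2 ns)}"
proof -
  have inj: "inj_on rk Oc"
  proof (rule inj_onI)
    fix i j assume ij: "i \<in> Oc" "j \<in> Oc" "rk i = rk j"
    show "i = j"
    proof (cases i j rule: linorder_cases)
      case less
      then show ?thesis using rk_less[OF ij(1) less] ij(3) by simp
    next
      case greater
      then show ?thesis using rk_less[OF ij(2) greater] ij(3) by simp
    qed
  qed
  have "rk i < length (tilde_dim q1 q2 ns)" if "i \<in> Oc" for i
    using that unfolding Oc_A rk_A tilde_dim_def length_nths by (elim conjE) (rule card_below_less)
  then have sub: "rk ` Oc \<subseteq> {..<length (tilde_dim q1 q2 ns)}" by blast
  have "rk ` Oc = {..<length (tilde_dim q1 q2 ns)}"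
    by (rule card_subset_eq[OF finite_lessThan sub]) (simp add: card_image[OF inj] length_tilde_dim)
  with inj show ?thesis by (simp add: bij_betw_def)
qed

abbreviation "ren \<equiv> renumber q1 q2"

lemma ren_eq: "ren c = (rk (fst c), snd c)"
  by (simp add: renumber_def rk_def)

lemma outer_Oc: "c \<in> C \<Longrightarrow> c \<notin> B \<Longrightarrow> fst c \<in> Oc"
  by (auto simp: Oc_def B_def cells_def)

lemma ren_inj:
  assumes "c \<in> C" "c \<notin> B" "d \<in> C" "d \<notin> B" "ren c = ren d"
  shows "c = d"
proof -
  have "rk (fst c) = rk (fst d)" "snd c = snd d" using assms(5) by (simp_all add: ren_eq)
  moreover have "fst c = fst d"
    by (rule inj_onD[OF bij_betw_imp_inj_on[OF rk_bij] calculation(1) outer_Oc[OF assms(1,2)] outer_Oc[OF assms(3,4)]])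
  ultimately show ?thesis by (simp add: prod_eq_iff)
qed

lemma ren_cells: "c \<in> C \<Longrightarrow> c \<notin> B \<Longrightarrow> ren c \<in> cells (tilde_dim q1 q2 ns)"
  using rk_nth[OF outer_Oc, of c] bij_betwE[OF rk_bij] outer_Oc[of c] by (cases c) (auto simp: ren_eq cells_def)

text \<open>Since \<open>rk\<close> numbers the outer columns consecutively, column permutations of
  the smaller tableau are families in \<open>Operms\<close>. The resulting expression is the
  open-string factor of \<open>sum_rho_U\<close>.\<close>

lemma bpf_full_tilde:
  fixes X :: "nat \<Rightarrow> 'a mat"
  assumes SP: "finite SP" "\<And>s. s \<in> SP \<Longrightarrow> s \<in> C \<and> s \<notin> B \<and> e s \<in> C \<and> e s \<notin> B"
    and t: "t = (\<lambda>s. Arrow (ren s) (ren (e s)) (l s)) ` SP"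
  shows "bpf_full (tilde_dim q1 q2 ns) t X =
    (\<Sum>\<pi>\<in>Operms. (\<Prod>i\<in>Oc. of_int (sign (\<pi> i))) * (\<Prod>s\<in>SP. X (l s) $$ (outer_value \<pi> s, outer_value \<pi> (e s))))"
proof -
  let ?L = "{..<length (tilde_dim q1 q2 ns)}"
  have O: "Operms = Pi\<^sub>E Oc (\<lambda>i. {p. p permutes {..<tilde_dim q1 q2 ns ! rk i}})"
    unfolding Operms_def by (rule PiE_cong) (simp only: rk_nth)
  have inj: "inj_on (\<lambda>s. Arrow (ren s) (ren (e s)) (l s)) SP"
    by (rule inj_onI) (use ren_inj SP(2) in blast)
  have aw: "arrow_weight X t (\<lambda>c. \<sigma> (fst c) (snd c)) =
      (\<Prod>s\<in>SP. X (l s) $$ (outer_value (restrict (\<sigma> \<circ> rk) Oc) s, outer_value (restrict (\<sigma> \<circ> rk) Oc) (e s)))" for \<sigma>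
    unfolding arrow_weight_def t prod.reindex[OF inj]
  proof (rule prod.cong[OF refl])
    fix s assume "s \<in> SP"
    then have "s \<in> C" "s \<notin> B" "e s \<in> C" "e s \<notin> B" using SP(2) by blast+
    then have "fst s \<in> Oc" "fst (e s) \<in> Oc" using outer_Oc by blast+
    then show "((\<lambda>a. X (label a) $$ (\<sigma> (fst (tail a)) (snd (tail a)), \<sigma> (fst (head a)) (snd (head a)))) \<circ>
        (\<lambda>s. Arrow (ren s) (ren (e s)) (l s))) s =
      X (l s) $$ (outer_value (restrict (\<sigma> \<circ> rk) Oc) s, outer_value (restrict (\<sigma> \<circ> rk) Oc) (e s))"
      by (simp add: ren_eq outer_value_def)
  qed
  have sg: "(\<Prod>i\<in>?L. of_int (sign (\<sigma> i))) = (\<Prod>i\<in>Oc. of_int (sign (restrict (\<sigma> \<circ> rk) Oc i)) :: 'a)" for \<sigma> :: "nat \<Rightarrow> nat \<Rightarrow> nat"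
  proof -
    have "(\<Prod>i\<in>?L. of_int (sign (\<sigma> i))) = (\<Prod>i\<in>Oc. of_int (sign (\<sigma> (rk i))) :: 'a)"
      by (rule prod.reindex_bij_betw[OF rk_bij, symmetric])
    also have "\<dots> = (\<Prod>i\<in>Oc. of_int (sign (restrict (\<sigma> \<circ> rk) Oc i)))" by (rule prod.cong[OF refl]) simp
    finally show ?thesis .
  qed
  show ?thesis unfolding bpf_full_def col_perms_def aw sg O
    by (rule sum_PiE_reindex[OF rk_bij, where E = "\<lambda>k. {p. p permutes {..<tilde_dim q1 q2 ns ! k}}", symmetric])
qed

section \<open>Paths of the permuted tableau as walks of a joining\<close>

abbreviation "ptab \<xi> \<equiv> permute_tableau q2 \<xi> T"

definition pc :: "(nat \<Rightarrow> nat) \<Rightarrow> cell \<Rightarrow> cell" where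
  "pc \<xi> = permute_cell q2 \<xi>"

text \<open>The arrow leaving c, drawn in the permuted tableau. Cells are always named by their
  place in the original tableau, so that all joinings act on one fixed set.\<close>

definition alpha :: "(nat \<Rightarrow> nat) \<Rightarrow> cell \<Rightarrow> letter arrow" where
  "alpha \<xi> c = Arrow (pc \<xi> c) (pc \<xi> (th c)) (lam c)"

definition pth :: "(nat \<Rightarrow> nat) \<Rightarrow> cell \<Rightarrow> nat \<Rightarrow> path" where
  "pth \<xi> c m = map (\<lambda>i. alpha \<xi> ((nx (jn \<xi>) ^^ i) c)) [0..<m]"

lemma alpha_simps [simp]: "tail (alpha \<xi> c) = pc \<xi> c" "head (alpha \<xi> c) = pc \<xi> (th c)" "label (alpha \<xi> c) = lam c"
  by (simp_all add: alpha_def)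

lemma fst_pc [simp]: "fst (pc \<xi> c) = fst c"
  by (simp add: pc_def permute_cell_def)

lemma pc_outer: "c \<in> C \<Longrightarrow> c \<notin> B \<Longrightarrow> pc \<xi> c = c"
  by (auto simp: pc_def permute_cell_def B_def prod_eq_iff)

lemma length_pth [simp]: "length (pth \<xi> c m) = m"
  by (simp add: pth_def)

lemma pth_nth: "i < m \<Longrightarrow> pth \<xi> c m ! i = alpha \<xi> ((nx (jn \<xi>) ^^ i) c)"
  by (simp add: pth_def)

lemma arrow_transp_alpha: "c \<in> C \<Longrightarrow> arrow_transp (alpha \<xi> c) = alpha \<xi> (th c)"
  by (simp add: alpha_def th_th lam_th)

lemma arrows_t_ptab: "arrows_t (ptab \<xi>) = alpha \<xi> ` C"
proof -
  let ?p = "\<lambda>a. Arrow (permute_cell q2 \<xi> (tail a)) (permute_cell q2 \<xi> (head a)) (label a)"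
  have 1: "letter_arrow (?p a) = alpha \<xi> (tail a)" "arrow_transp (letter_arrow (?p a)) = alpha \<xi> (head a)" if "a \<in> T" for a
    using arr_T[OF that] by (simp_all add: alpha_def pc_def letter_arrow_def)
  have "alpha \<xi> ` C = alpha \<xi> ` (tail ` T) \<union> alpha \<xi> ` (head ` T)"
  proof -
    have "C = tail ` T \<union> head ` T"
    proof (intro equalityI subsetI)
      fix c assume "c \<in> C"
      then show "c \<in> tail ` T \<union> head ` T" by (cases rule: cell_cases) auto
    next
      fix c assume "c \<in> tail ` T \<union> head ` T"
      then show "c \<in> C" using tableau_arrow[OF tab] by blast
    qed
    then show ?thesis by (simp add: image_Un)
  qed
  moreover have "letter_arrow ` ptab \<xi> = alpha \<xi> ` (tail ` T)"
    unfolding permute_tableau_def image_image by (rule image_cong[OF refl 1(1)])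
  moreover have "(arrow_transp \<circ> letter_arrow) ` ptab \<xi> = alpha \<xi> ` (head ` T)"
    unfolding permute_tableau_def image_image comp_def by (rule image_cong[OF refl 1(2)])
  ultimately show ?thesis by (simp only: arrows_t_def)
qed

context
  fixes \<xi> assumes \<xi>: "\<xi> permutes {..<n}"
begin

abbreviation "J \<equiv> jn \<xi>"

lemma J_in: "J \<in> joinings" by (rule jn_joinings[OF \<xi>])

lemma pc_inj: "pc \<xi> c = pc \<xi> d \<longleftrightarrow> c = d"
  using permutes_inj[OF \<xi>] by (auto simp: pc_def permute_cell_def prod_eq_iff inj_eq split: if_splits)

lemma alpha_inj: "alpha \<xi> c = alpha \<xi> d \<longleftrightarrow> c = d"
  using pc_inj by (auto simp: alpha_def)

text \<open>Permuting column \<open>q2\<close> by \<xi> moves the cell joined to row \<xi> k of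
  column \<open>q1\<close> into that row. Being in equal rows of the two columns is thus being
  partners under \<open>jn \<xi>\<close>.\<close>

lemma successive_alpha:
  assumes "c \<in> C" "d \<in> C"
  shows "successive q1 q2 (alpha \<xi> c) (alpha \<xi> d) \<longleftrightarrow> th c \<in> B \<and> d = nx J c"
proof -
  have B: "u \<in> B \<longleftrightarrow> fst u \<in> {q1, q2}" if "u \<in> C" for u using that by (simp add: B_def)
  obtain i k where ik: "th c = (i, k)" by (cases "th c")
  obtain j l where jl: "d = (j, l)" by (cases d)
  show ?thesis
  proof (cases "th c \<in> B")
    case True
    then have i: "i \<in> {q1, q2}" "k < n" by (simp_all only: ik B_iff)
    have iff: "k = \<xi> l \<longleftrightarrow> l = pinv \<xi> k" using permutes_inverses[OF \<xi>] by metis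
    show ?thesis
    proof (cases "i = q1")
      case iq: True
      have "nx J c = (q2, pinv \<xi> k)" using True by (simp add: nx_def jn_def ik iq)
      then show ?thesis using True iff q12 by (auto simp: successive_def ik jl iq pc_def permute_cell_def)
    next
      case False
      then have iq: "i = q2" using i by simp
      have "nx J c = (q1, \<xi> k)" using True q12 by (simp add: nx_def jn_def ik iq)
      then show ?thesis using True q12 by (auto simp: successive_def ik jl iq pc_def permute_cell_def)
    qed
  next
    case False
    then show ?thesis using B[OF th_in_C[OF assms(1)]] by (simp add: successive_def)
  qed
qed

lemma pow_C: "c \<in> C \<Longrightarrow> al J k c \<Longrightarrow> (nx J ^^ k) c \<in> C"
  by (rule nx_pow_C[OF J_in])

lemma is_path_pth:
  assumes c: "c \<in> C" and al: "al J m c"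
  shows "is_path q1 q2 (ptab \<xi>) (pth \<xi> c (Suc m))"
  unfolding is_path_def
proof (intro conjI allI impI)
  have C': "(nx J ^^ i) c \<in> C" if "i \<le> m" for i using pow_C[OF c al_mono[OF al that]] .
  show "pth \<xi> c (Suc m) \<noteq> []" by (simp add: pth_def)
  show "set (pth \<xi> c (Suc m)) \<subseteq> arrows_t (ptab \<xi>)"
    unfolding arrows_t_ptab pth_def using C' by (auto simp: less_Suc_eq_le simp del: upt_Suc)
  fix i assume i: "Suc i < length (pth \<xi> c (Suc m))"
  then have "al J (Suc i) c" using al_mono[OF al, of "Suc i"] by simp
  then have "th ((nx J ^^ i) c) \<in> B" by (simp add: al_Suc)
  then show "successive q1 q2 (pth \<xi> c (Suc m) ! i) (pth \<xi> c (Suc m) ! Suc i)"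
    using successive_alpha[OF C'[of i] C'[of "Suc i"]] i by (simp add: pth_nth)
qed

text \<open>A path has no choices after its first arrow: a cell is the tail of a single arrow or
  transposed arrow, and the joint decides where the path goes on.\<close>

lemma is_path_form:
  assumes p: "is_path q1 q2 (ptab \<xi>) p"
  obtains c m where "c \<in> C" "al J m c" "p = pth \<xi> c (Suc m)"
proof -
  have ne: "p \<noteq> []" and sub: "set p \<subseteq> alpha \<xi> ` C"
    and suc: "\<And>i. Suc i < length p \<Longrightarrow> successive q1 q2 (p ! i) (p ! Suc i)"
    using p unfolding is_path_def arrows_t_ptab by auto
  obtain m where m: "length p = Suc m" using ne by (cases p) auto
  have "p ! 0 \<in> alpha \<xi> ` C" using sub m nth_mem[of 0 p] by auto
  then obtain c where c: "c \<in> C" "p ! 0 = alpha \<xi> c" by blast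
  have ind: "al J i c \<and> p ! i = alpha \<xi> ((nx J ^^ i) c)" if "i \<le> m" for i
    using that
  proof (induction i)
    case (Suc i)
    then have IH: "al J i c" "p ! i = alpha \<xi> ((nx J ^^ i) c)" by simp_all
    have "p ! Suc i \<in> alpha \<xi> ` C" using sub m Suc.prems nth_mem[of "Suc i" p] by auto
    then obtain d where d: "d \<in> C" "p ! Suc i = alpha \<xi> d" by blast
    have "successive q1 q2 (alpha \<xi> ((nx J ^^ i) c)) (alpha \<xi> d)" using suc[of i] Suc.prems m IH(2) d(2) by simp
    then show ?case using successive_alpha[OF pow_C[OF c(1) IH(1)] d(1)] IH(1) d(2) by (simp add: al_Suc)
  qed (simp add: c)
  have "p = pth \<xi> c (Suc m)"
    by (rule nth_equalityI) (use m ind in \<open>simp_all add: pth_nth\<close>)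
  moreover have "al J m c" using ind[of m] by blast
  ultimately show thesis using that[OF c(1), of m] by blast
qed

lemma hd_pth: "hd (pth \<xi> c (Suc m)) = alpha \<xi> c"
  by (simp add: pth_def hd_map del: upt_Suc)

lemma last_pth: "last (pth \<xi> c (Suc m)) = alpha \<xi> ((nx J ^^ m) c)"
  by (simp add: pth_def)

lemma pth_tail: "path_tail (pth \<xi> c (Suc m)) = pc \<xi> c"
  by (simp add: pth_def hd_map del: upt_Suc)

lemma pth_head: "path_head (pth \<xi> c (Suc m)) = pc \<xi> (th ((nx J ^^ m) c))"
  by (simp add: pth_def)

lemma path_word_pth: "path_word (pth \<xi> c m) = map (\<lambda>i. lam ((nx J ^^ i) c)) [0..<m]"
  by (simp add: pth_def)

lemma path_word_len:
  assumes "\<And>i. i < len (R J c) \<Longrightarrow> al J i c"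
  shows "path_word (pth \<xi> c (len (R J c))) = word_of (R J c)"
  unfolding path_word_pth word_of_def using assms by (simp add: R_def)

definition opath :: "cell \<Rightarrow> path" where
  "opath c = pth \<xi> c (len (R J c))"

lemma opath_word: "c \<in> opens \<Longrightarrow> path_word (opath c) = word_of (R J c)"
  unfolding opath_def by (rule path_word_len) (use len_outer(2)[OF J_in] in \<open>auto simp: opens_def\<close>)

lemma len_opens:
  assumes "c \<in> opens"
  obtains m where "len (R J c) = Suc (Suc m)" "al J (Suc m) c" "th ((nx J ^^ Suc m) c) \<notin> B"
proof -
  have c: "c \<in> C" "c \<notin> B" "th c \<in> B" using assms by (auto simp: opens_def)
  note l = len_outer[OF J_in c(1,2)]
  have "al J (Suc 0) c" using c(3) by (simp add: al_Suc)
  then have "Suc 0 < len (R J c)" using l(2)[of "Suc 0"] by simp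
  then obtain m where m: "len (R J c) = Suc (Suc m)" using less_imp_Suc_add[of "Suc 0" "len (R J c)"] by auto
  have a: "al J (Suc m) c" "\<not> al J (Suc (Suc m)) c" using l(2)[of "Suc m"] l(2)[of "Suc (Suc m)"] m by linarith+
  then have "th ((nx J ^^ Suc m) c) \<notin> B" using al_Suc[of J "Suc m" c] by blast
  then show thesis by (rule that[OF m a(1)])
qed

lemma opath_tail:
  assumes "c \<in> opens"
  shows "path_tail (opath c) = c"
proof -
  obtain m where m: "len (R J c) = Suc (Suc m)" using assms by (rule len_opens)
  have "c \<in> C" "c \<notin> B" using assms by (simp_all add: opens_def)
  then show ?thesis unfolding opath_def m pth_tail by (rule pc_outer)
qed

lemma opath_head:
  assumes "c \<in> opens"
  shows "path_head (opath c) = end_cell J c"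
proof -
  obtain m where m: "len (R J c) = Suc (Suc m)" "al J (Suc m) c" "th ((nx J ^^ Suc m) c) \<notin> B" using assms by (rule len_opens)
  have "c \<in> C" using assms by (simp add: opens_def)
  then have "th ((nx J ^^ Suc m) c) \<in> C" by (rule th_in_C[OF pow_C[OF _ m(2)]])
  from pc_outer[OF this m(3)] show ?thesis unfolding opath_def end_cell_def m(1) pth_head by simp
qed

lemma open_path_iff: "open_path q1 q2 (ptab \<xi>) p \<longleftrightarrow> (\<exists>c\<in>opens. p = opath c)"
proof
  assume p: "open_path q1 q2 (ptab \<xi>) p"
  then have ip: "is_path q1 q2 (ptab \<xi>) p" by (simp add: open_path_def)
  obtain c m where c: "c \<in> C" "al J m c" "p = pth \<xi> c (Suc m)" using is_path_form[OF ip] .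
  have pp: "2 \<le> Suc m" "fst c \<notin> {q1, q2}" "fst (th ((nx J ^^ m) c)) \<notin> {q1, q2}"
    using p unfolding open_path_def c(3) pth_tail pth_head by simp_all
  then have nB: "c \<notin> B" "th ((nx J ^^ m) c) \<notin> B" by (auto simp: B_def)
  have "al J 1 c" using c(2) by (rule al_mono) (use pp(1) in simp)
  then have o: "c \<in> opens" using c(1) nB by (simp add: opens_def al_Suc)
  have "\<not> al J (Suc m) c" using nB(2) by (simp add: al_Suc)
  then have "len (R J c) = Suc m" using c(2) len_outer(2)[OF J_in c(1) nB(1), of m] len_outer(2)[OF J_in c(1) nB(1), of "Suc m"] by linarith
  then have "p = opath c" using c(3) by (simp add: opath_def)
  with o show "\<exists>c\<in>opens. p = opath c" by blast
next
  assume "\<exists>c\<in>opens. p = opath c"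
  then obtain c where c: "c \<in> opens" "p = opath c" by blast
  obtain m where m: "len (R J c) = Suc (Suc m)" "al J (Suc m) c" "th ((nx J ^^ Suc m) c) \<notin> B" using c(1) by (rule len_opens)
  have cC: "c \<in> C" "c \<notin> B" using c(1) by (auto simp: opens_def)
  have e: "th ((nx J ^^ Suc m) c) \<in> C" using th_in_C[OF pow_C[OF cC(1) m(2)]] .
  show "open_path q1 q2 (ptab \<xi>) p"
    unfolding open_path_def c(2) opath_def m(1) pth_tail pth_head
    using is_path_pth[OF cC(1) m(2)] cC m(3) e by (simp add: B_def del: funpow.simps)
qed

definition cpath :: "cell \<Rightarrow> path" where
  "cpath c = pth \<xi> c (len (R J c))"

lemma cpath_word: "c \<in> immortals J \<Longrightarrow> path_word (cpath c) = word_of (R J c)"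
  unfolding cpath_def by (rule path_word_len) (simp add: immortals_def)

lemma immortal_of_period:
  assumes "c \<in> C" "al J m c" "(nx J ^^ m) c = c" "0 < m"
  shows "c \<in> immortals J"
proof -
  have "al J (k * m) c" for k
  proof (induction k)
    case (Suc k)
    then show ?case using al_add[of J m "k * m" c] assms by simp
  qed simp
  then have "al J k c" for k using al_mono[of J "k * m" c k] assms(4) by simp
  then show ?thesis using assms(1) by (simp add: immortals_def)
qed

text \<open>Traversing each arrow at most once amounts to stopping at the first return to c. An
  arrow can never be met again in the opposite direction, because the walk would then read the same
  forwards and backwards.\<close>

lemma closed_path_iff:
  "closed_path q1 q2 (ptab \<xi>) p \<longleftrightarrow>
    (\<exists>c\<in>immortals J. \<exists>m. p = pth \<xi> c (Suc m) \<and> (nx J ^^ Suc m) c = c \<and> (\<forall>i. 0 < i \<and> i \<le> m \<longrightarrow> (nx J ^^ i) c \<noteq> c))"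
proof
  assume p: "closed_path q1 q2 (ptab \<xi>) p"
  then have ip: "is_path q1 q2 (ptab \<xi>) p" by (simp add: closed_path_def)
  obtain c m where c: "c \<in> C" "al J m c" "p = pth \<xi> c (Suc m)" using is_path_form[OF ip] .
  have lst: "last p = alpha \<xi> ((nx J ^^ m) c)" and hd: "hd p = alpha \<xi> c"
    unfolding c(3) by (rule last_pth, rule hd_pth)
  have "successive q1 q2 (last p) (hd p)" using p by (simp add: closed_path_def)
  then have s: "th ((nx J ^^ m) c) \<in> B" "c = (nx J ^^ Suc m) c"
    unfolding lst hd using successive_alpha[OF pow_C[OF c(1,2)] c(1)] by simp_all
  have "c \<in> immortals J" by (rule immortal_of_period[of _ "Suc m"]) (use c s in \<open>simp_all add: al_Suc\<close>)
  moreover have "(nx J ^^ i) c \<noteq> c" if i: "0 < i" "i \<le> m" for i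
  proof -
    have "p ! 0 \<noteq> p ! i" using p i unfolding closed_path_def c(3) by simp
    then show ?thesis using i unfolding c(3) by (auto simp: pth_nth)
  qed
  ultimately show "\<exists>c\<in>immortals J. \<exists>m. p = pth \<xi> c (Suc m) \<and> (nx J ^^ Suc m) c = c \<and> (\<forall>i. 0 < i \<and> i \<le> m \<longrightarrow> (nx J ^^ i) c \<noteq> c)"
    using c(3) s(2)[symmetric] by blast
next
  assume "\<exists>c\<in>immortals J. \<exists>m. p = pth \<xi> c (Suc m) \<and> (nx J ^^ Suc m) c = c \<and> (\<forall>i. 0 < i \<and> i \<le> m \<longrightarrow> (nx J ^^ i) c \<noteq> c)"
  then obtain c m where c: "c \<in> immortals J" and p: "p = pth \<xi> c (Suc m)" and per: "(nx J ^^ Suc m) c = c"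
    and min: "\<And>i. 0 < i \<Longrightarrow> i \<le> m \<Longrightarrow> (nx J ^^ i) c \<noteq> c" by blast
  have cC: "c \<in> C" and im: "\<And>k. al J k c" using c by (auto simp: immortals_def)
  have lst: "last p = alpha \<xi> ((nx J ^^ m) c)" and hd: "hd p = alpha \<xi> c"
    unfolding p by (rule last_pth, rule hd_pth)
  have "al J (Suc m) c" by (rule im)
  then have "successive q1 q2 (last p) (hd p)"
    unfolding lst hd using successive_alpha[OF pow_C[OF cC im] cC] per by (simp add: al_Suc)
  moreover have "p ! i \<noteq> p ! j \<and> p ! i \<noteq> arrow_transp (p ! j)" if ij: "i < j" "j < length p" for i j
  proof
    have e: "p ! i = alpha \<xi> ((nx J ^^ i) c)" "p ! j = alpha \<xi> ((nx J ^^ j) c)" using ij unfolding p by (simp_all add: pth_nth)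
    show "p ! i \<noteq> p ! j"
    proof
      assume "p ! i = p ! j"
      then have "(nx J ^^ i) c = (nx J ^^ j) c" by (simp add: e alpha_inj)
      then have "c = (nx J ^^ (j - i)) c" using nx_pow_cancel[OF J_in cC cC im im, of i j] ij by simp
      moreover have "0 < j - i" "j - i \<le> m" using ij by (simp_all add: p)
      ultimately show False using min by metis
    qed
    show "p ! i \<noteq> arrow_transp (p ! j)"
    proof
      assume "p ! i = arrow_transp (p ! j)"
      then have "(nx J ^^ i) c = th ((nx J ^^ j) c)" by (simp add: e arrow_transp_alpha[OF pow_C[OF cC im]] alpha_inj)
      also have "(nx J ^^ j) c = (nx J ^^ (j - i)) ((nx J ^^ i) c)" using ij by (simp add: nx_add)
      \<comment> \<open>The later cell is the far end of the earlier arrow, so turning round would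
        give the reading of the starting cell once more.\<close>
      finally have "R J ((nx J ^^ i) c) = R J (th ((nx J ^^ (j - i)) ((nx J ^^ i) c)))" by (rule arg_cong[where f = "R J"])
      then show False using R_not_palindrome[OF J_in pow_C[OF cC im] al_pow_immortal[OF J_in im]] by blast
    qed
  qed
  ultimately show "closed_path q1 q2 (ptab \<xi>) p"
    using is_path_pth[OF cC im, of m] unfolding closed_path_def p by blast
qed

lemma closed_path_prim:
  assumes prim: "prim J"
  shows "closed_path q1 q2 (ptab \<xi>) p \<longleftrightarrow> (\<exists>c\<in>immortals J. p = cpath c)"
proof
  assume "closed_path q1 q2 (ptab \<xi>) p"
  then obtain c m where c: "c \<in> immortals J" "p = pth \<xi> c (Suc m)" "(nx J ^^ Suc m) c = c"
    and min: "\<And>i. 0 < i \<Longrightarrow> i \<le> m \<Longrightarrow> (nx J ^^ i) c \<noteq> c" unfolding closed_path_iff by blast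
  have cC: "c \<in> C" and im: "\<And>k. al J k c" using c(1) by (auto simp: immortals_def)
  note l = len_immortal[OF J_in cC im]
  have e: "(nx J ^^ len (R J c)) c = c" using prim cC im by (simp add: prim_def)
  have "len (R J c) \<le> Suc m" using l(3)[of "Suc m"] c(3) by simp
  moreover have "\<not> len (R J c) \<le> m" using min[OF l(1)] e by blast
  ultimately have "len (R J c) = Suc m" by simp
  then have "p = cpath c" using c(2) by (simp add: cpath_def)
  with c(1) show "\<exists>c\<in>immortals J. p = cpath c" by blast
next
  assume "\<exists>c\<in>immortals J. p = cpath c"
  then obtain c where c: "c \<in> immortals J" "p = cpath c" by blast
  have cC: "c \<in> C" and im: "\<And>k. al J k c" using c(1) by (auto simp: immortals_def)
  note l = len_immortal[OF J_in cC im]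
  obtain m where m: "len (R J c) = Suc m" using l(1) by (metis gr0_implies_Suc)
  have "(nx J ^^ Suc m) c = c" unfolding m[symmetric] using prim cC im by (simp add: prim_def)
  moreover have "(nx J ^^ i) c \<noteq> c" if "0 < i" "i \<le> m" for i using l(3)[of i] that m by auto
  ultimately show "closed_path q1 q2 (ptab \<xi>) p" unfolding closed_path_iff c(2) cpath_def m using c(1) by blast
qed

lemma transp_pth:
  assumes "c \<in> C" "al J m c"
  shows "word_transp arrow_transp (pth \<xi> c (Suc m)) = pth \<xi> (th ((nx J ^^ m) c)) (Suc m)"
proof (rule nth_equalityI)
  fix i assume "i < length (word_transp arrow_transp (pth \<xi> c (Suc m)))"
  then have i: "i \<le> m" by (simp add: word_transp_def)
  have a: "al J (m - i) c" using assms(2) by (rule al_mono) simp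
  have "word_transp arrow_transp (pth \<xi> c (Suc m)) ! i = arrow_transp (alpha \<xi> ((nx J ^^ (m - i)) c))"
    using i by (simp add: word_transp_def rev_nth pth_nth)
  also have "\<dots> = alpha \<xi> (th ((nx J ^^ (m - i)) c))" by (rule arrow_transp_alpha[OF pow_C[OF assms(1) a]])
  also have "\<dots> = pth \<xi> (th ((nx J ^^ m) c)) (Suc m) ! i"
    using nx_pow_rev[OF J_in assms i] i by (simp add: pth_nth)
  finally show "word_transp arrow_transp (pth \<xi> c (Suc m)) ! i = pth \<xi> (th ((nx J ^^ m) c)) (Suc m) ! i" .
qed (simp add: word_transp_def)

lemma rotate_pth:
  assumes "(nx J ^^ L) c = c"
  shows "rotate k (pth \<xi> c L) = pth \<xi> ((nx J ^^ k) c) L"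
proof (rule nth_equalityI)
  fix i assume "i < length (rotate k (pth \<xi> c L))"
  then have i: "i < L" by simp
  have "(nx J ^^ ((k + i) div L * L)) c = c" by (rule period_mult[OF J_in assms])
  then have "(nx J ^^ ((k + i) div L * L + (k + i) mod L)) c = (nx J ^^ ((k + i) mod L)) c"
    using nx_add[of "(k + i) mod L" J "(k + i) div L * L" c] by (simp only:)
  then have "(nx J ^^ ((k + i) mod L)) c = (nx J ^^ (k + i)) c" by (simp only: div_mult_mod_eq)
  then show "rotate k (pth \<xi> c L) ! i = pth \<xi> ((nx J ^^ k) c) L ! i"
    using i by (simp add: nth_rotate pth_nth nx_add)
qed simp

text \<open>Transposing an open path exchanges the two ends of its string. By
  \<open>R_not_palindrome\<close> the readings from both ends differ, and for open strings readings
  and words determine each other.\<close>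

lemma open_path_not_palindrome:
  assumes "c \<in> opens"
  shows "word_transp letter_transp (path_word (opath c)) \<noteq> path_word (opath c)" "word_transp arrow_transp (opath c) = opath (end_cell J c)"
    "end_cell J c \<in> opens" "end_cell J (end_cell J c) = c"
proof -
  obtain m where m: "len (R J c) = Suc (Suc m)" "al J (Suc m) c" "th ((nx J ^^ Suc m) c) \<notin> B" using assms by (rule len_opens)
  have c: "c \<in> C" "c \<notin> B" "th c \<in> B" using assms by (auto simp: opens_def)
  let ?e = "th ((nx J ^^ Suc m) c)"
  have e: "end_cell J c = ?e" by (simp add: end_cell_def m(1))
  have pC: "(nx J ^^ Suc m) c \<in> C" by (rule pow_C[OF c(1) m(2)])
  have eC: "?e \<in> C" by (rule th_in_C[OF pC])
  have pB: "(nx J ^^ Suc m) c \<in> B" by (rule nx_pow_B[OF J_in m(2)]) simp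
  have r: "(nx J ^^ Suc m) ?e = th c" "al J (Suc m) ?e" by (rule nx_pow_rev_all[OF J_in c(1) m(2)])+
  show eo: "end_cell J c \<in> opens" unfolding e opens_def using eC m(3) th_th[OF pC] pB by simp
  have "al J (Suc (Suc m)) ?e \<longleftrightarrow> al J (Suc m) ?e \<and> th ((nx J ^^ Suc m) ?e) \<in> B" by (rule al_Suc)
  then have n: "\<not> al J (Suc (Suc m)) ?e" unfolding r(1) th_th[OF c(1)] using c(2) by blast
  note l = len_outer(2)[OF J_in eC m(3)]
  have L: "len (R J ?e) = Suc (Suc m)" using l[of "Suc m"] l[of "Suc (Suc m)"] r(2) n by linarith
  show tr: "word_transp arrow_transp (opath c) = opath (end_cell J c)"
    unfolding opath_def m(1) transp_pth[OF c(1) m(2)] e L ..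
  have "end_cell J ?e = c" by (simp only: end_cell_def L diff_Suc_1 r(1) th_th[OF c(1)])
  then show "end_cell J (end_cell J c) = c" by (simp only: e)
  have "R J c \<noteq> R J ?e" by (rule R_not_palindrome[OF J_in c(1) m(2)])
  then have "word_of (R J (end_cell J c)) \<noteq> word_of (R J c)"
    using R_opens[OF J_in assms] R_opens[OF J_in eo] e by metis
  moreover have "word_transp letter_transp (path_word (opath c)) = path_word (opath (end_cell J c))"
    by (simp only: path_word_transp[symmetric] tr)
  ultimately show "word_transp letter_transp (path_word (opath c)) \<noteq> path_word (opath c)"
    by (simp only: opath_word[OF assms] opath_word[OF eo] not_False_eq_True)
qed

lemma pc_C: "c \<in> C \<Longrightarrow> pc \<xi> c \<in> C"
  using permutes_in_image[OF \<xi>, of "snd c"] nq2 by (cases c) (simp add: pc_def permute_cell_def cells_def, blast)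

lemma pc_surj: "pc \<xi> ` C = C"
proof (rule endo_inj_surj[OF fin_C])
  show "pc \<xi> ` C \<subseteq> C" by (rule image_subsetI) (rule pc_C)
  show "inj_on (pc \<xi>) C" by (rule inj_onI) (simp only: pc_inj)
qed

lemma tableau_ptab: "tableau_with_subst ns (ptab \<xi>) Xs"
proof -
  let ?f = "\<lambda>a. Arrow (pc \<xi> (tail a)) (pc \<xi> (head a)) (label a)"
  have P: "ptab \<xi> = ?f ` T" by (simp add: permute_tableau_def pc_def)
  note t = tab[unfolded tableau_with_subst_def]
  have ex: "\<exists>!a. a \<in> ?f ` T \<and> (tail a = c \<or> head a = c)" if "c \<in> C" for c
  proof -
    have "c \<in> pc \<xi> ` C" unfolding pc_surj by (rule that)
    then obtain d where d: "d \<in> C" "c = pc \<xi> d" by blast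
    have "\<exists>!a. a \<in> T \<and> (tail a = d \<or> head a = d)" using t d(1) by (elim conjE) (rule bspec)
    then obtain a where "a \<in> T \<and> (tail a = d \<or> head a = d)" by (rule ex1E)
    then have a: "a \<in> T" "tail a = d \<or> head a = d" by simp_all
    show ?thesis
    proof (rule ex1I[of _ "?f a"])
      show "?f a \<in> ?f ` T \<and> (tail (?f a) = c \<or> head (?f a) = c)" using a d(2) by auto
      fix x assume "x \<in> ?f ` T \<and> (tail x = c \<or> head x = c)"
      then obtain b where b: "b \<in> T" "x = ?f b" "pc \<xi> (tail b) = pc \<xi> d \<or> pc \<xi> (head b) = pc \<xi> d" unfolding d(2) by (elim conjE imageE) simp
      then have "tail b = d \<or> head b = d" by (simp only: pc_inj)
      then have "d \<in> {tail b, head b}" by (elim disjE) simp_all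
      moreover have "d \<in> {tail a, head a}" using a(2) by (elim disjE) simp_all
      ultimately have "b = a" by (rule tableau_cell_unique[OF tab b(1) a(1)])
      then show "x = ?f a" using b(2) by simp
    qed
  qed
  have mat: "Xs ! label a \<in> carrier_mat (ns ! tail_col a) (ns ! head_col a)" if "a \<in> T" for a
    using t that by (elim conjE) (rule bspec)
  have lab: "label ` T = {..<length Xs}" using t by (elim conjE)
  have ev: "even (sum_list ns)" using t by (elim conjE)
  show ?thesis unfolding tableau_with_subst_def P
  proof (intro conjI ballI impI)
    show "even (sum_list ns)" by (rule ev)
    show "label ` ?f ` T = {..<length Xs}" unfolding image_image by (simp add: lab)
    show "\<And>c. c \<in> C \<Longrightarrow> \<exists>!a. a \<in> ?f ` T \<and> (tail a = c \<or> head a = c)" by (rule ex)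
    fix x assume "x \<in> ?f ` T"
    then obtain a where a: "a \<in> T" "x = ?f a" by blast
    note ta = tableau_arrow[OF tab a(1)]
    show "tail x \<in> C" "head x \<in> C" using ta pc_C by (simp_all add: a(2))
    show "tail x \<noteq> head x" using ta(3) by (simp add: a(2) pc_inj)
    show "Xs ! label x \<in> carrier_mat (ns ! tail_col x) (ns ! head_col x)" using mat[OF a(1)] by (simp add: a(2))
    fix y assume "y \<in> ?f ` T" and l: "label x = label y"
    then obtain b where b: "b \<in> T" "y = ?f b" by blast
    have "label a = label b" using l by (simp add: a(2) b(2))
    note same_label = tableau_same_label[OF tab a(1) b(1) this]
    show "head_col x = head_col y" "tail_col x = tail_col y" using same_label by (simp_all add: a(2) b(2))
  qed
qed

lemma count_open_paths: "count_open J w = card {c \<in> opens. path_word (opath c) = w}"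
proof -
  have "{c \<in> opens. word_of (R J c) = w} = {c \<in> opens. path_word (opath c) = w}"
    using opath_word by (intro Collect_cong conj_cong refl) simp
  then show ?thesis by (simp only: count_open_def)
qed

text \<open>An open string gives two transposed paths, starting at its two ends with different
  words. If either word is equivalent to w, exactly one end has the word w.\<close>

lemma card_reps_open:
  assumes P: "representatives (eq_t arrow_transp) {p. open_path q1 q2 (ptab \<xi>) p} P"
  shows "card {p \<in> P. eq_t letter_transp w (path_word p)} = count_open J w"
  unfolding count_open_paths
proof (rule card_representatives[OF equivalence_eq_t equivalence_eq_t _ P])
  show "arrow_transp (arrow_transp x) = x" "letter_transp (letter_transp l) = l" for x l by simp_all
  show "{p. open_path q1 q2 (ptab \<xi>) p} = opath ` opens" unfolding open_path_iff by blast
  show "eq_t letter_transp (path_word p) (path_word q)" if "eq_t arrow_transp p q" for p q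
    using that path_word_transp[of q] by (auto simp: eq_t_def)
next
  fix x assume x: "x \<in> opens" and e: "eq_t letter_transp w (path_word (opath x))"
  note np = open_path_not_palindrome[OF x]
  from e have "w = path_word (opath x) \<or> w = path_word (opath (end_cell J x))"
    unfolding eq_t_def path_word_transp[symmetric] np(2) .
  moreover have "eq_t arrow_transp (opath x) (opath x)" "eq_t arrow_transp (opath x) (opath (end_cell J x))"
    by (simp_all add: eq_t_iff[of arrow_transp] np(2))
  ultimately show "\<exists>y\<in>opens. eq_t arrow_transp (opath x) (opath y) \<and> path_word (opath y) = w"
    using x np(3) by blast
next
  fix x y assume xy: "x \<in> opens" "y \<in> opens" "path_word (opath x) = w" "path_word (opath y) = w"
    and e: "eq_t arrow_transp (opath x) (opath y)"
  have "opath x \<noteq> word_transp arrow_transp (opath y)"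
  proof
    assume "opath x = word_transp arrow_transp (opath y)"
    then have "path_word (opath x) = word_transp letter_transp (path_word (opath y))" by (simp only: path_word_transp)
    then show False using open_path_not_palindrome(1)[OF xy(2)] xy(3,4) by simp
  qed
  then have "opath x = opath y" using e by (simp add: eq_t_def)
  then have "path_tail (opath x) = path_tail (opath y)" by (rule arg_cong[where f = "\<lambda>p. path_tail p"])
  then show "x = y" by (simp only: opath_tail[OF xy(1)] opath_tail[OF xy(2)])
qed

lemma immortals_nx:
  assumes "c \<in> immortals J"
  shows "(nx J ^^ k) c \<in> immortals J" "th c \<in> immortals J" "c \<in> C" "al J k c"
proof -
  show c: "c \<in> C" and im: "al J k c" for k using assms by (simp_all add: immortals_def)
  show "(nx J ^^ k) c \<in> immortals J"
    using nx_pow_C[OF J_in c im] al_pow_immortal[OF J_in im, of _ k] by (simp add: immortals_def)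
  show "th c \<in> immortals J" using th_in_C[OF c] rev_period(1)[OF J_in c im] by (simp add: immortals_def)
qed

context
  assumes prim: "prim J"
begin

lemma nx_len: "c \<in> immortals J \<Longrightarrow> (nx J ^^ len (R J c)) c = c"
  using prim by (simp add: prim_def immortals_def)

lemma len_nx_le:
  assumes c: "c \<in> immortals J"
  shows "len (R J ((nx J ^^ k) c)) \<le> len (R J c)" "len (R J (th c)) \<le> len (R J c)"
proof -
  let ?L = "len (R J c)"
  note i = immortals_nx[OF c]
  have pos: "0 < ?L" by (rule len_immortal(1)[OF J_in i(3,4)])
  have "(nx J ^^ ?L) ((nx J ^^ k) c) = (nx J ^^ (?L + k)) c" by (simp only: nx_add add.commute[of k])
  also have "\<dots> = (nx J ^^ k) c" by (simp only: nx_add[symmetric] nx_len[OF c])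
  finally have e: "R J ((nx J ^^ ?L) ((nx J ^^ k) c)) = R J ((nx J ^^ k) c)" by (simp only:)
  note i1 = immortals_nx[OF i(1)[of k]]
  show "len (R J ((nx J ^^ k) c)) \<le> ?L" by (rule len_immortal(3)[OF J_in i1(3,4) pos e])
  note i2 = immortals_nx[OF i(2)]
  have "(nx J ^^ ?L) (th c) = th c" by (rule rev_period(2)[OF J_in i(3,4) nx_len[OF c]])
  then have "R J ((nx J ^^ ?L) (th c)) = R J (th c)" by (simp only:)
  then show "len (R J (th c)) \<le> ?L" by (rule len_immortal(3)[OF J_in i2(3,4) pos])
qed

lemma len_nx:
  assumes c: "c \<in> immortals J"
  shows "len (R J ((nx J ^^ k) c)) = len (R J c)" "len (R J (th c)) = len (R J c)"
proof -
  let ?L = "len (R J c)"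
  note i = immortals_nx[OF c]
  have pos: "0 < ?L" by (rule len_immortal(1)[OF J_in i(3,4)])
  have k: "k + (k * ?L - k) = k * ?L" using pos by (cases ?L) auto
  have "(nx J ^^ (k * ?L - k)) ((nx J ^^ k) c) = (nx J ^^ (k * ?L)) c" by (simp only: nx_add k)
  also have "\<dots> = c" by (rule period_mult[OF J_in nx_len[OF c]])
  finally have b: "(nx J ^^ (k * ?L - k)) ((nx J ^^ k) c) = c" .
  have "?L \<le> len (R J ((nx J ^^ k) c))"
    using len_nx_le(1)[OF i(1)[of k], of "k * ?L - k"] unfolding b .
  then show "len (R J ((nx J ^^ k) c)) = ?L" using len_nx_le(1)[OF c, of k] by simp
  have "?L \<le> len (R J (th c))" using len_nx_le(2)[OF i(2)] unfolding th_th[OF i(3)] .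
  then show "len (R J (th c)) = ?L" using len_nx_le(2)[OF c] by simp
qed

lemma cpath_nx:
  assumes "c \<in> immortals J"
  shows "cpath ((nx J ^^ k) c) = rotate k (cpath c)"
  unfolding cpath_def len_nx(1)[OF assms] by (rule rotate_pth[OF nx_len[OF assms], symmetric])

text \<open>Going to the last arrow of the period and turning round there gives the first cell of
  the transposed closed path.\<close>

definition cback :: "cell \<Rightarrow> cell" where
  "cback c = th ((nx J ^^ (len (R J c) - 1)) c)"

lemma cpath_cback:
  assumes c: "c \<in> immortals J"
  shows "word_transp arrow_transp (cpath c) = cpath (cback c)" "cback c \<in> immortals J"
proof -
  note i = immortals_nx[OF c]
  have pos: "0 < len (R J c)" by (rule len_immortal(1)[OF J_in i(3,4)])
  then obtain m where m: "len (R J c) = Suc m" by (cases "len (R J c)") auto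
  show "cback c \<in> immortals J" unfolding cback_def by (rule immortals_nx(2)[OF i(1)])
  have "len (R J (cback c)) = Suc m" unfolding cback_def len_nx(2)[OF i(1)] len_nx(1)[OF c] by (rule m)
  then show "word_transp arrow_transp (cpath c) = cpath (cback c)"
    unfolding cpath_def m by (simp only: transp_pth[OF i(3,4)]) (simp only: cback_def m diff_Suc_1)
qed

lemma cpath_inj:
  assumes c: "c \<in> immortals J" and d: "d \<in> immortals J" and e: "cpath c = cpath d"
  shows "c = d"
proof -
  have hd: "hd (cpath x) = alpha \<xi> x" if x: "x \<in> immortals J" for x
  proof -
    note i = immortals_nx[OF x]
    have pos: "0 < len (R J x)" by (rule len_immortal(1)[OF J_in i(3,4)])
    then obtain m where m: "len (R J x) = Suc m" by (cases "len (R J x)") auto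
    show ?thesis unfolding cpath_def m by (rule hd_pth)
  qed
  have "alpha \<xi> c = alpha \<xi> d" using hd[OF c] hd[OF d] e by simp
  then show ?thesis by (simp only: alpha_inj)
qed

text \<open>Every cell of the reversed cycle is the far end of an arrow on the walk from c once c is
  allowed to go round often enough, and no such cell has the reading of c.\<close>

lemma cback_not_return:
  assumes c: "c \<in> immortals J"
  shows "R J ((nx J ^^ i) (cback c)) \<noteq> R J c"
proof -
  let ?L = "len (R J c)"
  let ?k = "?L - 1 + i * ?L"
  note im = immortals_nx[OF c]
  have pos: "0 < ?L" by (rule len_immortal(1)[OF J_in im(3,4)])
  have "i * 1 \<le> i * ?L" by (rule mult_le_mono2) (use pos in simp)
  then have "i \<le> i * ?L" by (simp only: mult_1_right)
  then have ik: "i \<le> ?k" by (rule trans_le_add2)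
  have "(nx J ^^ (i * ?L)) c = c" by (rule period_mult[OF J_in nx_len[OF c]])
  then have e: "(nx J ^^ ?k) c = (nx J ^^ (?L - 1)) c" using nx_add[of "?L - 1" "J" "i * ?L" c] by (simp only: add.commute)
  have r: "(nx J ^^ i) (cback c) = th ((nx J ^^ (?k - i)) c)"
    unfolding cback_def e[symmetric] by (rule conjunct1[OF nx_pow_rev[OF J_in im(3,4) ik]])
  show ?thesis unfolding r by (rule not_sym[OF R_not_palindrome[OF J_in im(3,4)]])
qed

lemma count_closed_paths: "count_closed J w = card {c \<in> immortals J. path_word (cpath c) = w}"
proof -
  have "{c \<in> immortals J. word_of (R J c) = w} = {c \<in> immortals J. path_word (cpath c) = w}"
    using cpath_word by (intro Collect_cong conj_cong refl) simp
  then show ?thesis by (simp only: count_closed_def)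
qed

text \<open>On a cycle that closes after one period different cells have different readings, and the
  reversed cycle shares no reading with it. So a closed path whose word is equivalent to w passes
  through exactly one cell, in one direction, whose word is w.\<close>

lemma card_reps_closed:
  assumes P: "representatives (eq_ct arrow_transp) {p. closed_path q1 q2 (ptab \<xi>) p} P"
  shows "card {p \<in> P. eq_ct letter_transp w (path_word p)} = count_closed J w"
  unfolding count_closed_paths
proof (rule card_representatives[OF equivalence_eq_ct equivalence_eq_ct _ P eq_ct_path_word])
  show "arrow_transp (arrow_transp x) = x" "letter_transp (letter_transp l) = l" for x l by simp_all
  show "{p. closed_path q1 q2 (ptab \<xi>) p} = cpath ` immortals J" unfolding closed_path_prim[OF prim] by blast
  show "eq_ct arrow_transp p q \<Longrightarrow> eq_ct arrow_transp p q" for p q .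
next
  fix x assume x: "x \<in> immortals J" and e: "eq_ct letter_transp w (path_word (cpath x))"
  note b = cpath_cback[OF x]
  have "eq_ct letter_transp (path_word (cpath x)) w" by (rule eq_ct_sym[OF letter_transp_invol e])
  then have "(\<exists>i. w = rotate i (path_word (cpath x))) \<or> (\<exists>i. w = rotate i (path_word (cpath (cback x))))"
    unfolding eq_ct_iff[OF letter_transp_invol] path_word_transp[symmetric] b(1) .
  then show "\<exists>y\<in>immortals J. eq_ct arrow_transp (cpath x) (cpath y) \<and> path_word (cpath y) = w"
  proof (elim disjE exE)
    fix i assume w: "w = rotate i (path_word (cpath x))"
    show ?thesis
    proof (intro bexI conjI)
      show "(nx J ^^ i) x \<in> immortals J" by (rule immortals_nx(1)[OF x])
      show "path_word (cpath ((nx J ^^ i) x)) = w" by (simp only: cpath_nx[OF x] w rotate_map)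
      show "eq_ct arrow_transp (cpath x) (cpath ((nx J ^^ i) x))"
        unfolding eq_ct_iff[OF arrow_transp_invol] cpath_nx[OF x] by blast
    qed
  next
    fix i assume w: "w = rotate i (path_word (cpath (cback x)))"
    show ?thesis
    proof (intro bexI conjI)
      show "(nx J ^^ i) (cback x) \<in> immortals J" by (rule immortals_nx(1)[OF b(2)])
      show "path_word (cpath ((nx J ^^ i) (cback x))) = w" by (simp only: cpath_nx[OF b(2)] w rotate_map)
      show "eq_ct arrow_transp (cpath x) (cpath ((nx J ^^ i) (cback x)))"
        unfolding eq_ct_iff[OF arrow_transp_invol] cpath_nx[OF b(2)] b(1) by blast
    qed
  qed
next
  fix x y assume xy: "x \<in> immortals J" "y \<in> immortals J" "path_word (cpath x) = w" "path_word (cpath y) = w"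
    and e: "eq_ct arrow_transp (cpath x) (cpath y)"
  note b = cpath_cback[OF xy(1)]
  have "word_of (R J y) = word_of (R J x)" using xy(3,4) by (simp only: cpath_word[OF xy(1)] cpath_word[OF xy(2)])
  then have r: "R J y = R J x" using R_immortal[OF J_in xy(1)] R_immortal[OF J_in xy(2)] by simp
  from e have "(\<exists>i. cpath y = cpath ((nx J ^^ i) x)) \<or> (\<exists>i. cpath y = cpath ((nx J ^^ i) (cback x)))"
    unfolding eq_ct_iff[OF arrow_transp_invol] b(1) cpath_nx[OF xy(1)] cpath_nx[OF b(2)] .
  then show "x = y"
  proof (elim disjE exE)
    fix i assume "cpath y = cpath ((nx J ^^ i) x)"
    then have y: "y = (nx J ^^ i) x" by (rule cpath_inj[OF xy(2) immortals_nx(1)[OF xy(1)]])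
    note im = immortals_nx[OF xy(1)]
    have "(nx J ^^ i) x = x" using r unfolding y by (rule prim_return[OF J_in prim im(3,4)])
    then show ?thesis using y by simp
  next
    fix i assume "cpath y = cpath ((nx J ^^ i) (cback x))"
    then have y: "y = (nx J ^^ i) (cback x)" by (rule cpath_inj[OF xy(2) immortals_nx(1)[OF b(2)]])
    show ?thesis using cback_not_return[OF xy(1), of i] r unfolding y by (rule notE)
  qed
qed

end

lemma finite_closed_paths: "finite {p. closed_path q1 q2 (ptab \<xi>) p}"
proof (rule finite_subset)
  show "{p. closed_path q1 q2 (ptab \<xi>) p} \<subseteq> {p. set p \<subseteq> arrows_t (ptab \<xi>) \<and> distinct p}"
  proof
    fix p assume "p \<in> {p. closed_path q1 q2 (ptab \<xi>) p}"
    then have p: "is_path q1 q2 (ptab \<xi>) p" and d: "\<And>i j. i < j \<Longrightarrow> j < length p \<Longrightarrow> p ! i \<noteq> p ! j"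
      by (simp_all add: closed_path_def)
    have "p ! i \<noteq> p ! j" if "i < length p" "j < length p" "i \<noteq> j" for i j
      using d[of i j] d[of j i] that by (cases i j rule: linorder_cases) fastforce+
    then have "distinct p" by (simp only: distinct_conv_nth) blast
    then show "p \<in> {p. set p \<subseteq> arrows_t (ptab \<xi>) \<and> distinct p}" using p by (simp add: is_path_def)
  qed
  show "finite {p. set p \<subseteq> arrows_t (ptab \<xi>) \<and> distinct p}"
    by (rule finite_subset_distinct) (simp add: arrows_t_ptab fin_C)
qed

text \<open>The word of each closed path is equivalent to some primitive c_j. A cycle longer than
  the minimal period of its reading would have a proper power as its word, and equivalence preserves
  that.\<close>

lemma admissible_prim:
  assumes Cs: "representatives (eq_ct arrow_transp) {p. closed_path q1 q2 (ptab \<xi>) p} Cs"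
    and m: "mset_equiv (eq_ct letter_transp) (image_mset path_word (mset_set Cs)) (mset_with_mult \<gamma> cs)"
    and lc: "length \<gamma> = length cs"
    and pr: "\<And>u. u \<in> set cs \<Longrightarrow> primitive u"
  shows "prim J"
  unfolding prim_def
proof (intro ballI impI)
  fix c assume cC: "c \<in> C" and "\<forall>i. al J i c"
  then have im: "\<And>i. al J i c" by blast
  have ci: "c \<in> immortals J" using cC im by (simp add: immortals_def)
  let ?P = "\<lambda>L. 0 < L \<and> (nx J ^^ L) c = c"
  \<comment> \<open>L is the length of the cycle, to be compared with the minimal period
    \<open>len (R J c)\<close> of the reading. The remainder of L modulo that period is again a
    period, hence 0.\<close>
  define L where "L = (LEAST L. ?P L)"
  have "\<exists>L. ?P L" by (rule period_exists[OF J_in cC im])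
  then have L: "?P L" unfolding L_def by (rule LeastI_ex)
  have Lmin: "(nx J ^^ i) c \<noteq> c" if "0 < i" "i < L" for i
    using not_less_Least[of i ?P] that unfolding L_def by blast
  obtain m0 where m0: "L = Suc m0" using L by (cases L) auto
  let ?p = "pth \<xi> c L"
  have "closed_path q1 q2 (ptab \<xi>) ?p" unfolding closed_path_iff
  proof (intro bexI[OF _ ci] exI conjI allI impI)
    show "pth \<xi> c L = pth \<xi> c (Suc m0)" by (simp only: m0)
    show "(nx J ^^ Suc m0) c = c" using L by (simp only: m0)
    show "(nx J ^^ i) c \<noteq> c" if "0 < i \<and> i \<le> m0" for i by (rule Lmin) (use that m0 in simp_all)
  qed
  then obtain q where q: "q \<in> Cs" "eq_ct arrow_transp ?p q" using Cs unfolding representatives_def by blast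
  have wq: "eq_ct letter_transp (path_word ?p) (path_word q)" by (rule eq_ct_path_word[OF q(2)])
  have fin: "finite Cs" using Cs unfolding representatives_def by (blast intro: finite_subset[OF _ finite_closed_paths])
  have "0 < card {x \<in> Cs. eq_ct letter_transp (path_word q) (path_word x)}"
    using fin q(1) eq_ct_refl by (intro card_gt_0_iff[THEN iffD2] conjI) auto
  moreover have "card {x \<in> Cs. eq_ct letter_transp (path_word q) (path_word x)}
      = size (filter_mset (eq_ct letter_transp (path_word q)) (mset_with_mult \<gamma> cs))"
    using m unfolding mset_equiv_def size_filter_image[OF fin] by (elim conjE) (rule spec)
  ultimately have "(\<Sum>i<length cs. if eq_ct letter_transp (path_word q) (cs ! i) then \<gamma> ! i else 0) \<noteq> 0"
    by (simp only: size_filter_mult[OF lc])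
  then obtain i where i: "i \<in> {..<length cs}" "(if eq_ct letter_transp (path_word q) (cs ! i) then \<gamma> ! i else 0) \<noteq> 0"
    by (rule sum.not_neutral_contains_not_neutral)
  have u: "cs ! i \<in> set cs" "eq_ct letter_transp (path_word q) (cs ! i)" using i by (auto split: if_splits)
  have "eq_ct letter_transp (path_word ?p) (cs ! i)" by (rule eq_ct_trans[OF letter_transp_invol wq u(2)])
  then have prp: "primitive (path_word ?p)" by (rule primitive_eq_ct[OF _ pr[OF u(1)]])
  let ?l = "len (R J c)"
  note l = len_immortal[OF J_in cC im]
  note Rm = R_mod[OF J_in ci l(1,2)]
  have Lper: "R J c (L + i) = R J c i" for i
    using R_period_iff[OF J_in im, of L] L by simp
  have "R J c (L mod ?l + i) = R J c i" for i
  proof -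
    have "R J c (L mod ?l + i) = R J c ((L mod ?l + i) mod ?l)" by (rule Rm)
    also have "\<dots> = R J c ((L + i) mod ?l)" by (simp only: mod_add_left_eq)
    also have "\<dots> = R J c (L + i)" by (rule Rm[symmetric])
    finally show ?thesis by (simp only: Lper)
  qed
  then have "R J ((nx J ^^ (L mod ?l)) c) = R J c" unfolding R_period_iff[OF J_in im] by blast
  then have "L mod ?l = 0" using l(3)[of "L mod ?l"] mod_less_divisor[OF l(1), of L] by linarith
  then obtain k where k: "L = k * ?l" by (metis mod_0_imp_dvd dvdE mult.commute)
  let ?g = "\<lambda>i. lam ((nx J ^^ i) c)"
  have gm: "?g i = ?g (i mod ?l)" for i
    using Rm[of i] im by (simp add: R_def)
  have "path_word ?p = concat (replicate k (map ?g [0..<?l]))"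
  proof (rule nth_equalityI)
    show len: "length (path_word ?p) = length (concat (replicate k (map ?g [0..<?l])))"
      by (simp add: k length_concat sum_list_replicate)
    fix i assume "i < length (path_word ?p)"
    then have i: "i < k * ?l" by (simp add: k)
    have "concat (replicate k (map ?g [0..<?l])) ! i = map ?g [0..<?l] ! (i mod length (map ?g [0..<?l]))"
      by (rule concat_replicate_nth) (use i in simp)
    also have "\<dots> = ?g (i mod ?l)" using l(1) by simp
    also have "\<dots> = path_word ?p ! i" using i gm[of i] by (simp add: path_word_pth k)
    finally show "path_word ?p ! i = concat (replicate k (map ?g [0..<?l])) ! i" by (rule sym)
  qed
  then have "\<not> 2 \<le> k" using prp unfolding primitive_def by blast
  moreover have "k \<noteq> 0" using L k by (cases k) auto
  ultimately have "k = 1" by simp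
  then show "(nx J ^^ ?l) c = c" using L k by simp
qed

text \<open>The multiplicities of an admissible quadruple are numbers of cells with a given word, so
  they depend on the readings alone. This is the bridge between equivalence of quadruples and
  \<open>same\<close>.\<close>

lemma admissible_facts:
  assumes x: "T_quadruple s (\<beta>, \<gamma>, b, cs)" and ad: "admissible_perm q1 q2 n T (\<beta>, \<gamma>, b, cs) \<xi>"
  shows "prim J"
    and "size (filter_mset (eq_t letter_transp w) (mset_with_mult \<beta> b)) = count_open J w"
    and "size (filter_mset (eq_ct letter_transp w) (mset_with_mult \<gamma> cs)) = count_closed J w"
proof -
  from ad obtain Cs where Cs: "representatives (eq_ct arrow_transp) {p. closed_path q1 q2 (ptab \<xi>) p} Cs"
    and mc: "mset_equiv (eq_ct letter_transp) (image_mset path_word (mset_set Cs)) (mset_with_mult \<gamma> cs)"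
    and mo: "mset_equiv (eq_t letter_transp) (image_mset path_word (mset_set (T_open q1 q2 (ptab \<xi>)))) (mset_with_mult \<beta> b)"
    by auto
  show prim: "prim J" by (rule admissible_prim[OF Cs mc]) (use x in auto)
  have fin: "finite Cs" using Cs unfolding representatives_def by (blast intro: finite_subset[OF _ finite_closed_paths])
  note ro = T_open_representatives[OF tableau_ptab, of q1 q2]
  have "T_open q1 q2 (ptab \<xi>) \<subseteq> opath ` opens" using open_path_iff by (auto simp: T_open_def)
  then have fo: "finite (T_open q1 q2 (ptab \<xi>))" by (rule finite_subset) (simp add: finite_opens)
  show "size (filter_mset (eq_ct letter_transp w) (mset_with_mult \<gamma> cs)) = count_closed J w"
    using mc unfolding mset_equiv_def size_filter_image[OF fin] card_reps_closed[OF prim Cs] by (elim conjE) (rule sym, rule spec)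
  show "size (filter_mset (eq_t letter_transp w) (mset_with_mult \<beta> b)) = count_open J w"
    using mo unfolding mset_equiv_def size_filter_image[OF fo] card_reps_open[OF ro] by (elim conjE) (rule sym, rule spec)
qed

section \<open>Starting cells belonging to an admissible quadruple\<close>

context
  fixes \<beta> \<gamma> b cs P
  assumes quad: "T_quadruple (length Xs) (\<beta>, \<gamma>, b, cs)"
    and adm: "admissible_perm q1 q2 n T (\<beta>, \<gamma>, b, cs) \<xi>"
    and coh: "coherent_open_reps q1 q2 (ptab \<xi>) P"
begin

lemmas prim_jx = admissible_facts(1)[OF quad adm]
lemmas count_closed_mult = admissible_facts(3)[OF quad adm]

lemma quad_cs: "length \<gamma> = length cs" "\<And>i j. i < j \<Longrightarrow> j < length cs \<Longrightarrow> \<not> eq_ct letter_transp (cs ! i) (cs ! j)"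
  using quad by simp_all

lemmas eqv_ct = equivalence_eq_ct[where tr = letter_transp, OF letter_transp_invol]

lemma cs_index_unique:
  assumes i: "i < length cs" and j: "j < length cs" and e: "eq_ct letter_transp (cs ! i) (cs ! j)"
  shows "i = j"
proof (cases i j rule: linorder_cases)
  case less
  then show ?thesis using quad_cs(2)[OF less j] e by blast
next
  case greater
  have "eq_ct letter_transp (cs ! j) (cs ! i)" by (rule eq_ct_sym[OF letter_transp_invol e])
  then show ?thesis using quad_cs(2)[OF greater i] by blast
qed

lemma cs_unique:
  assumes u: "u \<in> set cs" and v: "v \<in> set cs" and e: "eq_ct letter_transp u v"
  shows "u = v"
proof -
  obtain i where i: "i < length cs" "u = cs ! i" using u by (metis in_set_conv_nth)
  obtain k where k: "k < length cs" "v = cs ! k" using v by (metis in_set_conv_nth)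
  have "i = k" by (rule cs_index_unique[OF i(1) k(1)]) (use e i(2) k(2) in simp)
  then show ?thesis by (simp only: i(2) k(2))
qed

text \<open>One end for every string outside the cycles: the tail of an isolated arrow, recognized
  by its letter, and the first cell of each chosen open path. The cells in \<open>loops\<close> have
  a word literally equal to some c_j, so each of its periods begins exactly like c_j.\<close>

definition starts :: "cell set" where
  "starts = {c \<in> isolated. \<exists>i. lam c = Letter i} \<union> {c \<in> opens. opath c \<in> P}"

definition loops :: "cell set" where
  "loops = {c \<in> immortals J. word_of (R J c) \<in> set cs}"

definition W :: "(nat \<Rightarrow> letter option) set" where
  "W = R J ` (starts \<union> loops)"

lemma starts_outer: "c \<in> starts \<Longrightarrow> c \<in> C" "c \<in> starts \<Longrightarrow> c \<notin> B"
  by (auto simp: starts_def isolated_def opens_def)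

lemma loopsD:
  assumes "c \<in> loops"
  shows "c \<in> immortals J" "word_of (R J c) \<in> set cs" "c \<in> C" "c \<in> B"
proof -
  show a: "c \<in> immortals J" "word_of (R J c) \<in> set cs" using assms by (simp_all add: loops_def)
  show "c \<in> C" using a(1) by (simp add: immortals_def)
  show "c \<in> B" by (rule subsetD[OF immortals_B[OF J_in] a(1)])
qed

lemma R_eq_B:
  assumes "c \<in> C" "d \<in> C" "R F c = R F d"
  shows "c \<in> B \<longleftrightarrow> d \<in> B" "lam c = lam d" "th c \<in> B \<longleftrightarrow> th d \<in> B"
proof -
  have "R F c 0 = R F d 0" "R F c (Suc 0) = R F d (Suc 0)" by (simp_all only: assms(3))
  then show l: "lam c = lam d" and "th c \<in> B \<longleftrightarrow> th d \<in> B" using R_1[of F c] R_1[of F d] by (simp_all add: R_0 del: not_None_eq)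
  show "c \<in> B \<longleftrightarrow> d \<in> B" by (rule lam_B[OF assms(1,2) l])
qed

lemma P_reps: "representatives (eq_t arrow_transp) {p. open_path q1 q2 (ptab \<xi>) p} P"
  using coh by (simp add: coherent_open_reps_def)

lemma P_one:
  assumes "c \<in> opens"
  shows "opath c \<in> P \<longleftrightarrow> opath (end_cell J c) \<notin> P"
proof -
  note np = open_path_not_palindrome[OF assms]
  have o: "opath c \<in> {p. open_path q1 q2 (ptab \<xi>) p}" using open_path_iff assms by blast
  have "\<exists>!y. y \<in> P \<and> eq_t arrow_transp (opath c) y" using P_reps o unfolding representatives_def by (elim conjE) (rule bspec)
  then have ex: "\<exists>!y. y \<in> P \<and> (y = opath c \<or> y = opath (end_cell J c))"
    by (simp only: eq_t_iff[OF arrow_transp_invol] np(2))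
  have "opath c \<noteq> opath (end_cell J c)"
  proof
    assume "opath c = opath (end_cell J c)"
    then have "word_transp arrow_transp (opath c) = opath c" by (rule trans[OF np(2) sym])
    then have "word_transp letter_transp (path_word (opath c)) = path_word (opath c)" by (simp only: path_word_transp[symmetric])
    then show False using np(1) by blast
  qed
  then show ?thesis using ex by metis
qed

text \<open>This is where coherence of P enters. If the other end of the string at c were chosen,
  the chosen paths of c and d would have transposed words; coherence makes these equal, while no
  open path has a word equal to its transpose.\<close>

lemma path_coherent:
  assumes c: "c \<in> opens" and d: "d \<in> opens" and e: "R J c = R J d" and dP: "opath d \<in> P"
  shows "opath c \<in> P"
proof (rule ccontr)
  assume "opath c \<notin> P"
  then have eP: "opath (end_cell J c) \<in> P" using P_one[OF c] by blast
  note np = open_path_not_palindrome[OF c]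
  have cd: "path_word (opath c) = path_word (opath d)" by (simp only: opath_word[OF c] opath_word[OF d] e)
  have we: "path_word (opath (end_cell J c)) = word_transp letter_transp (path_word (opath d))"
    by (simp only: np(2)[symmetric] path_word_transp cd)
  then have "eq_t letter_transp (path_word (opath (end_cell J c))) (path_word (opath d))"
    by (simp add: eq_t_def)
  then have "path_word (opath (end_cell J c)) = path_word (opath d)"
    using coh eP dP unfolding coherent_open_reps_def by blast
  then show False using np(1) unfolding cd we by blast
qed

lemma W_outer:
  assumes c: "c \<in> C" "c \<notin> B"
  shows "R J c \<in> W \<longleftrightarrow> c \<in> starts"
proof
  assume "R J c \<in> W"
  then obtain d where d: "d \<in> starts \<or> d \<in> loops" "R J c = R J d" unfolding W_def by blast
  have dC: "d \<in> C" using d(1) starts_outer(1)[of d] loopsD(3)[of d] by blast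
  note e = R_eq_B[OF c(1) dC d(2)]
  have dS: "d \<in> starts" using d(1) e(1) c(2) loopsD(4)[of d] by blast
  show "c \<in> starts"
  proof (cases "d \<in> opens")
    case True
    then have "opath d \<in> P" using dS by (auto simp: starts_def isolated_def opens_def)
    moreover have o: "c \<in> opens" using c e(3) True by (simp add: opens_def)
    ultimately have "opath c \<in> P" using path_coherent[OF o True d(2)] by blast
    then show ?thesis using o by (simp add: starts_def)
  next
    case False
    then have "d \<in> isolated" "\<exists>i. lam d = Letter i" using dS by (simp_all add: starts_def)
    then show ?thesis using c e(2,3) by (simp add: starts_def isolated_def)
  qed
qed (simp add: W_def)

lemma R_immortal_eq:
  assumes "c \<in> immortals J" "d \<in> immortals J" "word_of (R J c) = word_of (R J d)"
  shows "R J c = R J d"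
  using R_immortal[OF J_in assms(1)] R_immortal[OF J_in assms(2)] assms(3) by simp

lemma W_inner:
  assumes c: "c \<in> B"
  shows "R J c \<in> W \<longleftrightarrow> c \<in> loops"
proof
  assume "R J c \<in> W"
  then obtain d where d: "d \<in> starts \<or> d \<in> loops" "R J c = R J d" unfolding W_def by blast
  have dC: "d \<in> C" using d(1) starts_outer(1)[of d] loopsD(3)[of d] by blast
  have cC: "c \<in> C" using c B_C by blast
  have "d \<in> B" using R_eq_B(1)[OF cC dC d(2)] c by blast
  then have dl: "d \<in> loops" using d(1) starts_outer(2)[of d] by blast
  then have "\<not> ends (R J c)" using loopsD(1)[OF dl] immortals_ends[of d "J"] d(2) by simp
  then have "c \<in> immortals J" using cC immortals_ends[of c "J"] by blast
  then show "c \<in> loops" using loopsD(2)[OF dl] d(2) by (simp add: loops_def)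
qed (simp add: W_def)

lemma St_W: "St J W - B = starts" "clo J W = loops"
proof -
  show "St J W - B = starts"
  proof (intro equalityI subsetI)
    fix c assume "c \<in> St J W - B"
    then show "c \<in> starts" using W_outer[of c] by (simp add: St_def)
  next
    fix c assume c: "c \<in> starts"
    then show "c \<in> St J W - B" using W_outer[of c] starts_outer[OF c] by (simp add: St_def)
  qed
  show "clo J W = loops"
  proof (intro equalityI subsetI)
    fix c assume "c \<in> clo J W"
    then show "c \<in> loops" using W_inner[of c] by (simp add: clo_def St_def)
  next
    fix c assume c: "c \<in> loops"
    then show "c \<in> clo J W" using W_inner[of c] loopsD[OF c] by (simp add: clo_def St_def)
  qed
qed

lemma outer_mortal:
  assumes c: "c \<in> C" "c \<notin> B" and al: "al J k c"
  shows "(nx J ^^ k) c \<notin> immortals J"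
proof
  assume "(nx J ^^ k) c \<in> immortals J"
  then have "\<And>i. al J i ((nx J ^^ k) c)" by (simp add: immortals_def)
  then have "\<And>i. al J i c" by (rule al_immortal[OF J_in al])
  then have "c \<in> immortals J" using c(1) by (simp add: immortals_def)
  then show False using immortals_B[OF J_in] c(2) by blast
qed

text \<open>The walk from an outer cell never reaches a cycle, so the only start it can meet is its
  first cell.\<close>

lemma outer_forward:
  assumes c: "c \<in> C" "c \<notin> B"
  shows "(\<exists>k. al J k c \<and> R J ((nx J ^^ k) c) \<in> W) \<longleftrightarrow> c \<in> starts"
proof
  assume "\<exists>k. al J k c \<and> R J ((nx J ^^ k) c) \<in> W"
  then obtain k where k: "al J k c" "R J ((nx J ^^ k) c) \<in> W" by blast
  show "c \<in> starts"
  proof (cases k)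
    case 0
    then show ?thesis using k W_outer[OF c] by simp
  next
    case (Suc m)
    have "(nx J ^^ k) c \<in> B" by (rule nx_pow_B[OF J_in k(1)]) (simp add: Suc)
    then have "(nx J ^^ k) c \<in> loops" using k(2) W_inner by blast
    then show ?thesis using outer_mortal[OF c k(1)] loopsD(1) by blast
  qed
next
  assume "c \<in> starts"
  then have "al J 0 c \<and> R J ((nx J ^^ 0) c) \<in> W" using W_outer[OF c] by simp
  then show "\<exists>k. al J k c \<and> R J ((nx J ^^ k) c) \<in> W" by (rule exI)
qed

lemma end_cell_outer:
  assumes c: "c \<in> C" "c \<notin> B"
  shows "end_cell J c \<in> C" "end_cell J c \<notin> B" "al J (len (R J c) - 1) c"
proof -
  note l = len_outer[OF J_in c]
  obtain m where m: "len (R J c) = Suc m" using l(1) by (cases "len (R J c)") auto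
  have a: "al J m c" "\<not> al J (Suc m) c" using l(2)[of m] l(2)[of "Suc m"] m by simp_all
  show "al J (len (R J c) - 1) c" using a(1) by (simp add: m)
  show "end_cell J c \<in> C" unfolding end_cell_def m diff_Suc_1 by (rule th_in_C[OF nx_pow_C[OF J_in c(1) a(1)]])
  show "end_cell J c \<notin> B" unfolding end_cell_def m diff_Suc_1 using a al_Suc[of "J" m c] by blast
qed

lemma outer_backward:
  assumes c: "c \<in> C" "c \<notin> B"
  shows "(\<exists>k. al J k c \<and> R J (th ((nx J ^^ k) c)) \<in> W) \<longleftrightarrow> end_cell J c \<in> starts"
proof
  assume "\<exists>k. al J k c \<and> R J (th ((nx J ^^ k) c)) \<in> W"
  then obtain k where k: "al J k c" "R J (th ((nx J ^^ k) c)) \<in> W" by blast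
  have nC: "(nx J ^^ k) c \<in> C" by (rule nx_pow_C[OF J_in c(1) k(1)])
  have nB: "th ((nx J ^^ k) c) \<notin> B"
  proof
    assume "th ((nx J ^^ k) c) \<in> B"
    then have "th ((nx J ^^ k) c) \<in> loops" using W_inner k(2) by blast
    then have "th (th ((nx J ^^ k) c)) \<in> immortals J" by (intro immortals_nx(2) loopsD(1))
    then show False using outer_mortal[OF c k(1)] by (simp only: th_th[OF nC])
  qed
  have "\<not> al J (Suc k) c" using nB al_Suc[of "J" k c] by blast
  then have "len (R J c) = Suc k" using k(1) len_outer(2)[OF J_in c, of k] len_outer(2)[OF J_in c, of "Suc k"] by linarith
  then have "th ((nx J ^^ k) c) = end_cell J c" by (simp add: end_cell_def)
  then show "end_cell J c \<in> starts" using k(2) W_outer[OF end_cell_outer(1,2)[OF c]] by simp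
next
  assume "end_cell J c \<in> starts"
  then have "R J (end_cell J c) \<in> W" using W_outer[OF end_cell_outer(1,2)[OF c]] by blast
  then show "\<exists>k. al J k c \<and> R J (th ((nx J ^^ k) c)) \<in> W"
    using end_cell_outer(3)[OF c] unfolding end_cell_def by blast
qed

lemma end_cell_isolated:
  assumes "c \<in> isolated"
  shows "end_cell J c = th c" "word_of (R J c) = [lam c]"
proof -
  have c: "c \<in> C" "c \<notin> B" "th c \<notin> B" using assms by (simp_all add: isolated_def)
  have "\<not> al J (Suc 0) c" using c(3) by (simp add: al_Suc)
  then have l: "len (R J c) = Suc 0" using len_outer(1)[OF J_in c(1,2)] len_outer(2)[OF J_in c(1,2), of "Suc 0"] by linarith
  show "end_cell J c = th c" by (simp add: end_cell_def l)
  show "word_of (R J c) = [lam c]" by (simp add: word_of_def l R_0)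
qed

lemma starts_one:
  assumes c: "c \<in> C" "c \<notin> B"
  shows "c \<in> starts \<longleftrightarrow> end_cell J c \<notin> starts"
proof (cases "th c \<in> B")
  case False
  then have i: "c \<in> isolated" "th c \<in> isolated" using c th_in_C[OF c(1)] th_th[OF c(1)] by (simp_all add: isolated_def)
  have disj: "d \<in> starts \<longleftrightarrow> (\<exists>i. lam d = Letter i)" if "d \<in> isolated" for d
    using that by (auto simp: starts_def isolated_def opens_def)
  show ?thesis unfolding end_cell_isolated(1)[OF i(1)] disj[OF i(1)] disj[OF i(2)] lam_th[OF c(1)]
    by (cases "lam c") simp_all
next
  case True
  then have o: "c \<in> opens" using c by (simp add: opens_def)
  have disj: "d \<in> starts \<longleftrightarrow> opath d \<in> P" if "d \<in> opens" for d
    using that by (auto simp: starts_def isolated_def opens_def)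
  show ?thesis unfolding disj[OF o] disj[OF open_path_not_palindrome(3)[OF o]] by (rule P_one[OF o])
qed

lemma word_nx:
  assumes c: "c \<in> immortals J"
  shows "word_of (R J ((nx J ^^ k) c)) = rotate k (word_of (R J c))"
    "word_of (R J (cback c)) = word_transp letter_transp (word_of (R J c))"
proof -
  have "path_word (cpath ((nx J ^^ k) c)) = rotate k (path_word (cpath c))"
    by (simp only: cpath_nx[OF prim_jx c] rotate_map)
  then show "word_of (R J ((nx J ^^ k) c)) = rotate k (word_of (R J c))"
    by (simp only: cpath_word[OF c] cpath_word[OF immortals_nx(1)[OF c]])
  note cb = cpath_cback[OF prim_jx c]
  have "path_word (cpath (cback c)) = word_transp letter_transp (path_word (cpath c))"
    by (simp only: cb(1)[symmetric] path_word_transp)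
  then show "word_of (R J (cback c)) = word_transp letter_transp (word_of (R J c))"
    by (simp only: cpath_word[OF c] cpath_word[OF cb(2)])
qed

lemma th_cback:
  assumes c: "c \<in> immortals J"
  shows "th ((nx J ^^ k) c) = cback ((nx J ^^ Suc k) c)"
proof -
  let ?L = "len (R J c)"
  note i = immortals_nx[OF c]
  have pos: "0 < ?L" by (rule len_immortal(1)[OF J_in i(3,4)])
  then have s: "Suc k + (?L - 1) = ?L + k" by simp
  have "(nx J ^^ (?L - 1)) ((nx J ^^ Suc k) c) = (nx J ^^ (?L + k)) c"
    by (simp only: nx_add s)
  also have "\<dots> = (nx J ^^ k) c" by (simp only: nx_add[symmetric] nx_len[OF prim_jx c])
  finally show ?thesis by (simp only: cback_def[OF prim_jx] len_nx(1)[OF prim_jx c])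
qed

lemma eq_ct_orbit:
  assumes c: "c \<in> immortals J"
  shows "eq_ct letter_transp (word_of (R J c)) (word_of (R J ((nx J ^^ k) c)))"
    "eq_ct letter_transp (word_of (R J c)) (word_of (R J (th ((nx J ^^ k) c))))"
proof -
  show "eq_ct letter_transp (word_of (R J c)) (word_of (R J ((nx J ^^ k) c)))"
    unfolding word_nx(1)[OF c] eq_ct_iff[OF letter_transp_invol] by blast
  have "word_of (R J (th ((nx J ^^ k) c))) = word_transp letter_transp (rotate (Suc k) (word_of (R J c)))"
    by (simp only: th_cback[OF c] word_nx(2)[OF immortals_nx(1)[OF c]] word_nx(1)[OF c])
  then show "eq_ct letter_transp (word_of (R J c)) (word_of (R J (th ((nx J ^^ k) c))))"
    unfolding eq_ct_def eq_t_iff[OF letter_transp_invol] by blast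
qed

text \<open>The word of c is counted in the quadruple with a nonzero multiplicity, so it is
  equivalent to some c_j. The rotation and transposition involved tell where on the cycle, and in
  which direction, a cell of \<open>loops\<close> lies.\<close>

lemma immortal_some_loop:
  assumes c: "c \<in> immortals J"
  shows "(\<exists>k. (nx J ^^ k) c \<in> loops) \<or> (\<exists>k. th ((nx J ^^ k) c) \<in> loops)"
proof -
  let ?w = "word_of (R J c)"
  have "0 < count_closed J ?w"
    unfolding count_closed_def using finite_immortals[of "J"] c by (intro card_gt_0_iff[THEN iffD2] conjI) (blast, simp)
  then have "size (filter_mset (eq_ct letter_transp ?w) (mset_with_mult \<gamma> cs)) \<noteq> 0" by (simp only: count_closed_mult)
  then obtain j where j: "j < length cs" "eq_ct letter_transp ?w (cs ! j)"
    using size_class_mult(2)[OF quad_cs(1) eqv_ct quad_cs(2), of ?w] by blast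
  have mem: "cs ! j \<in> set cs" using j(1) by simp
  from j(2) obtain i where "eq_t letter_transp (rotate i ?w) (cs ! j)" unfolding eq_ct_def by blast
  then have "cs ! j = rotate i ?w \<or> cs ! j = word_transp letter_transp (rotate i ?w)"
    by (simp only: eq_t_iff[OF letter_transp_invol])
  then show ?thesis
  proof
    assume "cs ! j = rotate i ?w"
    then have "word_of (R J ((nx J ^^ i) c)) \<in> set cs" using mem by (simp only: word_nx(1)[OF c])
    then have "(nx J ^^ i) c \<in> loops" using immortals_nx(1)[OF c] by (simp add: loops_def)
    then show ?thesis by blast
  next
    assume e: "cs ! j = word_transp letter_transp (rotate i ?w)"
    let ?d = "(nx J ^^ i) c"
    have d: "?d \<in> immortals J" by (rule immortals_nx(1)[OF c])
    have "word_of (R J (cback ?d)) \<in> set cs" using mem by (simp only: word_nx(2)[OF d] word_nx(1)[OF c] e)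
    then have "cback ?d \<in> loops" using cpath_cback(2)[OF prim_jx d] by (simp add: loops_def)
    then have "th ((nx J ^^ (i + (len (R J ?d) - 1))) c) \<in> loops" by (simp only: cback_def[OF prim_jx] nx_add)
    then show ?thesis by blast
  qed
qed

text \<open>Two cells of \<open>loops\<close> on the same cycle have equivalent words, hence the
  same c_j and equal readings. For opposite directions this is excluded by
  \<open>R_not_palindrome\<close>.\<close>

lemma immortal_one_side:
  assumes c: "c \<in> immortals J" and k: "(nx J ^^ k) c \<in> loops" and l: "th ((nx J ^^ l) c) \<in> loops"
  shows False
proof -
  let ?L = "len (R J c)" and ?d = "(nx J ^^ k) c" and ?e = "th ((nx J ^^ l) c)"
  note i = immortals_nx[OF c]
  have pos: "0 < ?L" by (rule len_immortal(1)[OF J_in i(3,4)])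
  have "eq_ct letter_transp (word_of (R J ?d)) (word_of (R J ?e))"
    by (rule eq_ct_trans[OF letter_transp_invol eq_ct_sym[OF letter_transp_invol eq_ct_orbit(1)[OF c]] eq_ct_orbit(2)[OF c]])
  then have "word_of (R J ?d) = word_of (R J ?e)" by (rule cs_unique[OF loopsD(2)[OF k] loopsD(2)[OF l]])
  then have e: "R J ?d = R J ?e" by (rule R_immortal_eq[OF loopsD(1)[OF k] loopsD(1)[OF l]])
  have kk: "k + (l + (k * ?L - k)) = k * ?L + l" using pos by (cases ?L) auto
  have "(nx J ^^ (l + (k * ?L - k))) ?d = (nx J ^^ (k * ?L + l)) c" by (simp only: nx_add kk)
  also have "\<dots> = (nx J ^^ l) c" by (simp only: nx_add[symmetric] period_mult[OF J_in nx_len[OF prim_jx c]])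
  finally have r: "(nx J ^^ (l + (k * ?L - k))) ?d = (nx J ^^ l) c" .
  note di = immortals_nx[OF i(1)[of k]]
  show False using R_not_palindrome[OF J_in di(3,4), of "l + (k * ?L - k)"] unfolding r using e by (rule notE)
qed

theorem good_W: "good J W"
  unfolding good_def
proof (intro conjI ballI allI impI)
  show "W \<subseteq> R J ` {c \<in> C. E J c}" unfolding W_def
  proof (rule image_mono, rule subsetI)
    fix c assume "c \<in> starts \<union> loops"
    then show "c \<in> {c \<in> C. E J c}"
    proof
      assume "c \<in> starts"
      then show ?thesis using starts_outer by (simp add: E_def)
    next
      assume "c \<in> loops"
      then show ?thesis using loopsD(1,3)[of c] by (simp add: E_def immortals_def)
    qed
  qed
next
  fix c assume cC: "c \<in> C" and Ec: "E J c"
  show "(\<exists>k. al J k c \<and> R J ((nx J ^^ k) c) \<in> W) \<noteq> (\<exists>k. al J k c \<and> R J (th ((nx J ^^ k) c)) \<in> W)"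
  proof (cases "c \<in> B")
    case False
    show ?thesis unfolding outer_forward[OF cC False] outer_backward[OF cC False] using starts_one[OF cC False] by blast
  next
    case True
    then have ci: "c \<in> immortals J" using cC Ec by (simp add: E_def immortals_def)
    note i = immortals_nx[OF ci]
    have B: "(nx J ^^ k) c \<in> B" "th ((nx J ^^ k) c) \<in> B" for k
      using i(1)[of k] immortals_nx(2)[OF i(1)[of k]] immortals_B[OF J_in] by blast+
    have "(\<exists>k. al J k c \<and> R J ((nx J ^^ k) c) \<in> W) \<longleftrightarrow> (\<exists>k. (nx J ^^ k) c \<in> loops)"
      by (simp only: i(4) W_inner[OF B(1)] simp_thms)
    moreover have "(\<exists>k. al J k c \<and> R J (th ((nx J ^^ k) c)) \<in> W) \<longleftrightarrow> (\<exists>k. th ((nx J ^^ k) c) \<in> loops)"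
      by (simp only: i(4) W_inner[OF B(2)] simp_thms)
    ultimately show ?thesis using immortal_some_loop[OF ci] immortal_one_side[OF ci] by blast
  qed
next
  fix c k assume cC: "c \<in> C" and a: "R J c \<in> W \<and> al J k c \<and> R J ((nx J ^^ k) c) \<in> W"
  then have r: "R J c \<in> W" "al J k c" "R J ((nx J ^^ k) c) \<in> W" by simp_all
  show "R J ((nx J ^^ k) c) = R J c"
  proof (cases k)
    case (Suc m)
    have "(nx J ^^ k) c \<in> B" by (rule nx_pow_B[OF J_in r(2)]) (simp add: Suc)
    then have l: "(nx J ^^ k) c \<in> loops" using W_inner r(3) by blast
    show ?thesis
    proof (cases "c \<in> B")
      case False
      then show ?thesis using outer_mortal[OF cC False r(2)] loopsD(1)[OF l] by blast
    next
      case True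
      then have cl: "c \<in> loops" using W_inner r(1) by blast
      have "word_of (R J c) = word_of (R J ((nx J ^^ k) c))"
        by (rule cs_unique[OF loopsD(2)[OF cl] loopsD(2)[OF l] eq_ct_orbit(1)[OF loopsD(1)[OF cl]]])
      then show ?thesis by (rule R_immortal_eq[OF loopsD(1)[OF cl] loopsD(1)[OF l], symmetric])
    qed
  qed simp
qed

text \<open>The readings that occur correspond to the indices j with \<gamma>_j nonzero, and
  \<gamma>_j is the number of starts with that reading. The other indices add factors
  \<open>sigma 0\<close>, equal to 1.\<close>

lemma prod_loops:
  "(\<Prod>r\<in>R J ` loops. sigma (card {s \<in> loops. R J s = r}) (word_mat Xs (word_of r))) =
    (\<Prod>j<length \<gamma>. sigma (\<gamma> ! j) (word_mat Xs (cs ! j)))"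
proof -
  define N where "N = {j. j < length cs \<and> \<gamma> ! j \<noteq> 0}"
  have cnt: "count_closed J (cs ! j) = \<gamma> ! j" if j: "j < length cs" for j
    using size_class_mult(1)[OF quad_cs(1) eqv_ct quad_cs(2) j eq_ct_refl] by (simp only: count_closed_mult)
  have lp: "R J s = per_reading (word_of (R J s))" if "s \<in> loops" for s
    by (rule R_immortal[OF J_in loopsD(1)[OF that]])
  have ex: "\<exists>s\<in>loops. word_of (R J s) = cs ! j" if j: "j \<in> N" for j
  proof -
    have jl: "j < length cs" "\<gamma> ! j \<noteq> 0" using j by (simp_all add: N_def)
    have "count_closed J (cs ! j) \<noteq> 0" using jl(2) by (simp only: cnt[OF jl(1)] not_False_eq_True)
    then have "card {c \<in> immortals J. word_of (R J c) = cs ! j} \<noteq> 0" unfolding count_closed_def .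
    then have "{c \<in> immortals J. word_of (R J c) = cs ! j} \<noteq> {}" by (metis card.empty)
    then obtain s where s: "s \<in> immortals J" "word_of (R J s) = cs ! j" by blast
    then have "s \<in> loops" using jl(1) by (simp add: loops_def)
    with s(2) show ?thesis by blast
  qed
  have wp: "word_of (per_reading (cs ! j)) = cs ! j" if j: "j \<in> N" for j
  proof -
    obtain s where s: "s \<in> loops" "word_of (R J s) = cs ! j" using ex[OF j] by blast
    have "R J s = per_reading (cs ! j)" using lp[OF s(1)] unfolding s(2) .
    then show ?thesis using s(2) by simp
  qed
  have inj: "inj_on (\<lambda>j. per_reading (cs ! j)) N"
  proof (rule inj_onI)
    fix i j assume ij: "i \<in> N" "j \<in> N" "per_reading (cs ! i) = per_reading (cs ! j)"
    have "cs ! i = word_of (per_reading (cs ! i))" by (rule wp[OF ij(1), symmetric])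
    also have "\<dots> = word_of (per_reading (cs ! j))" by (simp only: ij(3))
    also have "\<dots> = cs ! j" by (rule wp[OF ij(2)])
    finally have "cs ! i = cs ! j" .
    then have "eq_ct letter_transp (cs ! i) (cs ! j)" by (simp only: eq_ct_refl)
    then show "i = j" by (rule cs_index_unique[rotated 2]) (use ij(1,2) in \<open>simp_all add: N_def\<close>)
  qed
  have img: "R J ` loops = (\<lambda>j. per_reading (cs ! j)) ` N"
  proof (intro equalityI subsetI)
    fix r assume "r \<in> R J ` loops"
    then obtain s where s: "s \<in> loops" "r = R J s" by blast
    obtain j where j: "j < length cs" "word_of (R J s) = cs ! j" using loopsD(2)[OF s(1)] by (metis in_set_conv_nth)
    have "card {c \<in> immortals J. word_of (R J c) = cs ! j} \<noteq> 0"
      using finite_immortals[of "J"] loopsD(1)[OF s(1)] j(2) by (simp only: neq0_conv card_gt_0_iff) (intro conjI, blast, simp)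
    then have "count_closed J (cs ! j) \<noteq> 0" unfolding count_closed_def .
    then have "j \<in> N" using j(1) by (simp only: N_def mem_Collect_eq cnt[OF j(1)] simp_thms)
    moreover have "r = per_reading (cs ! j)" using lp[OF s(1)] unfolding s(2) j(2) .
    ultimately show "r \<in> (\<lambda>j. per_reading (cs ! j)) ` N" by blast
  next
    fix r assume "r \<in> (\<lambda>j. per_reading (cs ! j)) ` N"
    then obtain j where j: "j \<in> N" "r = per_reading (cs ! j)" by blast
    obtain s where s: "s \<in> loops" "word_of (R J s) = cs ! j" using ex[OF j(1)] by blast
    have "R J s = r" using lp[OF s(1)] unfolding s(2) j(2) .
    then show "r \<in> R J ` loops" using s(1) by blast
  qed
  have card: "card {s \<in> loops. R J s = per_reading (cs ! j)} = \<gamma> ! j" if j: "j \<in> N" for j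
  proof -
    have jl: "j < length cs" using j by (simp add: N_def)
    have "{s \<in> loops. R J s = per_reading (cs ! j)} = {c \<in> immortals J. word_of (R J c) = cs ! j}"
    proof (intro equalityI subsetI)
      fix s assume "s \<in> {s \<in> loops. R J s = per_reading (cs ! j)}"
      then have s: "s \<in> loops" "R J s = per_reading (cs ! j)" by simp_all
      show "s \<in> {c \<in> immortals J. word_of (R J c) = cs ! j}" using loopsD(1)[OF s(1)] s(2) wp[OF j] by simp
    next
      fix s assume "s \<in> {c \<in> immortals J. word_of (R J c) = cs ! j}"
      then have s: "s \<in> immortals J" "word_of (R J s) = cs ! j" by simp_all
      then have sl: "s \<in> loops" using jl by (simp add: loops_def)
      have "R J s = per_reading (cs ! j)" using lp[OF sl] unfolding s(2) .
      then show "s \<in> {s \<in> loops. R J s = per_reading (cs ! j)}" using sl by simp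
    qed
    then show ?thesis using cnt[OF jl] by (simp only: count_closed_def)
  qed
  have "(\<Prod>r\<in>R J ` loops. sigma (card {s \<in> loops. R J s = r}) (word_mat Xs (word_of r))) =
      (\<Prod>j\<in>N. sigma (card {s \<in> loops. R J s = per_reading (cs ! j)}) (word_mat Xs (word_of (per_reading (cs ! j)))))"
    unfolding img by (simp only: prod.reindex[OF inj] comp_def)
  also have "\<dots> = (\<Prod>j\<in>N. sigma (\<gamma> ! j) (word_mat Xs (cs ! j)))"
    by (intro prod.cong refl) (simp only: card wp)
  also have "\<dots> = (\<Prod>j<length \<gamma>. sigma (\<gamma> ! j) (word_mat Xs (cs ! j)))"
    by (rule prod.mono_neutral_left) (auto simp: N_def quad_cs(1) sigma_def)
  finally show ?thesis .
qed

section \<open>The term of one quadruple\<close>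

context
  fixes r :: "letter rel"
  assumes r: "strict_linear_order r"
begin

abbreviation "ec \<equiv> end_cell J"
abbreviation "wd \<equiv> \<lambda>s. word_of (R J s)"

lemma S_outer:
  assumes "s \<in> starts"
  shows "s \<in> C" "s \<notin> B" "ec s \<in> C" "ec s \<notin> B" "ec s \<notin> starts"
proof -
  show c: "s \<in> C" "s \<notin> B" by (rule starts_outer[OF assms])+
  show "ec s \<in> C" "ec s \<notin> B" by (rule end_cell_outer(1,2)[OF c])+
  show "ec s \<notin> starts" using starts_one[OF c] assms by blast
qed

lemma S_cases:
  assumes "s \<in> starts"
  shows "s \<in> isolated \<and> (\<exists>i. lam s = Letter i) \<or> s \<in> opens \<and> opath s \<in> P"
  using assms unfolding starts_def by blast

lemma end_end:
  assumes "s \<in> starts"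
  shows "ec (ec s) = s"
  using S_cases[OF assms]
proof
  assume "s \<in> isolated \<and> (\<exists>i. lam s = Letter i)"
  then have s: "s \<in> isolated" "s \<in> C" by (auto simp: isolated_def)
  then have "th s \<in> isolated" using th_in_C[OF s(2)] th_th[OF s(2)] by (simp add: isolated_def)
  then show ?thesis by (simp only: end_cell_isolated(1)[OF s(1)] end_cell_isolated(1) th_th[OF s(2)])
next
  assume "s \<in> opens \<and> opath s \<in> P"
  then show ?thesis using open_path_not_palindrome(4) by blast
qed

lemma finite_S: "finite starts"
  by (rule finite_subset[OF _ fin_C]) (use S_outer(1) in blast)

text \<open>Both kinds of arrows of T-tilde become strings with an outer start: an arrow kept from T
  is a string with one letter, a chosen open path a longer one.\<close>

lemma tilde_arrows_eq: "tilde_arrows q1 q2 (ptab \<xi>) P = (\<lambda>s. Arrow s (ec s) (wd s)) ` starts"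
proof -
  let ?h = "\<lambda>s. Arrow s (ec s) (wd s)"
  have 1: "(\<lambda>a. Arrow (tail a) (head a) [Letter (label a)]) ` {a \<in> ptab \<xi>. tail_col a \<notin> {q1, q2} \<and> head_col a \<notin> {q1, q2}}
      = ?h ` {s \<in> isolated. \<exists>i. lam s = Letter i}"
  proof (intro equalityI subsetI)
    fix x assume "x \<in> (\<lambda>a. Arrow (tail a) (head a) [Letter (label a)]) ` {a \<in> ptab \<xi>. tail_col a \<notin> {q1, q2} \<and> head_col a \<notin> {q1, q2}}"
    then obtain a where a: "a \<in> ptab \<xi>" "fst (tail a) \<notin> {q1, q2}" "fst (head a) \<notin> {q1, q2}" and x: "x = Arrow (tail a) (head a) [Letter (label a)]"
      by blast
    obtain a0 where a0: "a0 \<in> T" "a = Arrow (pc \<xi> (tail a0)) (pc \<xi> (head a0)) (label a0)"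
      using a(1) unfolding permute_tableau_def pc_def[symmetric] by (rule imageE)
    note C = tableau_arrow(1,2)[OF tab a0(1)]
    have nB: "tail a0 \<notin> B" "head a0 \<notin> B" using a(2,3) by (simp_all add: a0(2) B_def)
    note pcs = pc_outer[OF C(1) nB(1)] pc_outer[OF C(2) nB(2)]
    have i: "tail a0 \<in> isolated" using C nB arr_T(1)[OF a0(1)] by (simp add: isolated_def)
    have "x = ?h (tail a0)"
      by (simp add: x a0(2) pcs end_cell_isolated[OF i] arr_T[OF a0(1)])
    then show "x \<in> ?h ` {s \<in> isolated. \<exists>i. lam s = Letter i}" using i arr_T(3)[OF a0(1)] by blast
  next
    fix x assume "x \<in> ?h ` {s \<in> isolated. \<exists>i. lam s = Letter i}"
    then obtain s i where s: "s \<in> isolated" "lam s = Letter i" and x: "x = ?h s" by blast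
    have sC: "s \<in> C" "s \<notin> B" "th s \<notin> B" using s(1) by (simp_all add: isolated_def)
    show "x \<in> (\<lambda>a. Arrow (tail a) (head a) [Letter (label a)]) ` {a \<in> ptab \<xi>. tail_col a \<notin> {q1, q2} \<and> head_col a \<notin> {q1, q2}}"
      using sC(1)
    proof (cases rule: cell_cases)
      case (1 a0)
      note C = tableau_arrow(1,2)[OF tab 1(1)]
      have nB: "tail a0 \<notin> B" "head a0 \<notin> B" using sC arr_T(1)[OF 1(1)] 1(2) by simp_all
      note pcs = pc_outer[OF C(1) nB(1)] pc_outer[OF C(2) nB(2)]
      let ?a = "Arrow (pc \<xi> (tail a0)) (pc \<xi> (head a0)) (label a0)"
      have m: "?a \<in> ptab \<xi>" unfolding permute_tableau_def pc_def[symmetric] by (rule image_eqI[OF refl 1(1)])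
      have cols: "fst (tail a0) \<notin> {q1, q2}" "fst (head a0) \<notin> {q1, q2}" using nB C by (simp_all add: B_def)
      show ?thesis
      proof (rule image_eqI)
        show "x = Arrow (tail ?a) (head ?a) [Letter (label ?a)]"
          using end_cell_isolated[OF s(1)] arr_T[OF 1(1)] by (simp add: x pcs 1(2))
        show "?a \<in> {a \<in> ptab \<xi>. tail_col a \<notin> {q1, q2} \<and> head_col a \<notin> {q1, q2}}" using m cols by simp
      qed
    next
      case (2 a0)
      then show ?thesis using s(2) arr_T(4)[OF 2(1)] by simp
    qed
  qed
  have Psub: "\<exists>c\<in>opens. p = opath c" if "p \<in> P" for p
    using P_reps that open_path_iff unfolding representatives_def by blast
  have 2: "(\<lambda>p. Arrow (path_tail p) (path_head p) (path_word p)) ` P = ?h ` {s \<in> opens. opath s \<in> P}"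
  proof -
    have P: "P = opath ` {s \<in> opens. opath s \<in> P}" using Psub by blast
    have "(\<lambda>p. Arrow (path_tail p) (path_head p) (path_word p)) ` P =
        (\<lambda>s. Arrow (path_tail (opath s)) (path_head (opath s)) (path_word (opath s))) ` {s \<in> opens. opath s \<in> P}"
      by (subst P) (simp only: image_image)
    also have "\<dots> = ?h ` {s \<in> opens. opath s \<in> P}"
    proof (rule image_cong[OF refl])
      fix s assume "s \<in> {s \<in> opens. opath s \<in> P}"
      then have s: "s \<in> opens" by simp
      show "Arrow (path_tail (opath s)) (path_head (opath s)) (path_word (opath s)) = ?h s"
        by (simp only: opath_tail[OF s] opath_head[OF s] opath_word[OF s])
    qed
    finally show ?thesis .
  qed
  show ?thesis unfolding tilde_arrows_def 1 2 starts_def by (rule image_Un[symmetric])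
qed

abbreviation "WW \<equiv> wd ` starts"
abbreviation "ix \<equiv> word_index r WW"
abbreviation "tt \<equiv> tilde_tableau r q1 q2 (ptab \<xi>) P"
abbreviation "tX \<equiv> tilde_subst r q1 q2 (ptab \<xi>) P Xs"

lemma label_tilde: "label ` tilde_arrows q1 q2 (ptab \<xi>) P = WW"
  by (simp only: tilde_arrows_eq image_image arrow.sel)

lemma tilde_tableau_eq: "tt = (\<lambda>s. Arrow (ren s) (ren (ec s)) (ix (wd s))) ` starts"
  by (simp only: tilde_tableau_def Let_def label_tilde tilde_arrows_eq image_image arrow.sel)

lemma finite_WW: "finite WW" using finite_S by simp

lemma tilde_subst_ix:
  assumes "w \<in> WW"
  shows "tX ! ix w = word_mat Xs w"
proof -
  have "ix w < card WW" by (rule word_index_inj(2)[OF r finite_WW assms])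
  then have "tX ! ix w = word_mat Xs (the_inv_into WW ix (ix w))"
    by (simp add: tilde_subst_def Let_def label_tilde)
  also have "the_inv_into WW ix (ix w) = w" by (rule the_inv_into_f_f[OF word_index_inj(1)[OF r finite_WW] assms])
  finally show ?thesis .
qed

lemma ix_eq:
  assumes s: "s \<in> starts" and s': "s' \<in> starts"
  shows "ix (wd s) = ix (wd s') \<longleftrightarrow> R J s = R J s'"
proof
  assume "ix (wd s) = ix (wd s')"
  then have "wd s = wd s'" by (rule inj_onD[OF word_index_inj(1)[OF r finite_WW]]) (use s s' in blast)+
  then show "R J s = R J s'" using R_outer[OF J_in S_outer(1,2)[OF s]] R_outer[OF J_in S_outer(1,2)[OF s']] by simp
qed simp

lemma S_inj: "inj_on (\<lambda>s. Arrow (ren s) (ren (ec s)) (ix (wd s))) starts"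
  by (rule inj_onI) (use ren_inj S_outer(1,2) in blast)

text \<open>Equal indices mean equal words and hence equal readings. The first letter fixes the
  column of the tail and the last letter that of the head. Arrows are disjoint because exactly one
  end of each string is a start.\<close>

lemma arrows_ok_tilde: "arrows_ok (tilde_dim q1 q2 ns) tt"
  unfolding arrows_ok_def tilde_tableau_eq
proof (intro conjI ballI impI)
  let ?f = "\<lambda>s. Arrow (ren s) (ren (ec s)) (ix (wd s))"
  show "finite (?f ` starts)" using finite_S by simp
  fix a assume "a \<in> ?f ` starts"
  then obtain s where s: "s \<in> starts" "a = ?f s" by blast
  note o = S_outer[OF s(1)]
  show "tail a \<in> cells (tilde_dim q1 q2 ns)" unfolding s(2) arrow.sel by (rule ren_cells[OF o(1,2)])
  show "head a \<in> cells (tilde_dim q1 q2 ns)" unfolding s(2) arrow.sel by (rule ren_cells[OF o(3,4)])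
  show "tail a \<noteq> head a"
  proof
    assume "tail a = head a"
    then have "ren s = ren (ec s)" by (simp only: s(2) arrow.sel)
    then have "s = ec s" by (rule ren_inj[OF o(1-4)])
    then show False using o(5) s(1) by simp
  qed
  fix a' assume "a' \<in> ?f ` starts"
  then obtain s' where s': "s' \<in> starts" "a' = ?f s'" by blast
  note o' = S_outer[OF s'(1)]
  show "a = a'" if "{tail a, head a} \<inter> {tail a', head a'} \<noteq> {}"
  proof -
    have "ren s = ren s' \<or> ren s = ren (ec s') \<or> ren (ec s) = ren s' \<or> ren (ec s) = ren (ec s')"
      using that unfolding s(2) s'(2) arrow.sel by blast
    then have "s = s' \<or> s = ec s' \<or> ec s = s' \<or> ec s = ec s'"
      using ren_inj[OF o(1,2) o'(1,2)] ren_inj[OF o(1,2) o'(3,4)] ren_inj[OF o(3,4) o'(1,2)] ren_inj[OF o(3,4) o'(3,4)] by blast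
    then have "s = s' \<or> ec s = ec s'" using o(5) o'(5) s(1) s'(1) by metis
    then have "s = s'" using end_end[OF s(1)] end_end[OF s'(1)] by metis
    then show ?thesis by (simp only: s(2) s'(2))
  qed
  have lab: "fst s = fst s' \<and> fst (ec s) = fst (ec s')" if "label a = label a'"
  proof -
    have "ix (wd s) = ix (wd s')" using that by (simp only: s(2) s'(2) arrow.sel)
    then have e: "R J s = R J s'" using ix_eq[OF s(1) s'(1)] by blast
    let ?k = "len (R J s) - 1"
    have a: "al J ?k s" by (rule end_cell_outer(3)[OF o(1,2)])
    have a': "al J ?k s'" using end_cell_outer(3)[OF o'(1,2)] by (simp only: e)
    have l: "lam ((nx J ^^ ?k) s) = lam ((nx J ^^ ?k) s')" by (rule R_eq_lam[OF e a])
    have "fst (th ((nx J ^^ ?k) s)) = fst (th ((nx J ^^ ?k) s'))"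
      by (rule lam_cols(2)[OF nx_pow_C[OF J_in o(1) a] nx_pow_C[OF J_in o'(1) a'] l])
    moreover have "fst s = fst s'" by (rule lam_cols(1)[OF o(1) o'(1) R_eq_B(2)[OF o(1) o'(1) e]])
    ultimately show ?thesis by (simp only: end_cell_def e simp_thms)
  qed
  show "head_col a = head_col a'" "tail_col a = tail_col a'" if "label a = label a'"
    using lab[OF that] by (simp_all add: s(2) s'(2) ren_eq)
qed

lemma card_aut_tilde: "card (aut tt label) = card (aut starts (R J))"
proof (rule card_aut_bij[symmetric])
  show "bij_betw (\<lambda>s. Arrow (ren s) (ren (ec s)) (ix (wd s))) starts tt"
    unfolding tilde_tableau_eq by (rule inj_on_imp_bij_betw[OF S_inj])
  show "(label (Arrow (ren s) (ren (ec s)) (ix (wd s))) = label (Arrow (ren s') (ren (ec s')) (ix (wd s')))) = (R J s = R J s')"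
    if "s \<in> starts" "s' \<in> starts" for s s' unfolding arrow.sel by (rule ix_eq[OF that])
qed

text \<open>The order N of the group on all starts is a1 * a2, since open and closed starts have
  different readings. The factor a1 reappears between the full sum and \<open>bpf\<close> of
  T-tilde, a2 in front of the \<open>sigma\<close>, so N cancels.\<close>

theorem sum_same_eq_term:
  "(\<Sum>G\<in>{G \<in> joinings. same J G}. U G) = of_nat (card (aut T label)) *
    (of_int (sign \<xi>) * bpf (tilde_dim q1 q2 ns) tt tX * (\<Prod>j<length \<gamma>. sigma (\<gamma> ! j) (word_mat Xs (cs ! j))))"
proof -
  let ?W = "W" and ?K = "loops" and ?R = "R J"
  note g = good_W and pj = prim_jx
  note st = St_W
  define N where "N = card (aut (St J ?W) ?R)"
  define M where "M = card labelled_perms"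
  define a1 where "a1 = card (aut starts ?R)"
  define a2 where "a2 = card (aut ?K ?R)"
  define p :: 'a where "p = (\<Prod>j<length \<gamma>. sigma (\<gamma> ! j) (word_mat Xs (cs ! j)))"
  define bt where "bt = bpf (tilde_dim q1 q2 ns) tt tX"
  have KB: "?K \<subseteq> B" using loopsD(4) by blast
  have un: "St J ?W = starts \<union> ?K" unfolding st[symmetric] clo_def by blast
  have "?R s \<noteq> ?R c" if sc: "s \<in> starts" "c \<in> ?K" for s c
    using R_eq_B(1)[OF S_outer(1)[OF sc(1)] loopsD(3)[OF sc(2)], of "J"] S_outer(2)[OF sc(1)] loopsD(4)[OF sc(2)] by blast
  then have "?R ` starts \<inter> ?R ` ?K = {}" by blast
  moreover have "starts \<inter> ?K = {}" using S_outer(2) KB by blast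
  ultimately have N: "N = a1 * a2" unfolding N_def un a1_def a2_def by (intro card_aut_Un)
  have "finite (St J ?W)" by (rule finite_St)
  then have Npos: "0 < N" unfolding N_def by (rule card_aut_pos)
  have main: "of_nat N * (\<Sum>G\<in>{G \<in> joinings. same J G}. U G) = of_nat M * (\<Sum>\<rho>\<in>aut ?K ?R. U (cj \<rho> J))"
    unfolding N_def M_def st(2)[symmetric] by (rule sum_same_joinings[OF J_in g U_cj])
  have fK: "finite (?R ` ?K)" using finite_subset[OF KB finite_B] by simp
  have full: "bpf_full (tilde_dim q1 q2 ns) tt ((!) tX) =
    (\<Sum>\<pi>\<in>Operms. (\<Prod>i\<in>Oc. of_int (sign (\<pi> i))) * (\<Prod>s\<in>starts. word_mat Xs (wd s) $$ (outer_value \<pi> s, outer_value \<pi> (ec s))))"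
  proof -
    have "bpf_full (tilde_dim q1 q2 ns) tt ((!) tX) =
      (\<Sum>\<pi>\<in>Operms. (\<Prod>i\<in>Oc. of_int (sign (\<pi> i))) * (\<Prod>s\<in>starts. tX ! ix (wd s) $$ (outer_value \<pi> s, outer_value \<pi> (ec s))))"
      by (rule bpf_full_tilde[OF finite_S _ tilde_tableau_eq]) (use S_outer in blast)
    also have "\<dots> = (\<Sum>\<pi>\<in>Operms. (\<Prod>i\<in>Oc. of_int (sign (\<pi> i))) * (\<Prod>s\<in>starts. word_mat Xs (wd s) $$ (outer_value \<pi> s, outer_value \<pi> (ec s))))"
      by (intro sum.cong refl arg_cong2[where f = "(*)"] prod.cong) (simp add: tilde_subst_ix)
    finally show ?thesis .
  qed
  have "(\<Sum>\<rho>\<in>aut ?K ?R. U (cj \<rho> J)) = of_int (sign \<xi>) * bpf_full (tilde_dim q1 q2 ns) tt ((!) tX) * (of_nat a2 * p)"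
    using sum_rho_U[OF J_in g pj, of "?R ` ?K"] fK
    unfolding st full jperm_jn[OF \<xi>] a2_def p_def prod_loops by simp
  also have "bpf_full (tilde_dim q1 q2 ns) tt ((!) tX) = of_nat a1 * bt"
    unfolding bt_def a1_def card_aut_tilde[symmetric] by (rule card_aut_mult_bpf[OF arrows_ok_tilde, symmetric])
  finally have rho: "(\<Sum>\<rho>\<in>aut ?K ?R. U (cj \<rho> J)) = of_int (sign \<xi>) * (of_nat a1 * bt) * (of_nat a2 * p)" .
  have "of_nat N * (\<Sum>G\<in>{G \<in> joinings. same J G}. U G) = of_nat M * (of_int (sign \<xi>) * (of_nat a1 * bt) * (of_nat a2 * p))"
    by (simp only: main rho)
  also have "\<dots> = of_nat N * (of_nat M * (of_int (sign \<xi>) * bt * p))" by (simp only: N of_nat_mult mult_ac)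
  finally have "of_nat N * (\<Sum>G\<in>{G \<in> joinings. same J G}. U G) = of_nat N * (of_nat M * (of_int (sign \<xi>) * bt * p))" .
  then have "(\<Sum>G\<in>{G \<in> joinings. same J G}. U G) = of_nat M * (of_int (sign \<xi>) * bt * p)"
    by (rule of_nat_mult_left_cancel[OF _ Npos])
  then show ?thesis unfolding M_def card_labelled_perms bt_def p_def .
qed

lemma WW_over:
  assumes "w \<in> WW"
  shows "w \<in> words_over (length Xs)"
proof -
  obtain s where s: "s \<in> starts" "w = wd s" using assms by blast
  note o = S_outer[OF s(1)]
  have "letter_index (the (R J s k)) < length Xs" if k: "k < len (R J s)" for k
  proof -
    have a: "al J k s" using len_outer(2)[OF J_in o(1,2)] k by blast
    show ?thesis using lam_index[OF nx_pow_C[OF J_in o(1) a]] a by (simp add: R_def)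
  qed
  then show ?thesis unfolding s(2) by (auto simp: words_over_def word_of_def)
qed

lemma tilde_arrow_facts:
  assumes "a \<in> tt"
  shows "tail a \<in> cells (tilde_dim q1 q2 ns) \<and> head a \<in> cells (tilde_dim q1 q2 ns) \<and> label a < length tX \<and>
    tX ! label a \<in> carrier_mat (tilde_dim q1 q2 ns ! tail_col a) (tilde_dim q1 q2 ns ! head_col a)"
proof -
  obtain s where s: "s \<in> starts" "a = Arrow (ren s) (ren (ec s)) (ix (wd s))" using assms unfolding tilde_tableau_eq by blast
  note o = S_outer[OF s(1)]
  have w: "wd s \<in> WW" using s(1) by blast
  have len: "length tX = card WW" by (simp add: tilde_subst_def Let_def label_tilde)
  have "s \<in> St J (W)" using St_W(1) s(1) by blast
  then have "word_mat Xs (wd s) \<in> carrier_mat (ns ! fst s) (ns ! fst (ec s))"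
    by (rule word_mat_cell_string(1)[OF J_in good_W prim_jx])
  then have "tX ! ix (wd s) \<in> carrier_mat (ns ! fst s) (ns ! fst (ec s))" by (simp only: tilde_subst_ix[OF w])
  moreover have "ix (wd s) < length tX" unfolding len by (rule word_index_inj(2)[OF r finite_WW w])
  moreover have "tilde_dim q1 q2 ns ! rk (fst s) = ns ! fst s" "tilde_dim q1 q2 ns ! rk (fst (ec s)) = ns ! fst (ec s)"
    using rk_nth[OF outer_Oc[OF o(1,2)]] rk_nth[OF outer_Oc[OF o(3,4)]] .
  moreover note ren_cells[OF o(1,2)] ren_cells[OF o(3,4)]
  ultimately show ?thesis by (simp only: s(2) arrow.sel ren_eq fst_conv simp_thms)
qed

text \<open>The arrows and indices of T-tilde are built from words and do not depend on the
  matrices, so a homomorphism only has to be applied to the matrices of the words.\<close>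

lemma bpf_tilde_hom:
  assumes "comm_ring_hom h"
  shows "bpf (tilde_dim q1 q2 ns) tt (tilde_subst r q1 q2 (ptab \<xi>) P (map (map_mat h) Xs)) = h (bpf (tilde_dim q1 q2 ns) tt tX)"
proof -
  interpret h: comm_ring_hom h by (rule assms)
  note inj = word_index_inj[OF r finite_WW]
  have "ix ` WW \<subseteq> {..<card WW}" using inj(2) by blast
  then have surj: "ix ` WW = {..<card WW}" by (rule card_subset_eq[OF finite_lessThan]) (simp add: card_image[OF inj(1)])
  have mem: "the_inv_into WW ix k \<in> WW" if "k < card WW" for k
    by (rule the_inv_into_into[OF inj(1) _ subset_refl]) (use that surj in blast)
  have "tilde_subst r q1 q2 (ptab \<xi>) P (map (map_mat h) Xs) = map (map_mat h) tX"
    unfolding tilde_subst_def Let_def label_tilde map_map comp_def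
  proof (rule map_cong[OF refl])
    fix k assume "k \<in> set [0..<card WW]"
    then have k: "k < card WW" by simp
    show "word_mat (map (map_mat h) Xs) (the_inv_into WW ix k) = map_mat h (word_mat Xs (the_inv_into WW ix k))"
      by (rule h.word_mat_hom[OF WW_over[OF mem[OF k]]])
  qed
  then show ?thesis by (simp only: h.bpf_hom[OF tilde_arrow_facts])
qed

end

end

end

end

section \<open>Summation over the admissible quadruples\<close>

lemma reps_list:
  assumes S: "equivalence S"
  shows "finite A \<Longrightarrow> \<exists>b. set b \<subseteq> A \<and> (\<forall>i j. i < j \<and> j < length b \<longrightarrow> \<not> S (b ! i) (b ! j)) \<and> (\<forall>x\<in>A. \<exists>j<length b. S x (b ! j))"
proof (induction rule: finite_induct)
  case (insert x A)
  then obtain b where b: "set b \<subseteq> A" "\<And>i j. i < j \<Longrightarrow> j < length b \<Longrightarrow> \<not> S (b ! i) (b ! j)" "\<And>x. x \<in> A \<Longrightarrow> \<exists>j<length b. S x (b ! j)"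
    by blast
  show ?case
  proof (cases "\<exists>j<length b. S x (b ! j)")
    case True
    show ?thesis by (rule exI[of _ b]) (use b True in auto)
  next
    case False
    show ?thesis
    proof (intro exI[of _ "x # b"] conjI allI impI ballI)
      show "set (x # b) \<subseteq> insert x A" using b(1) by auto
      fix i j assume ij: "i < j \<and> j < length (x # b)"
      then obtain j' where j: "j = Suc j'" by (cases j) auto
      show "\<not> S ((x # b) ! i) ((x # b) ! j)"
      proof (cases i)
        case 0
        then show ?thesis using False ij j by simp
      next
        case (Suc i')
        then show ?thesis using b(2)[of i' j'] ij j by simp
      qed
    next
      fix y assume "y \<in> insert x A"
      then show "\<exists>j<length (x # b). S y ((x # b) ! j)"
      proof
        assume "y = x"
        then have "0 < length (x # b) \<and> S y ((x # b) ! 0)" using equivalenceD(1)[OF S] by simp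
        then show ?thesis by (rule exI)
      next
        assume "y \<in> A"
        then obtain j where "j < length b" "S y (b ! j)" using b(3) by blast
        then have "Suc j < length (x # b) \<and> S y ((x # b) ! Suc j)" by simp
        then show ?thesis by (rule exI)
      qed
    qed
  qed
qed simp

lemma representatives_exist:
  assumes S: "equivalence S"
  shows "\<exists>P. representatives S A P"
proof -
  define rep where "rep x = (SOME y. y \<in> A \<and> S x y)" for x
  have rep: "rep x \<in> A \<and> S x (rep x)" if "x \<in> A" for x
    unfolding rep_def by (rule someI[of _ x]) (use that equivalenceD(1)[OF S] in simp)
  have "representatives S A (rep ` A)" unfolding representatives_def
  proof (intro conjI ballI)
    show "rep ` A \<subseteq> A" using rep by blast
    fix x assume x: "x \<in> A"
    show "\<exists>!y. y \<in> rep ` A \<and> S x y"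
    proof (rule ex1I[of _ "rep x"])
      show "rep x \<in> rep ` A \<and> S x (rep x)" using rep[OF x] x by blast
      fix y assume y: "y \<in> rep ` A \<and> S x y"
      then obtain z where z: "z \<in> A" "y = rep z" by blast
      have "S z y" unfolding z(2) using rep[OF z(1)] by (rule conjunct2)
      then have "S x z" by (rule equivalenceD(3)[OF S conjunct2[OF y] equivalenceD(2)[OF S]])
      then have "S x = S z" by (rule equivalence_class_eq[OF S])
      then show "y = rep x" by (simp only: z(2) rep_def)
    qed
  qed
  then show ?thesis by (rule exI)
qed

context tableau_cols
begin

lemma word_of_over:
  assumes F: "F \<in> joinings" and c: "c \<in> C" and al: "\<And>k. k < len (R F c) \<Longrightarrow> al F k c"
  shows "word_of (R F c) \<in> words_over (length Xs)"
proof -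
  have "letter_index (the (R F c k)) < length Xs" if "k < len (R F c)" for k
    using lam_index[OF nx_pow_C[OF F c al[OF that]]] al[OF that] by (simp add: R_def)
  then show ?thesis by (auto simp: words_over_def word_of_def)
qed

text \<open>In a proper power the first letter would recur inside the string. But the first letter
  belongs to a cell outside B and all later ones to cells of B.\<close>

lemma primitive_open_word:
  assumes F: "F \<in> joinings" and c: "c \<in> C" "c \<notin> B"
  shows "primitive (word_of (R F c))"
  unfolding primitive_def
proof
  assume "\<exists>v k. 2 \<le> k \<and> word_of (R F c) = concat (replicate k v)"
  then obtain v k where k: "2 \<le> k" and w: "word_of (R F c) = concat (replicate k v)" by blast
  note l = len_outer[OF F c]
  have "length (word_of (R F c)) = k * length v" unfolding w by (simp add: length_concat sum_list_replicate)
  then have L: "len (R F c) = k * length v" by simp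
  then have v: "0 < length v" using l(1) by (cases "length v") simp_all
  then have lt: "length v < k * length v" using k by (cases k) auto
  have "word_of (R F c) ! length v = v ! (length v mod length v)" "word_of (R F c) ! 0 = v ! (0 mod length v)"
    unfolding w by (rule concat_replicate_nth, use lt in simp)+
  then have "word_of (R F c) ! length v = word_of (R F c) ! 0" by simp
  moreover have a: "al F (length v) c" using l(2)[of "length v"] lt L by simp
  ultimately have e: "lam ((nx F ^^ length v) c) = lam c"
    using lt L l(1) by (simp add: word_of_nth R_def)
  have "(nx F ^^ length v) c \<in> B" by (rule nx_pow_B[OF F a v])
  then show False using lam_B[OF nx_pow_C[OF F c(1) a] c(1) e] c(2) by blast
qed

text \<open>If the word were a proper power, its root would be a shorter period of the
  reading.\<close>

lemma primitive_closed_word: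
  assumes F: "F \<in> joinings" and c: "c \<in> immortals F"
  shows "primitive (word_of (R F c))"
  unfolding primitive_def
proof
  assume "\<exists>v k. 2 \<le> k \<and> word_of (R F c) = concat (replicate k v)"
  then obtain v k where k: "2 \<le> k" and w: "word_of (R F c) = concat (replicate k v)" by blast
  have cC: "c \<in> C" and im: "\<And>k. al F k c" using c by (simp_all add: immortals_def)
  have pos: "0 < len (R F c)" by (rule len_immortal(1)[OF F cC im])
  have "length (word_of (R F c)) = k * length v" unfolding w by (simp add: length_concat sum_list_replicate)
  then have L: "len (R F c) = k * length v" by simp
  then have v: "0 < length v" using pos by (cases "length v") simp_all
  then have lt: "length v < k * length v" using k by (cases k) auto
  have Ri: "R F c i = Some (v ! (i mod length v))" for i
  proof -
    have "R F c i = per_reading (word_of (R F c)) i" by (rule fun_cong[OF R_immortal[OF F c]])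
    also have "\<dots> = Some (word_of (R F c) ! (i mod (k * length v)))" by (simp only: per_reading_def length_word_of L)
    also have "word_of (R F c) ! (i mod (k * length v)) = v ! (i mod (k * length v) mod length v)"
      unfolding w by (rule concat_replicate_nth) (use L pos in simp)
    also have "i mod (k * length v) mod length v = i mod length v" by (simp add: mod_mod_cancel)
    finally show ?thesis .
  qed
  have "len (R F c) \<le> length v" by (rule len_le[OF v]) (simp add: Ri)
  then show False using L lt by simp
qed

text \<open>Choose representatives of the words that occur, and as multiplicity the number of cells
  with exactly that word. By the counts of representatives this number depends only on the class of
  the word and equals the number of paths in it.\<close>

lemma quadruple_exists:
  assumes \<xi>: "\<xi> permutes {..<n}" and prim: "prim (jn \<xi>)"
  shows "\<exists>x. T_quadruple (length Xs) x \<and> admissible_perm q1 q2 n T x \<xi>"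
proof -
  let ?w = "\<lambda>c. word_of (R (jn \<xi>) c)"
  note F = jn_joinings[OF \<xi>]
  have eo: "equivalence (eq_t letter_transp)" by (rule equivalence_eq_t) simp
  have ec: "equivalence (eq_ct letter_transp)" by (rule equivalence_eq_ct) simp
  have ea: "equivalence (eq_ct arrow_transp)" by (rule equivalence_eq_ct) simp
  obtain b where b': "set b \<subseteq> ?w ` opens \<and> (\<forall>i j. i < j \<and> j < length b \<longrightarrow> \<not> eq_t letter_transp (b ! i) (b ! j)) \<and>
      (\<forall>x\<in>?w ` opens. \<exists>j<length b. eq_t letter_transp x (b ! j))"
    using reps_list[OF eo finite_imageI[OF finite_opens]] by (rule exE)
  note b1 = conjunct1[OF b'] and b2 = conjunct1[OF conjunct2[OF b']] and b3 = conjunct2[OF conjunct2[OF b']]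
  have b2': "\<not> eq_t letter_transp (b ! i) (b ! j)" if "i < j" "j < length b" for i j
    using b2 that by blast
  note b = b1 b2' bspec[OF b3]
  obtain cs where c': "set cs \<subseteq> ?w ` immortals (jn \<xi>) \<and> (\<forall>i j. i < j \<and> j < length cs \<longrightarrow> \<not> eq_ct letter_transp (cs ! i) (cs ! j)) \<and>
      (\<forall>x\<in>?w ` immortals (jn \<xi>). \<exists>j<length cs. eq_ct letter_transp x (cs ! j))"
    using reps_list[OF ec finite_imageI[OF finite_immortals]] by (rule exE)
  note c1 = conjunct1[OF c'] and c2 = conjunct1[OF conjunct2[OF c']] and c3 = conjunct2[OF conjunct2[OF c']]
  have c2': "\<not> eq_ct letter_transp (cs ! i) (cs ! j)" if "i < j" "j < length cs" for i j
    using c2 that by blast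
  note c = c1 c2' bspec[OF c3]
  define \<beta> where "\<beta> = map (count_open (jn \<xi>)) b"
  define \<gamma> where "\<gamma> = map (count_closed (jn \<xi>)) cs"
  have lb: "length \<beta> = length b" and lc: "length \<gamma> = length cs" by (simp_all add: \<beta>_def \<gamma>_def)
  obtain Cs where Cs: "representatives (eq_ct arrow_transp) {p. closed_path q1 q2 (ptab \<xi>) p} Cs"
    using representatives_exist[OF ea] by blast
  have fin: "finite Cs" using Cs unfolding representatives_def by (blast intro: finite_subset[OF _ finite_closed_paths[OF \<xi>]])
  note ro = T_open_representatives[OF tableau_ptab[OF \<xi>], of q1 q2]
  have "T_open q1 q2 (ptab \<xi>) \<subseteq> opath \<xi> ` opens" using open_path_iff[OF \<xi>] by (auto simp: T_open_def)
  then have fo: "finite (T_open q1 q2 (ptab \<xi>))" by (rule finite_subset) (simp add: finite_opens)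
  have so: "size (filter_mset (eq_t letter_transp w) (mset_with_mult \<beta> b)) = count_open (jn \<xi>) w" for w
  proof (cases "\<exists>j<length b. eq_t letter_transp w (b ! j)")
    case True
    then obtain j where j: "j < length b" "eq_t letter_transp w (b ! j)" by blast
    have "size (filter_mset (eq_t letter_transp w) (mset_with_mult \<beta> b)) = \<beta> ! j" by (rule size_class_mult(1)[OF lb eo b(2) j])
    also have "\<dots> = count_open (jn \<xi>) (b ! j)" using j(1) by (simp add: \<beta>_def)
    also have "\<dots> = count_open (jn \<xi>) w"
      unfolding card_reps_open[OF \<xi> ro, symmetric] equivalence_class_eq[OF eo j(2)] ..
    finally show ?thesis .
  next
    case False
    then have "size (filter_mset (eq_t letter_transp w) (mset_with_mult \<beta> b)) = 0"
      by (intro size_class_mult(2)[OF lb eo b(2)]) blast+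
    moreover have "{c \<in> opens. ?w c = w} = {}" using False b(3) by blast
    then have "count_open (jn \<xi>) w = 0" by (simp only: count_open_def card.empty)
    ultimately show ?thesis by simp
  qed
  have sc: "size (filter_mset (eq_ct letter_transp w) (mset_with_mult \<gamma> cs)) = count_closed (jn \<xi>) w" for w
  proof (cases "\<exists>j<length cs. eq_ct letter_transp w (cs ! j)")
    case True
    then obtain j where j: "j < length cs" "eq_ct letter_transp w (cs ! j)" by blast
    have "size (filter_mset (eq_ct letter_transp w) (mset_with_mult \<gamma> cs)) = \<gamma> ! j" by (rule size_class_mult(1)[OF lc ec c(2) j])
    also have "\<dots> = count_closed (jn \<xi>) (cs ! j)" using j(1) by (simp add: \<gamma>_def)
    also have "\<dots> = count_closed (jn \<xi>) w"
      unfolding card_reps_closed[OF \<xi> prim Cs, symmetric] equivalence_class_eq[OF ec j(2)] ..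
    finally show ?thesis .
  next
    case False
    then have "size (filter_mset (eq_ct letter_transp w) (mset_with_mult \<gamma> cs)) = 0"
      by (intro size_class_mult(2)[OF lc ec c(2)]) blast+
    moreover have "{c \<in> immortals (jn \<xi>). ?w c = w} = {}" using False c(3) by blast
    then have "count_closed (jn \<xi>) w = 0" by (simp only: count_closed_def card.empty)
    ultimately show ?thesis by simp
  qed
  have wo: "u \<in> words_over (length Xs) \<and> primitive u" if u: "u \<in> set b" for u
  proof -
    obtain d where d: "d \<in> opens" "u = ?w d" using u b(1) by blast
    have dC: "d \<in> C" "d \<notin> B" using d(1) by (simp_all add: opens_def)
    show ?thesis unfolding d(2)
      using word_of_over[OF F dC(1) iffD2[OF len_outer(2)[OF F dC]]] primitive_open_word[OF F dC] by (rule conjI)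
  qed
  have wc: "u \<in> words_over (length Xs) \<and> primitive u" if u: "u \<in> set cs" for u
  proof -
    obtain d where d: "d \<in> immortals (jn \<xi>)" "u = ?w d" using u c(1) by blast
    note i = immortals_nx[OF \<xi> d(1)]
    show ?thesis unfolding d(2)
      using word_of_over[OF F i(3) i(4)] primitive_closed_word[OF F d(1)] by (rule conjI)
  qed
  have "T_quadruple (length Xs) (\<beta>, \<gamma>, b, cs)"
    unfolding T_quadruple.simps using lb lc wo wc b(2) c(2) by (intro conjI allI ballI impI) blast+
  moreover have "admissible_perm q1 q2 n T (\<beta>, \<gamma>, b, cs) \<xi>"
    unfolding admissible_perm.simps
  proof (intro conjI exI)
    show "\<xi> permutes {..<n}" by (rule \<xi>)
    show "mset_equiv (eq_t letter_transp) (image_mset path_word (mset_set (T_open q1 q2 (ptab \<xi>)))) (mset_with_mult \<beta> b)"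
      unfolding mset_equiv_iff[OF eo] size_filter_image[OF fo] card_reps_open[OF \<xi> ro] so by blast
    show "representatives (eq_ct arrow_transp) {p. closed_path q1 q2 (ptab \<xi>) p} Cs" by (rule Cs)
    show "mset_equiv (eq_ct letter_transp) (image_mset path_word (mset_set Cs)) (mset_with_mult \<gamma> cs)"
      unfolding mset_equiv_iff[OF ec] size_filter_image[OF fin] card_reps_closed[OF \<xi> prim Cs] sc by blast
  qed
  ultimately show ?thesis by blast
qed

text \<open>Both relations compare the same two counting functions, once as class sizes of the
  multisets and once as numbers of cells with a given word.\<close>

lemma quadruple_equiv_iff_same:
  assumes x: "T_quadruple s x" "admissible_perm q1 q2 n T x \<xi>" and y: "T_quadruple s y" "admissible_perm q1 q2 n T y \<xi>'"
  shows "quadruple_equiv x y \<longleftrightarrow> same (jn \<xi>) (jn \<xi>')"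
proof -
  obtain \<beta> \<gamma> b cs where xe: "x = (\<beta>, \<gamma>, b, cs)" by (cases x)
  obtain \<beta>' \<gamma>' b' cs' where ye: "y = (\<beta>', \<gamma>', b', cs')" by (cases y)
  have p: "\<xi> permutes {..<n}" "\<xi>' permutes {..<n}" using x(2) y(2) by (simp_all add: xe ye)
  have eo: "equivalence (eq_t letter_transp)" by (rule equivalence_eq_t) simp
  have ec: "equivalence (eq_ct letter_transp)" by (rule equivalence_eq_ct) simp
  note fx = admissible_facts[OF p(1) x[unfolded xe]]
  note fy = admissible_facts[OF p(2) y[unfolded ye]]
  show ?thesis
    unfolding same_iff_counts[OF jn_joinings[OF p(1)] jn_joinings[OF p(2)]] xe ye quadruple_equiv.simps
      mset_equiv_iff[OF eo] mset_equiv_iff[OF ec] fx fy fun_eq_iff ..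
qed

text \<open>The joinings split into classes under \<open>same\<close>, and the classes correspond
  one to one to the members of Q. Summing \<open>sum_same_eq_term\<close> over the classes gives the
  full sum, and the common factor is cancelled by torsion-freeness.\<close>

theorem bpf_expansion:
  fixes \<xi> :: "quadruple \<Rightarrow> nat \<Rightarrow> nat" and P :: "quadruple \<Rightarrow> path set"
  assumes Q: "representatives quadruple_equiv (admissible q1 q2 n (length Xs) T) Q"
    and ad: "\<And>x. x \<in> Q \<Longrightarrow> admissible_perm q1 q2 n T x (\<xi> x)"
    and coh: "\<And>x. x \<in> Q \<Longrightarrow> coherent_open_reps q1 q2 (ptab (\<xi> x)) (P x)"
    and r: "strict_linear_order r"
  shows "bpf ns T Xs =
    (\<Sum>x\<in>Q. case x of (\<beta>, \<gamma>, b, c) \<Rightarrow>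
       of_int (sign (\<xi> x)) *
       bpf (tilde_dim q1 q2 ns) (tilde_tableau r q1 q2 (ptab (\<xi> x)) (P x)) (tilde_subst r q1 q2 (ptab (\<xi> x)) (P x) Xs) *
       (\<Prod>j<length \<gamma>. sigma (\<gamma> ! j) (word_mat Xs (c ! j))))"
proof -
  let ?F = "\<lambda>x. jn (\<xi> x)" and ?K = "\<lambda>x. {J \<in> joinings. same (jn (\<xi> x)) J}"
  have tq: "T_quadruple (length Xs) x" if "x \<in> Q" for x
    using Q that unfolding representatives_def admissible_def by blast
  have pm: "\<xi> x permutes {..<n}" if "x \<in> Q" for x using ad[OF that] by (cases x) simp
  have Fj: "?F x \<in> joinings" if "x \<in> Q" for x by (rule jn_joinings[OF pm[OF that]])
  have srefl: "same J J" for J by (simp add: same_def)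
  have uniq: "x = y" if xy: "x \<in> Q" "y \<in> Q" "same (?F x) (?F y)" for x y
  proof -
    have xA: "x \<in> admissible q1 q2 n (length Xs) T" using Q xy(1) unfolding representatives_def by blast
    have "\<exists>!z. z \<in> Q \<and> quadruple_equiv x z" using Q xA unfolding representatives_def by (elim conjE) (rule bspec)
    moreover have "quadruple_equiv x x" using quadruple_equiv_iff_same[OF tq ad tq ad, OF xy(1,1,1,1)] srefl by blast
    moreover have "quadruple_equiv x y" using quadruple_equiv_iff_same[OF tq ad tq ad, OF xy(1,1,2,2)] xy(3) by blast
    ultimately show ?thesis using xy(1,2) by blast
  qed
  have ex: "\<exists>x\<in>Q. same (?F x) J" if J: "J \<in> joinings" for J
  proof -
    \<comment> \<open>Only joinings with short cycles arise directly from quadruples, so J is first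
      replaced by a primitive joining with the same readings, hence of the same class.\<close>
    obtain J' where J': "J' \<in> joinings" "\<And>c. c \<in> C \<Longrightarrow> R J' c = R J c" "prim J'" using prim_exists[OF J] by blast
    have p: "jperm J' permutes {..<n}" by (rule jperm_permutes[OF J'(1)])
    have "prim (jn (jperm J'))" using J'(3) by (simp only: jn_jperm[OF J'(1)])
    from quadruple_exists[OF p this] obtain z where z: "T_quadruple (length Xs) z" "admissible_perm q1 q2 n T z (jperm J')" by blast
    then have "z \<in> admissible q1 q2 n (length Xs) T" by (auto simp: admissible_def)
    then obtain y where y: "y \<in> Q" "quadruple_equiv z y" using Q unfolding representatives_def by blast
    have "same (jn (jperm J')) (?F y)" using quadruple_equiv_iff_same[OF z tq[OF y(1)] ad[OF y(1)]] y(2) by blast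
    then have "same J' (?F y)" by (simp only: jn_jperm[OF J'(1)])
    moreover have "same J J'" by (rule same_cong[OF J'(2)])
    ultimately have "same J (?F y)" by (rule same_trans[rotated])
    then have "same (?F y) J" by (rule same_sym)
    then show ?thesis using y(1) by blast
  qed
  have finQ: "finite Q"
  proof (rule finite_imageD)
    show "finite (?F ` Q)" by (rule finite_subset[OF _ finite_joinings]) (use Fj in blast)
    show "inj_on ?F Q"
    proof (rule inj_onI)
      fix x y assume xy: "x \<in> Q" "y \<in> Q" "?F x = ?F y"
      show "x = y" by (rule uniq[OF xy(1,2)]) (simp only: xy(3) srefl)
    qed
  qed
  have union: "joinings = (\<Union>x\<in>Q. ?K x)" using ex by blast
  have disj: "?K x \<inter> ?K y = {}" if xy: "x \<in> Q" "y \<in> Q" "x \<noteq> y" for x y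
  proof (rule ccontr)
    assume "?K x \<inter> ?K y \<noteq> {}"
    then obtain J where J: "same (?F x) J" "same (?F y) J" by blast
    have "same (?F x) (?F y)" by (rule same_trans[OF J(1) same_sym[OF J(2)]])
    then show False using uniq[OF xy(1,2)] xy(3) by blast
  qed
  let ?t = "\<lambda>x. case x of (\<beta>, \<gamma>, b, c) \<Rightarrow>
       of_int (sign (\<xi> x)) *
       bpf (tilde_dim q1 q2 ns) (tilde_tableau r q1 q2 (ptab (\<xi> x)) (P x)) (tilde_subst r q1 q2 (ptab (\<xi> x)) (P x) Xs) *
       (\<Prod>j<length \<gamma>. sigma (\<gamma> ! j) (word_mat Xs (c ! j)))"
  have trm: "(\<Sum>J\<in>?K x. U J) = of_nat (card (aut T label)) * ?t x" if x: "x \<in> Q" for x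
  proof -
    obtain \<beta> \<gamma> b cs where xe: "x = (\<beta>, \<gamma>, b, cs)" by (cases x)
    show ?thesis unfolding xe prod.case
      by (rule sum_same_eq_term[OF pm tq ad coh r, OF x[unfolded xe] x[unfolded xe] x[unfolded xe] x[unfolded xe]])
  qed
  have "of_nat (card (aut T label)) * bpf ns T Xs = bpf_full ns T ((!) Xs)" by (rule card_aut_mult_bpf[OF T_ok])
  also have "\<dots> = (\<Sum>J\<in>(\<Union>x\<in>Q. ?K x). U J)" unfolding union[symmetric] by (rule bpf_full_eq_sum_U)
  also have "\<dots> = (\<Sum>x\<in>Q. \<Sum>J\<in>?K x. U J)"
    by (rule sum.UNION_disjoint[OF finQ]) (use finite_joinings disj in auto)
  also have "\<dots> = (\<Sum>x\<in>Q. of_nat (card (aut T label)) * ?t x)" by (rule sum.cong[OF refl]) (rule trm)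
  also have "\<dots> = of_nat (card (aut T label)) * (\<Sum>x\<in>Q. ?t x)" by (rule sum_distrib_left[symmetric])
  finally have "of_nat (card (aut T label)) * bpf ns T Xs = of_nat (card (aut T label)) * (\<Sum>x\<in>Q. ?t x)" .
  moreover have "finite T" using T_ok by (simp add: arrows_ok_def)
  then have "0 < card (aut T label)" by (rule card_aut_pos)
  ultimately show ?thesis by (rule of_nat_mult_left_cancel)
qed

end

section \<open>Reduction to torsion-free rings\<close>

text \<open>The multiplicative monoid of a ring written additively: the type \<open>'a expo \<Rightarrow>\<^sub>0 int\<close> is its monoid
  ring over the integers.\<close>

datatype 'a expo = Expo (base: 'a)

instantiation expo :: (comm_monoid_mult) comm_monoid_add
begin

definition "0 = Expo 1"
definition "x + y = Expo (base x * base y)"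

instance
  by standard (simp_all add: zero_expo_def plus_expo_def mult_ac)

end

instance int :: torsion_free_ring
  by standard simp

instance poly_mapping :: (comm_monoid_add, torsion_free_ring) torsion_free_ring
proof
  fix k and f :: "'a \<Rightarrow>\<^sub>0 'b"
  assume f: "of_nat (Suc k) * f = 0"
  have l: "Poly_Mapping.lookup (of_nat m * f) x = of_nat m * Poly_Mapping.lookup f x" for m x
    by (induction m) (simp_all add: lookup_add distrib_right)
  show "f = 0"
  proof (rule poly_mapping_eqI)
    fix x
    have "of_nat (Suc k) * Poly_Mapping.lookup f x = 0" by (simp only: l[symmetric] f lookup_zero)
    then show "Poly_Mapping.lookup f x = Poly_Mapping.lookup 0 x" by (simp only: lookup_zero) (rule torsion_free)
  qed
qed

text \<open>The homomorphism that sends the basis element of a to a. It has an entrywise section, so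
  any matrices over the given ring lift to the torsion-free monoid ring.\<close>

definition monoid_ring_eval :: "('a::comm_ring_1 expo \<Rightarrow>\<^sub>0 int) \<Rightarrow> 'a" where
  "monoid_ring_eval f = (\<Sum>k\<in>Poly_Mapping.keys f. of_int (Poly_Mapping.lookup f k) * base k)"

lemma monoid_ring_eval_superset:
  assumes "finite K" "Poly_Mapping.keys f \<subseteq> K"
  shows "monoid_ring_eval f = (\<Sum>k\<in>K. of_int (Poly_Mapping.lookup f k) * base k)"
  unfolding monoid_ring_eval_def
  by (rule sum.mono_neutral_left[OF assms]) (simp add: in_keys_iff)

lemma monoid_ring_eval_0: "monoid_ring_eval 0 = 0"
  by (simp add: monoid_ring_eval_def)

lemma monoid_ring_eval_add: "monoid_ring_eval (f + g) = monoid_ring_eval f + monoid_ring_eval g"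
proof -
  let ?K = "Poly_Mapping.keys f \<union> Poly_Mapping.keys g"
  have K: "finite ?K" by simp
  have "monoid_ring_eval (f + g) = (\<Sum>k\<in>?K. of_int (Poly_Mapping.lookup (f + g) k) * base k)"
    by (rule monoid_ring_eval_superset[OF K keys_add])
  also have "\<dots> = (\<Sum>k\<in>?K. of_int (Poly_Mapping.lookup f k) * base k) + (\<Sum>k\<in>?K. of_int (Poly_Mapping.lookup g k) * base k)"
    by (simp only: lookup_add of_int_add distrib_right sum.distrib)
  also have "\<dots> = monoid_ring_eval f + monoid_ring_eval g"
    using monoid_ring_eval_superset[OF K Un_upper1] monoid_ring_eval_superset[OF K Un_upper2] by (simp only:)
  finally show ?thesis .
qed

lemma monoid_ring_eval_sum: "monoid_ring_eval (sum F A) = (\<Sum>a\<in>A. monoid_ring_eval (F a))"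
  by (induction A rule: infinite_finite_induct) (simp_all add: monoid_ring_eval_0 monoid_ring_eval_add)

lemma monoid_ring_eval_single: "monoid_ring_eval (Poly_Mapping.single k v) = of_int v * base k"
  using monoid_ring_eval_superset[of "{k}" "Poly_Mapping.single k v"] by simp

lemma sum_single_lookup: "f = (\<Sum>k\<in>Poly_Mapping.keys f. Poly_Mapping.single k (Poly_Mapping.lookup f k))"
proof (rule poly_mapping_eqI)
  fix x
  have "Poly_Mapping.lookup (\<Sum>k\<in>Poly_Mapping.keys f. Poly_Mapping.single k (Poly_Mapping.lookup f k)) x = (\<Sum>k\<in>Poly_Mapping.keys f. if k = x then Poly_Mapping.lookup f k else 0)"
    by (simp add: lookup_sum lookup_single when_def)
  also have "\<dots> = Poly_Mapping.lookup f x" by (simp add: in_keys_iff)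
  finally show "Poly_Mapping.lookup f x = Poly_Mapping.lookup (\<Sum>k\<in>Poly_Mapping.keys f. Poly_Mapping.single k (Poly_Mapping.lookup f k)) x" by (rule sym)
qed

lemma monoid_ring_eval_mult: "monoid_ring_eval (f * g) = monoid_ring_eval f * monoid_ring_eval g"
proof -
  have "f * g = (\<Sum>k\<in>Poly_Mapping.keys f. Poly_Mapping.single k (Poly_Mapping.lookup f k)) * (\<Sum>l\<in>Poly_Mapping.keys g. Poly_Mapping.single l (Poly_Mapping.lookup g l))"
    by (simp only: sum_single_lookup[symmetric])
  also have "\<dots> = (\<Sum>k\<in>Poly_Mapping.keys f. \<Sum>l\<in>Poly_Mapping.keys g. Poly_Mapping.single (k + l) (Poly_Mapping.lookup f k * Poly_Mapping.lookup g l))"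
    by (simp only: sum_product mult_single)
  finally have "monoid_ring_eval (f * g) = (\<Sum>k\<in>Poly_Mapping.keys f. \<Sum>l\<in>Poly_Mapping.keys g. of_int (Poly_Mapping.lookup f k * Poly_Mapping.lookup g l) * base (k + l))"
    by (simp only: monoid_ring_eval_sum monoid_ring_eval_single)
  also have "\<dots> = monoid_ring_eval f * monoid_ring_eval g"
    unfolding monoid_ring_eval_def sum_product
    by (intro sum.cong refl) (simp add: plus_expo_def mult_ac)
  finally show ?thesis .
qed

lemma monoid_ring_eval_1: "monoid_ring_eval 1 = 1"
proof -
  have "monoid_ring_eval (Poly_Mapping.single 0 1) = 1" by (simp add: monoid_ring_eval_single zero_expo_def)
  then show ?thesis by (simp only: single_one)
qed

lemma monoid_ring_eval_hom: "comm_ring_hom monoid_ring_eval"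
  by unfold_locales (simp_all add: monoid_ring_eval_0 monoid_ring_eval_1 monoid_ring_eval_add monoid_ring_eval_mult)

lemma map_mat_eval_lift: "map_mat monoid_ring_eval (map_mat (\<lambda>x. Poly_Mapping.single (Expo x) 1) A) = A"
  by (rule eq_matI) (simp_all add: monoid_ring_eval_single)

theorem theorem3:
  fixes \<iota> :: "'k::field \<Rightarrow> 'a::comm_ring_1"
    and T :: "nat arrow set" and Xs :: "'a mat list"
    and \<xi> :: "quadruple \<Rightarrow> nat \<Rightarrow> nat" and P :: "quadruple \<Rightarrow> path set"
  assumes "infinite (UNIV :: 'k set)" and "comm_ring_hom \<iota>"
    and "strict_linear_order r"
    and "tableau_with_subst ns T Xs"
    and "q1 < q2" and "q2 < length ns" and "ns ! q1 = n" and "ns ! q2 = n"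
    and "representatives quadruple_equiv (admissible q1 q2 n (length Xs) T) Q"
    and "\<And>x. x \<in> Q \<Longrightarrow> admissible_perm q1 q2 n T x (\<xi> x)"
    and "\<And>x. x \<in> Q \<Longrightarrow> coherent_open_reps q1 q2 (permute_tableau q2 (\<xi> x) T) (P x)"
  shows "bpf ns T Xs =
    (\<Sum>x\<in>Q. case x of (\<beta>, \<gamma>, b, c) \<Rightarrow>
       of_int (sign (\<xi> x)) *
       bpf (tilde_dim q1 q2 ns)
           (tilde_tableau r q1 q2 (permute_tableau q2 (\<xi> x) T) (P x))
           (tilde_subst r q1 q2 (permute_tableau q2 (\<xi> x) T) (P x) Xs) *
       (\<Prod>j<length \<gamma>. sigma (\<gamma> ! j) (word_mat Xs (c ! j))))"
proof -
  note r = assms(3) and tab = assms(4) and Q = assms(9) and ad = assms(10) and coh = assms(11)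
  let ?ev = "monoid_ring_eval :: ('a expo \<Rightarrow>\<^sub>0 int) \<Rightarrow> 'a"
  \<comment> \<open>Each entry is lifted to its own basis element. The tableau, the quadruples, the
    permutations and the path representatives are unchanged; only the matrices are replaced.\<close>
  define Ys where "Ys = map (map_mat (\<lambda>x. Poly_Mapping.single (Expo x) (1 :: int))) Xs"
  have XY: "Xs = map (map_mat ?ev) Ys"
    unfolding Ys_def map_map comp_def map_mat_eval_lift by simp
  have len: "length Ys = length Xs" by (simp add: Ys_def)
  have lab: "label a < length Xs" if "a \<in> T" for a
  proof -
    have "label ` T = {..<length Xs}" using tab unfolding tableau_with_subst_def by (elim conjE)
    then show ?thesis using imageI[OF that, of label] by simp
  qed
  have mat: "Ys ! label a \<in> carrier_mat (ns ! tail_col a) (ns ! head_col a)" if a: "a \<in> T" for a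
  proof -
    have "Xs ! label a \<in> carrier_mat (ns ! tail_col a) (ns ! head_col a)"
      using tab a unfolding tableau_with_subst_def by (elim conjE) (rule bspec)
    then show ?thesis using lab[OF a] by (simp add: Ys_def)
  qed
  have tabY: "tableau_with_subst ns T Ys"
    using tab unfolding tableau_with_subst_def len by (elim conjE) (intro conjI; (assumption | (rule ballI, erule mat)))
  interpret tableau_cols ns T Ys q1 q2 n
    by (rule tableau_cols.intro[OF tabY assms(5-8)])
  interpret ev: comm_ring_hom ?ev by (rule monoid_ring_eval_hom)
  have hT: "tail a \<in> cells ns \<and> head a \<in> cells ns \<and> label a < length Ys \<and> Ys ! label a \<in> carrier_mat (ns ! tail_col a) (ns ! head_col a)"
    if "a \<in> T" for a
    using tableau_arrow[OF tab that] lab[OF that] mat[OF that] len by simp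
  have "bpf ns T Xs = ?ev (bpf ns T Ys)" unfolding XY by (rule ev.bpf_hom[OF hT])
  also note bpf_expansion[OF Q[folded len] ad coh r]
  also have "?ev (\<Sum>x\<in>Q. case x of (\<beta>, \<gamma>, b, c) \<Rightarrow>
       of_int (sign (\<xi> x)) *
       bpf (tilde_dim q1 q2 ns) (tilde_tableau r q1 q2 (permute_tableau q2 (\<xi> x) T) (P x))
           (tilde_subst r q1 q2 (permute_tableau q2 (\<xi> x) T) (P x) Ys) *
       (\<Prod>j<length \<gamma>. sigma (\<gamma> ! j) (word_mat Ys (c ! j)))) =
    (\<Sum>x\<in>Q. case x of (\<beta>, \<gamma>, b, c) \<Rightarrow>
       of_int (sign (\<xi> x)) *
       bpf (tilde_dim q1 q2 ns) (tilde_tableau r q1 q2 (permute_tableau q2 (\<xi> x) T) (P x))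
           (tilde_subst r q1 q2 (permute_tableau q2 (\<xi> x) T) (P x) Xs) *
       (\<Prod>j<length \<gamma>. sigma (\<gamma> ! j) (word_mat Xs (c ! j))))"
    unfolding ev.hom_sum
  proof (rule sum.cong[OF refl])
    fix x assume x: "x \<in> Q"
    obtain \<beta> \<gamma> b cs where xe: "x = (\<beta>, \<gamma>, b, cs)" by (cases x)
    have "x \<in> admissible q1 q2 n (length Xs) T" using Q x unfolding representatives_def by blast
    then have "T_quadruple (length Ys) x" by (simp add: admissible_def len)
    then have quad: "T_quadruple (length Ys) (\<beta>, \<gamma>, b, cs)" by (simp only: xe)
    have adm: "admissible_perm q1 q2 n T (\<beta>, \<gamma>, b, cs) (\<xi> x)" using ad[OF x] unfolding xe .
    have pm: "\<xi> x permutes {..<n}" using adm by simp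
    have tl: "bpf (tilde_dim q1 q2 ns) (tilde_tableau r q1 q2 (ptab (\<xi> x)) (P x)) (tilde_subst r q1 q2 (ptab (\<xi> x)) (P x) Xs) =
        ?ev (bpf (tilde_dim q1 q2 ns) (tilde_tableau r q1 q2 (ptab (\<xi> x)) (P x)) (tilde_subst r q1 q2 (ptab (\<xi> x)) (P x) Ys))"
      unfolding XY by (rule bpf_tilde_hom[OF pm quad adm coh[OF x] r monoid_ring_eval_hom])
    have sg: "sigma (\<gamma> ! j) (word_mat Xs (cs ! j)) = ?ev (sigma (\<gamma> ! j) (word_mat Ys (cs ! j)))" if j: "j < length \<gamma>" for j
    proof -
      have "cs ! j \<in> words_over (length Ys)" using quad j by simp
      from ev.word_mat_hom[OF this] show ?thesis unfolding XY by (simp only: ev.sigma_hom)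
    qed
    have "(\<Prod>j<length \<gamma>. sigma (\<gamma> ! j) (word_mat Xs (cs ! j))) = ?ev (\<Prod>j<length \<gamma>. sigma (\<gamma> ! j) (word_mat Ys (cs ! j)))"
      unfolding ev.hom_prod by (rule prod.cong[OF refl]) (simp add: sg)
    then show "?ev (case x of (\<beta>, \<gamma>, b, c) \<Rightarrow>
       of_int (sign (\<xi> x)) *
       bpf (tilde_dim q1 q2 ns) (tilde_tableau r q1 q2 (ptab (\<xi> x)) (P x))
           (tilde_subst r q1 q2 (ptab (\<xi> x)) (P x) Ys) *
       (\<Prod>j<length \<gamma>. sigma (\<gamma> ! j) (word_mat Ys (c ! j)))) =
      (case x of (\<beta>, \<gamma>, b, c) \<Rightarrow>
       of_int (sign (\<xi> x)) *
       bpf (tilde_dim q1 q2 ns) (tilde_tableau r q1 q2 (ptab (\<xi> x)) (P x))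
           (tilde_subst r q1 q2 (ptab (\<xi> x)) (P x) Xs) *
       (\<Prod>j<length \<gamma>. sigma (\<gamma> ! j) (word_mat Xs (c ! j))))"
      using tl unfolding xe prod.case ev.hom_mult ev.hom_of_int by (simp only:)
  qed
  finally show ?thesis .
qed

end
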